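(* Let $\Gamma_S\subseteq\Gamma$ be a portion of the physical boundary which admits a $C^2$ parametrization, and let $\tilde\Gamma_{h,S}$ be the union of the edges $\tilde E\subset\tilde\Gamma_h$ such that $\boldsymbol M_h(\tilde E)\subset\Gamma_S$. Assume that in a suitable neighborhood $\Omega_S$ of $\Gamma_S$ in $\overline\Omega$, which contains the region between $\Gamma_S$ and $\tilde\Gamma_{h,S}$, the exact solution $u$ satisfies $u\in W^{2,p}(\Omega_S)$ for some $p\in[2,\infty]$. Then there exists a constant $C_p>0$, independent of $h_\Gamma$, such that if $h_\Gamma$ is sufficiently small one has $$\|h^{-1/2}R_hu\|_{0,\tilde\Gamma_{h,S}}\le C_p\,h_\Gamma^{\,3/2-1/p+\zeta'}\,\|\mathcal Hu\|_{L^p(\Omega_S)},$$ where $\zeta'=(2-1/p)\zeta>0$ and $\mathcal Hu$ denotes the Hessian matrix of $u$.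
   Context: Let $\Omega\subset\mathbb{R}^2$ be a bounded connected open set with Lipschitz boundary $\Gamma=\partial\Omega$ formed by $C^2$ curves intersecting at a finite number of vertices; $\mathrm{diam}(\Omega)\simeq1$. $u$ is the solution of $-\Delta u=f$ in $\Omega$, $u=g$ on $\Gamma$. Let $\mathcal D\supseteq\overline\Omega$ be a closed domain and let $\mathcal T_h$ be a family of admissible, shape-regular triangulations of $\mathcal D$. Put $\tilde{\mathcal T}_h:=\{T\in\mathcal T_h: T\subset\overline\Omega\}$, $\tilde\Omega_h:=\mathrm{int}\big(\bigcup_{T\in\tilde{\mathcal T}_h}T\big)\subseteq\Omega$, $\tilde\Gamma_h:=\partial\tilde\Omega_h$. $h_T$ is the diameter of $T$, $h$ is the piecewise constant function with $h_{|T}=h_T$, and $h_\Gamma:=\max\{h_T: T\in\tilde{\mathcal T}_h,\ T\cap\tilde\Gamma_h\neq\emptyset\}$. $\|\cdot\|_{0,D}$ is the $L^2(D)$ norm. $\boldsymbol M_h:\tilde\Gamma_h\to\Gamma$ is a mapping, $\boldsymbol d(\tilde{\boldsymbol x}):=\boldsymbol M_h(\tilde{\boldsymbol x})-\tilde{\boldsymbol x}$. For edges $\tilde E\subset\tilde\Gamma_h$ with $\boldsymbol M_h(\tilde E)\subset\Gamma_S$, $\boldsymbol M_h(\tilde{\boldsymbol x})$ is the closest-point projection of $\tilde{\boldsymbol x}\in\tilde E$ upon $\Gamma$, and $\boldsymbol d(\tilde{\boldsymbol x})$ is aligned with the outward unit normal to $\Gamma$ at $\boldsymbol M_h(\tilde{\boldsymbol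 x})$. The "region between $\Gamma_S$ and $\tilde\Gamma_{h,S}$" is the union over such edges of the segments $[\tilde{\boldsymbol x},\boldsymbol M_h(\tilde{\boldsymbol x})]$, $\tilde{\boldsymbol x}\in\tilde E$, contained in $\overline\Omega$. The Taylor remainder on $\tilde\Gamma_h$ is $R_hu:=\bar g-S_hu$, where $\bar g:=g\circ\boldsymbol M_h$ and $S_hu:=u+\nabla u\cdot\boldsymbol d$. Standing assumption: there are constants $c_d>0$, $\zeta>0$ independent of the mesh with $\|\boldsymbol d(\tilde{\boldsymbol x})\|\le c_dh_T^{1+\zeta}$ for all $\tilde{\boldsymbol x}\in T\cap\tilde\Gamma_h$ and all $T\in\tilde{\mathcal T}_h$. *)

theory Defs
  imports "HOL-Analysis.Analysis" "HOL-Probability.Essential_Supremum"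
begin

section \<open>Domains with piecewise $C^2$ Lipschitz boundary\<close>

definition lipschitz_boundary :: "(real^2) set \<Rightarrow> bool" where
  "lipschitz_boundary \<Omega> \<longleftrightarrow>
     (\<forall>x\<in>frontier \<Omega>. \<exists>e\<^sub>1 e\<^sub>2 r \<delta> L \<phi>.
        norm e\<^sub>1 = 1 \<and> norm e\<^sub>2 = 1 \<and> e\<^sub>1 \<bullet> e\<^sub>2 = 0 \<and> 0 < r \<and> 0 < \<delta> \<and>
        L-lipschitz_on {-r<..<r} (\<phi> :: real \<Rightarrow> real) \<and>
        (\<forall>y. \<bar>(y - x) \<bullet> e\<^sub>1\<bar> < r \<and> \<bar>(y - x) \<bullet> e\<^sub>2\<bar> < \<delta> \<longrightarrow>
             (y \<in> \<Omega> \<longleftrightarrow> (y - x) \<bullet> e\<^sub>2 < \<phi> ((y - x) \<bullet> e\<^sub>1))))"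

text \<open>
  Simple regular curves, $C^2$ up to the end points of the unit interval.  A closed curve has to
  close up in a $C^2$ fashion, so that no vertex is hidden in its base point.
\<close>

definition C2_curve :: "(real \<Rightarrow> real^2) \<Rightarrow> bool" where
  "C2_curve \<gamma> \<longleftrightarrow> simple_path \<gamma> \<and>
     (\<exists>\<gamma>' \<gamma>''.
        (\<forall>t\<in>{0..1}. (\<gamma> has_vector_derivative \<gamma>' t) (at t within {0..1}) \<and> \<gamma>' t \<noteq> 0 \<and>
                    (\<gamma>' has_vector_derivative \<gamma>'' t) (at t within {0..1})) \<and>
        continuous_on {0..1} \<gamma>'' \<and>
        (pathstart \<gamma> = pathfinish \<gamma> \<longrightarrow> \<gamma>' 0 = \<gamma>' 1 \<and> \<gamma>'' 0 = \<gamma>'' 1))"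

definition piecewise_C2_boundary :: "(real^2) set \<Rightarrow> bool" where
  "piecewise_C2_boundary \<Omega> \<longleftrightarrow>
     (\<exists>\<C>. finite \<C> \<and> (\<forall>c\<in>\<C>. C2_curve c) \<and> frontier \<Omega> = (\<Union>c\<in>\<C>. path_image c) \<and>
          (\<forall>c\<in>\<C>. \<forall>c'\<in>\<C>. c \<noteq> c' \<longrightarrow> finite (path_image c \<inter> path_image c')))"

text \<open>
  \<^term>\<open>\<nu>\<close> is the outward unit normal along a boundary curve \<^term>\<open>\<gamma>\<close>.  At the end points of
  \<^term>\<open>\<gamma>\<close>, which may be vertices of the boundary, it is the normal of this curve, obtained as a limit.
\<close>

definition outward_unit_normal_along ::
    "(real^2) set \<Rightarrow> (real \<Rightarrow> real^2) \<Rightarrow> (real \<Rightarrow> real^2) \<Rightarrow> bool" where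
  "outward_unit_normal_along \<Omega> \<gamma> \<nu> \<longleftrightarrow>
     continuous_on {0..1} \<nu> \<and>
     (\<forall>t\<in>{0..1}. norm (\<nu> t) = 1 \<and> \<nu> t \<bullet> vector_derivative \<gamma> (at t within {0..1}) = 0) \<and>
     (\<forall>t\<in>{0<..<1}. \<forall>\<^sub>F s in at_right 0. \<gamma> t + s *\<^sub>R \<nu> t \<notin> closure \<Omega> \<and> \<gamma> t - s *\<^sub>R \<nu> t \<in> \<Omega>)"

definition neighbourhood_in :: "(real^2) set \<Rightarrow> (real^2) set \<Rightarrow> (real^2) set \<Rightarrow> bool" where
  "neighbourhood_in X S N \<longleftrightarrow> N \<subseteq> X \<and> (\<exists>U. open U \<and> S \<subseteq> U \<and> U \<inter> X \<subseteq> N)"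

definition closed_domain :: "(real^2) set \<Rightarrow> bool" where
  "closed_domain D \<longleftrightarrow> connected (interior D) \<and> D = closure (interior D)"


section \<open>Lebesgue and Sobolev spaces\<close>

definition in_Lp :: "'a measure \<Rightarrow> ereal \<Rightarrow> ('a \<Rightarrow> 'b::euclidean_space) \<Rightarrow> bool" where
  "in_Lp \<mu> p w \<longleftrightarrow> w \<in> borel_measurable \<mu> \<and>
     (if p = \<infinity> then esssup \<mu> (\<lambda>x. ereal (norm (w x))) < \<infinity>
      else integrable \<mu> (\<lambda>x. norm (w x) powr real_of_ereal p))"

definition Lp_norm :: "'a measure \<Rightarrow> ereal \<Rightarrow> ('a \<Rightarrow> 'b::euclidean_space) \<Rightarrow> real" where
  "Lp_norm \<mu> p w =
     (if p = \<infinity> then real_of_ereal (esssup \<mu> (\<lambda>x. ereal (norm (w x))))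
      else (LINT x|\<mu>. norm (w x) powr real_of_ereal p) powr (1 / real_of_ereal p))"

definition locally_integrable :: "(real^2) set \<Rightarrow> (real^2 \<Rightarrow> 'b::euclidean_space) \<Rightarrow> bool" where
  "locally_integrable D w \<longleftrightarrow> (\<forall>K. compact K \<and> K \<subseteq> D \<longrightarrow> integrable (lebesgue_on K) w)"

definition partial_deriv :: "2 \<Rightarrow> (real^2 \<Rightarrow> real) \<Rightarrow> real^2 \<Rightarrow> real" where
  "partial_deriv i \<phi> x = frechet_derivative \<phi> (at x) (axis i 1)"

primrec Ck_fun :: "nat \<Rightarrow> (real^2 \<Rightarrow> real) \<Rightarrow> bool" where
  "Ck_fun 0 \<phi> \<longleftrightarrow> continuous_on UNIV \<phi>"
| "Ck_fun (Suc k) \<phi> \<longleftrightarrow>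
     (\<forall>x. \<phi> differentiable (at x)) \<and> (\<forall>i. Ck_fun k (partial_deriv i \<phi>))"

definition test_function :: "(real^2) set \<Rightarrow> (real^2 \<Rightarrow> real) \<Rightarrow> bool" where
  "test_function D \<phi> \<longleftrightarrow> (\<forall>k. Ck_fun k \<phi>) \<and>
     compact (closure {x. \<phi> x \<noteq> 0}) \<and> closure {x. \<phi> x \<noteq> 0} \<subseteq> D"

definition weak_gradient ::
    "(real^2) set \<Rightarrow> (real^2 \<Rightarrow> real) \<Rightarrow> (real^2 \<Rightarrow> real^2) \<Rightarrow> bool" where
  "weak_gradient D w G \<longleftrightarrow> locally_integrable D w \<and> locally_integrable D G \<and>
     (\<forall>\<phi> i. test_function D \<phi> \<longrightarrow>
        (LINT x|lebesgue_on D. w x * partial_deriv i \<phi> x) = - (LINT x|lebesgue_on D. G x $ i * \<phi> x))"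

definition weak_hessian ::
    "(real^2) set \<Rightarrow> (real^2 \<Rightarrow> real^2) \<Rightarrow> (real^2 \<Rightarrow> real^2^2) \<Rightarrow> bool" where
  "weak_hessian D G H \<longleftrightarrow> (\<forall>i. weak_gradient D (\<lambda>x. G x $ i) (\<lambda>x. H x $ i))"

text \<open>
  \<^term>\<open>u\<close> belongs to $W^{1,p}(D)$, respectively $W^{2,p}(D)$, with weak gradient \<^term>\<open>G\<close> and weak
  Hessian \<^term>\<open>H\<close>.  The norm of \<^term>\<open>H x\<close> is the Frobenius norm.
\<close>

definition sobolev1 ::
    "(real^2) set \<Rightarrow> ereal \<Rightarrow> (real^2 \<Rightarrow> real) \<Rightarrow> (real^2 \<Rightarrow> real^2) \<Rightarrow> bool" where
  "sobolev1 D p u G \<longleftrightarrow>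
     in_Lp (lebesgue_on D) p u \<and> in_Lp (lebesgue_on D) p G \<and> weak_gradient D u G"

definition sobolev2 ::
    "(real^2) set \<Rightarrow> ereal \<Rightarrow> (real^2 \<Rightarrow> real) \<Rightarrow> (real^2 \<Rightarrow> real^2) \<Rightarrow> (real^2 \<Rightarrow> real^2^2) \<Rightarrow> bool" where
  "sobolev2 D p u G H \<longleftrightarrow>
     sobolev1 D p u G \<and> in_Lp (lebesgue_on D) p H \<and> weak_hessian D G H"

text \<open>
  The trace of a Sobolev function at a point of the closure of \<^term>\<open>D\<close> is its Lebesgue value, the
  limit of the averages over $B(x,r) \cap D$.  For a $W^{1,1}$ function on a Lipschitz domain it
  exists, and is the usual trace, at almost every point (for arc length) of the boundary and of any
  segment inside the domain; cf. Evans and Gariepy, Measure Theory and Fine Properties of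
  Functions, Section 5.3.
\<close>

definition has_trace_at ::
    "(real^2) set \<Rightarrow> (real^2 \<Rightarrow> 'b::euclidean_space) \<Rightarrow> real^2 \<Rightarrow> 'b \<Rightarrow> bool" where
  "has_trace_at D w x t \<longleftrightarrow>
     (\<forall>\<^sub>F r in at_right 0. integrable (lebesgue_on (ball x r \<inter> D)) w) \<and>
     ((\<lambda>r. (LINT y|lebesgue_on (ball x r \<inter> D). norm (w y - t)) / measure lebesgue (ball x r \<inter> D))
        \<longlongrightarrow> 0) (at_right 0)"

definition trace_at :: "(real^2) set \<Rightarrow> (real^2 \<Rightarrow> 'b::euclidean_space) \<Rightarrow> real^2 \<Rightarrow> 'b" where
  "trace_at D w x = (THE t. has_trace_at D w x t)"

text \<open>Null sets of the one-dimensional Hausdorff measure (arc length).\<close>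

definition arc_length_null :: "(real^2) set \<Rightarrow> bool" where
  "arc_length_null N \<longleftrightarrow>
     (\<forall>\<epsilon>>0. \<exists>(a :: nat \<Rightarrow> real^2) (r :: nat \<Rightarrow> real).
        (\<forall>n. 0 \<le> r n) \<and> N \<subseteq> (\<Union>n. cball (a n) (r n)) \<and> summable r \<and> suminf r < \<epsilon>)"

text \<open>
  \<^term>\<open>u\<close> is a weak ($H^1$) solution, with weak gradient \<^term>\<open>G\<close>, of the Dirichlet problem
  $-\Delta u = f$ in \<^term>\<open>\<Omega>\<close>, $u = g$ on the boundary.
\<close>

definition dirichlet_solution ::
    "(real^2) set \<Rightarrow> (real^2 \<Rightarrow> real) \<Rightarrow> (real^2 \<Rightarrow> real) \<Rightarrow> (real^2 \<Rightarrow> real) \<Rightarrow> (real^2 \<Rightarrow> real^2) \<Rightarrow> bool"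
  where
  "dirichlet_solution \<Omega> f g u G \<longleftrightarrow>
     sobolev1 \<Omega> 2 u G \<and> locally_integrable \<Omega> f \<and>
     (\<forall>\<phi>. test_function \<Omega> \<phi> \<longrightarrow>
        (LINT x|lebesgue_on \<Omega>. (\<Sum>i\<in>UNIV. G x $ i * partial_deriv i \<phi> x)) =
        (LINT x|lebesgue_on \<Omega>. f x * \<phi> x)) \<and>
     (\<exists>N. arc_length_null N \<and> (\<forall>x\<in>frontier \<Omega> - N. has_trace_at \<Omega> u x (g x)))"


section \<open>Triangulations and the surrogate boundary\<close>

definition admissible_triangulation :: "(real^2) set \<Rightarrow> (real^2) set set \<Rightarrow> bool" where
  "admissible_triangulation D \<T> \<longleftrightarrow> triangulation \<T> \<and> (\<forall>T\<in>\<T>. 2 simplex T) \<and> \<Union>\<T> = D"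

definition inradius :: "(real^2) set \<Rightarrow> real" where
  "inradius T = Sup {r. 0 \<le> r \<and> (\<exists>x. cball x r \<subseteq> T)}"

definition shape_regular_family :: "('i \<Rightarrow> (real^2) set set) \<Rightarrow> bool" where
  "shape_regular_family \<T> \<longleftrightarrow> (\<exists>\<kappa>>0. \<forall>i. \<forall>T\<in>\<T> i. diameter T \<le> \<kappa> * inradius T)"

definition interior_mesh :: "(real^2) set \<Rightarrow> (real^2) set set \<Rightarrow> (real^2) set set" where
  "interior_mesh \<Omega> \<T> = {T\<in>\<T>. T \<subseteq> closure \<Omega>}"

definition surrogate_domain :: "(real^2) set \<Rightarrow> (real^2) set set \<Rightarrow> (real^2) set" where
  "surrogate_domain \<Omega> \<T> = interior (\<Union>(interior_mesh \<Omega> \<T>))"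

definition surrogate_boundary :: "(real^2) set \<Rightarrow> (real^2) set set \<Rightarrow> (real^2) set" where
  "surrogate_boundary \<Omega> \<T> = frontier (surrogate_domain \<Omega> \<T>)"

definition boundary_meshsize :: "(real^2) set \<Rightarrow> (real^2) set set \<Rightarrow> real" where
  "boundary_meshsize \<Omega> \<T> =
     Max (diameter ` {T\<in>interior_mesh \<Omega> \<T>. T \<inter> surrogate_boundary \<Omega> \<T> \<noteq> {}})"

text \<open>
  The edges \<^term>\<open>E\<close> of the surrogate boundary that are mapped into \<^term>\<open>S\<close>, each paired with the
  triangle \<^term>\<open>T\<close> of the interior mesh it belongs to.  This triangle is unique, since an edge
  shared by two triangles of the interior mesh is not contained in the surrogate boundary.
\<close>

definition surrogate_edges ::
    "(real^2) set \<Rightarrow> (real^2) set \<Rightarrow> (real^2) set set \<Rightarrow> (real^2 \<Rightarrow> real^2) \<Rightarrow>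
     ((real^2) set \<times> (real^2) set) set" where
  "surrogate_edges \<Omega> S \<T> M =
     {(T, E). T \<in> interior_mesh \<Omega> \<T> \<and> E edge_of T \<and> E \<subseteq> surrogate_boundary \<Omega> \<T> \<and> M ` E \<subseteq> S}"

definition closest_point_map_on ::
    "(real^2) set \<Rightarrow> (real^2) set \<Rightarrow> (real^2 \<Rightarrow> real^2) \<Rightarrow> bool" where
  "closest_point_map_on E \<Gamma> M \<longleftrightarrow> (\<forall>x\<in>E. M x \<in> \<Gamma> \<and> (\<forall>y\<in>\<Gamma>. dist x (M x) \<le> dist x y))"

definition region_between ::
    "(real^2) set \<Rightarrow> (real^2) set \<Rightarrow> (real^2) set set \<Rightarrow> (real^2 \<Rightarrow> real^2) \<Rightarrow> (real^2) set" where
  "region_between \<Omega> S \<T> M =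
     (\<Union>(T, E)\<in>surrogate_edges \<Omega> S \<T> M. \<Union>x\<in>E. closed_segment x (M x))"


section \<open>The Taylor remainder and its weighted norm\<close>

definition taylor_extension ::
    "(real^2) set \<Rightarrow> (real^2 \<Rightarrow> real) \<Rightarrow> (real^2 \<Rightarrow> real^2) \<Rightarrow> (real^2 \<Rightarrow> real^2) \<Rightarrow> real^2 \<Rightarrow> real" where
  "taylor_extension \<Omega> u G M x = trace_at \<Omega> u x + trace_at \<Omega> G x \<bullet> (M x - x)"

definition taylor_remainder ::
    "(real^2) set \<Rightarrow> (real^2 \<Rightarrow> real) \<Rightarrow> (real^2 \<Rightarrow> real) \<Rightarrow> (real^2 \<Rightarrow> real^2) \<Rightarrow>
     (real^2 \<Rightarrow> real^2) \<Rightarrow> real^2 \<Rightarrow> real" where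
  "taylor_remainder \<Omega> g u G M x = g (M x) - taylor_extension \<Omega> u G M x"

definition edge_path :: "(real^2) set \<Rightarrow> real \<Rightarrow> real^2" where
  "edge_path E = (SOME c. \<exists>a b. c = linepath a b \<and> E = closed_segment a b)"

definition square_integrable_edge :: "(real^2) set \<Rightarrow> (real^2 \<Rightarrow> real) \<Rightarrow> bool" where
  "square_integrable_edge E w \<longleftrightarrow> in_Lp (lebesgue_on {0..1}) 2 (\<lambda>t. w (edge_path E t))"

text \<open>
  The integral over the segment \<^term>\<open>E\<close> with respect to arc length; the length of a segment is its
  diameter.
\<close>

definition edge_integral :: "(real^2) set \<Rightarrow> (real^2 \<Rightarrow> real) \<Rightarrow> real" where
  "edge_integral E w = diameter E * (LINT t|lebesgue_on {0..1}. w (edge_path E t))"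

text \<open>The $L^2$ norm of $h^{-1/2} w$ over the union of the given edges.\<close>

definition weighted_edge_norm ::
    "((real^2) set \<times> (real^2) set) set \<Rightarrow> (real^2 \<Rightarrow> real) \<Rightarrow> real" where
  "weighted_edge_norm \<E> w =
     sqrt (\<Sum>(T, E)\<in>\<E>. edge_integral E (\<lambda>x. (diameter T powr (-1/2) * w x)\<^sup>2))"

end

theory Submission
  imports Defs
begin

text \<open>
  Along the segment of length \<open>d\<close> from \<open>x\<close> to \<open>M x\<close>, Taylor's formula and the Cauchy-Schwarz
  inequality bound the squared remainder by \<open>d\<^sup>3\<close> times the integral of the squared Hessian over that
  segment.  Integrating over an edge, the map that sends an edge parameter and a distance to the
  corresponding point of the layer has Jacobian bounded below by the length of the edge, because the
  edge is almost tangential, so the segments sweep out the layer with bounded multiplicity.  In order to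
  use only integrals over the layer, the Hessian is majorised by \<open>norm (H y)\<^sup>2 \<le> A + V y\<close> with a
  constant \<open>A\<close>, whose contribution is controlled by the total length of the edges, and an integrable \<open>V\<close>;
  optimising the splitting gives the stated power of the mesh size.

  The formula is first proved for mollifications at interior points \<open>x + (d - 2 \<theta>) n\<close>, the ball of radius
  \<open>\<theta>\<close> around which stays in the domain.  In the limit one needs that Sobolev functions have
  Lebesgue values at almost every point of an edge; where the edge touches the boundary there is nothing to
  prove, since \<open>M x = x\<close> there.
\<close>

section \<open>Coordinatewise expanding maps\<close>

lemma emeasure_vimage_le_of_cubes:
  fixes \<Psi> :: "'a::euclidean_space \<Rightarrow> 'b::euclidean_space" and C :: ennreal
  assumes S: "S \<in> sets borel" and \<Psi>: "\<Psi> \<in> borel_measurable (restrict_space borel S)"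
    and C: "C < \<infinity>"
    and cube: "\<And>u v s. 0 < s \<Longrightarrow> (\<And>i. i \<in> Basis \<Longrightarrow> v \<bullet> i - u \<bullet> i = s) \<Longrightarrow>
      emeasure lborel (S \<inter> \<Psi> -` cbox u v) \<le> C * emeasure lborel (cbox u v)"
    and B: "B \<in> sets borel"
  shows "emeasure lborel (S \<inter> \<Psi> -` B) \<le> C * emeasure lborel B"
proof -
  have meas: "S \<inter> \<Psi> -` A \<in> sets borel" if "A \<in> sets borel" for A
    using measurable_sets[OF \<Psi> that] S
    by (simp add: space_restrict_space sets_restrict_space_iff Int_commute)
  have open_le: "emeasure lborel (S \<inter> \<Psi> -` U) \<le> C * emeasure lborel U" if U: "open U" for U
  proof -
    have part: "emeasure lborel (S \<inter> \<Psi> -` (U \<inter> cbox (- real (Suc n) *\<^sub>R One) (real (Suc n) *\<^sub>R One)))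
        \<le> C * emeasure lborel U" for n :: nat
    proof -
      let ?a = "- real (Suc n) *\<^sub>R One :: 'b" and ?b = "real (Suc n) *\<^sub>R One :: 'b"
      have ga: "gauge (\<lambda>x. if x \<in> U then U else UNIV)"
        using U by (auto simp: gauge_def)
      have bne: "box ?a ?b \<noteq> {}" by (simp add: box_ne_empty)
      obtain \<D> where D: "countable \<D>"
        "\<And>K. K \<in> \<D> \<Longrightarrow> interior K \<noteq> {} \<and> (\<exists>c d. K = cbox c d)"
        "pairwise (\<lambda>A B. interior A \<inter> interior B = {}) \<D>"
        "\<And>K. K \<in> \<D> \<Longrightarrow> \<exists>x \<in> (U \<inter> cbox ?a ?b) \<inter> K. K \<subseteq> (if x \<in> U then U else UNIV)"
        "\<And>u v. cbox u v \<in> \<D> \<Longrightarrow> \<exists>m. \<forall>i\<in>Basis. v \<bullet> i - u \<bullet> i = (?b \<bullet> i - ?a \<bullet> i) / 2 ^ m"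
        "U \<inter> cbox ?a ?b \<subseteq> \<Union>\<D>"
        by (rule covering_lemma[of "U \<inter> cbox ?a ?b" ?a ?b, OF _ bne ga]) auto
      have KU: "K \<subseteq> U" if "K \<in> \<D>" for K using D(4)[OF that] by auto
      have Kle: "emeasure lborel (S \<inter> \<Psi> -` K) \<le> C * emeasure lborel (interior K)" if K: "K \<in> \<D>" for K
      proof -
        obtain u v where uv: "K = cbox u v" using D(2)[OF K] by auto
        obtain m where m: "\<forall>i\<in>Basis. v \<bullet> i - u \<bullet> i = (?b \<bullet> i - ?a \<bullet> i) / 2 ^ m"
          using D(5)[of u v] K uv by blast
        have side: "v \<bullet> i - u \<bullet> i = 2 * real (Suc n) / 2 ^ m" if "i \<in> Basis" for i
          using m that by (simp add: algebra_simps)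
        have "emeasure lborel (S \<inter> \<Psi> -` cbox u v) \<le> C * emeasure lborel (cbox u v)"
          by (rule cube[OF _ side]) auto
        then show ?thesis using uv by (simp add: interior_cbox emeasure_lborel_box_eq emeasure_lborel_cbox_eq)
      qed
      have fin: "emeasure lborel (S \<inter> \<Psi> -` \<Union>F) \<le> C * emeasure lborel U" if F: "finite F" "F \<subseteq> \<D>" for F
      proof -
        have mK: "K \<in> sets borel" if "K \<in> F" for K
          using D(2)[of K] F that by (metis borel_closed closed_cbox subsetD)
        have "S \<inter> \<Psi> -` \<Union>F = (\<Union>K\<in>F. S \<inter> \<Psi> -` K)" by auto
        then have "emeasure lborel (S \<inter> \<Psi> -` \<Union>F) \<le> (\<Sum>K\<in>F. emeasure lborel (S \<inter> \<Psi> -` K))"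
          using emeasure_subadditive_finite[of F "\<lambda>K. S \<inter> \<Psi> -` K" lborel] F meas mK by (auto simp: image_subset_iff)
        also have "\<dots> \<le> (\<Sum>K\<in>F. C * emeasure lborel (interior K))"
          by (intro sum_mono Kle) (use F in auto)
        also have "\<dots> = C * (\<Sum>K\<in>F. emeasure lborel (interior K))"
          by (simp add: sum_distrib_left)
        also have "(\<Sum>K\<in>F. emeasure lborel (interior K)) = emeasure lborel (\<Union>K\<in>F. interior K)"
        proof (rule sum_emeasure)
          show "disjoint_family_on interior F"
            using D(3) F(2) by (auto simp: disjoint_family_on_def pairwise_def)
        qed (use F in auto)
        also have "C * emeasure lborel (\<Union>K\<in>F. interior K) \<le> C * emeasure lborel U"
          by (intro mult_left_mono emeasure_mono) (use F KU interior_subset U in \<open>auto, blast\<close>)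
        finally show ?thesis .
      qed
      show ?thesis
      proof (cases "\<D> = {}")
        case True
        then show ?thesis using D(6) by (simp add: subset_empty)
      next
        case False
        define F where "F k = from_nat_into \<D> ` {..<k::nat}" for k
        have FD: "F k \<subseteq> \<D>" "finite (F k)" for k
          unfolding F_def using from_nat_into[OF False] by auto
        have mF: "\<Union>(F k) \<in> sets borel" for k
        proof (intro sets.finite_Union)
          show "F k \<subseteq> sets borel" using D(2) FD by (metis borel_closed closed_cbox subsetD subsetI)
        qed (use FD in auto)
        have inc: "incseq (\<lambda>k. S \<inter> \<Psi> -` \<Union>(F k))"
          unfolding incseq_def F_def by force
        have "U \<inter> cbox ?a ?b \<subseteq> (\<Union>k. \<Union>(F k))"
        proof
          fix x assume "x \<in> U \<inter> cbox ?a ?b"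
          then obtain K where K: "K \<in> \<D>" "x \<in> K" using D(6) by auto
          obtain j where "from_nat_into \<D> j = K" using from_nat_into_surj[OF D(1) K(1)] by auto
          then show "x \<in> (\<Union>k. \<Union>(F k))" using K by (auto simp: F_def intro!: exI[of _ "Suc j"])
        qed
        then have "S \<inter> \<Psi> -` (U \<inter> cbox ?a ?b) \<subseteq> (\<Union>k. S \<inter> \<Psi> -` \<Union>(F k))" by blast
        moreover have "(\<Union>k. S \<inter> \<Psi> -` \<Union>(F k)) \<in> sets lborel"
          using meas[OF mF] by (intro sets.countable_UN) auto
        ultimately have "emeasure lborel (S \<inter> \<Psi> -` (U \<inter> cbox ?a ?b)) \<le> emeasure lborel (\<Union>k. S \<inter> \<Psi> -` \<Union>(F k))"
          by (rule emeasure_mono)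
        also have "\<dots> = (SUP k. emeasure lborel (S \<inter> \<Psi> -` \<Union>(F k)))"
          by (rule SUP_emeasure_incseq[symmetric]) (use meas mF inc in auto)
        also have "\<dots> \<le> C * emeasure lborel U"
          by (intro SUP_least fin FD)
        finally show ?thesis .
      qed
    qed
    let ?c = "\<lambda>n. cbox (- real (Suc n) *\<^sub>R One) (real (Suc n) *\<^sub>R One) :: 'b set"
    have cover: "(\<Union>n. ?c n) = UNIV"
    proof -
      have "x \<in> (\<Union>n. ?c n)" for x :: 'b
      proof -
        obtain n :: nat where "norm x \<le> real n" using real_arch_simple by blast
        then have "\<bar>x \<bullet> i\<bar> \<le> real (Suc n)" if "i \<in> Basis" for i
          using Basis_le_norm[OF that, of x] by auto
        then have "x \<in> ?c n" by (auto simp: mem_box abs_le_iff) (smt (verit, best))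
        then show ?thesis by blast
      qed
      then show ?thesis by auto
    qed
    have "emeasure lborel (S \<inter> \<Psi> -` U) = emeasure lborel (\<Union>n. S \<inter> \<Psi> -` (U \<inter> ?c n))"
    proof -
      have "S \<inter> \<Psi> -` U = (\<Union>n. S \<inter> \<Psi> -` (U \<inter> ?c n))" using cover by blast
      then show ?thesis by simp
    qed
    also have "\<dots> = (SUP n. emeasure lborel (S \<inter> \<Psi> -` (U \<inter> ?c n)))"
    proof (rule SUP_emeasure_incseq[symmetric])
      show "range (\<lambda>n. S \<inter> \<Psi> -` (U \<inter> ?c n)) \<subseteq> sets lborel"
        unfolding sets_lborel by (intro image_subsetI meas sets.Int borel_open U borel_closed closed_cbox)
      have "?c m \<subseteq> ?c n" if "m \<le> n" for m n
        using that by (auto simp: subset_box)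
      then show "incseq (\<lambda>n. S \<inter> \<Psi> -` (U \<inter> ?c n))" unfolding incseq_def by blast
    qed
    also have "\<dots> \<le> C * emeasure lborel U" by (intro SUP_least part)
    finally show ?thesis .
  qed
  show ?thesis
  proof (rule ennreal_le_epsilon)
    fix e :: real assume fin: "C * emeasure lborel B < top" and e: "0 < e"
    obtain c where c: "C = ennreal c" "0 \<le> c" using C by (cases C) auto
    define e' where "e' = e / (c + 1)"
    have e': "e' > 0" using c e by (simp add: e'_def)
    obtain U where U: "open U" "B \<subseteq> U" "emeasure lborel (U - B) < ennreal e'"
      using outer_regular_lborel[OF B e'] by metis
    have "emeasure lborel (S \<inter> \<Psi> -` B) \<le> emeasure lborel (S \<inter> \<Psi> -` U)"
      by (intro emeasure_mono) (use U meas in auto)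
    also have "\<dots> \<le> C * emeasure lborel U" by (rule open_le[OF U(1)])
    also have "emeasure lborel U = emeasure lborel B + emeasure lborel (U - B)"
      using U B by (simp add: plus_emeasure Un_absorb1)
    also have "C * (emeasure lborel B + emeasure lborel (U - B)) \<le> C * emeasure lborel B + C * ennreal e'"
      using U(3) by (auto simp: distrib_left intro!: add_left_mono mult_left_mono)
    also have "C * ennreal e' \<le> ennreal e"
      using c e by (simp add: e'_def ennreal_mult[symmetric] ennreal_leI field_simps)
    finally show "emeasure lborel (S \<inter> \<Psi> -` B) \<le> C * emeasure lborel B + ennreal e"
      by (simp add: add_left_mono)
  qed
qed

lemma nn_integral_vimage_le_of_cubes:
  fixes \<Psi> :: "'a::euclidean_space \<Rightarrow> 'b::euclidean_space" and C :: ennreal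
  assumes S: "S \<in> sets borel" and \<Psi>: "\<Psi> \<in> borel_measurable (restrict_space borel S)"
    and C: "C < \<infinity>"
    and cube: "\<And>u v s. 0 < s \<Longrightarrow> (\<And>i. i \<in> Basis \<Longrightarrow> v \<bullet> i - u \<bullet> i = s) \<Longrightarrow>
      emeasure lborel (S \<inter> \<Psi> -` cbox u v) \<le> C * emeasure lborel (cbox u v)"
    and f: "f \<in> borel_measurable borel"
  shows "(\<integral>\<^sup>+x. f (\<Psi> x) * indicator S x \<partial>lborel) \<le> C * (\<integral>\<^sup>+y. f y \<partial>lborel)"
proof -
  have \<Psi>': "\<Psi> \<in> measurable (restrict_space lborel S) borel"
    using \<Psi> by (simp cong: measurable_cong_sets sets_restrict_space_cong)
  let ?N = "distr (restrict_space lborel S) borel \<Psi>"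
  have le: "?N \<le> scale_measure C lborel"
  proof (subst le_measure)
    show "\<forall>A\<in>sets ?N. emeasure ?N A \<le> emeasure (scale_measure C lborel) A"
    proof
      fix A assume A: "A \<in> sets ?N"
      have "emeasure ?N A = emeasure lborel (S \<inter> \<Psi> -` A)"
        using A S by (subst emeasure_distr[OF \<Psi>'])
          (auto simp: space_restrict_space emeasure_restrict_space Int_commute)
      then show "emeasure ?N A \<le> emeasure (scale_measure C lborel) A"
        using emeasure_vimage_le_of_cubes[where B=A, OF S \<Psi> C cube] A by simp
    qed
  qed simp
  have "(\<integral>\<^sup>+x. f (\<Psi> x) * indicator S x \<partial>lborel) = (\<integral>\<^sup>+x. f (\<Psi> x) \<partial>restrict_space lborel S)"
    using S by (simp add: nn_integral_restrict_space)
  also have "\<dots> = (\<integral>\<^sup>+y. f y \<partial>?N)"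
    using f by (simp add: nn_integral_distr[OF \<Psi>'])
  also have "\<dots> \<le> (\<integral>\<^sup>+y. f y \<partial>scale_measure C lborel)"
    by (rule nn_integral_mono_measure[OF _ le]) simp
  also have "\<dots> = C * (\<integral>\<^sup>+y. f y \<partial>lborel)"
    using f by (simp add: nn_integral_scale_measure)
  finally show ?thesis .
qed

text \<open>A single constant would be too crude below, where the map is stretched in one direction only.\<close>

lemma nn_integral_expanding_le:
  fixes \<Psi> :: "'a::euclidean_space \<Rightarrow> 'b::euclidean_space" and L :: "'a \<Rightarrow> real"
  assumes dim: "DIM('a) = DIM('b)"
    and S: "S \<in> sets borel" and cont: "continuous_on S \<Psi>"
    and L: "\<And>i. i \<in> Basis \<Longrightarrow> 0 \<le> L i"
    and expand: "\<And>x y i. x \<in> S \<Longrightarrow> y \<in> S \<Longrightarrow> i \<in> Basis \<Longrightarrow> \<bar>x \<bullet> i - y \<bullet> i\<bar> \<le> L i * dist (\<Psi> x) (\<Psi> y)"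
    and f: "f \<in> borel_measurable borel"
  shows "(\<integral>\<^sup>+x. f (\<Psi> x) * indicator S x \<partial>lborel)
    \<le> ennreal (\<Prod>i\<in>Basis. 2 * real DIM('b) * L i) * (\<integral>\<^sup>+y. f y \<partial>lborel)"
proof (rule nn_integral_vimage_le_of_cubes[OF S _ _ _ f])
  show \<Psi>: "\<Psi> \<in> borel_measurable (restrict_space borel S)"
    by (rule borel_measurable_continuous_on_restrict[OF cont])
  fix u v :: 'b and s :: real
  assume s: "0 < s" and side: "\<And>i. i \<in> Basis \<Longrightarrow> v \<bullet> i - u \<bullet> i = s"
  let ?D = "real DIM('b)"
  show "emeasure lborel (S \<inter> \<Psi> -` cbox u v)
      \<le> ennreal (\<Prod>i\<in>Basis. 2 * ?D * L i) * emeasure lborel (cbox u v)"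
  proof (cases "S \<inter> \<Psi> -` cbox u v = {}")
    case True then show ?thesis by simp
  next
    case False
    then obtain x0 where x0: "x0 \<in> S" "\<Psi> x0 \<in> cbox u v" by auto
    have diam: "dist y z \<le> ?D * s" if "y \<in> cbox u v" "z \<in> cbox u v" for y z
    proof -
      have "\<bar>(y - z) \<bullet> i\<bar> \<le> s" if i: "i \<in> Basis" for i
        using that \<open>y \<in> _\<close> \<open>z \<in> _\<close> side[OF i] unfolding mem_box inner_diff_left
        by (smt (verit, best))
      then have "(\<Sum>i\<in>Basis. \<bar>(y - z) \<bullet> i\<bar>) \<le> (\<Sum>i\<in>(Basis::'b set). s)"
        by (intro sum_mono)
      then show ?thesis using norm_le_l1[of "y - z"] by (simp add: dist_norm)
    qed
    define q where "q = (\<Sum>i\<in>Basis. (?D * s * L i) *\<^sub>R i)"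
    have qi: "q \<bullet> i = ?D * s * L i" if "i \<in> Basis" for i
      using that by (simp add: q_def)
    have sub: "S \<inter> \<Psi> -` cbox u v \<subseteq> cbox (x0 - q) (x0 + q)"
    proof
      fix x assume x: "x \<in> S \<inter> \<Psi> -` cbox u v"
      have "\<bar>x \<bullet> i - x0 \<bullet> i\<bar> \<le> q \<bullet> i" if i: "i \<in> Basis" for i
      proof -
        have "\<bar>x \<bullet> i - x0 \<bullet> i\<bar> \<le> L i * dist (\<Psi> x) (\<Psi> x0)" using expand x x0 i by auto
        also have "\<dots> \<le> L i * (?D * s)" by (intro mult_left_mono diam L i) (use x x0 in auto)
        finally show ?thesis using qi[OF i] by (simp add: mult_ac)
      qed
      then show "x \<in> cbox (x0 - q) (x0 + q)"
        by (auto simp: mem_box inner_diff_left inner_add_left abs_le_iff) (smt (verit, best))+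
    qed
    have "emeasure lborel (S \<inter> \<Psi> -` cbox u v) \<le> emeasure lborel (cbox (x0 - q) (x0 + q))"
      by (intro emeasure_mono sub) auto
    also have "\<dots> = ennreal (\<Prod>i\<in>Basis. 2 * (?D * s * L i))"
    proof -
      have "(x0 - q) \<bullet> i \<le> (x0 + q) \<bullet> i" if "i \<in> Basis" for i
        using qi[OF that] L[OF that] s by (simp add: inner_diff_left inner_add_left)
      moreover have "(\<Prod>i\<in>Basis. (x0 + q - (x0 - q)) \<bullet> i) = (\<Prod>i\<in>Basis. 2 * (?D * s * L i))"
        by (rule prod.cong) (auto simp: inner_diff_left inner_add_left qi)
      ultimately show ?thesis by (simp add: emeasure_lborel_cbox_eq)
    qed
    also have "\<dots> = ennreal (\<Prod>i\<in>Basis. 2 * ?D * L i) * emeasure lborel (cbox u v)"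
    proof -
      have uv: "u \<bullet> i \<le> v \<bullet> i" if "i \<in> Basis" for i using side[OF that] s by simp
      have "(\<Prod>i\<in>Basis. (v - u) \<bullet> i) = s ^ DIM('b)"
        using side by (simp add: inner_diff_left)
      then have "emeasure lborel (cbox u v) = ennreal (s ^ DIM('b))"
        using uv by (simp add: emeasure_lborel_cbox_eq)
      moreover have "(\<Prod>i\<in>(Basis::'a set). 2 * (?D * s * L i)) = (\<Prod>i\<in>Basis. 2 * ?D * L i) * s ^ DIM('b)"
        using dim by (simp add: prod.distrib mult_ac power_mult_distrib)
      ultimately show ?thesis using s L by (simp add: ennreal_mult[symmetric] prod_nonneg)
    qed
    finally show ?thesis .
  qed
qed simp

section \<open>A mollifier\<close>

definition flat :: "nat \<Rightarrow> real \<Rightarrow> real" where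
  "flat k s = (if s \<le> 0 then 0 else (1 / s) ^ k * exp (- (1 / s)))"

lemma flat_nonneg: "0 \<le> flat k s"
  by (simp add: flat_def)

lemma power_le_fact_exp: "0 \<le> x \<Longrightarrow> x ^ n \<le> fact n * exp (x::real)"
proof -
  assume x: "0 \<le> x"
  have "x ^ n /\<^sub>R fact n \<le> exp x"
    unfolding exp_def
    by (rule order_trans[OF _ sum_le_suminf[of _ "{n}"]]) (use x summable_exp_generic[of x] in auto)
  then show ?thesis by (simp add: field_simps)
qed

lemma flat_le: "flat k s \<le> fact (k + 2) * s\<^sup>2"
proof (cases "s \<le> 0")
  case False
  then have s: "s > 0" by simp
  have "(1 / s) ^ (k + 2) \<le> fact (k + 2) * exp (1 / s)"
    by (rule power_le_fact_exp) (use s in simp)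
  then have "(1 / s) ^ (k + 2) * exp (- (1 / s)) \<le> fact (k + 2)"
    unfolding exp_minus inverse_eq_divide times_divide_eq_right mult_1_right by (subst divide_le_eq) simp
  then have "(1 / s) ^ (k + 2) * exp (- (1 / s)) * s\<^sup>2 \<le> fact (k + 2) * s\<^sup>2"
    by (rule mult_right_mono) simp
  moreover have "(1 / s) ^ (k + 2) * exp (- (1 / s)) * s\<^sup>2 = flat k s"
    using s by (simp add: flat_def power_add field_simps power2_eq_square)
  ultimately show ?thesis by simp
qed (simp add: flat_def)

lemma DERIV_flat: "(flat k has_real_derivative (flat (k + 2) s - real k * flat (k + 1) s)) (at s)"
proof -
  consider "s < 0" | "s = 0" | "s > 0" by linarith
  then show ?thesis
  proof cases
    case 1
    have "((\<lambda>_. 0) has_real_derivative 0) (at s)" by simp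
    then have "(flat k has_real_derivative 0) (at s)"
      by (rule has_field_derivative_transform_within_open[of _ _ _ "{..<0}"]) (use 1 in \<open>auto simp: flat_def\<close>)
    then show ?thesis using 1 by (simp add: flat_def)
  next
    case 2
    have "((\<lambda>h. flat k h / h) \<longlongrightarrow> 0) (at 0)"
    proof (rule Lim_null_comparison)
      show "\<forall>\<^sub>F h in at 0. norm (flat k h / h) \<le> fact (k + 2) * \<bar>h\<bar>"
      proof (rule eventuallyI)
        fix h :: real
        show "norm (flat k h / h) \<le> fact (k + 2) * \<bar>h\<bar>"
        proof (cases "h = 0")
          case False
          then show ?thesis using flat_le[of k h] flat_nonneg[of k h]
            by (simp add: power2_eq_square divide_le_eq mult.assoc)
        qed simp
      qed
      show "((\<lambda>h::real. fact (k + 2) * \<bar>h\<bar>) \<longlongrightarrow> 0) (at 0)"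
        by (rule tendsto_eq_intros | simp)+
    qed
    then show ?thesis using 2 by (simp add: DERIV_def flat_def)
  next
    case 3
    have "((\<lambda>s. (1 / s) ^ k * exp (- (1 / s))) has_real_derivative
        (1 / s) ^ (k + 2) * exp (- (1 / s)) - real k * ((1 / s) ^ (k + 1) * exp (- (1 / s)))) (at s)"
      using 3 by (auto intro!: derivative_eq_intros simp: divide_simps power2_eq_square)
        (cases k; simp add: field_simps)
    then have "(flat k has_real_derivative
        (1 / s) ^ (k + 2) * exp (- (1 / s)) - real k * ((1 / s) ^ (k + 1) * exp (- (1 / s)))) (at s)"
      by (rule has_field_derivative_transform_within_open[of _ _ _ "{0<..}"]) (use 3 in \<open>auto simp: flat_def\<close>)
    then show ?thesis using 3 by (simp add: flat_def)
  qed
qed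

text \<open>An algebra of functions that contains the bump function around \<open>z\<close> and is closed under partial derivatives.\<close>

inductive bump_algebra :: "real \<Rightarrow> real^2 \<Rightarrow> (real^2 \<Rightarrow> real) \<Rightarrow> bool" for r z where
  "bump_algebra r z (\<lambda>x. flat k (1 - (x - z) \<bullet> (x - z) / r\<^sup>2))"
| "bump_algebra r z (\<lambda>_. c)"
| "bump_algebra r z (\<lambda>x. x $ i)"
| "bump_algebra r z f \<Longrightarrow> bump_algebra r z g \<Longrightarrow> bump_algebra r z (\<lambda>x. f x + g x)"
| "bump_algebra r z f \<Longrightarrow> bump_algebra r z g \<Longrightarrow> bump_algebra r z (\<lambda>x. f x * g x)"

lemma has_derivative_partial_deriv:
  "(f has_derivative D) (at x) \<Longrightarrow> partial_deriv i f x = D (axis i 1)"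
  unfolding partial_deriv_def using frechet_derivative_at by metis

lemma has_derivative_bump:
  fixes x z :: "real^2"
  shows "((\<lambda>x. flat k (1 - (x - z) \<bullet> (x - z) / r\<^sup>2)) has_derivative
     (\<lambda>h. (flat (k + 2) (1 - (x - z) \<bullet> (x - z) / r\<^sup>2) - real k * flat (k + 1) (1 - (x - z) \<bullet> (x - z) / r\<^sup>2))
        * (- (2 / r\<^sup>2) * ((x - z) \<bullet> h)))) (at x)"
proof -
  have "((\<lambda>x. 1 - c * ((x - z) \<bullet> (x - z))) has_derivative (\<lambda>h. - (2 * c) * ((x - z) \<bullet> h))) (at x)" for c
    by (auto intro!: derivative_eq_intros simp: inner_commute)
  from this[of "1 / r\<^sup>2"] have "((\<lambda>x. 1 - (x - z) \<bullet> (x - z) / r\<^sup>2) has_derivative (\<lambda>h. - (2 / r\<^sup>2) * ((x - z) \<bullet> h))) (at x)"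
    by simp
  from has_derivative_compose[OF this DERIV_flat[unfolded has_field_derivative_def]]
  show ?thesis .
qed

lemma bump_algebra_differentiable:
  assumes "bump_algebra r z f"
  shows "(\<forall>x. f differentiable (at x)) \<and> (\<forall>i. bump_algebra r z (partial_deriv i f))"
  using assms
proof induction
  case (1 k)
  have "bump_algebra r z (partial_deriv i (\<lambda>x. flat k (1 - (x - z) \<bullet> (x - z) / r\<^sup>2)))" for i
  proof -
    have "partial_deriv i (\<lambda>x. flat k (1 - (x - z) \<bullet> (x - z) / r\<^sup>2)) =
       (\<lambda>x. (flat (k + 2) (1 - (x - z) \<bullet> (x - z) / r\<^sup>2) + (- real k) * flat (k + 1) (1 - (x - z) \<bullet> (x - z) / r\<^sup>2))
        * ((- (2 / r\<^sup>2)) * (x $ i + (- (z $ i)))))"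
      by (rule ext, subst has_derivative_partial_deriv[OF has_derivative_bump]) (simp add: inner_axis)
    then show ?thesis
      by (simp only:) (intro bump_algebra.intros)
  qed
  then show ?case using has_derivative_bump[of k z r] unfolding differentiable_def by blast
next
  case (2 c)
  have "partial_deriv i (\<lambda>_. c) = (\<lambda>_. 0)" for i
    by (rule ext, subst has_derivative_partial_deriv[OF has_derivative_const]) simp
  then show ?case by (auto intro: bump_algebra.intros)
next
  case (3 j)
  have d: "((\<lambda>x. x $ j) has_derivative (\<lambda>h. h $ j)) (at x)" for x :: "real^2"
    by (rule bounded_linear.has_derivative[OF bounded_linear_vec_nth]) (rule has_derivative_ident)
  have "partial_deriv i (\<lambda>x. x $ j) = (\<lambda>_. axis i 1 $ j)" for i
    by (rule ext, subst has_derivative_partial_deriv[OF d]) simp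
  then show ?case using d by (auto intro: bump_algebra.intros simp: differentiable_def)
next
  case (4 f g)
  have "partial_deriv i (\<lambda>x. f x + g x) = (\<lambda>x. partial_deriv i f x + partial_deriv i g x)" for i
  proof
    fix x
    show "partial_deriv i (\<lambda>x. f x + g x) x = partial_deriv i f x + partial_deriv i g x"
      using 4 unfolding partial_deriv_def[of i f] partial_deriv_def[of i g]
      by (subst has_derivative_partial_deriv[OF has_derivative_add[where f=f and g=g]])
        (auto simp: frechet_derivative_works[symmetric])
  qed
  then show ?case using 4 by (auto intro: bump_algebra.intros)
next
  case (5 f g)
  have "partial_deriv i (\<lambda>x. f x * g x) = (\<lambda>x. f x * partial_deriv i g x + partial_deriv i f x * g x)" for i
  proof
    fix x
    show "partial_deriv i (\<lambda>x. f x * g x) x = f x * partial_deriv i g x + partial_deriv i f x * g x"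
      using 5 unfolding partial_deriv_def[of i f] partial_deriv_def[of i g]
      by (subst has_derivative_partial_deriv[OF has_derivative_mult[where f=f and g=g]])
        (auto simp: frechet_derivative_works[symmetric])
  qed
  then show ?case using 5 by (auto intro!: bump_algebra.intros)
qed

lemma bump_algebra_Ck_fun: "bump_algebra r z f \<Longrightarrow> Ck_fun k f"
proof (induction k arbitrary: f)
  case 0
  then show ?case
    using bump_algebra_differentiable[OF 0]
    by (auto simp: continuous_on_eq_continuous_at differentiable_imp_continuous_within)
next
  case (Suc k)
  then show ?case using bump_algebra_differentiable[OF Suc.prems] by auto
qed

definition bump :: "real \<Rightarrow> real^2 \<Rightarrow> real" where
  "bump r v = flat 0 (1 - v \<bullet> v / r\<^sup>2)"

lemma bump_nonneg: "0 \<le> bump r v"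
  by (simp add: bump_def flat_nonneg)

lemma bump_le_1: "bump r v \<le> 1"
  by (simp add: bump_def flat_def)

lemma bump_eq_0_iff: "0 < r \<Longrightarrow> bump r v = 0 \<longleftrightarrow> r \<le> norm v"
proof -
  assume r: "0 < r"
  have "bump r v = 0 \<longleftrightarrow> r\<^sup>2 \<le> (norm v)\<^sup>2"
    using r by (simp add: bump_def flat_def field_simps power2_norm_eq_inner)
  then show ?thesis using r by (simp add: power_mono_iff)
qed

lemma continuous_flat: "continuous_on UNIV (flat k)"
  by (intro continuous_at_imp_continuous_on ballI DERIV_isCont[OF DERIV_flat])

lemma continuous_bump: "continuous_on A (bump r)"
  unfolding bump_def
  by (rule continuous_on_compose2[OF continuous_flat]) (auto simp: divide_inverse intro!: continuous_intros)

lemma bump_measurable [measurable]: "bump r \<in> borel_measurable borel"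
  by (intro borel_measurable_continuous_onI continuous_bump)

lemma integrable_bump: "0 < r \<Longrightarrow> integrable lborel (bump r)"
proof (rule Bochner_Integration.integrable_bound[of lborel "indicat_real (cball 0 r)"])
  assume r: "0 < r"
  show "integrable lborel (indicat_real (cball (0::real^2) r))"
    using emeasure_lborel_cball_finite[of "0::real^2" r] by auto
  show "AE v in lborel. norm (bump r v) \<le> norm (indicat_real (cball 0 r) v)"
    using bump_nonneg[of r] bump_le_1[of r] bump_eq_0_iff[OF r, THEN iffD2, OF less_imp_le]
    by (intro AE_I2) (auto split: split_indicator simp: not_le)
qed auto

definition bump_mass :: "real \<Rightarrow> real" where
  "bump_mass r = (LINT v|lborel. bump r v)"

lemma bump_mass_ge: "0 < r \<Longrightarrow> exp (- (4 / 3)) * (pi * (r / 2)\<^sup>2) \<le> bump_mass r"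
proof -
  assume r: "0 < r"
  have fin: "emeasure lborel (cball (0::real^2) (r / 2)) < \<infinity>"
    by (rule emeasure_lborel_cball_finite)
  have "(LINT v|lborel. exp (- (4 / 3)) * indicat_real (cball (0::real^2) (r / 2)) v) \<le> bump_mass r"
    unfolding bump_mass_def
  proof (rule integral_mono)
    show "integrable lborel (\<lambda>v. exp (- (4 / 3)) * indicat_real (cball (0::real^2) (r / 2)) v)"
      using fin by (intro integrable_mult_right) auto
    fix v :: "real^2"
    show "exp (- (4 / 3)) * indicat_real (cball 0 (r / 2)) v \<le> bump r v"
    proof (cases "v \<in> cball 0 (r / 2)")
      case True
      then have "norm v \<le> r / 2" by simp
      then have "(norm v)\<^sup>2 \<le> (r / 2)\<^sup>2" by (intro power_mono) auto
      then have q: "v \<bullet> v / r\<^sup>2 \<le> 1 / 4"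
        using r by (simp add: power2_norm_eq_inner field_simps)
      define s where "s = 1 - v \<bullet> v / r\<^sup>2"
      have s: "3 / 4 \<le> s" using q by (simp add: s_def)
      then have "1 / s \<le> 4 / 3" by (simp add: field_simps)
      then have "exp (- (4 / 3)) \<le> flat 0 s" using s by (simp add: flat_def)
      then show ?thesis using True by (simp add: bump_def s_def)
    qed (simp add: bump_nonneg)
  qed (rule integrable_bump[OF r])
  moreover have "measure lborel (cball (0::real^2) (r / 2)) = pi * (r / 2)\<^sup>2"
    using content_cball[of "r / 2" "0::real^2"] r by (simp add: unit_ball_vol_2)
  ultimately show ?thesis by simp
qed

lemma bump_mass_pos: "0 < r \<Longrightarrow> 0 < bump_mass r"
  by (rule less_le_trans[OF _ bump_mass_ge]) auto

definition kern :: "real \<Rightarrow> real^2 \<Rightarrow> real" where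
  "kern r v = bump r v / bump_mass r"

definition kern_grad :: "real \<Rightarrow> real^2 \<Rightarrow> real^2" where
  "kern_grad r v = (- 2 * flat 2 (1 - v \<bullet> v / r\<^sup>2) / (r\<^sup>2 * bump_mass r)) *\<^sub>R v"

lemma has_derivative_kern:
  "(kern r has_derivative (\<lambda>h. kern_grad r v \<bullet> h)) (at v)"
proof -
  have "((\<lambda>v. bump r v / bump_mass r) has_derivative
     (\<lambda>h. (flat 2 (1 - v \<bullet> v / r\<^sup>2) * (- (2 / r\<^sup>2) * (v \<bullet> h))) / bump_mass r)) (at v)"
    unfolding bump_def divide_inverse[of _ "bump_mass r"]
    using has_derivative_bump[of 0 0 r v] by (intro has_derivative_mult_left) (simp add: numeral_2_eq_2)
  moreover have "(\<lambda>h. (flat 2 (1 - v \<bullet> v / r\<^sup>2) * (- (2 / r\<^sup>2) * (v \<bullet> h))) / bump_mass r) = (\<lambda>h. kern_grad r v \<bullet> h)"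
    by (auto simp: kern_grad_def fun_eq_iff)
  moreover have "(\<lambda>v. bump r v / bump_mass r) = kern r" by (simp add: kern_def fun_eq_iff)
  ultimately show ?thesis by simp
qed

lemma kern_nonneg: "0 < r \<Longrightarrow> 0 \<le> kern r v"
  using bump_nonneg bump_mass_pos[of r] by (simp add: kern_def)

lemma kern_eq_0: "0 < r \<Longrightarrow> r \<le> norm v \<Longrightarrow> kern r v = 0"
  by (simp add: kern_def bump_eq_0_iff)

lemma continuous_kern: "continuous_on A (kern r)"
  unfolding kern_def divide_inverse by (intro continuous_intros continuous_bump)

lemma kern_measurable [measurable]: "kern r \<in> borel_measurable borel"
  by (intro borel_measurable_continuous_onI continuous_kern)

lemma continuous_kern_grad: "continuous_on A (kern_grad r)"
  unfolding kern_grad_def divide_inverse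
  by (intro continuous_intros continuous_on_compose2[OF continuous_flat]) auto

lemma kern_grad_measurable [measurable]: "kern_grad r \<in> borel_measurable borel"
  by (intro borel_measurable_continuous_onI continuous_kern_grad)

lemma kern_le: "0 < r \<Longrightarrow> kern r v \<le> 1 / bump_mass r"
  using bump_le_1 bump_mass_pos[of r] by (simp add: kern_def divide_right_mono)

lemma kern_grad_bounded: "0 < r \<Longrightarrow> \<exists>B. \<forall>v. norm (kern_grad r v) \<le> B"
proof -
  assume r: "0 < r"
  have "compact (kern_grad r ` cball 0 r)"
    by (intro compact_continuous_image continuous_kern_grad compact_cball)
  then obtain B where B: "\<And>v. v \<in> cball 0 r \<Longrightarrow> norm (kern_grad r v) \<le> B"
    using bounded_iff compact_imp_bounded by (metis image_eqI)
  have "norm (kern_grad r v) \<le> max B 0" for v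
  proof (cases "v \<in> cball 0 r")
    case False
    then have "r\<^sup>2 \<le> (norm v)\<^sup>2" using r by (intro power_mono) auto
    then have "flat 2 (1 - v \<bullet> v / r\<^sup>2) = 0"
      using r by (simp add: flat_def power2_norm_eq_inner field_simps)
    then show ?thesis by (simp add: kern_grad_def)
  qed (use B in \<open>auto intro: max.coboundedI1\<close>)
  then show ?thesis by blast
qed

lemma integral_kern: "0 < r \<Longrightarrow> (LINT v|lborel. kern r v) = 1"
  using bump_mass_pos[of r] by (simp add: kern_def integrable_bump bump_mass_def)

lemma kern_minus: "kern r (- v) = kern r v"
  by (simp add: kern_def bump_def)

lemma integral_kern_shift: "0 < r \<Longrightarrow> (LINT y|lborel. kern r (z - y)) = 1"
proof -
  assume r: "0 < r"
  have "(LINT y|lborel. kern r (z - y)) = (LINT y|lborel. kern r (y - z))"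
    using kern_minus[of r "_ - z"] by simp
  also have "\<dots> = (LINT y|lborel. kern r (z + y - z))"
    by (subst lborel_distr_plus[of z, symmetric], subst integral_distr) auto
  finally show ?thesis using integral_kern[OF r] by simp
qed

lemma integrable_kern_shift: "0 < r \<Longrightarrow> integrable lborel (\<lambda>y. kern r (z - y))"
  using integral_kern_shift[of r z] not_integrable_integral_eq by fastforce

lemma test_function_kern:
  assumes "0 < r" "cball z r \<subseteq> W"
  shows "test_function W (\<lambda>y. kern r (z - y))"
proof -
  have "bump_algebra r z (\<lambda>y. flat 0 (1 - (y - z) \<bullet> (y - z) / r\<^sup>2) * (1 / bump_mass r))"
    by (intro bump_algebra.intros)
  moreover have "(\<lambda>y. flat 0 (1 - (y - z) \<bullet> (y - z) / r\<^sup>2) * (1 / bump_mass r)) = (\<lambda>y. kern r (z - y))"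
    unfolding kern_def bump_def by (subst minus_diff_eq[of _ z, symmetric], subst inner_minus_left) (simp add: algebra_simps)
  ultimately have "Ck_fun k (\<lambda>y. kern r (z - y))" for k
    using bump_algebra_Ck_fun by metis
  moreover have "{y. kern r (z - y) \<noteq> 0} \<subseteq> cball z r"
    using kern_eq_0[OF assms(1)] by (force simp: dist_norm)
  then have "closure {y. kern r (z - y) \<noteq> 0} \<subseteq> cball z r"
    by (simp add: closure_minimal)
  ultimately show ?thesis
    unfolding test_function_def using assms(2)
    by (meson bounded_cball bounded_subset closed_closure compact_eq_bounded_closed subset_trans)
qed

lemma partial_deriv_kern:
  "partial_deriv i (\<lambda>y. kern r (z - y)) y = - (kern_grad r (z - y) $ i)"
proof -
  have "((\<lambda>y. z - y) has_derivative (\<lambda>h. - h)) (at y)"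
    by (auto intro!: derivative_eq_intros)
  from has_derivative_compose[OF this has_derivative_kern]
  show ?thesis by (subst has_derivative_partial_deriv[where D="\<lambda>h. kern_grad r (z - y) \<bullet> (- h)"]) (auto simp: inner_axis)
qed

definition moll :: "real \<Rightarrow> (real^2 \<Rightarrow> real) \<Rightarrow> real^2 \<Rightarrow> real" where
  "moll r f z = (LINT y|lborel. f y * kern r (z - y))"

lemma integrable_mult_kern:
  assumes "0 < r" "integrable lborel f"
  shows "integrable lborel (\<lambda>y. f y * kern r (z - y))"
proof (rule Bochner_Integration.integrable_bound)
  show "integrable lborel (\<lambda>y. \<bar>f y\<bar> * (1 / bump_mass r))"
    using assms by (intro integrable_mult_left integrable_abs)
  show "AE y in lborel. norm (f y * kern r (z - y)) \<le> norm (\<bar>f y\<bar> * (1 / bump_mass r))"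
    using kern_le[OF assms(1)] kern_nonneg[OF assms(1)] bump_mass_pos[OF assms(1)]
    by (intro AE_I2) (auto simp: abs_mult simp del: times_divide_eq_right intro!: mult_left_mono)
  have "f \<in> borel_measurable lborel" using assms(2) by simp
  then show "(\<lambda>y. f y * kern r (z - y)) \<in> borel_measurable lborel" by measurable
qed

lemma moll_nonneg: "0 < r \<Longrightarrow> (\<And>y. 0 \<le> f y) \<Longrightarrow> 0 \<le> moll r f z"
  unfolding moll_def by (intro Bochner_Integration.integral_nonneg mult_nonneg_nonneg kern_nonneg)

lemma moll_diff:
  assumes "0 < r" "integrable lborel f" "integrable lborel g"
  shows "moll r (\<lambda>y. f y - g y) z = moll r f z - moll r g z"
  unfolding moll_def using assms by (simp add: left_diff_distrib integrable_mult_kern)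

lemma moll_add:
  assumes "0 < r" "integrable lborel f" "integrable lborel g"
  shows "moll r (\<lambda>y. f y + g y) z = moll r f z + moll r g z"
  unfolding moll_def using assms by (simp add: distrib_right integrable_mult_kern)

lemma moll_cmult: "moll r (\<lambda>y. c * f y) z = c * moll r f z"
  unfolding moll_def by (simp add: mult.assoc)

lemma moll_Cauchy_Schwarz:
  assumes r: "0 < r" and f: "integrable lborel f" and f2: "integrable lborel (\<lambda>y. (f y)\<^sup>2)"
  shows "(moll r f z)\<^sup>2 \<le> moll r (\<lambda>y. (f y)\<^sup>2) z"
proof -
  define m where "m = moll r f z"
  have "0 \<le> (LINT y|lborel. (f y - m)\<^sup>2 * kern r (z - y))"
    by (intro Bochner_Integration.integral_nonneg mult_nonneg_nonneg kern_nonneg r) simp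
  also have "\<dots> = (LINT y|lborel. (f y)\<^sup>2 * kern r (z - y) - (2 * m) * (f y * kern r (z - y)) + m\<^sup>2 * kern r (z - y))"
    by (intro Bochner_Integration.integral_cong) (auto simp: power2_eq_square algebra_simps)
  also have "\<dots> = moll r (\<lambda>y. (f y)\<^sup>2) z - (2 * m) * moll r f z + m\<^sup>2"
    unfolding moll_def using integrable_mult_kern[OF r f] integrable_mult_kern[OF r f2] integrable_kern_shift[OF r]
      integral_kern_shift[OF r, of z]
    by (simp add: Bochner_Integration.integral_add Bochner_Integration.integral_diff)
  finally show ?thesis by (simp add: m_def power2_eq_square)
qed

lemma kern_lipschitz:
  assumes r: "0 < r"
  obtains B where "0 \<le> B" "\<And>v v'. \<bar>kern r v - kern r v'\<bar> \<le> B * norm (v - v')"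
proof -
  obtain B where B: "\<And>v. norm (kern_grad r v) \<le> B" using kern_grad_bounded[OF r] by blast
  have B0: "0 \<le> B" using order_trans[OF norm_ge_zero B] .
  have "norm (kern r v - kern r v') \<le> B * norm (v - v')" for v v'
  proof (rule differentiable_bound[of UNIV])
    fix x :: "real^2"
    show "(kern r has_derivative (\<lambda>h. kern_grad r x \<bullet> h)) (at x within UNIV)"
      using has_derivative_kern by simp
    show "onorm (\<lambda>h. kern_grad r x \<bullet> h) \<le> B"
      by (rule onorm_bound) (use B[of x] Cauchy_Schwarz_ineq2 in \<open>auto intro!: order_trans[OF Cauchy_Schwarz_ineq2] mult_right_mono B0\<close>)
  qed auto
  then show ?thesis using that B0 by simp
qed

lemma continuous_moll:
  assumes r: "0 < r" and f: "integrable lborel f"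
  shows "continuous_on A (moll r f)"
proof (rule continuous_at_imp_continuous_on, rule ballI)
  fix z
  show "isCont (moll r f) z"
    unfolding continuous_at_sequentially
  proof (intro allI impI)
    fix X :: "nat \<Rightarrow> real^2" assume X: "X \<longlonglongrightarrow> z"
    have fm [measurable]: "f \<in> borel_measurable lborel" using f by simp
    have "(\<lambda>n. LINT y|lborel. f y * kern r (X n - y)) \<longlonglongrightarrow> (LINT y|lborel. f y * kern r (z - y))"
    proof (rule integral_dominated_convergence)
      show "integrable lborel (\<lambda>y. \<bar>f y\<bar> * (1 / bump_mass r))"
        using f by (intro integrable_mult_left integrable_abs)
      show "AE y in lborel. norm (f y * kern r (X n - y)) \<le> \<bar>f y\<bar> * (1 / bump_mass r)" for n
        using kern_le[OF r] kern_nonneg[OF r]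
        by (intro AE_I2) (auto simp: abs_mult simp del: times_divide_eq_right intro!: mult_left_mono)
      show "AE y in lborel. (\<lambda>n. f y * kern r (X n - y)) \<longlonglongrightarrow> f y * kern r (z - y)"
      proof (intro AE_I2 tendsto_mult tendsto_const)
        fix y
        show "(\<lambda>n. kern r (X n - y)) \<longlonglongrightarrow> kern r (z - y)"
          by (rule continuous_on_tendsto_compose[OF continuous_kern[of UNIV]]) (auto intro!: tendsto_intros X)
      qed
    qed auto
    then show "(moll r f \<circ> X) \<longlonglongrightarrow> moll r f z" by (simp add: moll_def comp_def)
  qed
qed

lemma moll_measurable [measurable]:
  "0 < r \<Longrightarrow> integrable lborel f \<Longrightarrow> moll r f \<in> borel_measurable borel"
  by (intro borel_measurable_continuous_onI continuous_moll)

lemma DERIV_moll_line: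
  assumes r: "0 < r" and w: "integrable lborel w" and G: "\<And>i. integrable lborel (\<lambda>y. G y $ i)"
    and weak: "\<And>\<phi> i. test_function W \<phi> \<Longrightarrow>
      (LINT y|lborel. w y * partial_deriv i \<phi> y) = - (LINT y|lborel. G y $ i * \<phi> y)"
    and sub: "cball (x + s *\<^sub>R n) r \<subseteq> W"
  shows "((\<lambda>s. moll r w (x + s *\<^sub>R n)) has_real_derivative moll r (\<lambda>y. G y \<bullet> n) (x + s *\<^sub>R n)) (at s)"
proof -
  let ?z = "x + s *\<^sub>R n"
  obtain B where B: "0 \<le> B" "\<And>v v'. \<bar>kern r v - kern r v'\<bar> \<le> B * norm (v - v')"
    using kern_lipschitz[OF r] by blast
  have wm [measurable]: "w \<in> borel_measurable lborel" using w by simp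
  have D: "((\<lambda>h. (moll r w (x + (s + h) *\<^sub>R n) - moll r w ?z) / h)
      \<longlongrightarrow> (LINT y|lborel. w y * (kern_grad r (?z - y) \<bullet> n))) (at 0)"
    unfolding tendsto_at_iff_sequentially comp_def
  proof (intro allI impI)
    fix X :: "nat \<Rightarrow> real" assume X: "\<forall>i. X i \<in> UNIV - {0}" "X \<longlonglongrightarrow> 0"
    have "(\<lambda>k. LINT y|lborel. w y * ((kern r (?z - y + X k *\<^sub>R n) - kern r (?z - y)) / X k))
       \<longlonglongrightarrow> (LINT y|lborel. w y * (kern_grad r (?z - y) \<bullet> n))"
    proof (rule integral_dominated_convergence)
      show "integrable lborel (\<lambda>y. \<bar>w y\<bar> * (B * norm n))"
        using w by (intro integrable_mult_left integrable_abs)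
      show "AE y in lborel. norm (w y * ((kern r (?z - y + X k *\<^sub>R n) - kern r (?z - y)) / X k)) \<le> \<bar>w y\<bar> * (B * norm n)" for k
      proof (rule AE_I2)
        fix y
        have "\<bar>(kern r (?z - y + X k *\<^sub>R n) - kern r (?z - y)) / X k\<bar> \<le> B * norm n"
          using B(2)[of "?z - y + X k *\<^sub>R n" "?z - y"] X(1)[rule_format, of k]
          by (simp add: field_simps)
        then show "norm (w y * ((kern r (?z - y + X k *\<^sub>R n) - kern r (?z - y)) / X k)) \<le> \<bar>w y\<bar> * (B * norm n)"
          unfolding real_norm_def abs_mult by (rule mult_left_mono) simp
      qed
      show "AE y in lborel. (\<lambda>k. w y * ((kern r (?z - y + X k *\<^sub>R n) - kern r (?z - y)) / X k)) \<longlonglongrightarrow> w y * (kern_grad r (?z - y) \<bullet> n)"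
      proof (intro AE_I2 tendsto_mult tendsto_const)
        fix y
        have "((\<lambda>h. ?z - y + h *\<^sub>R n) has_derivative (\<lambda>h. h *\<^sub>R n)) (at 0)"
          by (auto intro!: derivative_eq_intros)
        from has_derivative_compose[OF this has_derivative_kern]
        have "((\<lambda>h. kern r (?z - y + h *\<^sub>R n)) has_real_derivative (kern_grad r (?z - y) \<bullet> n)) (at 0)"
          by (rule has_derivative_imp_has_field_derivative) simp
        then have "((\<lambda>h. (kern r (?z - y + h *\<^sub>R n) - kern r (?z - y)) / h) \<longlongrightarrow> kern_grad r (?z - y) \<bullet> n) (at 0)"
          by (simp add: DERIV_def)
        then show "(\<lambda>k. (kern r (?z - y + X k *\<^sub>R n) - kern r (?z - y)) / X k) \<longlonglongrightarrow> kern_grad r (?z - y) \<bullet> n"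
          using X unfolding tendsto_at_iff_sequentially comp_def by blast
      qed
    qed measurable
    moreover have "(LINT y|lborel. w y * ((kern r (?z - y + X k *\<^sub>R n) - kern r (?z - y)) / X k))
        = (moll r w (x + (s + X k) *\<^sub>R n) - moll r w ?z) / X k" for k
    proof -
      have "(LINT y|lborel. w y * ((kern r (?z - y + X k *\<^sub>R n) - kern r (?z - y)) / X k))
        = (LINT y|lborel. (w y * kern r ((x + (s + X k) *\<^sub>R n) - y) - w y * kern r (?z - y)) / X k)"
        by (intro Bochner_Integration.integral_cong) (auto simp: algebra_simps diff_divide_distrib)
      also have "\<dots> = (moll r w (x + (s + X k) *\<^sub>R n) - moll r w ?z) / X k"
        unfolding moll_def using integrable_mult_kern[OF r w] by simp
      finally show ?thesis .
    qed
    ultimately show "(\<lambda>k. (moll r w (x + (s + X k) *\<^sub>R n) - moll r w ?z) / X k)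
       \<longlonglongrightarrow> (LINT y|lborel. w y * (kern_grad r (?z - y) \<bullet> n))" by (simp only:)
  qed
  obtain Bg where Bg: "\<And>v. norm (kern_grad r v) \<le> Bg" using kern_grad_bounded[OF r] by blast
  have int_i: "integrable lborel (\<lambda>y. w y * kern_grad r (?z - y) $ i)" for i
  proof (rule Bochner_Integration.integrable_bound)
    show "integrable lborel (\<lambda>y. \<bar>w y\<bar> * Bg)" using w by (intro integrable_mult_left integrable_abs)
    show "AE y in lborel. norm (w y * kern_grad r (?z - y) $ i) \<le> norm (\<bar>w y\<bar> * Bg)"
    proof (rule AE_I2)
      fix y
      have "\<bar>kern_grad r (?z - y) $ i\<bar> \<le> Bg" using component_le_norm_cart Bg order_trans by blast
      then have "\<bar>w y\<bar> * \<bar>kern_grad r (?z - y) $ i\<bar> \<le> \<bar>w y\<bar> * \<bar>Bg\<bar>" by (intro mult_left_mono) auto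
      then show "norm (w y * kern_grad r (?z - y) $ i) \<le> norm (\<bar>w y\<bar> * Bg)" by (simp add: abs_mult)
    qed
    have [measurable]: "(\<lambda>v. kern_grad r v $ i) \<in> borel_measurable borel"
      by (intro borel_measurable_continuous_onI continuous_intros continuous_kern_grad)
    show "(\<lambda>y. w y * kern_grad r (?z - y) $ i) \<in> borel_measurable lborel" by measurable
  qed
  have "(LINT y|lborel. w y * (kern_grad r (?z - y) \<bullet> n))
      = (LINT y|lborel. (\<Sum>i\<in>UNIV. n $ i * (w y * kern_grad r (?z - y) $ i)))"
    by (simp add: inner_vec_def sum_distrib_left mult_ac)
  also have "\<dots> = (\<Sum>i\<in>UNIV. n $ i * (LINT y|lborel. w y * kern_grad r (?z - y) $ i))"
    using int_i by (subst Bochner_Integration.integral_sum) auto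
  also have "\<dots> = (\<Sum>i\<in>UNIV. n $ i * (LINT y|lborel. G y $ i * kern r (?z - y)))"
  proof (intro sum.cong refl arg_cong2[where f="(*)"])
    fix i
    show "(LINT y|lborel. w y * kern_grad r (?z - y) $ i) = (LINT y|lborel. G y $ i * kern r (?z - y))"
      using weak[OF test_function_kern[OF r sub], of i] by (simp add: partial_deriv_kern)
  qed
  also have "\<dots> = (LINT y|lborel. (\<Sum>i\<in>UNIV. n $ i * (G y $ i * kern r (?z - y))))"
    using integrable_mult_kern[OF r G] by (subst Bochner_Integration.integral_sum) auto
  also have "\<dots> = moll r (\<lambda>y. G y \<bullet> n) ?z"
    by (simp add: moll_def inner_vec_def sum_distrib_left sum_distrib_right mult_ac)
  finally show ?thesis using D by (simp add: DERIV_def)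
qed

lemma nn_integral_kern: "0 < r \<Longrightarrow> (\<integral>\<^sup>+z. ennreal (kern r (z - y)) \<partial>lborel) = 1"
proof -
  assume r: "0 < r"
  have "(\<integral>\<^sup>+z. ennreal (kern r (z - y)) \<partial>lborel) = (\<integral>\<^sup>+z. ennreal (kern r (y - z)) \<partial>lborel)"
    using kern_minus[of r "y - _"] by simp
  also have "\<dots> = ennreal (LINT z|lborel. kern r (y - z))"
    by (intro nn_integral_eq_integral integrable_kern_shift r AE_I2 kern_nonneg)
  finally show ?thesis using integral_kern_shift[OF r] by simp
qed

lemma nn_integral_moll_kernel:
  assumes r: "0 < r" and [measurable]: "f \<in> borel_measurable lborel"
  shows "(\<integral>\<^sup>+z. (\<integral>\<^sup>+y. ennreal \<bar>f y\<bar> * ennreal (kern r (z - y)) \<partial>lborel) \<partial>lborel) = (\<integral>\<^sup>+y. ennreal \<bar>f y\<bar> \<partial>lborel)"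
proof -
  have "(\<integral>\<^sup>+z. (\<integral>\<^sup>+y. ennreal \<bar>f y\<bar> * ennreal (kern r (z - y)) \<partial>lborel) \<partial>lborel)
     = (\<integral>\<^sup>+y. (\<integral>\<^sup>+z. ennreal \<bar>f y\<bar> * ennreal (kern r (z - y)) \<partial>lborel) \<partial>lborel)"
    by (rule lborel_pair.Fubini') measurable
  also have "\<dots> = (\<integral>\<^sup>+y. ennreal \<bar>f y\<bar> * 1 \<partial>lborel)"
    by (subst nn_integral_cmult) (auto simp: nn_integral_kern[OF r])
  finally show ?thesis by simp
qed

lemma moll_eq_nn_integral:
  assumes r: "0 < r" and f: "integrable lborel f" and nonneg: "\<And>y. 0 \<le> f y"
  shows "ennreal (moll r f z) = (\<integral>\<^sup>+y. ennreal \<bar>f y\<bar> * ennreal (kern r (z - y)) \<partial>lborel)"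
  unfolding moll_def
  using nonneg kern_nonneg[OF r]
  by (subst nn_integral_eq_integral[symmetric, OF integrable_mult_kern[OF r f]]) (auto simp: ennreal_mult)

lemma nn_integral_moll:
  assumes r: "0 < r" and f: "integrable lborel f" and nonneg: "\<And>y. 0 \<le> f y"
  shows "(\<integral>\<^sup>+z. ennreal (moll r f z) \<partial>lborel) = (\<integral>\<^sup>+y. ennreal (f y) \<partial>lborel)"
  using nn_integral_moll_kernel[OF r, of f] f nonneg by (simp add: moll_eq_nn_integral[OF r f nonneg])

lemma abs_moll_le: "0 < r \<Longrightarrow> \<bar>moll r f z\<bar> \<le> moll r (\<lambda>y. \<bar>f y\<bar>) z"
  unfolding moll_def
  by (rule order_trans[OF integral_abs_bound]) (simp add: abs_mult kern_nonneg)

lemma nn_integral_abs_moll_le: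
  assumes r: "0 < r" and f: "integrable lborel f"
  shows "(\<integral>\<^sup>+z. ennreal \<bar>moll r f z\<bar> \<partial>lborel) \<le> (\<integral>\<^sup>+y. ennreal \<bar>f y\<bar> \<partial>lborel)"
proof -
  have "(\<integral>\<^sup>+z. ennreal \<bar>moll r f z\<bar> \<partial>lborel) \<le> (\<integral>\<^sup>+z. ennreal (moll r (\<lambda>y. \<bar>f y\<bar>) z) \<partial>lborel)"
    by (intro nn_integral_mono ennreal_leI abs_moll_le r)
  also have "\<dots> = (\<integral>\<^sup>+y. ennreal \<bar>f y\<bar> \<partial>lborel)"
    by (rule nn_integral_moll[OF r integrable_abs[OF f]]) simp
  finally show ?thesis .
qed

text \<open>For the indicator of an open set the mollifications converge from below on the set, and they
  have the same integral, so the excess outside the set vanishes as well.\<close>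

lemma moll_L1_open:
  assumes U: "open U" and fin: "emeasure lborel U < \<infinity>"
  shows "((\<lambda>r. \<integral>\<^sup>+z. ennreal \<bar>moll r (indicator U) z - indicator U z\<bar> \<partial>lborel) \<longlongrightarrow> 0) (at_right 0)"
  unfolding tendsto_at_iff_sequentially comp_def
proof (intro allI impI)
  fix X :: "nat \<Rightarrow> real" assume X: "\<forall>i. X i \<in> {0<..} - {0}" "X \<longlonglongrightarrow> 0"
  let ?f = "indicat_real U"
  have f: "integrable lborel ?f" using U fin by auto
  have Xp: "0 < X n" for n using X(1) by auto
  have le1: "moll (X n) ?f z \<le> 1" for n z
  proof -
    have "moll (X n) ?f z \<le> (LINT y|lborel. kern (X n) (z - y))"
      unfolding moll_def
      by (intro integral_mono integrable_mult_kern integrable_kern_shift Xp f)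
        (auto split: split_indicator intro: kern_nonneg Xp)
    then show ?thesis using integral_kern_shift[OF Xp] by simp
  qed
  have ge0: "0 \<le> moll (X n) ?f z" for n z by (rule moll_nonneg[OF Xp]) auto
  have m [measurable]: "moll (X n) ?f \<in> borel_measurable borel" for n by (rule moll_measurable[OF Xp f])
  define d where "d n z = ?f z - moll (X n) ?f z" for n z
  have di: "integrable lborel (moll (X n) ?f)" for n
    using nn_integral_moll[OF Xp f, of n] fin U ge0
    by (intro integrableI_nonneg) (auto simp: ennreal_indicator)
  have ieq: "integral\<^sup>L lborel (moll (X n) ?f) = integral\<^sup>L lborel ?f" for n
    using nn_integral_moll[OF Xp f, of n] nn_integral_eq_integral[OF di[of n]] nn_integral_eq_integral[OF f] ge0
    by (simp add: Bochner_Integration.integral_nonneg)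
  have pos: "(\<lambda>n. LINT z|lborel. max 0 (d n z)) \<longlonglongrightarrow> (LINT z::real^2|lborel. (0::real))"
  proof (rule integral_dominated_convergence[where w="?f"])
    show "AE z in lborel. norm (max 0 (d n z)) \<le> ?f z" for n
      using ge0 by (intro AE_I2) (auto simp: d_def)
    show "AE z in lborel. (\<lambda>n. max 0 (d n z)) \<longlonglongrightarrow> 0"
    proof (rule AE_I2)
      fix z
      show "(\<lambda>n. max 0 (d n z)) \<longlonglongrightarrow> 0"
      proof (cases "z \<in> U")
        case True
        obtain e where e: "e > 0" "ball z e \<subseteq> U" using U True open_contains_ball by blast
        have "\<forall>\<^sub>F n in sequentially. X n < e" using X(2) e(1) by (rule order_tendstoD)
        then have "\<forall>\<^sub>F n in sequentially. 0 = max 0 (d n z)"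
        proof eventually_elim
          case (elim n)
          have eq: "?f y * kern (X n) (z - y) = kern (X n) (z - y)" for y
          proof (cases "y \<in> U")
            case False
            then have "X n \<le> norm (z - y)" using e elim by (force simp: dist_norm)
            then show ?thesis using kern_eq_0[OF Xp] by simp
          qed simp
          have "moll (X n) ?f z = 1"
            unfolding moll_def eq by (rule integral_kern_shift[OF Xp])
          then show ?case using True by (simp add: d_def)
        qed
        then show ?thesis by (rule Lim_transform_eventually[OF tendsto_const])
      next
        case False
        then show ?thesis using ge0 by (simp add: d_def)
      qed
    qed
  qed (use f d_def in \<open>auto\<close>)
  have "(\<integral>\<^sup>+z. ennreal \<bar>moll (X n) ?f z - ?f z\<bar> \<partial>lborel) = ennreal (2 * (LINT z|lborel. max 0 (d n z)))" for n
  proof -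
    have idn: "integrable lborel (d n)" unfolding d_def using f di by auto
    have "(\<integral>\<^sup>+z. ennreal \<bar>moll (X n) ?f z - ?f z\<bar> \<partial>lborel) = ennreal (LINT z|lborel. \<bar>d n z\<bar>)"
      using idn by (subst nn_integral_eq_integral[symmetric, OF integrable_abs]) (auto simp: d_def abs_minus_commute)
    also have "(LINT z|lborel. \<bar>d n z\<bar>) = (LINT z|lborel. 2 * max 0 (d n z) - d n z)"
      by (intro Bochner_Integration.integral_cong) auto
    also have "\<dots> = 2 * (LINT z|lborel. max 0 (d n z)) - (LINT z|lborel. d n z)"
      using idn by (subst Bochner_Integration.integral_diff) (auto intro!: integrable_max)
    also have "(LINT z|lborel. d n z) = 0"
      unfolding d_def using f di ieq by simp
    finally show ?thesis by simp
  qed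
  moreover have "(\<lambda>n. ennreal (2 * (LINT z|lborel. max 0 (d n z)))) \<longlonglongrightarrow> ennreal (2 * 0)"
    using pos by (intro tendsto_ennrealI tendsto_mult tendsto_const) simp
  ultimately show "(\<lambda>n. \<integral>\<^sup>+z. ennreal \<bar>moll (X n) ?f z - ?f z\<bar> \<partial>lborel) \<longlonglongrightarrow> 0" by simp
qed

lemma ennreal_tendsto_0I:
  assumes "\<And>e::real. 0 < e \<Longrightarrow> \<forall>\<^sub>F x in F. f x \<le> ennreal e"
  shows "(f \<longlongrightarrow> (0::ennreal)) F"
proof (rule order_tendstoI)
  fix a :: ennreal assume "0 < a"
  then obtain e where e: "0 < e" "ennreal e < a"
    by (metis ennreal_0 ennreal_less_iff ennreal_neg dense le_cases less_ennreal.rep_eq ennreal_cases not_less order_less_imp_le top.not_eq_extremum ennreal_less_top)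
  show "\<forall>\<^sub>F x in F. f x < a"
    using assms[OF e(1)] by eventually_elim (use e in auto)
qed auto

lemma moll_L1_approx:
  assumes f: "integrable lborel f"
    and approx: "\<And>e. 0 < e \<Longrightarrow> \<exists>g. integrable lborel g \<and>
      ((\<lambda>r. \<integral>\<^sup>+z. ennreal \<bar>moll r g z - g z\<bar> \<partial>lborel) \<longlongrightarrow> 0) (at_right 0) \<and>
      (\<integral>\<^sup>+y. ennreal \<bar>f y - g y\<bar> \<partial>lborel) \<le> ennreal e"
  shows "((\<lambda>r. \<integral>\<^sup>+z. ennreal \<bar>moll r f z - f z\<bar> \<partial>lborel) \<longlongrightarrow> 0) (at_right 0)"
proof (rule ennreal_tendsto_0I)
  fix e :: real assume e: "0 < e"
  obtain g where g: "integrable lborel g"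
      "((\<lambda>r. \<integral>\<^sup>+z. ennreal \<bar>moll r g z - g z\<bar> \<partial>lborel) \<longlongrightarrow> 0) (at_right 0)"
      "(\<integral>\<^sup>+y. ennreal \<bar>f y - g y\<bar> \<partial>lborel) \<le> ennreal (e / 3)"
    using approx[of "e / 3"] e by auto
  have [measurable]: "f \<in> borel_measurable lborel" "g \<in> borel_measurable lborel" using f g by auto
  have "\<forall>\<^sub>F r in at_right 0. (\<integral>\<^sup>+z. ennreal \<bar>moll r g z - g z\<bar> \<partial>lborel) < ennreal (e / 3)"
    using g(2) e by (intro order_tendstoD) auto
  moreover have "\<forall>\<^sub>F r in at_right 0. (0::real) < r" by (simp add: eventually_at_right_less)
  ultimately show "\<forall>\<^sub>F r in at_right 0. (\<integral>\<^sup>+z. ennreal \<bar>moll r f z - f z\<bar> \<partial>lborel) \<le> ennreal e"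
  proof eventually_elim
    case (elim r)
    have [measurable]: "moll r f \<in> borel_measurable borel" "moll r g \<in> borel_measurable borel"
      "moll r (\<lambda>y. f y - g y) \<in> borel_measurable borel"
      using f g elim by (auto intro!: moll_measurable)
    have "(\<integral>\<^sup>+z. ennreal \<bar>moll r f z - f z\<bar> \<partial>lborel)
       \<le> (\<integral>\<^sup>+z. ennreal \<bar>moll r (\<lambda>y. f y - g y) z\<bar> + ennreal \<bar>moll r g z - g z\<bar> + ennreal \<bar>f z - g z\<bar> \<partial>lborel)"
      using moll_diff[OF elim(2) f g(1)]
      by (intro nn_integral_mono) (auto simp: ennreal_plus[symmetric] simp del: ennreal_plus intro!: ennreal_leI)
    also have "\<dots> = (\<integral>\<^sup>+z. ennreal \<bar>moll r (\<lambda>y. f y - g y) z\<bar> \<partial>lborel) + (\<integral>\<^sup>+z. ennreal \<bar>moll r g z - g z\<bar> \<partial>lborel)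
        + (\<integral>\<^sup>+z. ennreal \<bar>f z - g z\<bar> \<partial>lborel)"
      by (subst nn_integral_add; (subst nn_integral_add)?) auto
    also have "\<dots> \<le> ennreal (e / 3) + ennreal (e / 3) + ennreal (e / 3)"
    proof (intro add_mono)
      show "(\<integral>\<^sup>+z. ennreal \<bar>moll r (\<lambda>y. f y - g y) z\<bar> \<partial>lborel) \<le> ennreal (e / 3)"
        using nn_integral_abs_moll_le[OF elim(2), of "\<lambda>y. f y - g y"] f g by (auto intro: order_trans)
    qed (use elim g in auto)
    also have "\<dots> = ennreal e" using e by (simp add: ennreal_plus[symmetric] del: ennreal_plus)
    finally show ?case .
  qed
qed

lemma moll_L1:
  assumes "integrable lborel f"
  shows "((\<lambda>r. \<integral>\<^sup>+z. ennreal \<bar>moll r f z - f z\<bar> \<partial>lborel) \<longlongrightarrow> 0) (at_right 0)"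
  using assms
proof (induction rule: integrable_induct)
  case (base A c)
  have scale: "((\<lambda>r. \<integral>\<^sup>+z. ennreal \<bar>moll r (\<lambda>y. f y * c) z - f z * c\<bar> \<partial>lborel) \<longlongrightarrow> 0) (at_right 0)"
    if f: "integrable lborel f" and l: "((\<lambda>r. \<integral>\<^sup>+z. ennreal \<bar>moll r f z - f z\<bar> \<partial>lborel) \<longlongrightarrow> 0) (at_right 0)"
    for f :: "real^2 \<Rightarrow> real" and c
  proof -
    have "((\<lambda>r. ennreal \<bar>c\<bar> * (\<integral>\<^sup>+z. ennreal \<bar>moll r f z - f z\<bar> \<partial>lborel)) \<longlongrightarrow> ennreal \<bar>c\<bar> * 0) (at_right 0)"
      by (intro ennreal_tendsto_cmult l) simp
    moreover have "\<forall>\<^sub>F r in at_right 0. ennreal \<bar>c\<bar> * (\<integral>\<^sup>+z. ennreal \<bar>moll r f z - f z\<bar> \<partial>lborel)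
        = (\<integral>\<^sup>+z. ennreal \<bar>moll r (\<lambda>y. f y * c) z - f z * c\<bar> \<partial>lborel)"
      using eventually_at_right_less[of 0]
    proof eventually_elim
      case (elim r)
      have [measurable]: "moll r f \<in> borel_measurable borel" "f \<in> borel_measurable lborel"
        using f elim by (auto intro!: moll_measurable)
      have "moll r (\<lambda>y. f y * c) z - f z * c = c * (moll r f z - f z)" for z
        using moll_cmult[of r c f z] by (simp add: mult.commute[of _ c] right_diff_distrib)
      then show ?case by (simp add: abs_mult ennreal_mult nn_integral_cmult)
    qed
    ultimately show ?thesis by (simp add: tendsto_cong)
  qed
  have A: "A \<in> sets borel" using base by simp
  have fA: "integrable lborel (indicat_real A)" using base by auto
  have "((\<lambda>r. \<integral>\<^sup>+z. ennreal \<bar>moll r (indicat_real A) z - indicat_real A z\<bar> \<partial>lborel) \<longlongrightarrow> 0) (at_right 0)"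
  proof (rule moll_L1_approx[OF fA])
    fix e :: real assume e: "0 < e"
    obtain U where U: "open U" "A \<subseteq> U" "emeasure lborel (U - A) < ennreal e"
      using outer_regular_lborel[OF A e] by metis
    have "emeasure lborel U = emeasure lborel A + emeasure lborel (U - A)"
      using U A by (simp add: plus_emeasure Un_absorb1)
    also have "\<dots> < \<infinity>" using base(2) U(3) by (auto simp: ennreal_add_less_top intro: less_trans)
    finally have fin: "emeasure lborel U < \<infinity>" .
    have "(\<integral>\<^sup>+y. ennreal \<bar>indicat_real A y - indicat_real U y\<bar> \<partial>lborel) = (\<integral>\<^sup>+y. indicator (U - A) y \<partial>lborel)"
      using U by (intro nn_integral_cong) (auto split: split_indicator)
    also have "\<dots> \<le> ennreal e" using U A by simp
    finally show "\<exists>g. integrable lborel g \<and>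
      ((\<lambda>r. \<integral>\<^sup>+z. ennreal \<bar>moll r g z - g z\<bar> \<partial>lborel) \<longlongrightarrow> 0) (at_right 0) \<and>
      (\<integral>\<^sup>+y. ennreal \<bar>indicat_real A y - g y\<bar> \<partial>lborel) \<le> ennreal e"
      using moll_L1_open[OF U(1) fin] U(1) fin by (intro exI[of _ "indicat_real U"]) auto
  qed
  from scale[OF fA this, of c] show ?case by simp
next
  case (add f g)
  show ?case
  proof (rule tendsto_sandwich[OF _ _ tendsto_const])
    show "((\<lambda>r. (\<integral>\<^sup>+z. ennreal \<bar>moll r f z - f z\<bar> \<partial>lborel) + (\<integral>\<^sup>+z. ennreal \<bar>moll r g z - g z\<bar> \<partial>lborel)) \<longlongrightarrow> 0) (at_right 0)"
      using tendsto_add[OF add(3,4)] by simp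
    show "\<forall>\<^sub>F r in at_right 0. (\<integral>\<^sup>+z. ennreal \<bar>moll r (\<lambda>x. f x + g x) z - (f z + g z)\<bar> \<partial>lborel)
       \<le> (\<integral>\<^sup>+z. ennreal \<bar>moll r f z - f z\<bar> \<partial>lborel) + (\<integral>\<^sup>+z. ennreal \<bar>moll r g z - g z\<bar> \<partial>lborel)"
      using eventually_at_right_less[of 0]
    proof eventually_elim
      case (elim r)
      have [measurable]: "moll r f \<in> borel_measurable borel" "f \<in> borel_measurable lborel"
        "moll r g \<in> borel_measurable borel" "g \<in> borel_measurable lborel"
        using add elim by (auto intro!: moll_measurable)
      show ?case
        using moll_add[OF elim add(1,2)]
        by (subst nn_integral_add[symmetric])
          (auto intro!: nn_integral_mono ennreal_leI simp: ennreal_plus[symmetric] simp del: ennreal_plus)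
    qed
  qed auto
next
  case (lim f s)
  show ?case
  proof (rule moll_L1_approx[OF lim(4)])
    fix e :: real assume e: "0 < e"
    have "(\<lambda>i. LINT y|lborel. \<bar>f y - s i y\<bar>) \<longlonglongrightarrow> (LINT y::real^2|lborel. (0::real))"
    proof (rule integral_dominated_convergence[where w="\<lambda>y. 3 * \<bar>f y\<bar>"])
      show "AE y in lborel. (\<lambda>i. \<bar>f y - s i y\<bar>) \<longlonglongrightarrow> 0"
        using lim(2) by (intro AE_I2) (auto intro!: tendsto_eq_intros)
      show "AE y in lborel. norm \<bar>f y - s i y\<bar> \<le> 3 * \<bar>f y\<bar>" for i
      proof (rule AE_I2)
        fix y show "norm \<bar>f y - s i y\<bar> \<le> 3 * \<bar>f y\<bar>" using lim(3)[of y i] by simp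
      qed
    qed (use lim in auto)
    then have "\<forall>\<^sub>F i in sequentially. (LINT y|lborel. \<bar>f y - s i y\<bar>) < e"
      using e by (intro order_tendstoD) auto
    then obtain i where i: "(LINT y|lborel. \<bar>f y - s i y\<bar>) < e" by (auto dest: eventually_happens)
    have "(\<integral>\<^sup>+y. ennreal \<bar>f y - s i y\<bar> \<partial>lborel) = ennreal (LINT y|lborel. \<bar>f y - s i y\<bar>)"
      using lim by (intro nn_integral_eq_integral) auto
    then show "\<exists>g. integrable lborel g \<and>
      ((\<lambda>r. \<integral>\<^sup>+z. ennreal \<bar>moll r g z - g z\<bar> \<partial>lborel) \<longlongrightarrow> 0) (at_right 0) \<and>
      (\<integral>\<^sup>+y. ennreal \<bar>f y - g y\<bar> \<partial>lborel) \<le> ennreal e"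
      using lim(1,5) i by (intro exI[of _ "s i"]) (auto intro: ennreal_leI less_imp_le)
  qed
qed

lemma AE_lborel_reflect:
  fixes P :: "real \<Rightarrow> bool"
  assumes "AE x in lborel. P x"
  shows "AE x in lborel. P (- x)"
proof -
  obtain N where N: "N \<in> null_sets lborel" "{x. \<not> P x} \<subseteq> N"
    using assms by (auto simp: eventually_ae_filter)
  have "uminus -` N \<in> null_sets lborel"
  proof -
    have "N \<in> null_sets (distr lborel borel uminus)"
      using N by (simp add: lborel_distr_uminus)
    then show ?thesis by (subst (asm) null_sets_distr_iff) auto
  qed
  then show ?thesis by (rule AE_I') (use N in auto)
qed

lemma lebesgue_point_right:
  fixes f :: "real \<Rightarrow> real"
  assumes "\<And>a b. set_integrable lborel {a..b} f"
  shows "AE x in lborel. ((\<lambda>h. (LINT y:{x..x+h}|lborel. f y) / h) \<longlongrightarrow> f x) (at_right 0)"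
proof -
  have "f integrable_on cbox a b" for a b
    using set_borel_integral_eq_integral(1)[OF assms[of a b]] by simp
  then obtain N where N: "negligible N"
    "\<And>x e. \<lbrakk>x \<notin> N; 0 < e\<rbrakk> \<Longrightarrow> \<exists>d>0. \<forall>h. 0 < h \<and> h < d \<longrightarrow>
        norm (integral (cbox x (x + h *\<^sub>R One)) f /\<^sub>R h ^ DIM(real) - f x) < e"
    using integrable_ccontinuous_explicit[of f] by blast
  have "AE x in lebesgue. x \<notin> N"
    using N(1) by (simp add: negligible_iff_null_sets AE_not_in)
  then have "AE x in lborel. x \<notin> N" by (simp add: AE_completion_iff)
  then show ?thesis
  proof (rule AE_mp, intro AE_I2 impI)
    fix x assume "x \<notin> N"
    show "((\<lambda>h. (LINT y:{x..x+h}|lborel. f y) / h) \<longlongrightarrow> f x) (at_right 0)"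
    proof (rule tendstoI)
      fix e :: real assume "0 < e"
      obtain d where d: "d > 0" "\<And>h. 0 < h \<Longrightarrow> h < d \<Longrightarrow>
        norm (integral (cbox x (x + h *\<^sub>R One)) f /\<^sub>R h ^ DIM(real) - f x) < e"
        using N(2)[OF \<open>x \<notin> N\<close> \<open>0 < e\<close>] by blast
      show "\<forall>\<^sub>F h in at_right 0. dist ((LINT y:{x..x+h}|lborel. f y) / h) (f x) < e"
        unfolding eventually_at_right_field
        using d set_borel_integral_eq_integral(2)[OF assms]
        by (auto intro!: exI[of _ d] simp: dist_norm divide_inverse_commute)
    qed
  qed
qed

lemma lebesgue_points_real:
  fixes f :: "real \<Rightarrow> real"
  assumes f: "\<And>a b. set_integrable lborel {a..b} f"
  shows "AE x in lborel. ((\<lambda>r. (LINT y:{x-r..x+r}|lborel. \<bar>f y - f x\<bar>) / r) \<longlongrightarrow> 0) (at_right 0)"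
proof -
  have right: "AE x in lborel. ((\<lambda>r. (LINT y:{x..x+r}|lborel. \<bar>f y - f x\<bar>) / r) \<longlongrightarrow> 0) (at_right 0)"
    if f: "\<And>a b. set_integrable lborel {a..b} f" for f :: "real \<Rightarrow> real"
  proof -
    have int: "set_integrable lborel {a..b} (\<lambda>y. \<bar>f y - q\<bar>)" for a b q
      by (intro set_integrable_abs set_integral_diff f borel_integrable_atLeastAtMost' continuous_on_const)
    have "AE x in lborel. \<forall>q\<in>\<rat>. ((\<lambda>h. (LINT y:{x..x+h}|lborel. \<bar>f y - q\<bar>) / h) \<longlongrightarrow> \<bar>f x - q\<bar>) (at_right 0)"
      by (subst AE_ball_countable) (auto intro: lebesgue_point_right int simp: countable_rat)
    then show ?thesis
    proof (rule AE_mp, intro AE_I2 impI)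
      fix x
      assume *: "\<forall>q\<in>\<rat>. ((\<lambda>h. (LINT y:{x..x+h}|lborel. \<bar>f y - q\<bar>) / h) \<longlongrightarrow> \<bar>f x - q\<bar>) (at_right 0)"
      show "((\<lambda>r. (LINT y:{x..x+r}|lborel. \<bar>f y - f x\<bar>) / r) \<longlongrightarrow> 0) (at_right 0)"
      proof (rule tendstoI)
        fix e :: real assume e: "0 < e"
        obtain q where q: "q \<in> \<rat>" "f x < q" "q < f x + e / 4" using Rats_dense_in_real[of "f x" "f x + e/4"] e by auto
        have "\<forall>\<^sub>F h in at_right 0. dist ((LINT y:{x..x+h}|lborel. \<bar>f y - q\<bar>) / h) \<bar>f x - q\<bar> < e / 4"
          using * q e by (intro tendstoD) auto
        moreover have "\<forall>\<^sub>F h in at_right 0. (0::real) < h" by (simp add: eventually_at_right_less)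
        ultimately show "\<forall>\<^sub>F r in at_right 0. dist ((LINT y:{x..x+r}|lborel. \<bar>f y - f x\<bar>) / r) 0 < e"
        proof eventually_elim
          case (elim h)
          have "(LINT y:{x..x+h}|lborel. \<bar>f y - f x\<bar>) \<le> (LINT y:{x..x+h}|lborel. \<bar>f y - q\<bar> + \<bar>q - f x\<bar>)"
            by (rule set_integral_mono) (auto intro!: set_integral_add(1) int intro: borel_integrable_atLeastAtMost' continuous_on_const)
          also have "\<dots> = (LINT y:{x..x+h}|lborel. \<bar>f y - q\<bar>) + h * \<bar>q - f x\<bar>"
            using elim by (subst set_integral_add) (auto intro!: int borel_integrable_atLeastAtMost' continuous_on_const simp: set_lebesgue_integral_def)
          finally have "(LINT y:{x..x+h}|lborel. \<bar>f y - f x\<bar>) / h \<le> (LINT y:{x..x+h}|lborel. \<bar>f y - q\<bar>) / h + \<bar>q - f x\<bar>"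
            using elim by (simp add: field_simps)
          moreover have "(LINT y:{x..x+h}|lborel. \<bar>f y - f x\<bar>) / h \<ge> 0"
            using elim by (auto simp: set_lebesgue_integral_def intro!: divide_nonneg_nonneg integral_nonneg_AE)
          moreover have "\<bar>q - f x\<bar> < e / 4" "\<bar>f x - q\<bar> < e / 4" using q by auto
          ultimately show ?case using elim(1) e unfolding dist_real_def by linarith
        qed
      qed
    qed
  qed
  have left: "AE x in lborel. ((\<lambda>r. (LINT y:{x-r..x}|lborel. \<bar>f y - f x\<bar>) / r) \<longlongrightarrow> 0) (at_right 0)"
  proof -
    have refl: "(LINT y:{-b..-a}|lborel. g (- y)) = (LINT y:{a..b}|lborel. g y)" for a b :: real and g :: "real \<Rightarrow> real"
      unfolding set_lebesgue_integral_def
      by (subst lborel_integral_real_affine[of "-1" _ 0]) (auto intro!: Bochner_Integration.integral_cong split: split_indicator)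
    have "set_integrable lborel {a..b} (\<lambda>y. f (- y))" for a b
      using lborel_integrable_real_affine[OF f[of "-b" "-a", unfolded set_integrable_def], of "-1" 0]
      unfolding set_integrable_def
      by (rule Bochner_Integration.integrable_cong[THEN iffD1, rotated -1]) (auto split: split_indicator)
    from AE_lborel_reflect[OF right[OF this]]
    show ?thesis
    proof (rule AE_mp, intro AE_I2 impI)
      fix x
      assume "((\<lambda>r. (LINT y:{- x..- x + r}|lborel. \<bar>f (- y) - f (- (- x))\<bar>) / r) \<longlongrightarrow> 0) (at_right 0)"
      moreover have "(LINT y:{- x..- x + r}|lborel. \<bar>f (- y) - f x\<bar>) = (LINT y:{x-r..x}|lborel. \<bar>f y - f x\<bar>)" for r
        using refl[of x "x - r" "\<lambda>y. \<bar>f y - f x\<bar>"] by (simp add: algebra_simps)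
      ultimately show "((\<lambda>r. (LINT y:{x-r..x}|lborel. \<bar>f y - f x\<bar>) / r) \<longlongrightarrow> 0) (at_right 0)" by simp
    qed
  qed
  from right[OF f] left show ?thesis
  proof eventually_elim
    case (elim x)
    have int: "set_integrable lborel {a..b} (\<lambda>y. \<bar>f y - q\<bar>)" for a b q
      by (intro set_integrable_abs set_integral_diff f borel_integrable_atLeastAtMost' continuous_on_const)
    have "\<forall>\<^sub>F r in at_right 0. (LINT y:{x-r..x+r}|lborel. \<bar>f y - f x\<bar>) / r =
       (LINT y:{x..x+r}|lborel. \<bar>f y - f x\<bar>) / r + (LINT y:{x-r..x}|lborel. \<bar>f y - f x\<bar>) / r"
      using eventually_at_right_less[of 0]
    proof eventually_elim
      case (elim r)
      have "(LINT y:{x-r..x+r}|lborel. \<bar>f y - f x\<bar>) = (LINT y:{x-r..x} \<union> {x..x+r}|lborel. \<bar>f y - f x\<bar>)"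
        using elim by (auto intro!: arg_cong2[where f="\<lambda>A g. set_lebesgue_integral lborel A g"])
      also have "\<dots> = (LINT y:{x-r..x}|lborel. \<bar>f y - f x\<bar>) + (LINT y:{x..x+r}|lborel. \<bar>f y - f x\<bar>)"
      proof (rule set_integral_Un_AE)
        show "AE y in lborel. \<not> (y \<in> {x-r..x} \<and> y \<in> {x..x+r})"
          using AE_lborel_singleton[of x] by eventually_elim auto
      qed (auto intro: int)
      finally show ?case by (simp add: add_divide_distrib)
    qed
    then show ?case using tendsto_add[OF elim] by (simp add: tendsto_cong)
  qed
qed

section \<open>Normals along boundary curves\<close>

definition rot :: "real^2 \<Rightarrow> real^2" where
  "rot v = (\<chi> i. if i = 1 then - (v $ 2) else v $ 1)"

lemma rot_nth [simp]: "rot v $ 1 = - (v $ 2)" "rot v $ 2 = v $ 1"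
  by (simp_all add: rot_def)

lemma inner_vec_2: "x \<bullet> y = x $ 1 * y $ 1 + x $ 2 * y $ 2" for x y :: "real^2"
  by (simp add: inner_vec_def sum_2)

lemma norm_rot: "norm (rot v) = norm v"
  by (simp add: norm_eq_sqrt_inner inner_vec_2)

lemma inner_rot_self: "v \<bullet> rot v = 0" "rot v \<bullet> v = 0"
  by (simp_all add: inner_vec_2)

lemma rot_diff: "rot (v - w) = rot v - rot w"
  by (simp add: vec_eq_iff forall_2)

lemma rot_scaleR: "rot (c *\<^sub>R v) = c *\<^sub>R rot v"
  by (simp add: vec_eq_iff forall_2)

lemma continuous_on_rot: "continuous_on S f \<Longrightarrow> continuous_on S (\<lambda>x. rot (f x))"
proof -
  assume f: "continuous_on S f"
  have "continuous_on S (\<lambda>x. if i = 1 then - (f x $ 2) else f x $ 1)" for i :: 2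
    using f by (cases "i = 1") (auto intro!: continuous_intros)
  then show ?thesis unfolding rot_def by (intro continuous_on_vec_lambda)
qed

lemma perp_unit_eq_rot:
  fixes n g :: "real^2"
  assumes "norm n = 1" "n \<bullet> g = 0" "g \<noteq> 0"
  defines "\<tau> \<equiv> (1 / norm g) *\<^sub>R rot g"
  shows "n = (n \<bullet> \<tau>) *\<^sub>R \<tau>" "\<bar>n \<bullet> \<tau>\<bar> = 1"
proof -
  have g2: "g $ 1 * g $ 1 + g $ 2 * g $ 2 = (norm g)\<^sup>2"
    by (simp add: power2_norm_eq_inner inner_vec_2)
  have gp: "norm g > 0" using assms by simp
  have ng: "n $ 1 * g $ 1 + n $ 2 * g $ 2 = 0" using assms(2) by (simp add: inner_vec_2)
  have e1: "n $ 1 * (norm g)\<^sup>2 = (n \<bullet> rot g) * (- g $ 2)"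
    using ng unfolding inner_vec_2 rot_nth g2[symmetric] by algebra
  have e2: "n $ 2 * (norm g)\<^sup>2 = (n \<bullet> rot g) * g $ 1"
    using ng unfolding inner_vec_2 rot_nth g2[symmetric] by algebra
  show *: "n = (n \<bullet> \<tau>) *\<^sub>R \<tau>"
    using e1 e2 gp by (simp add: vec_eq_iff forall_2 \<tau>_def field_simps power2_eq_square)
  have "norm \<tau> = 1" using gp by (simp add: \<tau>_def norm_rot)
  then have "norm n = \<bar>n \<bullet> \<tau>\<bar>" using * by (metis mult.right_neutral norm_scaleR)
  then show "\<bar>n \<bullet> \<tau>\<bar> = 1" using assms(1) by linarith
qed

lemma norm_normalize_diff_le:
  fixes g h :: "'a::real_normed_vector"
  assumes "0 < m" "m \<le> norm g" "m \<le> norm h"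
  shows "norm ((1 / norm g) *\<^sub>R g - (1 / norm h) *\<^sub>R h) \<le> 2 / m * norm (g - h)"
proof -
  have gp: "norm g > 0" "norm h > 0" using assms by auto
  have "(1 / norm g) *\<^sub>R g - (1 / norm h) *\<^sub>R h = (1 / norm g) *\<^sub>R (g - h) + ((norm h - norm g) / (norm g * norm h)) *\<^sub>R h"
    using gp by (simp add: algebra_simps diff_divide_distrib)
  also have "norm \<dots> \<le> norm (g - h) / norm g + \<bar>norm h - norm g\<bar> / (norm g * norm h) * norm h"
    by (rule order_trans[OF norm_triangle_ineq]) (use gp in \<open>simp add: abs_mult\<close>)
  also have "\<dots> = (norm (g - h) + \<bar>norm h - norm g\<bar>) / norm g"
    using gp by (simp add: field_simps)
  also have "\<dots> \<le> (2 * norm (g - h)) / norm g"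
    using norm_triangle_ineq3[of g h] gp by (intro divide_right_mono) (auto simp: abs_minus_commute)
  also have "\<dots> \<le> (2 * norm (g - h)) / m"
    using assms gp by (intro divide_left_mono mult_pos_pos) auto
  finally show ?thesis by simp
qed

text \<open>The parameter \<open>k\<close> is the signed parameter distance, which for a closed curve may wrap around the base point.\<close>

lemma normal_bounds_near:
  fixes d g g' n n' :: "real^2"
  assumes m: "0 < m" "m \<le> norm g" and B: "0 < B" and k: "\<bar>k\<bar> \<le> m / (4 * B)"
    and d: "norm (d - k *\<^sub>R g) \<le> 2 * B * k\<^sup>2"
    and nn: "norm (n - n') \<le> 2 / m * (B * \<bar>k\<bar>)"
    and n: "norm n = 1" "n \<bullet> g = 0"
  shows "norm (n - n') \<le> 8 * B / m\<^sup>2 * norm d" "\<bar>n \<bullet> d\<bar> \<le> 8 * B / m\<^sup>2 * (norm d)\<^sup>2"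
proof -
  have "norm (k *\<^sub>R g) \<le> norm d + norm (d - k *\<^sub>R g)"
    using norm_triangle_ineq4[of d "d - k *\<^sub>R g"] by simp
  then have "\<bar>k\<bar> * norm g \<le> norm d + 2 * B * k\<^sup>2" using d by simp
  moreover have "\<bar>k\<bar> * m \<le> \<bar>k\<bar> * norm g" using m by (intro mult_left_mono) auto
  moreover have "2 * B * k\<^sup>2 \<le> m / 2 * \<bar>k\<bar>"
  proof -
    have "4 * B * \<bar>k\<bar> \<le> m" using k B by (simp add: field_simps)
    then have "4 * B * \<bar>k\<bar> * \<bar>k\<bar> \<le> m * \<bar>k\<bar>" by (rule mult_right_mono) simp
    then show ?thesis by (simp add: power2_eq_square abs_mult[symmetric])
  qed
  ultimately have "m / 2 * \<bar>k\<bar> \<le> norm d" by (simp add: algebra_simps)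
  then have kd: "\<bar>k\<bar> \<le> 2 / m * norm d" using m by (simp add: field_simps)
  have "norm (n - n') \<le> 2 / m * (B * (2 / m * norm d))"
    by (rule order_trans[OF nn]) (intro mult_left_mono kd; use m B in simp)
  also have "\<dots> = 4 * B / m\<^sup>2 * norm d" by (simp add: power2_eq_square)
  also have "\<dots> \<le> 8 * B / m\<^sup>2 * norm d"
    using B m by (intro mult_right_mono divide_right_mono) auto
  finally show "norm (n - n') \<le> 8 * B / m\<^sup>2 * norm d" .
  have "n \<bullet> d = n \<bullet> (d - k *\<^sub>R g)" using n by (simp add: inner_diff_right)
  then have "\<bar>n \<bullet> d\<bar> \<le> norm (d - k *\<^sub>R g)" using Cauchy_Schwarz_ineq2[of n "d - k *\<^sub>R g"] n by simp
  also have "\<dots> \<le> 2 * B * k\<^sup>2" by (rule d)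
  also have "\<dots> \<le> 2 * B * (2 / m * norm d)\<^sup>2"
    using B kd m by (intro mult_left_mono) (auto simp: abs_le_square_iff[symmetric] abs_of_pos)
  finally show "\<bar>n \<bullet> d\<bar> \<le> 8 * B / m\<^sup>2 * (norm d)\<^sup>2"
    by (simp add: power2_eq_square)
qed

lemma vector_differentiable_bound:
  fixes f :: "real \<Rightarrow> 'a::real_normed_vector"
  assumes "convex S" "\<And>x. x \<in> S \<Longrightarrow> (f has_vector_derivative f' x) (at x within S)"
    and B: "\<And>x. x \<in> S \<Longrightarrow> norm (f' x) \<le> B" and "x \<in> S" "y \<in> S"
  shows "norm (f x - f y) \<le> B * norm (x - y)"
proof (rule differentiable_bound[OF assms(1) _ _ assms(4,5)])
  fix x assume x: "x \<in> S"
  show "(f has_derivative (\<lambda>h. h *\<^sub>R f' x)) (at x within S)"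
    using assms(2)[OF x] by (simp add: has_vector_derivative_def)
  show "onorm (\<lambda>h. h *\<^sub>R f' x) \<le> B"
    using B[OF x] order_trans[OF norm_ge_zero B[OF x]]
    by (intro onorm_bound) (auto simp: mult.commute[of B] intro: mult_left_mono)
qed

lemma C2_curve_normal_bounds:
  assumes curve: "C2_curve \<gamma>" and cont\<nu>: "continuous_on {0..1} \<nu>"
    and \<nu>: "\<And>t. t \<in> {0..1} \<Longrightarrow> norm (\<nu> t) = 1 \<and> \<nu> t \<bullet> vector_derivative \<gamma> (at t within {0..1}) = 0"
  obtains K where "0 < K"
    "\<And>t t'. t \<in> {0..1} \<Longrightarrow> t' \<in> {0..1} \<Longrightarrow> norm (\<nu> t - \<nu> t') \<le> K * norm (\<gamma> t' - \<gamma> t)"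
    "\<And>t t'. t \<in> {0..1} \<Longrightarrow> t' \<in> {0..1} \<Longrightarrow> \<bar>\<nu> t \<bullet> (\<gamma> t' - \<gamma> t)\<bar> \<le> K * (norm (\<gamma> t' - \<gamma> t))\<^sup>2"
proof -
  let ?I = "{0..1::real}"
  obtain \<gamma>' \<gamma>'' where
    d1: "\<And>t. t \<in> ?I \<Longrightarrow> (\<gamma> has_vector_derivative \<gamma>' t) (at t within ?I)"
    and nz: "\<And>t. t \<in> ?I \<Longrightarrow> \<gamma>' t \<noteq> 0"
    and d2: "\<And>t. t \<in> ?I \<Longrightarrow> (\<gamma>' has_vector_derivative \<gamma>'' t) (at t within ?I)"
    and c2: "continuous_on ?I \<gamma>''"
    and cl: "pathstart \<gamma> = pathfinish \<gamma> \<Longrightarrow> \<gamma>' 0 = \<gamma>' 1"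
    and simple: "simple_path \<gamma>"
    using curve unfolding C2_curve_def by blast
  have vd: "vector_derivative \<gamma> (at t within ?I) = \<gamma>' t" if "t \<in> ?I" for t
    using vector_derivative_within_cbox[of 0 1 t \<gamma> "\<gamma>' t"] d1[OF that] that by simp
  have c1: "continuous_on ?I \<gamma>'"
    using d2 has_vector_derivative_continuous continuous_on_eq_continuous_within by blast
  have c0: "continuous_on ?I \<gamma>"
    using d1 has_vector_derivative_continuous continuous_on_eq_continuous_within by blast
  obtain B where B: "0 < B" "\<And>t. t \<in> ?I \<Longrightarrow> norm (\<gamma>'' t) \<le> B"
  proof -
    have "bounded (\<gamma>'' ` ?I)" by (intro compact_imp_bounded compact_continuous_image c2) auto
    then show ?thesis using that unfolding bounded_pos by (metis image_eqI)
  qed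
  obtain m where m: "0 < m" "\<And>t. t \<in> ?I \<Longrightarrow> m \<le> norm (\<gamma>' t)"
  proof -
    have "\<exists>x\<in>?I. \<forall>y\<in>?I. norm (\<gamma>' x) \<le> norm (\<gamma>' y)"
      by (rule continuous_attains_inf) (auto intro!: continuous_on_norm c1)
    then show ?thesis using that nz by (metis zero_less_norm_iff)
  qed
  have lip1: "norm (\<gamma>' s - \<gamma>' t) \<le> B * \<bar>s - t\<bar>" if "s \<in> ?I" "t \<in> ?I" for s t
    using vector_differentiable_bound[of ?I \<gamma>' \<gamma>'' B s t] d2 B that by auto
  have quad: "norm (\<gamma> s - \<gamma> t - (s - t) *\<^sub>R \<gamma>' t) \<le> B * (s - t)\<^sup>2" if st: "s \<in> ?I" "t \<in> ?I" for s t
  proof -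
    let ?S = "closed_segment s t"
    have sub: "?S \<subseteq> ?I" using st by (simp add: closed_segment_subset)
    have "norm ((\<gamma> s - s *\<^sub>R \<gamma>' t) - (\<gamma> t - t *\<^sub>R \<gamma>' t)) \<le> (B * \<bar>s - t\<bar>) * norm (s - t)"
    proof (rule vector_differentiable_bound[of ?S])
      fix u assume u: "u \<in> ?S"
      show "((\<lambda>u. \<gamma> u - u *\<^sub>R \<gamma>' t) has_vector_derivative \<gamma>' u - \<gamma>' t) (at u within ?S)"
      proof (intro has_vector_derivative_diff)
        show "(\<gamma> has_vector_derivative \<gamma>' u) (at u within ?S)"
          using d1 sub u by (meson has_vector_derivative_within_subset subsetD)
        show "((\<lambda>u. u *\<^sub>R \<gamma>' t) has_vector_derivative \<gamma>' t) (at u within ?S)"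
          by (auto intro!: derivative_eq_intros)
      qed
      have "norm (\<gamma>' u - \<gamma>' t) \<le> B * \<bar>u - t\<bar>" using lip1 u sub st by blast
      also have "\<bar>u - t\<bar> \<le> \<bar>s - t\<bar>"
        using u by (auto simp: closed_segment_eq_real_ivl split: if_splits)
      finally show "norm (\<gamma>' u - \<gamma>' t) \<le> B * \<bar>s - t\<bar>" using B by simp
    qed auto
    moreover have "(\<gamma> s - s *\<^sub>R \<gamma>' t) - (\<gamma> t - t *\<^sub>R \<gamma>' t) = \<gamma> s - \<gamma> t - (s - t) *\<^sub>R \<gamma>' t"
      by (simp add: algebra_simps)
    moreover have "(B * \<bar>s - t\<bar>) * norm (s - t) = B * (s - t)\<^sup>2"
      by (simp add: power2_eq_square abs_mult[symmetric] mult.assoc)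
    ultimately show ?thesis by (simp only:)
  qed
  define \<tau> where "\<tau> t = (1 / norm (\<gamma>' t)) *\<^sub>R rot (\<gamma>' t)" for t
  have \<nu>\<tau>: "\<nu> t = (\<nu> t \<bullet> \<tau> t) *\<^sub>R \<tau> t" "\<bar>\<nu> t \<bullet> \<tau> t\<bar> = 1" if "t \<in> ?I" for t
    using perp_unit_eq_rot[of "\<nu> t" "\<gamma>' t"] \<nu>[OF that] vd[OF that] nz[OF that] unfolding \<tau>_def by auto
  have "\<exists>c. \<forall>t\<in>?I. \<nu> t \<bullet> \<tau> t = c"
  proof -
    have "continuous_on ?I \<tau>"
      unfolding \<tau>_def using nz by (intro continuous_intros continuous_on_rot c1) auto
    then have "continuous_on ?I (\<lambda>t. \<nu> t \<bullet> \<tau> t)" by (intro continuous_intros cont\<nu>)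
    moreover have "(\<lambda>t. \<nu> t \<bullet> \<tau> t) ` ?I \<subseteq> {-1, 1}"
      using \<nu>\<tau>(2) by (force simp: abs_eq_iff split: abs_split)
    then have "finite ((\<lambda>t. \<nu> t \<bullet> \<tau> t) ` ?I)" by (rule finite_subset) auto
    ultimately have "(\<lambda>t. \<nu> t \<bullet> \<tau> t) constant_on ?I"
      by (intro continuous_finite_range_constant) auto
    then show ?thesis by (auto simp: constant_on_def)
  qed
  then obtain c where c: "\<And>t. t \<in> ?I \<Longrightarrow> \<nu> t \<bullet> \<tau> t = c" by blast
  have \<nu>lip: "norm (\<nu> t - \<nu> t') \<le> 2 / m * norm (\<gamma>' t - \<gamma>' t')" if "t \<in> ?I" "t' \<in> ?I" for t t'
  proof -
    have "\<nu> t = c *\<^sub>R \<tau> t" "\<nu> t' = c *\<^sub>R \<tau> t'" "\<bar>c\<bar> = 1"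
      using \<nu>\<tau>[OF that(1)] \<nu>\<tau>[OF that(2)] unfolding c[OF that(1)] c[OF that(2)] by blast+
    then have "norm (\<nu> t - \<nu> t') = norm (\<tau> t - \<tau> t')"
      by (metis mult.left_neutral norm_scaleR scaleR_diff_right)
    also have "\<tau> t - \<tau> t' = rot ((1 / norm (\<gamma>' t)) *\<^sub>R \<gamma>' t - (1 / norm (\<gamma>' t')) *\<^sub>R \<gamma>' t')"
      by (simp add: \<tau>_def rot_diff rot_scaleR)
    also have "norm \<dots> \<le> 2 / m * norm (\<gamma>' t - \<gamma>' t')"
      unfolding norm_rot by (rule norm_normalize_diff_le) (use m that in auto)
    finally show ?thesis .
  qed
  define \<delta> where "\<delta> = m / (4 * B)"
  have \<delta>: "\<delta> > 0" using m B by (simp add: \<delta>_def)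
  have near: "norm (\<nu> t - \<nu> t') \<le> 8 * B / m\<^sup>2 * norm (\<gamma> t' - \<gamma> t) \<and>
      \<bar>\<nu> t \<bullet> (\<gamma> t' - \<gamma> t)\<bar> \<le> 8 * B / m\<^sup>2 * (norm (\<gamma> t' - \<gamma> t))\<^sup>2"
    if t: "t \<in> ?I" "t' \<in> ?I" and k: "\<bar>k\<bar> \<le> \<delta>"
      and "norm (\<gamma> t' - \<gamma> t - k *\<^sub>R \<gamma>' t) \<le> 2 * B * k\<^sup>2" "norm (\<gamma>' t - \<gamma>' t') \<le> B * \<bar>k\<bar>" for t t' k
  proof -
    have "norm (\<nu> t - \<nu> t') \<le> 2 / m * (B * \<bar>k\<bar>)"
      using \<nu>lip[OF t] that(5) m by (meson divide_nonneg_pos mult_left_mono order_trans zero_le_numeral)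
    then show ?thesis
      using normal_bounds_near[OF m(1) m(2)[OF t(1)] B(1), of k "\<gamma> t' - \<gamma> t" "\<nu> t" "\<nu> t'"] that \<nu>[OF t(1)] vd[OF t(1)]
      by (auto simp: \<delta>_def)
  qed
  define closed where "closed \<longleftrightarrow> \<gamma> 0 = \<gamma> 1"
  define F where "F = {(t, t'). t \<in> ?I \<and> t' \<in> ?I \<and> \<delta> \<le> \<bar>t - t'\<bar> \<and> (closed \<longrightarrow> \<delta> \<le> t + 1 - t' \<and> \<delta> \<le> t' + 1 - t)}"
  have "compact F"
  proof -
    have "F = (?I \<times> ?I) \<inter> ({x. \<delta> \<le> \<bar>fst x - snd x\<bar>} \<inter>
       (if closed then {x. \<delta> \<le> fst x + 1 - snd x} \<inter> {x. \<delta> \<le> snd x + 1 - fst x} else UNIV))"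
      by (auto simp: F_def)
    also have "compact \<dots>"
      by (intro compact_Int_closed compact_Times)
        (auto intro!: closed_Int closed_Collect_le continuous_intros)
    finally show ?thesis .
  qed
  have Fne: "\<gamma> t \<noteq> \<gamma> t'" if "(t, t') \<in> F" for t t'
  proof
    assume eq: "\<gamma> t = \<gamma> t'"
    have "t \<noteq> t'" and I: "t \<in> ?I" "t' \<in> ?I" using that \<delta> by (auto simp: F_def)
    then have "t = 0 \<and> t' = 1 \<or> t = 1 \<and> t' = 0"
      using simple eq unfolding simple_path_def loop_free_def by blast
    then show False using eq that \<delta> by (auto simp: F_def closed_def)
  qed
  obtain c0 where c0: "0 < c0" "\<And>t t'. (t, t') \<in> F \<Longrightarrow> c0 \<le> norm (\<gamma> t' - \<gamma> t)"
  proof (cases "F = {}")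
    case True then show ?thesis using that[of 1] by simp
  next
    case False
    have "continuous_on F (\<lambda>x. norm (\<gamma> (snd x) - \<gamma> (fst x)))"
      by (intro continuous_intros continuous_on_compose2[OF c0]) (auto simp: F_def)
    then obtain x where x: "x \<in> F" "\<And>y. y \<in> F \<Longrightarrow> norm (\<gamma> (snd x) - \<gamma> (fst x)) \<le> norm (\<gamma> (snd y) - \<gamma> (fst y))"
      using continuous_attains_inf[OF \<open>compact F\<close> False] by blast
    show ?thesis
    proof (rule that)
      show "0 < norm (\<gamma> (snd x) - \<gamma> (fst x))" using Fne[of "fst x" "snd x"] x by simp
      show "norm (\<gamma> (snd x) - \<gamma> (fst x)) \<le> norm (\<gamma> t' - \<gamma> t)" if "(t, t') \<in> F" for t t'
        using x(2)[OF that] by simp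
    qed
  qed
  define K where "K = 8 * B / m\<^sup>2 + 2 / c0"
  have K8: "8 * B / m\<^sup>2 \<le> K" using c0 by (simp add: K_def)
  have K2: "2 / c0 \<le> K" using B by (simp add: K_def)
  have main: "norm (\<nu> t - \<nu> t') \<le> K * norm (\<gamma> t' - \<gamma> t) \<and>
      \<bar>\<nu> t \<bullet> (\<gamma> t' - \<gamma> t)\<bar> \<le> K * (norm (\<gamma> t' - \<gamma> t))\<^sup>2" if t: "t \<in> ?I" "t' \<in> ?I" for t t'
  proof (cases "(t, t') \<in> F")
    case True
    have far: "c0 \<le> norm (\<gamma> t' - \<gamma> t)" by (rule c0(2)[OF True])
    have "norm (\<nu> t - \<nu> t') \<le> 2" using norm_triangle_ineq4[of "\<nu> t" "\<nu> t'"] \<nu> t by simp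
    also have "2 \<le> 2 / c0 * norm (\<gamma> t' - \<gamma> t)" using far c0(1) by (simp add: field_simps)
    also have "\<dots> \<le> K * norm (\<gamma> t' - \<gamma> t)" by (intro mult_right_mono K2) simp
    finally have 1: "norm (\<nu> t - \<nu> t') \<le> K * norm (\<gamma> t' - \<gamma> t)" .
    have "\<bar>\<nu> t \<bullet> (\<gamma> t' - \<gamma> t)\<bar> \<le> 1 * norm (\<gamma> t' - \<gamma> t)"
      using Cauchy_Schwarz_ineq2[of "\<nu> t" "\<gamma> t' - \<gamma> t"] \<nu> t by simp
    also have "\<dots> \<le> (2 / c0 * norm (\<gamma> t' - \<gamma> t)) * norm (\<gamma> t' - \<gamma> t)"
      by (intro mult_right_mono) (use far c0(1) in \<open>simp_all add: field_simps\<close>)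
    also have "\<dots> \<le> K * (norm (\<gamma> t' - \<gamma> t))\<^sup>2"
      using mult_right_mono[OF K2, of "(norm (\<gamma> t' - \<gamma> t))\<^sup>2"] by (simp add: power2_eq_square)
    finally show ?thesis using 1 by simp
  next
    case False
    then consider "\<bar>t - t'\<bar> \<le> \<delta>" | "closed" "t + 1 - t' \<le> \<delta>" | "closed" "t' + 1 - t \<le> \<delta>"
      using t unfolding F_def by force
    then have "\<exists>k. \<bar>k\<bar> \<le> \<delta> \<and> norm (\<gamma> t' - \<gamma> t - k *\<^sub>R \<gamma>' t) \<le> 2 * B * k\<^sup>2 \<and> norm (\<gamma>' t - \<gamma>' t') \<le> B * \<bar>k\<bar>"
    proof cases
      case 1
      have "norm (\<gamma> t' - \<gamma> t - (t' - t) *\<^sub>R \<gamma>' t) \<le> 2 * B * (t' - t)\<^sup>2"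
        by (rule order_trans[OF quad[OF t(2,1)]]) (use B in \<open>auto intro: mult_right_mono\<close>)
      then show ?thesis using lip1[OF t] 1 by (intro exI[of _ "t' - t"]) (auto simp: abs_minus_commute)
    next
      case 2
      have g: "\<gamma> 0 = \<gamma> 1" "\<gamma>' 0 = \<gamma>' 1" using 2(1) cl by (auto simp: closed_def pathstart_def pathfinish_def)
      define \<sigma> where "\<sigma> = 1 - t'"
      have \<sigma>: "0 \<le> \<sigma>" "0 \<le> t" using t by (auto simp: \<sigma>_def)
      let ?k = "- (t + \<sigma>)"
      have "\<gamma> t' - \<gamma> t - ?k *\<^sub>R \<gamma>' t = (\<gamma> t' - \<gamma> 1 - (t' - 1) *\<^sub>R \<gamma>' 1) + (\<gamma> 0 - \<gamma> t - (0 - t) *\<^sub>R \<gamma>' t) + (- \<sigma>) *\<^sub>R (\<gamma>' 0 - \<gamma>' t)"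
        using g by (simp add: \<sigma>_def algebra_simps)
      also have "norm \<dots> \<le> B * (t' - 1)\<^sup>2 + B * (0 - t)\<^sup>2 + \<sigma> * (B * \<bar>0 - t\<bar>)"
        by (intro order_trans[OF norm_triangle_ineq] add_mono quad)
          (use t \<sigma> lip1[of 0 t] in \<open>auto intro: mult_left_mono\<close>)
      also have "\<dots> = B * (\<sigma>\<^sup>2 + t\<^sup>2 + \<sigma> * t)"
        using \<sigma> by (simp add: \<sigma>_def power2_eq_square algebra_simps)
      also have "\<dots> \<le> B * (2 * ?k\<^sup>2)"
        using B \<sigma> by (intro mult_left_mono) (auto simp: power2_eq_square algebra_simps)
      finally have a: "norm (\<gamma> t' - \<gamma> t - ?k *\<^sub>R \<gamma>' t) \<le> 2 * B * ?k\<^sup>2" by simp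
      have "norm (\<gamma>' t - \<gamma>' t') \<le> norm (\<gamma>' t - \<gamma>' 0) + norm (\<gamma>' 1 - \<gamma>' t')"
        using norm_triangle_ineq[of "\<gamma>' t - \<gamma>' 0" "\<gamma>' 1 - \<gamma>' t'"] g by simp
      also have "\<dots> \<le> B * \<bar>t - 0\<bar> + B * \<bar>1 - t'\<bar>" using t by (intro add_mono lip1) auto
      finally have b: "norm (\<gamma>' t - \<gamma>' t') \<le> B * \<bar>?k\<bar>" using \<sigma> by (simp add: \<sigma>_def algebra_simps)
      have "\<bar>?k\<bar> \<le> \<delta>" using 2 \<sigma> by (simp add: \<sigma>_def)
      with a b show ?thesis by blast
    next
      case 3
      have g: "\<gamma> 0 = \<gamma> 1" "\<gamma>' 0 = \<gamma>' 1" using 3(1) cl by (auto simp: closed_def pathstart_def pathfinish_def)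
      define \<sigma> where "\<sigma> = 1 - t"
      have \<sigma>: "0 \<le> \<sigma>" "0 \<le> t'" using t by (auto simp: \<sigma>_def)
      let ?k = "t' + \<sigma>"
      have "\<gamma> t' - \<gamma> t - ?k *\<^sub>R \<gamma>' t = (\<gamma> t' - \<gamma> 0 - (t' - 0) *\<^sub>R \<gamma>' 0) + (\<gamma> 1 - \<gamma> t - (1 - t) *\<^sub>R \<gamma>' t) + t' *\<^sub>R (\<gamma>' 1 - \<gamma>' t)"
        using g by (simp add: \<sigma>_def algebra_simps)
      also have "norm \<dots> \<le> B * (t' - 0)\<^sup>2 + B * (1 - t)\<^sup>2 + t' * (B * \<bar>1 - t\<bar>)"
        by (intro order_trans[OF norm_triangle_ineq] add_mono quad)
          (use t \<sigma> lip1[of 1 t] in \<open>auto intro: mult_left_mono\<close>)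
      also have "\<dots> = B * (t'\<^sup>2 + \<sigma>\<^sup>2 + t' * \<sigma>)"
        using \<sigma> by (simp add: \<sigma>_def power2_eq_square algebra_simps)
      also have "\<dots> \<le> B * (2 * ?k\<^sup>2)"
        using B \<sigma> by (intro mult_left_mono) (auto simp: power2_eq_square algebra_simps)
      finally have a: "norm (\<gamma> t' - \<gamma> t - ?k *\<^sub>R \<gamma>' t) \<le> 2 * B * ?k\<^sup>2" by simp
      have "norm (\<gamma>' t - \<gamma>' t') \<le> norm (\<gamma>' t - \<gamma>' 1) + norm (\<gamma>' 0 - \<gamma>' t')"
        using norm_triangle_ineq[of "\<gamma>' t - \<gamma>' 1" "\<gamma>' 0 - \<gamma>' t'"] g by simp
      also have "\<dots> \<le> B * \<bar>t - 1\<bar> + B * \<bar>0 - t'\<bar>" using t by (intro add_mono lip1) auto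
      finally have b: "norm (\<gamma>' t - \<gamma>' t') \<le> B * \<bar>?k\<bar>" using \<sigma> by (simp add: \<sigma>_def algebra_simps)
      have "\<bar>?k\<bar> \<le> \<delta>" using 3 \<sigma> by (simp add: \<sigma>_def)
      with a b show ?thesis by blast
    qed
    then obtain k where "\<bar>k\<bar> \<le> \<delta>" "norm (\<gamma> t' - \<gamma> t - k *\<^sub>R \<gamma>' t) \<le> 2 * B * k\<^sup>2" "norm (\<gamma>' t - \<gamma>' t') \<le> B * \<bar>k\<bar>"
      by blast
    from near[OF t this] show ?thesis
      using mult_right_mono[OF K8, of "norm (\<gamma> t' - \<gamma> t)"] mult_right_mono[OF K8, of "(norm (\<gamma> t' - \<gamma> t))\<^sup>2"]
      by fastforce
  qed
  have "0 < K" using B m c0 by (simp add: K_def add_pos_pos)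
  with main show ?thesis using that by blast
qed

section \<open>Lebesgue points on lines\<close>

definition lebesgue_value :: "(real^2 \<Rightarrow> real) \<Rightarrow> real^2 \<Rightarrow> real \<Rightarrow> bool" where
  "lebesgue_value w x v \<longleftrightarrow>
     (\<forall>e>0. \<forall>\<^sub>F r in at_right 0. (\<integral>\<^sup>+y\<in>ball x r. ennreal \<bar>w y - v\<bar> \<partial>lborel) \<le> ennreal (e * r\<^sup>2))"

lemma nn_integral_lborel_pair:
  fixes F :: "real \<times> real \<Rightarrow> ennreal"
  assumes [measurable]: "F \<in> borel_measurable borel"
  shows "(\<integral>\<^sup>+p. F p \<partial>lborel) = (\<integral>\<^sup>+t. \<integral>\<^sup>+s. F (t, s) \<partial>lborel \<partial>lborel)"
proof -
  have "F \<in> borel_measurable (lborel \<Otimes>\<^sub>M lborel)" by (simp add: lborel_prod)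
  from lborel.nn_integral_fst[OF this] show ?thesis by (simp add: lborel_prod)
qed

lemma abs_FTC_le:
  fixes K k :: "real \<Rightarrow> real"
  assumes K: "\<And>s. \<bar>s\<bar> \<le> \<delta> \<Longrightarrow> (K has_real_derivative k s) (at s)"
    and k: "continuous_on UNIV k" and s: "\<bar>s\<bar> \<le> \<delta>"
  shows "ennreal \<bar>K s - K 0\<bar> \<le> (\<integral>\<^sup>+u\<in>{-\<bar>s\<bar>..\<bar>s\<bar>}. ennreal \<bar>k u\<bar> \<partial>lborel)"
proof -
  have [measurable]: "k \<in> borel_measurable borel" by (rule borel_measurable_continuous_onI[OF k])
  have *: "ennreal \<bar>K b - K a\<bar> \<le> (\<integral>\<^sup>+u\<in>{-\<bar>s\<bar>..\<bar>s\<bar>}. ennreal \<bar>k u\<bar> \<partial>lborel)"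
    if ab: "a \<le> b" "-\<bar>s\<bar> \<le> a" "b \<le> \<bar>s\<bar>" for a b
  proof -
    have ck: "continuous_on {a..b} k" using k continuous_on_subset by blast
    have "(LBINT x. indicator {a..b} x *\<^sub>R k x) = K b - K a"
    proof (rule integral_FTC_Icc[OF ab(1) _ ck])
      fix x assume "a \<le> x" "x \<le> b"
      then have "\<bar>x\<bar> \<le> \<delta>" using ab s by linarith
      from K[OF this] show "(K has_vector_derivative k x) (at x within {a..b})"
        unfolding has_real_derivative_iff_has_vector_derivative by (rule has_vector_derivative_at_within)
    qed
    moreover have "integrable lborel (\<lambda>x. indicator {a..b} x *\<^sub>R k x)"
      using borel_integrable_atLeastAtMost'[OF ck] by (simp add: set_integrable_def)
    ultimately have "ennreal \<bar>K b - K a\<bar> \<le> (\<integral>\<^sup>+x. ennreal (norm (indicator {a..b} x *\<^sub>R k x)) \<partial>lborel)"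
      using integral_norm_bound_ennreal[of lborel "\<lambda>x. indicator {a..b} x *\<^sub>R k x"] by simp
    also have "\<dots> \<le> (\<integral>\<^sup>+u\<in>{-\<bar>s\<bar>..\<bar>s\<bar>}. ennreal \<bar>k u\<bar> \<partial>lborel)"
      using ab by (intro nn_integral_mono) (auto split: split_indicator)
    finally show ?thesis .
  qed
  show ?thesis
  proof (cases "0 \<le> s")
    case True then show ?thesis using *[of 0 s] by simp
  next
    case False then show ?thesis using *[of s 0] by (simp add: abs_minus_commute)
  qed
qed

lemma norm_frame: "norm (t *\<^sub>R d + s *\<^sub>R rot d) = norm d * sqrt (t\<^sup>2 + s\<^sup>2)" for d :: "real^2"
proof -
  have "(norm (t *\<^sub>R d + s *\<^sub>R rot d))\<^sup>2 = (norm d)\<^sup>2 * (t\<^sup>2 + s\<^sup>2)"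
    unfolding power2_norm_eq_inner inner_vec_2 by (simp add: algebra_simps power2_eq_square)
  then show ?thesis
    by (metis abs_of_nonneg norm_ge_zero real_sqrt_abs real_sqrt_mult)
qed

lemma frame_expand: "y = ((y \<bullet> d) / (norm d)\<^sup>2) *\<^sub>R d + ((y \<bullet> rot d) / (norm d)\<^sup>2) *\<^sub>R rot d"
  if "d \<noteq> 0" for d y :: "real^2"
proof -
  have c: "(norm d)\<^sup>2 \<noteq> 0" using that by simp
  have "(norm d)\<^sup>2 *\<^sub>R y = (y \<bullet> d) *\<^sub>R d + (y \<bullet> rot d) *\<^sub>R rot d"
    by (simp add: vec_eq_iff forall_2 power2_norm_eq_inner inner_vec_2 algebra_simps)
  then have "(1 / (norm d)\<^sup>2) *\<^sub>R ((norm d)\<^sup>2 *\<^sub>R y) = (1 / (norm d)\<^sup>2) *\<^sub>R ((y \<bullet> d) *\<^sub>R d + (y \<bullet> rot d) *\<^sub>R rot d)"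
    by simp
  then show ?thesis using c by (simp add: scaleR_add_right)
qed

lemma nn_integral_frame:
  fixes a d :: "real^2"
  assumes d: "d \<noteq> 0"
  obtains C where "0 < C"
    "\<And>f. f \<in> borel_measurable borel \<Longrightarrow>
       (\<integral>\<^sup>+t. \<integral>\<^sup>+s. f (a + t *\<^sub>R d + s *\<^sub>R rot d) \<partial>lborel \<partial>lborel) \<le> ennreal C * (\<integral>\<^sup>+y. f y \<partial>lborel)"
    "\<And>f. f \<in> borel_measurable borel \<Longrightarrow>
       (\<integral>\<^sup>+y. f y \<partial>lborel) \<le> ennreal C * (\<integral>\<^sup>+t. \<integral>\<^sup>+s. f (a + t *\<^sub>R d + s *\<^sub>R rot d) \<partial>lborel \<partial>lborel)"
proof -
  define \<Phi> where "\<Phi> p = a + fst p *\<^sub>R d + snd p *\<^sub>R rot d" for p :: "real \<times> real"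
  define \<Phi>' where "\<Phi>' y = (((y - a) \<bullet> d) / (norm d)\<^sup>2, ((y - a) \<bullet> rot d) / (norm d)\<^sup>2)" for y
  have d0: "norm d > 0" using d by simp
  have c\<Phi>: "continuous_on UNIV \<Phi>" unfolding \<Phi>_def by (intro continuous_intros)
  have c\<Phi>': "continuous_on UNIV \<Phi>'" unfolding \<Phi>'_def using d by (intro continuous_intros) auto
  have inv: "\<Phi> (\<Phi>' y) = y" for y
    using frame_expand[OF d, of "y - a"] by (simp add: \<Phi>_def \<Phi>'_def algebra_simps)
  have dist\<Phi>: "dist (\<Phi> p) (\<Phi> q) = norm d * dist p q" for p q
  proof -
    have "\<Phi> p - \<Phi> q = (fst p - fst q) *\<^sub>R d + (snd p - snd q) *\<^sub>R rot d"
      by (simp add: \<Phi>_def algebra_simps)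
    then show ?thesis
      by (simp add: dist_norm norm_frame norm_prod_def)
  qed
  define C1 where "C1 = (\<Prod>i\<in>(Basis::(real \<times> real) set). 2 * real DIM(real^2) * (1 / norm d))"
  define C2 where "C2 = (\<Prod>i\<in>(Basis::(real^2) set). 2 * real DIM(real \<times> real) * norm d)"
  have pos: "0 < C1" "0 < C2" unfolding C1_def C2_def using d0 by (auto intro!: prod_pos)
  have 1: "(\<integral>\<^sup>+t. \<integral>\<^sup>+s. f (a + t *\<^sub>R d + s *\<^sub>R rot d) \<partial>lborel \<partial>lborel) \<le> ennreal C1 * (\<integral>\<^sup>+y. f y \<partial>lborel)"
    if [measurable]: "f \<in> borel_measurable borel" for f
  proof -
    have [measurable]: "\<Phi> \<in> borel_measurable borel" by (rule borel_measurable_continuous_onI[OF c\<Phi>])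
    have "(\<integral>\<^sup>+p. f (\<Phi> p) * indicator UNIV p \<partial>lborel) \<le> ennreal C1 * (\<integral>\<^sup>+y. f y \<partial>lborel)"
      unfolding C1_def
    proof (rule nn_integral_expanding_le)
      fix p q i :: "real \<times> real" assume i: "i \<in> Basis"
      have "\<bar>p \<bullet> i - q \<bullet> i\<bar> \<le> dist p q"
        using Basis_le_norm[OF i, of "p - q"] by (simp add: inner_diff_left dist_norm)
      then show "\<bar>p \<bullet> i - q \<bullet> i\<bar> \<le> 1 / norm d * dist (\<Phi> p) (\<Phi> q)" using d0 by (simp add: dist\<Phi>)
    qed (use c\<Phi> in auto)
    then show ?thesis by (simp add: nn_integral_lborel_pair) (simp add: \<Phi>_def)
  qed
  have 2: "(\<integral>\<^sup>+y. f y \<partial>lborel) \<le> ennreal C2 * (\<integral>\<^sup>+t. \<integral>\<^sup>+s. f (a + t *\<^sub>R d + s *\<^sub>R rot d) \<partial>lborel \<partial>lborel)"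
    if [measurable]: "f \<in> borel_measurable borel" for f
  proof -
    have [measurable]: "\<Phi> \<in> borel_measurable borel" by (rule borel_measurable_continuous_onI[OF c\<Phi>])
    have "(\<integral>\<^sup>+y. f (\<Phi> (\<Phi>' y)) * indicator UNIV y \<partial>lborel) \<le> ennreal C2 * (\<integral>\<^sup>+p. f (\<Phi> p) \<partial>lborel)"
      unfolding C2_def
    proof (rule nn_integral_expanding_le[where f="\<lambda>p. f (\<Phi> p)"])
      fix y z i :: "real^2" assume i: "i \<in> Basis"
      have "\<bar>y \<bullet> i - z \<bullet> i\<bar> \<le> dist y z"
        using Basis_le_norm[OF i, of "y - z"] by (simp add: inner_diff_left dist_norm)
      also have "\<dots> = norm d * dist (\<Phi>' y) (\<Phi>' z)" using dist\<Phi>[of "\<Phi>' y" "\<Phi>' z"] by (simp add: inv)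
      finally show "\<bar>y \<bullet> i - z \<bullet> i\<bar> \<le> norm d * dist (\<Phi>' y) (\<Phi>' z)" .
    qed (use c\<Phi>' in auto)
    then show ?thesis by (simp add: nn_integral_lborel_pair inv) (simp add: \<Phi>_def)
  qed
  show ?thesis
  proof (rule that[of "C1 + C2"])
    fix f :: "real^2 \<Rightarrow> ennreal" assume f: "f \<in> borel_measurable borel"
    show "(\<integral>\<^sup>+t. \<integral>\<^sup>+s. f (a + t *\<^sub>R d + s *\<^sub>R rot d) \<partial>lborel \<partial>lborel) \<le> ennreal (C1 + C2) * (\<integral>\<^sup>+y. f y \<partial>lborel)"
      by (rule order_trans[OF 1[OF f]]) (use pos in \<open>auto intro!: mult_right_mono ennreal_leI\<close>)
    show "(\<integral>\<^sup>+y. f y \<partial>lborel) \<le> ennreal (C1 + C2) * (\<integral>\<^sup>+t. \<integral>\<^sup>+s. f (a + t *\<^sub>R d + s *\<^sub>R rot d) \<partial>lborel \<partial>lborel)"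
      by (rule order_trans[OF 2[OF f]]) (use pos in \<open>auto intro!: mult_right_mono ennreal_leI\<close>)
  qed (use pos in simp)
qed

text \<open>Almost every line in direction \<open>rot d\<close> carries an absolutely continuous representative; its value at
  parameter \<open>0\<close> is the limit of the mollifications there.\<close>

lemma line_limits:
  fixes a d :: "real^2"
  assumes d: "d \<noteq> 0" and r0: "0 < r0" and \<delta>: "0 < \<delta>"
    and w: "integrable lborel w" and G: "\<And>i. integrable lborel (\<lambda>y. G y $ i)"
    and weak: "\<And>\<phi> i. test_function W \<phi> \<Longrightarrow>
      (LINT y|lborel. w y * partial_deriv i \<phi> y) = - (LINT y|lborel. G y $ i * \<phi> y)"
    and box: "\<And>t s. \<alpha> \<le> t \<Longrightarrow> t \<le> \<beta> \<Longrightarrow> \<bar>s\<bar> \<le> \<delta> \<Longrightarrow> cball (a + t *\<^sub>R d + s *\<^sub>R rot d) r0 \<subseteq> W"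
  obtains v where "v \<in> borel_measurable borel"
    "AE t in lborel. \<alpha> \<le> t \<and> t \<le> \<beta> \<longrightarrow> (AE s in lborel. \<bar>s\<bar> \<le> \<delta> \<longrightarrow>
       ennreal \<bar>w (a + t *\<^sub>R d + s *\<^sub>R rot d) - v t\<bar>
         \<le> (\<integral>\<^sup>+u\<in>{-\<bar>s\<bar>..\<bar>s\<bar>}. ennreal \<bar>G (a + t *\<^sub>R d + u *\<^sub>R rot d) \<bullet> rot d\<bar> \<partial>lborel))"
proof -
  define g where "g y = G y \<bullet> rot d" for y
  have g: "integrable lborel g"
    unfolding g_def inner_vec_def using G by auto
  have [measurable]: "w \<in> borel_measurable borel" "g \<in> borel_measurable borel" using w g by auto
  have "\<exists>\<theta>. 0 < \<theta> \<and> \<theta> < r0 \<and> (\<integral>\<^sup>+z. ennreal \<bar>moll \<theta> w z - w z\<bar> \<partial>lborel) \<le> ennreal ((1/2)^n)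
      \<and> (\<integral>\<^sup>+z. ennreal \<bar>moll \<theta> g z - g z\<bar> \<partial>lborel) \<le> ennreal ((1/2)^n)" for n :: nat
  proof -
    have p: "(0::ennreal) < ennreal ((1/2)^n)" by simp
    have "\<forall>\<^sub>F \<theta> in at_right 0. 0 < \<theta> \<and> \<theta> < r0 \<and> (\<integral>\<^sup>+z. ennreal \<bar>moll \<theta> w z - w z\<bar> \<partial>lborel) < ennreal ((1/2)^n)
      \<and> (\<integral>\<^sup>+z. ennreal \<bar>moll \<theta> g z - g z\<bar> \<partial>lborel) < ennreal ((1/2)^n)"
      using order_tendstoD(2)[OF moll_L1[OF w] p] order_tendstoD(2)[OF moll_L1[OF g] p]
        eventually_at_right_less[of 0] eventually_at_rightI[of 0 r0 "\<lambda>\<theta>. \<theta> < r0"] r0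
      by (intro eventually_conj) auto
    from eventually_happens'[OF trivial_limit_at_right_real this]
    show ?thesis by (auto intro: less_imp_le)
  qed
  then have "\<exists>\<theta>. \<forall>n::nat. 0 < \<theta> n \<and> \<theta> n < r0 \<and> (\<integral>\<^sup>+z. ennreal \<bar>moll (\<theta> n) w z - w z\<bar> \<partial>lborel) \<le> ennreal ((1/2)^n)
      \<and> (\<integral>\<^sup>+z. ennreal \<bar>moll (\<theta> n) g z - g z\<bar> \<partial>lborel) \<le> ennreal ((1/2)^n)"
    by (intro choice allI)
  then obtain \<theta> where \<theta>: "\<And>n::nat. 0 < \<theta> n" "\<And>n. \<theta> n < r0"
    "\<And>n. (\<integral>\<^sup>+z. ennreal \<bar>moll (\<theta> n) w z - w z\<bar> \<partial>lborel) \<le> ennreal ((1/2)^n)"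
    "\<And>n. (\<integral>\<^sup>+z. ennreal \<bar>moll (\<theta> n) g z - g z\<bar> \<partial>lborel) \<le> ennreal ((1/2)^n)"
    by blast
  define \<Phi> where "\<Phi> t s = a + t *\<^sub>R d + s *\<^sub>R rot d" for t s
  define f where "f n = moll (\<theta> n) w" for n
  define h where "h n = moll (\<theta> n) g" for n
  have cf: "continuous_on A (f n)" "continuous_on A (h n)" for n A
    unfolding f_def h_def by (intro continuous_moll \<theta> w g)+
  have [measurable]: "f n \<in> borel_measurable borel" "h n \<in> borel_measurable borel" for n
    by (rule borel_measurable_continuous_onI[OF cf(1)], rule borel_measurable_continuous_onI[OF cf(2)])
  have \<Phi>m [measurable]: "(\<lambda>p. \<Phi> (fst p) (snd p)) \<in> borel_measurable borel"
    unfolding \<Phi>_def by (intro borel_measurable_continuous_onI continuous_intros)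
  have \<Phi>m' [measurable]: "(\<lambda>s. \<Phi> t s) \<in> borel_measurable borel" "(\<lambda>t. \<Phi> t s) \<in> borel_measurable borel" for t s
    unfolding \<Phi>_def by (intro borel_measurable_continuous_onI continuous_intros)+
  obtain C where C: "0 < C" "\<And>f. f \<in> borel_measurable borel \<Longrightarrow>
       (\<integral>\<^sup>+t. \<integral>\<^sup>+s. f (\<Phi> t s) \<partial>lborel \<partial>lborel) \<le> ennreal C * (\<integral>\<^sup>+y. f y \<partial>lborel)"
    using nn_integral_frame[OF d, of a] unfolding \<Phi>_def by metis
  define E where "E n y = ennreal \<bar>f n y - w y\<bar> + ennreal \<bar>h n y - g y\<bar>" for n y
  have [measurable]: "E n \<in> borel_measurable borel" for n unfolding E_def by measurable
  have "(\<integral>\<^sup>+y. (\<Sum>n. E n y) \<partial>lborel) = (\<Sum>n. \<integral>\<^sup>+y. E n y \<partial>lborel)"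
    by (rule nn_integral_suminf) auto
  also have "\<dots> \<le> (\<Sum>n. ennreal (2 * (1/2)^n))"
  proof (intro suminf_le allI)
    fix n
    have "(\<integral>\<^sup>+y. E n y \<partial>lborel) = (\<integral>\<^sup>+y. ennreal \<bar>f n y - w y\<bar> \<partial>lborel) + (\<integral>\<^sup>+y. ennreal \<bar>h n y - g y\<bar> \<partial>lborel)"
      unfolding E_def by (rule nn_integral_add) auto
    also have "\<dots> \<le> ennreal ((1/2)^n) + ennreal ((1/2)^n)"
      unfolding f_def h_def by (intro add_mono \<theta>)
    also have "\<dots> = ennreal (2 * (1/2)^n)" by (simp add: ennreal_plus[symmetric] del: ennreal_plus)
    finally show "(\<integral>\<^sup>+y. E n y \<partial>lborel) \<le> ennreal (2 * (1/2)^n)" .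
  qed auto
  also have "\<dots> < \<infinity>"
    by (subst suminf_ennreal2) (auto intro!: summable_mult)
  finally have Efin: "(\<integral>\<^sup>+y. (\<Sum>n. E n y) \<partial>lborel) < \<infinity>" .
  have "(\<integral>\<^sup>+t. \<integral>\<^sup>+s. (\<Sum>n. E n (\<Phi> t s)) \<partial>lborel \<partial>lborel) \<le> ennreal C * (\<integral>\<^sup>+y. (\<Sum>n. E n y) \<partial>lborel)"
    by (rule C(2)) measurable
  also have "\<dots> < \<infinity>" using Efin by (simp add: ennreal_mult_less_top)
  finally have "(\<integral>\<^sup>+t. \<integral>\<^sup>+s. (\<Sum>n. E n (\<Phi> t s)) \<partial>lborel \<partial>lborel) \<noteq> \<infinity>" by simp
  moreover have "(\<lambda>t. \<integral>\<^sup>+s. (\<Sum>n. E n (\<Phi> t s)) \<partial>lborel) \<in> borel_measurable lborel"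
  proof -
    have "(\<lambda>p. \<Sum>n. E n (\<Phi> (fst p) (snd p))) \<in> borel_measurable (lborel \<Otimes>\<^sub>M lborel)"
      unfolding lborel_prod by measurable
    from lborel.borel_measurable_nn_integral_fst[OF this] show ?thesis by simp
  qed
  ultimately have AEt: "AE t in lborel. (\<integral>\<^sup>+s. (\<Sum>n. E n (\<Phi> t s)) \<partial>lborel) \<noteq> \<infinity>"
    by (intro nn_integral_PInf_AE)
  define v where "v t = lim (\<lambda>n. f n (\<Phi> t 0))" for t
  have "v \<in> borel_measurable borel" unfolding v_def by measurable
  moreover have "AE t in lborel. \<alpha> \<le> t \<and> t \<le> \<beta> \<longrightarrow> (AE s in lborel. \<bar>s\<bar> \<le> \<delta> \<longrightarrow>
       ennreal \<bar>w (\<Phi> t s) - v t\<bar> \<le> (\<integral>\<^sup>+u\<in>{-\<bar>s\<bar>..\<bar>s\<bar>}. ennreal \<bar>g (\<Phi> t u)\<bar> \<partial>lborel))"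
    using AEt
  proof (eventually_elim, intro impI)
    case (elim t)
    assume t: "\<alpha> \<le> t \<and> t \<le> \<beta>"
    define e where "e n = (\<integral>\<^sup>+s. E n (\<Phi> t s) \<partial>lborel)" for n
    have "(\<Sum>n. e n) = (\<integral>\<^sup>+s. (\<Sum>n. E n (\<Phi> t s)) \<partial>lborel)"
      unfolding e_def by (rule nn_integral_suminf[symmetric]) measurable
    then have esum: "(\<Sum>n. e n) \<noteq> top" using elim by simp
    have e0: "e \<longlonglongrightarrow> 0"
    proof -
      have fin: "e n < top" for n
        using esum by (metis ennreal_suminf_lessD top.not_eq_extremum)
      define q where "q n = enn2real (e n)" for n
      have eq: "e n = ennreal (q n)" "0 \<le> q n" for n using fin[of n] by (auto simp: q_def)
      have "summable q"
      proof (rule summable_suminf_not_top[OF eq(2)])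
        show "(\<Sum>n. ennreal (q n)) \<noteq> top" using esum by (simp only: eq(1)[symmetric] not_False_eq_True)
      qed
      then have "q \<longlonglongrightarrow> 0" by (rule summable_LIMSEQ_zero)
      then have "(\<lambda>n. ennreal (q n)) \<longlonglongrightarrow> ennreal 0" by (rule tendsto_ennrealI)
      moreover have "e = (\<lambda>n. ennreal (q n))" by (rule ext) (rule eq(1))
      ultimately show ?thesis by (simp only: ennreal_0)
    qed
    have K: "((\<lambda>s. f n (\<Phi> t s)) has_real_derivative h n (\<Phi> t s)) (at s)" if "\<bar>s\<bar> \<le> \<delta>" for n s
      unfolding f_def h_def g_def \<Phi>_def
    proof (rule DERIV_moll_line[OF \<theta>(1) w G weak])
      show "cball (a + t *\<^sub>R d + s *\<^sub>R rot d) (\<theta> n) \<subseteq> W"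
        using box[of t s] t that \<theta>(2)[of n] subset_cball[of "\<theta> n" r0] by (meson less_imp_le order_trans)
    qed
    have hcont: "continuous_on UNIV (\<lambda>s. h n (\<Phi> t s))" for n
      by (rule continuous_on_compose2[OF cf(2)[of UNIV]]) (auto simp: \<Phi>_def intro!: continuous_intros)
    have split: "(\<integral>\<^sup>+u\<in>A. ennreal \<bar>x u\<bar> \<partial>lborel) \<le> (\<integral>\<^sup>+u\<in>A. ennreal \<bar>y u\<bar> \<partial>lborel) + (\<integral>\<^sup>+u. ennreal \<bar>x u - y u\<bar> \<partial>lborel)"
      if [measurable]: "x \<in> borel_measurable borel" "y \<in> borel_measurable borel" "A \<in> sets borel"
      for x y :: "real \<Rightarrow> real" and A
      by (subst nn_integral_add[symmetric])
        (auto intro!: nn_integral_mono ennreal_leI split: split_indicator simp: ennreal_plus[symmetric] simp del: ennreal_plus)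
    have he: "(\<integral>\<^sup>+u. ennreal \<bar>h n (\<Phi> t u) - g (\<Phi> t u)\<bar> \<partial>lborel) \<le> e n" for n
      unfolding e_def E_def by (intro nn_integral_mono) auto
    have fe: "(\<integral>\<^sup>+u. ennreal \<bar>f n (\<Phi> t u) - w (\<Phi> t u)\<bar> \<partial>lborel) \<le> e n" for n
      unfolding e_def E_def by (intro nn_integral_mono) auto
    have diff0: "ennreal (2 * \<delta>) * ennreal \<bar>f n (\<Phi> t 0) - f k (\<Phi> t 0)\<bar> \<le> (e n + e k) + ennreal (2 * \<delta>) * (e n + e k)" for n k
    proof -
      have pt: "ennreal \<bar>f n (\<Phi> t 0) - f k (\<Phi> t 0)\<bar> \<le> ennreal \<bar>f n (\<Phi> t s) - w (\<Phi> t s)\<bar> + ennreal \<bar>f k (\<Phi> t s) - w (\<Phi> t s)\<bar> + (e n + e k)"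
        if s: "\<bar>s\<bar> \<le> \<delta>" for s
      proof -
        have "ennreal \<bar>(f n (\<Phi> t s) - f k (\<Phi> t s)) - (f n (\<Phi> t 0) - f k (\<Phi> t 0))\<bar>
           \<le> (\<integral>\<^sup>+u\<in>{-\<bar>s\<bar>..\<bar>s\<bar>}. ennreal \<bar>h n (\<Phi> t u) - h k (\<Phi> t u)\<bar> \<partial>lborel)"
          by (rule abs_FTC_le[of \<delta> "\<lambda>s. f n (\<Phi> t s) - f k (\<Phi> t s)"])
            (auto intro!: DERIV_diff K continuous_on_diff hcont s)
        also have "\<dots> \<le> (\<integral>\<^sup>+u. ennreal \<bar>h n (\<Phi> t u) - g (\<Phi> t u)\<bar> + ennreal \<bar>h k (\<Phi> t u) - g (\<Phi> t u)\<bar> \<partial>lborel)"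
          by (intro nn_integral_mono)
            (auto intro!: ennreal_leI split: split_indicator simp: ennreal_plus[symmetric] simp del: ennreal_plus)
        also have "\<dots> \<le> e n + e k"
          by (subst nn_integral_add) (auto intro!: add_mono he)
        finally have b: "ennreal \<bar>(f n (\<Phi> t s) - f k (\<Phi> t s)) - (f n (\<Phi> t 0) - f k (\<Phi> t 0))\<bar> \<le> e n + e k" .
        have "ennreal \<bar>f n (\<Phi> t 0) - f k (\<Phi> t 0)\<bar> \<le> ennreal \<bar>f n (\<Phi> t s) - w (\<Phi> t s)\<bar> + ennreal \<bar>f k (\<Phi> t s) - w (\<Phi> t s)\<bar>
           + ennreal \<bar>(f n (\<Phi> t s) - f k (\<Phi> t s)) - (f n (\<Phi> t 0) - f k (\<Phi> t 0))\<bar>"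
          by (auto simp: ennreal_plus[symmetric] simp del: ennreal_plus intro!: ennreal_leI)
        then show ?thesis using b by (meson add_left_mono order_trans)
      qed
      have [measurable]: "{-\<delta>..\<delta>} \<in> sets borel" by simp
      have len: "(\<integral>\<^sup>+s. c * indicator {-\<delta>..\<delta>} s \<partial>lborel) = ennreal (2 * \<delta>) * c" for c :: ennreal
        using \<delta> by (simp add: nn_integral_cmult_indicator mult.commute)
      have "ennreal (2 * \<delta>) * ennreal \<bar>f n (\<Phi> t 0) - f k (\<Phi> t 0)\<bar>
          = (\<integral>\<^sup>+s. ennreal \<bar>f n (\<Phi> t 0) - f k (\<Phi> t 0)\<bar> * indicator {-\<delta>..\<delta>} s \<partial>lborel)"
        by (simp add: len)
      also have "\<dots> \<le> (\<integral>\<^sup>+s. ennreal \<bar>f n (\<Phi> t s) - w (\<Phi> t s)\<bar> + ennreal \<bar>f k (\<Phi> t s) - w (\<Phi> t s)\<bar> + (e n + e k) * indicator {-\<delta>..\<delta>} s \<partial>lborel)"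
        using pt by (intro nn_integral_mono) (auto split: split_indicator)
      also have "\<dots> = (\<integral>\<^sup>+s. ennreal \<bar>f n (\<Phi> t s) - w (\<Phi> t s)\<bar> \<partial>lborel) + (\<integral>\<^sup>+s. ennreal \<bar>f k (\<Phi> t s) - w (\<Phi> t s)\<bar> \<partial>lborel) + ennreal (2 * \<delta>) * (e n + e k)"
        by (simp add: nn_integral_add len)
      also have "\<dots> \<le> (e n + e k) + ennreal (2 * \<delta>) * (e n + e k)"
        by (intro add_mono fe order_refl)
      finally show ?thesis .
    qed
    have "Cauchy (\<lambda>n. f n (\<Phi> t 0))"
    proof (rule metric_CauchyI)
      fix \<epsilon> :: real assume \<epsilon>: "0 < \<epsilon>"
      define \<eta> where "\<eta> = \<delta> * \<epsilon> / (2 * (1 + 2 * \<delta>))"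
      have \<eta>: "0 < \<eta>" using \<delta> \<epsilon> by (simp add: \<eta>_def)
      have "\<forall>\<^sub>F n in sequentially. e n < ennreal \<eta>" using e0 \<eta> by (intro order_tendstoD) auto
      then obtain N where N: "\<And>n. n \<ge> N \<Longrightarrow> e n < ennreal \<eta>" unfolding eventually_sequentially by blast
      have "dist (f n (\<Phi> t 0)) (f k (\<Phi> t 0)) < \<epsilon>" if "n \<ge> N" "k \<ge> N" for n k
      proof -
        have "e n + e k \<le> ennreal \<eta> + ennreal \<eta>"
          by (intro add_mono less_imp_le N that)
        also have "\<dots> = ennreal (2 * \<eta>)"
          using \<eta> by (simp add: ennreal_plus[symmetric] del: ennreal_plus)
        finally have ee: "e n + e k \<le> ennreal (2 * \<eta>)" .
        have "ennreal (2 * \<delta>) * ennreal \<bar>f n (\<Phi> t 0) - f k (\<Phi> t 0)\<bar> \<le> ennreal (2 * \<eta>) + ennreal (2 * \<delta>) * ennreal (2 * \<eta>)"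
          by (rule order_trans[OF diff0]) (intro add_mono ee mult_left_mono; simp)
        moreover have "ennreal (2 * \<delta>) * ennreal \<bar>f n (\<Phi> t 0) - f k (\<Phi> t 0)\<bar> = ennreal (2 * \<delta> * \<bar>f n (\<Phi> t 0) - f k (\<Phi> t 0)\<bar>)"
          using \<delta> by (intro ennreal_mult[symmetric]) auto
        moreover have "ennreal (2 * \<eta>) + ennreal (2 * \<delta>) * ennreal (2 * \<eta>) = ennreal (2 * \<eta> + 2 * \<delta> * (2 * \<eta>))"
          using \<delta> \<eta> by (subst ennreal_mult[symmetric]) (auto simp: ennreal_plus[symmetric] simp del: ennreal_plus)
        ultimately have "ennreal (2 * \<delta> * \<bar>f n (\<Phi> t 0) - f k (\<Phi> t 0)\<bar>) \<le> ennreal (2 * \<eta> + 2 * \<delta> * (2 * \<eta>))"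
          by (simp only:)
        then have "2 * \<delta> * \<bar>f n (\<Phi> t 0) - f k (\<Phi> t 0)\<bar> \<le> 2 * \<eta> + 2 * \<delta> * (2 * \<eta>)"
          using \<delta> \<eta> by (subst (asm) ennreal_le_iff) auto
        also have "\<dots> = \<eta> * (2 * (1 + 2 * \<delta>))" by (simp add: algebra_simps)
        also have "\<dots> = \<delta> * \<epsilon>" using \<delta> unfolding \<eta>_def by (intro nonzero_eq_divide_eq[THEN iffD1, OF _ refl]) auto
        also have "\<dots> < 2 * \<delta> * \<epsilon>" using \<delta> \<epsilon> by simp
        finally show ?thesis using \<delta> by (simp add: dist_real_def)
      qed
      then show "\<exists>M. \<forall>m\<ge>M. \<forall>n\<ge>M. dist (f m (\<Phi> t 0)) (f n (\<Phi> t 0)) < \<epsilon>" by blast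
    qed
    then have vlim: "(\<lambda>n. f n (\<Phi> t 0)) \<longlonglongrightarrow> v t"
      unfolding v_def using Cauchy_convergent convergent_LIMSEQ_iff by blast
    have "AE s in lborel. (\<Sum>n. E n (\<Phi> t s)) \<noteq> \<infinity>"
    proof (rule nn_integral_PInf_AE)
      show "(\<lambda>s. \<Sum>n. E n (\<Phi> t s)) \<in> borel_measurable lborel" by measurable
    qed (rule elim)
    then show "AE s in lborel. \<bar>s\<bar> \<le> \<delta> \<longrightarrow> ennreal \<bar>w (\<Phi> t s) - v t\<bar> \<le> (\<integral>\<^sup>+u\<in>{-\<bar>s\<bar>..\<bar>s\<bar>}. ennreal \<bar>g (\<Phi> t u)\<bar> \<partial>lborel)"
    proof (rule AE_mp, intro AE_I2 impI)
      fix s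
      assume elim: "(\<Sum>n. E n (\<Phi> t s)) \<noteq> \<infinity>" and s: "\<bar>s\<bar> \<le> \<delta>"
      have wl: "(\<lambda>n. f n (\<Phi> t s)) \<longlonglongrightarrow> w (\<Phi> t s)"
      proof -
        have "(\<Sum>n. ennreal \<bar>f n (\<Phi> t s) - w (\<Phi> t s)\<bar>) \<le> (\<Sum>n. E n (\<Phi> t s))"
          unfolding E_def by (rule suminf_le) auto
        then have "(\<Sum>n. ennreal \<bar>f n (\<Phi> t s) - w (\<Phi> t s)\<bar>) \<noteq> top"
          using elim by (auto simp: top_unique)
        then have "summable (\<lambda>n. \<bar>f n (\<Phi> t s) - w (\<Phi> t s)\<bar>)"
          by (intro summable_suminf_not_top) auto
        then have "(\<lambda>n. \<bar>f n (\<Phi> t s) - w (\<Phi> t s)\<bar>) \<longlonglongrightarrow> 0" by (rule summable_LIMSEQ_zero)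
        then show ?thesis by (simp add: tendsto_rabs_zero_iff LIM_zero_iff)
      qed
      have b: "ennreal \<bar>f n (\<Phi> t s) - f n (\<Phi> t 0)\<bar> \<le> (\<integral>\<^sup>+u\<in>{-\<bar>s\<bar>..\<bar>s\<bar>}. ennreal \<bar>g (\<Phi> t u)\<bar> \<partial>lborel) + e n" for n
      proof -
        have "ennreal \<bar>f n (\<Phi> t s) - f n (\<Phi> t 0)\<bar> \<le> (\<integral>\<^sup>+u\<in>{-\<bar>s\<bar>..\<bar>s\<bar>}. ennreal \<bar>h n (\<Phi> t u)\<bar> \<partial>lborel)"
          by (rule abs_FTC_le[of \<delta> "\<lambda>s. f n (\<Phi> t s)"]) (auto intro!: K hcont s)
        also have "\<dots> \<le> (\<integral>\<^sup>+u\<in>{-\<bar>s\<bar>..\<bar>s\<bar>}. ennreal \<bar>g (\<Phi> t u)\<bar> \<partial>lborel) + (\<integral>\<^sup>+u. ennreal \<bar>h n (\<Phi> t u) - g (\<Phi> t u)\<bar> \<partial>lborel)"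
          by (rule split) auto
        also have "\<dots> \<le> (\<integral>\<^sup>+u\<in>{-\<bar>s\<bar>..\<bar>s\<bar>}. ennreal \<bar>g (\<Phi> t u)\<bar> \<partial>lborel) + e n"
          by (intro add_left_mono he)
        finally show ?thesis .
      qed
      have l1: "(\<lambda>n. ennreal \<bar>f n (\<Phi> t s) - f n (\<Phi> t 0)\<bar>) \<longlonglongrightarrow> ennreal \<bar>w (\<Phi> t s) - v t\<bar>"
        by (intro tendsto_ennrealI tendsto_rabs tendsto_diff wl vlim)
      have l2: "(\<lambda>n. (\<integral>\<^sup>+u\<in>{-\<bar>s\<bar>..\<bar>s\<bar>}. ennreal \<bar>g (\<Phi> t u)\<bar> \<partial>lborel) + e n) \<longlonglongrightarrow> (\<integral>\<^sup>+u\<in>{-\<bar>s\<bar>..\<bar>s\<bar>}. ennreal \<bar>g (\<Phi> t u)\<bar> \<partial>lborel) + 0"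
        by (intro tendsto_add tendsto_const e0)
      show "ennreal \<bar>w (\<Phi> t s) - v t\<bar> \<le> (\<integral>\<^sup>+u\<in>{-\<bar>s\<bar>..\<bar>s\<bar>}. ennreal \<bar>g (\<Phi> t u)\<bar> \<partial>lborel)"
        using LIMSEQ_le[OF l1 l2] b by auto
    qed
  qed
  ultimately show ?thesis using that unfolding \<Phi>_def g_def by blast
qed

lemma set_integrable_of_integrable:
  "integrable lborel f \<Longrightarrow> A \<in> sets lborel \<Longrightarrow> set_integrable lborel A (f :: real \<Rightarrow> real)"
  unfolding set_integrable_def by (rule integrable_mult_indicator)

lemma nn_integral_lebesgue_point_le:
  fixes f :: "real \<Rightarrow> real"
  assumes f: "integrable lborel f" and \<rho>: "0 < \<rho>" and le: "(LINT y:{x-\<rho>..x+\<rho>}|lborel. \<bar>f y - f x\<bar>) / \<rho> < \<epsilon>"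
  shows "(\<integral>\<^sup>+y\<in>{x-\<rho>..x+\<rho>}. ennreal \<bar>f y - f x\<bar> \<partial>lborel) \<le> ennreal (\<epsilon> * \<rho>)"
proof -
  have "set_integrable lborel {x-\<rho>..x+\<rho>} (\<lambda>y. \<bar>f y - f x\<bar>)"
    by (intro set_integrable_abs set_integral_diff set_integrable_of_integrable f
      borel_integrable_atLeastAtMost' continuous_on_const) simp
  then have "(\<integral>\<^sup>+y. ennreal (indicator {x-\<rho>..x+\<rho>} y *\<^sub>R \<bar>f y - f x\<bar>) \<partial>lborel) = ennreal (LINT y:{x-\<rho>..x+\<rho>}|lborel. \<bar>f y - f x\<bar>)"
    unfolding set_integrable_def set_lebesgue_integral_def by (intro nn_integral_eq_integral) auto
  moreover have "(\<integral>\<^sup>+y. ennreal (indicator {x-\<rho>..x+\<rho>} y *\<^sub>R \<bar>f y - f x\<bar>) \<partial>lborel) = (\<integral>\<^sup>+y\<in>{x-\<rho>..x+\<rho>}. ennreal \<bar>f y - f x\<bar> \<partial>lborel)"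
    by (intro nn_integral_cong) (auto split: split_indicator)
  moreover have "(LINT y:{x-\<rho>..x+\<rho>}|lborel. \<bar>f y - f x\<bar>) \<le> \<epsilon> * \<rho>" using le \<rho> by (simp add: field_simps)
  ultimately show ?thesis by (metis ennreal_leI)
qed

lemma lebesgue_value_on_box:
  fixes a d :: "real^2"
  assumes d: "d \<noteq> 0" and r0: "0 < r0" and \<delta>: "0 < \<delta>"
    and w: "integrable lborel w" and G: "\<And>i. integrable lborel (\<lambda>y. G y $ i)"
    and weak: "\<And>\<phi> i. test_function W \<phi> \<Longrightarrow>
      (LINT y|lborel. w y * partial_deriv i \<phi> y) = - (LINT y|lborel. G y $ i * \<phi> y)"
    and box: "\<And>t s. \<alpha> \<le> t \<Longrightarrow> t \<le> \<beta> \<Longrightarrow> \<bar>s\<bar> \<le> \<delta> \<Longrightarrow> cball (a + t *\<^sub>R d + s *\<^sub>R rot d) r0 \<subseteq> W"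
  shows "AE t in lborel. \<alpha> < t \<and> t < \<beta> \<longrightarrow> (\<exists>v. lebesgue_value w (a + t *\<^sub>R d) v)"
proof -
  define g where "g y = G y \<bullet> rot d" for y
  define \<Phi> where "\<Phi> t s = a + t *\<^sub>R d + s *\<^sub>R rot d" for t s
  define m where "m \<rho> t = (\<integral>\<^sup>+u\<in>{-\<rho>..\<rho>}. ennreal \<bar>g (\<Phi> t u)\<bar> \<partial>lborel)" for \<rho> t
  have g: "integrable lborel g"
    unfolding g_def inner_vec_def using G by auto
  have [measurable]: "w \<in> borel_measurable borel" "g \<in> borel_measurable borel" using w g by auto
  have [measurable]: "(\<lambda>p. \<Phi> (fst p) (snd p)) \<in> borel_measurable borel"
    unfolding \<Phi>_def by (intro borel_measurable_continuous_onI continuous_intros)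
  have [measurable]: "(\<lambda>s. \<Phi> t s) \<in> borel_measurable borel" "(\<lambda>t. \<Phi> t s) \<in> borel_measurable borel" for t s
    unfolding \<Phi>_def by (intro borel_measurable_continuous_onI continuous_intros)+
  have [measurable]: "(\<lambda>p::real \<times> real. snd p) \<in> borel_measurable borel"
    by (intro borel_measurable_continuous_onI continuous_intros)
  obtain C where C: "0 < C" "\<And>f. f \<in> borel_measurable borel \<Longrightarrow>
       (\<integral>\<^sup>+t. \<integral>\<^sup>+s. f (\<Phi> t s) \<partial>lborel \<partial>lborel) \<le> ennreal C * (\<integral>\<^sup>+y. f y \<partial>lborel)"
    "\<And>f. f \<in> borel_measurable borel \<Longrightarrow>
       (\<integral>\<^sup>+y. f y \<partial>lborel) \<le> ennreal C * (\<integral>\<^sup>+t. \<integral>\<^sup>+s. f (\<Phi> t s) \<partial>lborel \<partial>lborel)"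
    using nn_integral_frame[OF d, of a] unfolding \<Phi>_def by blast
  obtain v where [measurable]: "v \<in> borel_measurable borel" and
    v: "AE t in lborel. \<alpha> \<le> t \<and> t \<le> \<beta> \<longrightarrow> (AE s in lborel. \<bar>s\<bar> \<le> \<delta> \<longrightarrow> ennreal \<bar>w (\<Phi> t s) - v t\<bar> \<le> m \<bar>s\<bar> t)"
    using line_limits[OF d r0 \<delta> w G weak box] unfolding \<Phi>_def m_def g_def by blast
  have pairm: "(\<lambda>t. \<integral>\<^sup>+s. F (\<Phi> t s) * indicator A s \<partial>lborel) \<in> borel_measurable borel"
    if [measurable]: "F \<in> borel_measurable borel" "A \<in> sets borel" for F :: "real^2 \<Rightarrow> ennreal" and A :: "real set"
  proof -
    have "(\<lambda>p. F (\<Phi> (fst p) (snd p)) * indicator A (snd p)) \<in> borel_measurable (lborel \<Otimes>\<^sub>M lborel)"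
      unfolding lborel_prod by measurable
    from lborel.borel_measurable_nn_integral_fst[OF this] show ?thesis by simp
  qed
  have mm [measurable]: "m \<rho> \<in> borel_measurable borel" for \<rho>
    unfolding m_def by (rule pairm) auto
  have m_mono: "m \<rho> t \<le> m \<rho>' t" if "\<rho> \<le> \<rho>'" for \<rho> \<rho>' t
    unfolding m_def using that by (intro nn_integral_mono) (auto split: split_indicator)
  have norm_fin: "(\<integral>\<^sup>+y. ennreal \<bar>f y\<bar> \<partial>lborel) < \<infinity>" if "integrable lborel f" for f :: "real^2 \<Rightarrow> real"
    using that unfolding integrable_iff_bounded by simp
  have mfin: "(\<integral>\<^sup>+t. m \<rho> t \<partial>lborel) < \<infinity>" for \<rho>
  proof -
    have "(\<integral>\<^sup>+t. m \<rho> t \<partial>lborel) \<le> (\<integral>\<^sup>+t. \<integral>\<^sup>+s. ennreal \<bar>g (\<Phi> t s)\<bar> \<partial>lborel \<partial>lborel)"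
      unfolding m_def by (intro nn_integral_mono) (auto split: split_indicator)
    also have "\<dots> \<le> ennreal C * (\<integral>\<^sup>+y. ennreal \<bar>g y\<bar> \<partial>lborel)" by (rule C(2)) measurable
    also have "\<dots> < \<infinity>" using norm_fin[OF g] by (simp add: ennreal_mult_less_top)
    finally show ?thesis .
  qed
  have mAE: "AE t in lborel. m \<delta> t \<noteq> \<infinity>"
  proof (rule nn_integral_PInf_AE)
    show "(\<integral>\<^sup>+t. m \<delta> t \<partial>lborel) \<noteq> \<infinity>" using mfin[of \<delta>] by simp
  qed simp
  define V where "V t = v t * indicator {\<alpha>..\<beta>} t" for t
  have [measurable]: "V \<in> borel_measurable borel" unfolding V_def by measurable
  have V: "integrable lborel V"
  proof (rule integrableI_bounded)
    have "AE t in lborel. ennreal (2 * \<delta>) * ennreal (norm (V t)) \<le> (\<integral>\<^sup>+s. ennreal \<bar>w (\<Phi> t s)\<bar> \<partial>lborel) + ennreal (2 * \<delta>) * m \<delta> t"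
      using v
    proof (rule AE_mp, intro AE_I2 impI)
      fix t assume *: "\<alpha> \<le> t \<and> t \<le> \<beta> \<longrightarrow> (AE s in lborel. \<bar>s\<bar> \<le> \<delta> \<longrightarrow> ennreal \<bar>w (\<Phi> t s) - v t\<bar> \<le> m \<bar>s\<bar> t)"
      show "ennreal (2 * \<delta>) * ennreal (norm (V t)) \<le> (\<integral>\<^sup>+s. ennreal \<bar>w (\<Phi> t s)\<bar> \<partial>lborel) + ennreal (2 * \<delta>) * m \<delta> t"
      proof (cases "\<alpha> \<le> t \<and> t \<le> \<beta>")
        case True
        have len: "(\<integral>\<^sup>+s. c * indicator {-\<delta>..\<delta>} s \<partial>lborel) = ennreal (2 * \<delta>) * c" for c :: ennreal
          using \<delta> by (simp add: nn_integral_cmult_indicator mult.commute)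
        have "ennreal (2 * \<delta>) * ennreal (norm (V t)) = (\<integral>\<^sup>+s. ennreal \<bar>v t\<bar> * indicator {-\<delta>..\<delta>} s \<partial>lborel)"
          using True by (simp add: len V_def)
        also have "\<dots> \<le> (\<integral>\<^sup>+s. ennreal \<bar>w (\<Phi> t s)\<bar> + m \<delta> t * indicator {-\<delta>..\<delta>} s \<partial>lborel)"
        proof (rule nn_integral_mono_AE)
          have "AE s in lborel. \<bar>s\<bar> \<le> \<delta> \<longrightarrow> ennreal \<bar>w (\<Phi> t s) - v t\<bar> \<le> m \<bar>s\<bar> t" using * True by simp
          then show "AE s in lborel. ennreal \<bar>v t\<bar> * indicator {-\<delta>..\<delta>} s \<le> ennreal \<bar>w (\<Phi> t s)\<bar> + m \<delta> t * indicator {-\<delta>..\<delta>} s"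
          proof (rule AE_mp, intro AE_I2 impI)
            fix s assume **: "\<bar>s\<bar> \<le> \<delta> \<longrightarrow> ennreal \<bar>w (\<Phi> t s) - v t\<bar> \<le> m \<bar>s\<bar> t"
            show "ennreal \<bar>v t\<bar> * indicator {-\<delta>..\<delta>} s \<le> ennreal \<bar>w (\<Phi> t s)\<bar> + m \<delta> t * indicator {-\<delta>..\<delta>} s"
            proof (cases "s \<in> {-\<delta>..\<delta>}")
              case True
              then have s: "\<bar>s\<bar> \<le> \<delta>" by auto
              have "ennreal \<bar>v t\<bar> \<le> ennreal \<bar>w (\<Phi> t s)\<bar> + ennreal \<bar>w (\<Phi> t s) - v t\<bar>"
                by (auto simp: ennreal_plus[symmetric] simp del: ennreal_plus intro!: ennreal_leI)
              also have "\<dots> \<le> ennreal \<bar>w (\<Phi> t s)\<bar> + m \<delta> t"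
                using ** s m_mono[OF s, of t] by (intro add_left_mono) auto
              finally show ?thesis using True by simp
            qed simp
          qed
        qed
        also have "\<dots> = (\<integral>\<^sup>+s. ennreal \<bar>w (\<Phi> t s)\<bar> \<partial>lborel) + ennreal (2 * \<delta>) * m \<delta> t"
          by (simp add: nn_integral_add len)
        finally show ?thesis .
      qed (auto simp: V_def)
    qed
    then have "(\<integral>\<^sup>+t. ennreal (2 * \<delta>) * ennreal (norm (V t)) \<partial>lborel)
        \<le> (\<integral>\<^sup>+t. (\<integral>\<^sup>+s. ennreal \<bar>w (\<Phi> t s)\<bar> \<partial>lborel) + ennreal (2 * \<delta>) * m \<delta> t \<partial>lborel)"
      by (rule nn_integral_mono_AE)
    also have "\<dots> = (\<integral>\<^sup>+t. (\<integral>\<^sup>+s. ennreal \<bar>w (\<Phi> t s)\<bar> \<partial>lborel) \<partial>lborel) + ennreal (2 * \<delta>) * (\<integral>\<^sup>+t. m \<delta> t \<partial>lborel)"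
      using pairm[of "\<lambda>y. ennreal \<bar>w y\<bar>" UNIV] by (simp add: nn_integral_add nn_integral_cmult)
    also have "\<dots> \<le> ennreal C * (\<integral>\<^sup>+y. ennreal \<bar>w y\<bar> \<partial>lborel) + ennreal (2 * \<delta>) * (\<integral>\<^sup>+t. m \<delta> t \<partial>lborel)"
      by (intro add_right_mono C(2)) measurable
    also have "\<dots> < \<infinity>" using norm_fin[OF w] mfin[of \<delta>] by (simp add: ennreal_mult_less_top)
    finally have "ennreal (2 * \<delta>) * (\<integral>\<^sup>+t. ennreal (norm (V t)) \<partial>lborel) < \<infinity>"
      by (simp add: nn_integral_cmult)
    then show "(\<integral>\<^sup>+t. ennreal (norm (V t)) \<partial>lborel) < \<infinity>"
      using \<delta> by (auto simp: ennreal_mult_less_top)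
  qed simp
  define M where "M k t = enn2real (m (\<delta> / real (Suc k)) t)" for k t
  have [measurable]: "M k \<in> borel_measurable borel" for k unfolding M_def by measurable
  have M: "integrable lborel (M k)" for k
  proof (rule integrableI_bounded)
    have "(\<integral>\<^sup>+t. ennreal (norm (M k t)) \<partial>lborel) \<le> (\<integral>\<^sup>+t. m (\<delta> / real (Suc k)) t \<partial>lborel)"
      unfolding M_def by (intro nn_integral_mono) (simp add: ennreal_enn2real_if)
    then show "(\<integral>\<^sup>+t. ennreal (norm (M k t)) \<partial>lborel) < \<infinity>" using mfin by (rule le_less_trans)
  qed simp
  have "AE t in lborel. \<forall>k. ((\<lambda>r. (LINT y:{t-r..t+r}|lborel. \<bar>M k y - M k t\<bar>) / r) \<longlongrightarrow> 0) (at_right 0)"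
    unfolding AE_all_countable by (intro allI lebesgue_points_real set_integrable_of_integrable M) simp
  moreover have "AE t in lborel. ((\<lambda>r. (LINT y:{t-r..t+r}|lborel. \<bar>V y - V t\<bar>) / r) \<longlongrightarrow> 0) (at_right 0)"
    by (intro lebesgue_points_real set_integrable_of_integrable V) simp
  ultimately have "AE t in lborel. m \<delta> t \<noteq> \<infinity> \<and>
     (\<forall>k. ((\<lambda>r. (LINT y:{t-r..t+r}|lborel. \<bar>M k y - M k t\<bar>) / r) \<longlongrightarrow> 0) (at_right 0)) \<and>
     ((\<lambda>r. (LINT y:{t-r..t+r}|lborel. \<bar>V y - V t\<bar>) / r) \<longlongrightarrow> 0) (at_right 0)"
    using mAE by simp
  then show ?thesis
  proof (rule AE_mp, intro AE_I2 impI, elim conjE)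
    fix t assume mt: "m \<delta> t \<noteq> \<infinity>"
      and LM: "\<forall>k. ((\<lambda>r. (LINT y:{t-r..t+r}|lborel. \<bar>M k y - M k t\<bar>) / r) \<longlongrightarrow> 0) (at_right 0)"
      and LV: "((\<lambda>r. (LINT y:{t-r..t+r}|lborel. \<bar>V y - V t\<bar>) / r) \<longlongrightarrow> 0) (at_right 0)"
      and t: "\<alpha> < t" "t < \<beta>"
    have M0: "(\<lambda>k. m (\<delta> / real (Suc k)) t) \<longlonglongrightarrow> 0"
    proof -
      have "(\<lambda>k. \<integral>\<^sup>+u. ennreal \<bar>g (\<Phi> t u)\<bar> * indicator {-(\<delta> / real (Suc k))..\<delta> / real (Suc k)} u \<partial>lborel) \<longlonglongrightarrow> nn_integral lborel (\<lambda>u::real. 0)"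
      proof (rule nn_integral_dominated_convergence[where w="\<lambda>u. ennreal \<bar>g (\<Phi> t u)\<bar> * indicator {-\<delta>..\<delta>} u"])
        show "(\<integral>\<^sup>+u. ennreal \<bar>g (\<Phi> t u)\<bar> * indicator {-\<delta>..\<delta>} u \<partial>lborel) < \<infinity>"
          using mt unfolding m_def by (simp add: less_top)
        show "AE u in lborel. ennreal \<bar>g (\<Phi> t u)\<bar> * indicator {-(\<delta> / real (Suc k))..\<delta> / real (Suc k)} u \<le> ennreal \<bar>g (\<Phi> t u)\<bar> * indicator {-\<delta>..\<delta>} u" for k
        proof -
          have "\<delta> / real (Suc k) \<le> \<delta>" using \<delta> by (simp add: field_simps)
          then show ?thesis by (intro AE_I2) (auto split: split_indicator)
        qed
        show "AE u in lborel. (\<lambda>k. ennreal \<bar>g (\<Phi> t u)\<bar> * indicator {-(\<delta> / real (Suc k))..\<delta> / real (Suc k)} u) \<longlonglongrightarrow> 0"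
          using AE_lborel_singleton[of 0]
        proof (rule AE_mp, intro AE_I2 impI)
          fix u :: real assume u: "u \<noteq> 0"
          have "(\<lambda>k. \<delta> / real (Suc k)) \<longlonglongrightarrow> 0"
            using LIMSEQ_Suc[OF lim_const_over_n[of \<delta>]] by simp
          then have "\<forall>\<^sub>F k in sequentially. \<delta> / real (Suc k) < \<bar>u\<bar>" using u by (intro order_tendstoD) auto
          then have "\<forall>\<^sub>F k in sequentially. 0 = ennreal \<bar>g (\<Phi> t u)\<bar> * indicator {-(\<delta> / real (Suc k))..\<delta> / real (Suc k)} u"
            by eventually_elim (auto split: split_indicator)
          then show "(\<lambda>k. ennreal \<bar>g (\<Phi> t u)\<bar> * indicator {-(\<delta> / real (Suc k))..\<delta> / real (Suc k)} u) \<longlonglongrightarrow> 0"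
            by (rule Lim_transform_eventually[OF tendsto_const])
        qed
      qed measurable
      then show ?thesis by (simp add: m_def)
    qed
    have "lebesgue_value w (a + t *\<^sub>R d) (v t)"
      unfolding lebesgue_value_def
    proof (intro allI impI)
      fix e :: real assume e: "0 < e"
      have d0: "norm d > 0" using d by simp
      define \<epsilon> where "\<epsilon> = e * (norm d)\<^sup>2 / (8 * C)"
      have \<epsilon>: "0 < \<epsilon>" using e d0 C by (simp add: \<epsilon>_def)
      have "\<forall>\<^sub>F k in sequentially. m (\<delta> / real (Suc k)) t < ennreal \<epsilon>"
        using M0 \<epsilon> by (intro order_tendstoD) auto
      then obtain k where k: "m (\<delta> / real (Suc k)) t < ennreal \<epsilon>" by (auto dest: eventually_happens)
      define \<delta>' where "\<delta>' = \<delta> / real (Suc k)"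
      have \<delta>': "0 < \<delta>'" "\<delta>' \<le> \<delta>" using \<delta> by (auto simp: \<delta>'_def field_simps)
      have Mk: "M k t \<le> \<epsilon>" using k \<epsilon> unfolding M_def
        by (metis enn2real_leI less_imp_le)
      have "\<forall>\<^sub>F \<rho> in at_right 0. (LINT y:{t-\<rho>..t+\<rho>}|lborel. \<bar>M k y - M k t\<bar>) / \<rho> < \<epsilon>
         \<and> (LINT y:{t-\<rho>..t+\<rho>}|lborel. \<bar>V y - V t\<bar>) / \<rho> < \<epsilon>"
        using LM LV \<epsilon> by (intro eventually_conj order_tendstoD(2)) auto
      then obtain b where b: "0 < b" "\<And>\<rho>. 0 < \<rho> \<Longrightarrow> \<rho> < b \<Longrightarrow>
          (LINT y:{t-\<rho>..t+\<rho>}|lborel. \<bar>M k y - M k t\<bar>) / \<rho> < \<epsilon> \<and> (LINT y:{t-\<rho>..t+\<rho>}|lborel. \<bar>V y - V t\<bar>) / \<rho> < \<epsilon>"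
        unfolding eventually_at_right_field by blast
      define b' where "b' = min b (min \<delta>' (min (t - \<alpha>) (\<beta> - t)))"
      have b': "0 < b'" using b \<delta>' t by (simp add: b'_def)
      show "\<forall>\<^sub>F r in at_right 0. (\<integral>\<^sup>+y\<in>ball (a + t *\<^sub>R d) r. ennreal \<bar>w y - v t\<bar> \<partial>lborel) \<le> ennreal (e * r\<^sup>2)"
        unfolding eventually_at_right_field
      proof (intro exI[of _ "b' * norm d"] conjI allI impI)
        show "0 < b' * norm d" using b' d0 by simp
        fix r :: real assume r: "0 < r" "r < b' * norm d"
        define \<rho> where "\<rho> = r / norm d"
        have \<rho>: "0 < \<rho>" "\<rho> < b'" using r d0 by (auto simp: \<rho>_def field_simps)
        have I1: "(\<integral>\<^sup>+y\<in>{t-\<rho>..t+\<rho>}. ennreal \<bar>M k y - M k t\<bar> \<partial>lborel) \<le> ennreal (\<epsilon> * \<rho>)"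
          using b(2)[of \<rho>] \<rho> by (intro nn_integral_lebesgue_point_le M) (auto simp: b'_def)
        have I2: "(\<integral>\<^sup>+y\<in>{t-\<rho>..t+\<rho>}. ennreal \<bar>V y - V t\<bar> \<partial>lborel) \<le> ennreal (\<epsilon> * \<rho>)"
          using b(2)[of \<rho>] \<rho> by (intro nn_integral_lebesgue_point_le V) (auto simp: b'_def)
        let ?B = "ball (a + t *\<^sub>R d) r"
        have [measurable]: "?B \<in> sets borel" by simp
        have inB: "\<bar>t' - t\<bar> \<le> \<rho> \<and> \<bar>s\<bar> \<le> \<rho>" if "\<Phi> t' s \<in> ?B" for t' s
        proof -
          have "\<Phi> t' s - (a + t *\<^sub>R d) = (t' - t) *\<^sub>R d + s *\<^sub>R rot d"
            by (simp add: \<Phi>_def algebra_simps)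
          then have "norm ((t' - t) *\<^sub>R d + s *\<^sub>R rot d) < r"
            using that by (metis dist_commute dist_norm mem_ball)
          then have "norm d * sqrt ((t' - t)\<^sup>2 + s\<^sup>2) < r" unfolding norm_frame .
          then have "sqrt ((t' - t)\<^sup>2 + s\<^sup>2) < \<rho>" using d0 by (simp add: \<rho>_def pos_less_divide_eq mult.commute)
          moreover have "\<bar>t' - t\<bar> \<le> sqrt ((t' - t)\<^sup>2 + s\<^sup>2)" "\<bar>s\<bar> \<le> sqrt ((t' - t)\<^sup>2 + s\<^sup>2)"
            by (auto intro: real_le_rsqrt)
          ultimately show ?thesis by linarith
        qed
        have len: "(\<integral>\<^sup>+s. c * indicator {-\<rho>..\<rho>} s \<partial>lborel) = ennreal (2 * \<rho>) * c" for c :: ennreal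
          using \<rho> by (simp add: nn_integral_cmult_indicator mult.commute)
        define Q where "Q t' = M k t + \<bar>M k t' - M k t\<bar> + \<bar>V t' - V t\<bar>" for t'
        have Q0: "0 \<le> Q t'" for t' unfolding Q_def M_def by simp
        have inner: "AE t' in lborel. (\<integral>\<^sup>+s. ennreal \<bar>w (\<Phi> t' s) - v t\<bar> * indicator ?B (\<Phi> t' s) \<partial>lborel)
           \<le> ennreal (2 * \<rho>) * (ennreal (Q t') * indicator {t-\<rho>..t+\<rho>} t')"
          using v mAE
        proof (eventually_elim)
          case (elim t')
          show ?case
          proof (cases "t' \<in> {t-\<rho>..t+\<rho>}")
            case False
            then have "\<Phi> t' s \<notin> ?B" for s using inB[of t' s] by (auto simp: abs_le_iff)
            then show ?thesis by simp
          next
            case True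
            then have t': "\<alpha> \<le> t'" "t' \<le> \<beta>" using \<rho> by (auto simp: b'_def)
            have "m \<delta>' t' \<noteq> \<infinity>" using elim(2) m_mono[OF \<delta>'(2), of t'] by (auto simp: top_unique)
            then have mM: "m \<delta>' t' = ennreal (M k t')" by (simp add: M_def \<delta>'_def less_top)
            have "(\<integral>\<^sup>+s. ennreal \<bar>w (\<Phi> t' s) - v t\<bar> * indicator ?B (\<Phi> t' s) \<partial>lborel)
              \<le> (\<integral>\<^sup>+s. ennreal (Q t') * indicator {-\<rho>..\<rho>} s \<partial>lborel)"
            proof (rule nn_integral_mono_AE)
              have "AE s in lborel. \<bar>s\<bar> \<le> \<delta> \<longrightarrow> ennreal \<bar>w (\<Phi> t' s) - v t'\<bar> \<le> m \<bar>s\<bar> t'" using elim(1) t' by simp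
              then show "AE s in lborel. ennreal \<bar>w (\<Phi> t' s) - v t\<bar> * indicator ?B (\<Phi> t' s) \<le> ennreal (Q t') * indicator {-\<rho>..\<rho>} s"
              proof (eventually_elim)
                case (elim s)
                show ?case
                proof (cases "\<Phi> t' s \<in> ?B")
                  case B: True
                  then have s: "\<bar>s\<bar> \<le> \<rho>" using inB by blast
                  then have s': "\<bar>s\<bar> \<le> \<delta>'" "\<bar>s\<bar> \<le> \<delta>" using \<rho> \<delta>' by (auto simp: b'_def)
                  have VV: "V t' = v t'" "V t = v t" using t' t by (auto simp: V_def)
                  have "ennreal \<bar>w (\<Phi> t' s) - v t'\<bar> \<le> ennreal (M k t')"
                    using elim s'(2) m_mono[OF s'(1), of t'] mM by auto
                  then have "\<bar>w (\<Phi> t' s) - v t'\<bar> \<le> M k t'"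
                    by (subst (asm) ennreal_le_iff) (auto simp: M_def)
                  then have "\<bar>w (\<Phi> t' s) - v t\<bar> \<le> Q t'" unfolding Q_def VV by linarith
                  then show ?thesis using B s by (auto simp: abs_le_iff intro!: ennreal_leI)
                qed simp
              qed
            qed
            then show ?thesis using True by (simp add: len)
          qed
        qed
        have "(\<integral>\<^sup>+y\<in>?B. ennreal \<bar>w y - v t\<bar> \<partial>lborel)
          \<le> ennreal C * (\<integral>\<^sup>+t'. \<integral>\<^sup>+s. ennreal \<bar>w (\<Phi> t' s) - v t\<bar> * indicator ?B (\<Phi> t' s) \<partial>lborel \<partial>lborel)"
          by (rule C(3)) measurable
        also have "\<dots> \<le> ennreal C * (\<integral>\<^sup>+t'. ennreal (2 * \<rho>) * (ennreal (Q t') * indicator {t-\<rho>..t+\<rho>} t') \<partial>lborel)"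
          by (intro mult_left_mono nn_integral_mono_AE inner) simp
        also have "\<dots> = ennreal C * (ennreal (2 * \<rho>) * (\<integral>\<^sup>+t'. ennreal (Q t') * indicator {t-\<rho>..t+\<rho>} t' \<partial>lborel))"
          unfolding Q_def by (subst nn_integral_cmult) auto
        also have "(\<integral>\<^sup>+t'. ennreal (Q t') * indicator {t-\<rho>..t+\<rho>} t' \<partial>lborel)
          = (\<integral>\<^sup>+t'. ennreal (M k t) * indicator {t-\<rho>..t+\<rho>} t' \<partial>lborel) + (\<integral>\<^sup>+t'\<in>{t-\<rho>..t+\<rho>}. ennreal \<bar>M k t' - M k t\<bar> \<partial>lborel)
            + (\<integral>\<^sup>+t'\<in>{t-\<rho>..t+\<rho>}. ennreal \<bar>V t' - V t\<bar> \<partial>lborel)"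
        proof -
          have "0 \<le> M k t" by (simp add: M_def)
          then have "ennreal (Q t') * indicator {t-\<rho>..t+\<rho>} t' = ennreal (M k t) * indicator {t-\<rho>..t+\<rho>} t'
             + ennreal \<bar>M k t' - M k t\<bar> * indicator {t-\<rho>..t+\<rho>} t' + ennreal \<bar>V t' - V t\<bar> * indicator {t-\<rho>..t+\<rho>} t'" for t'
            unfolding Q_def by (auto split: split_indicator simp: ennreal_plus)
          then show ?thesis by (simp add: nn_integral_add)
        qed
        also have "\<dots> \<le> ennreal (2 * \<rho> * \<epsilon>) + ennreal (\<epsilon> * \<rho>) + ennreal (\<epsilon> * \<rho>)"
        proof (intro add_mono I1 I2)
          have "(\<integral>\<^sup>+t'. ennreal (M k t) * indicator {t-\<rho>..t+\<rho>} t' \<partial>lborel) = ennreal (M k t) * ennreal (2 * \<rho>)"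
            using \<rho> by (simp add: nn_integral_cmult_indicator)
          also have "\<dots> \<le> ennreal \<epsilon> * ennreal (2 * \<rho>)" by (intro mult_right_mono ennreal_leI Mk) simp
          also have "\<dots> = ennreal (2 * \<rho> * \<epsilon>)" using \<epsilon> \<rho> by (subst ennreal_mult[symmetric]) (auto simp: mult_ac)
          finally show "(\<integral>\<^sup>+t'. ennreal (M k t) * indicator {t-\<rho>..t+\<rho>} t' \<partial>lborel) \<le> ennreal (2 * \<rho> * \<epsilon>)" .
        qed
        also have "ennreal (2 * \<rho> * \<epsilon>) + ennreal (\<epsilon> * \<rho>) + ennreal (\<epsilon> * \<rho>) = ennreal (4 * \<epsilon> * \<rho>)"
          using \<epsilon> \<rho> by (simp add: ennreal_plus[symmetric] del: ennreal_plus)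
        also have "ennreal C * (ennreal (2 * \<rho>) * ennreal (4 * \<epsilon> * \<rho>)) = ennreal (C * (2 * \<rho> * (4 * \<epsilon> * \<rho>)))"
        proof -
          have "ennreal (2 * \<rho>) * ennreal (4 * \<epsilon> * \<rho>) = ennreal (2 * \<rho> * (4 * \<epsilon> * \<rho>))"
            using \<rho> \<epsilon> by (intro ennreal_mult[symmetric]) auto
          moreover have "ennreal C * ennreal (2 * \<rho> * (4 * \<epsilon> * \<rho>)) = ennreal (C * (2 * \<rho> * (4 * \<epsilon> * \<rho>)))"
            using \<rho> \<epsilon> C by (intro ennreal_mult[symmetric]) auto
          ultimately show ?thesis by (simp only:)
        qed
        also have "C * (2 * \<rho> * (4 * \<epsilon> * \<rho>)) = e * r\<^sup>2"
          using C d0 by (simp add: \<epsilon>_def \<rho>_def power2_eq_square)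
        finally show "(\<integral>\<^sup>+y\<in>?B. ennreal \<bar>w y - v t\<bar> \<partial>lborel) \<le> ennreal (e * r\<^sup>2)"
          by (simp add: mult_left_mono)
      qed
    qed
    then show "\<exists>v. lebesgue_value w (a + t *\<^sub>R d) v" by blast
  qed
qed

lemma lebesgue_value_on_line:
  fixes a d :: "real^2"
  assumes d: "d \<noteq> 0" and W: "open W"
    and w: "integrable lborel w" and G: "\<And>i. integrable lborel (\<lambda>y. G y $ i)"
    and weak: "\<And>\<phi> i. test_function W \<phi> \<Longrightarrow>
      (LINT y|lborel. w y * partial_deriv i \<phi> y) = - (LINT y|lborel. G y $ i * \<phi> y)"
  shows "AE t in lborel. a + t *\<^sub>R d \<in> W \<longrightarrow> (\<exists>v. lebesgue_value w (a + t *\<^sub>R d) v)"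
proof -
  define bx where "bx q n \<longleftrightarrow> (\<forall>t s. q - 1 / real (Suc n) \<le> t \<and> t \<le> q + 1 / real (Suc n) \<and> \<bar>s\<bar> \<le> 1 / real (Suc n)
     \<longrightarrow> cball (a + t *\<^sub>R d + s *\<^sub>R rot d) (1 / real (Suc n)) \<subseteq> W)" for q and n :: nat
  have "AE t in lborel. bx q n \<longrightarrow> q - 1 / real (Suc n) < t \<and> t < q + 1 / real (Suc n) \<longrightarrow> (\<exists>v. lebesgue_value w (a + t *\<^sub>R d) v)" for q n
  proof (cases "bx q n")
    case True
    have "AE t in lborel. q - 1 / real (Suc n) < t \<and> t < q + 1 / real (Suc n) \<longrightarrow> (\<exists>v. lebesgue_value w (a + t *\<^sub>R d) v)"
      by (rule lebesgue_value_on_box[OF d _ _ w G weak, where ?r0.0="1 / real (Suc n)" and \<delta>="1 / real (Suc n)"])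
        (use True in \<open>auto simp: bx_def\<close>)
    then show ?thesis by simp
  qed simp
  then have "AE t in lborel. \<forall>q\<in>\<rat>. \<forall>n. bx q n \<longrightarrow> q - 1 / real (Suc n) < t \<and> t < q + 1 / real (Suc n) \<longrightarrow> (\<exists>v. lebesgue_value w (a + t *\<^sub>R d) v)"
    by (simp add: AE_ball_countable countable_rat AE_all_countable)
  then show ?thesis
  proof (rule AE_mp, intro AE_I2 impI)
    fix t0 assume *: "\<forall>q\<in>\<rat>. \<forall>n. bx q n \<longrightarrow> q - 1 / real (Suc n) < t0 \<and> t0 < q + 1 / real (Suc n) \<longrightarrow> (\<exists>v. lebesgue_value w (a + t0 *\<^sub>R d) v)"
      and x0: "a + t0 *\<^sub>R d \<in> W"
    obtain \<eta> where \<eta>: "0 < \<eta>" "ball (a + t0 *\<^sub>R d) \<eta> \<subseteq> W" using W x0 open_contains_ball by blast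
    obtain n :: nat where n: "1 / real (Suc n) < \<eta> / (3 * norm d + 1)"
      using reals_Archimedean[of "\<eta> / (3 * norm d + 1)"] \<eta> by (auto simp: add_nonneg_pos inverse_eq_divide)
    define p where "p = 1 / real (Suc n)"
    have c: "0 < 3 * norm d + 1" by (intro add_nonneg_pos) auto
    have p: "0 < p" "(3 * norm d + 1) * p < \<eta>"
      using n unfolding p_def[symmetric] pos_less_divide_eq[OF c] by (simp_all add: p_def mult.commute)
    obtain q where q: "q \<in> \<rat>" "t0 < q" "q < t0 + p" using Rats_dense_in_real[of t0 "t0 + p"] p by auto
    have "bx q n"
      unfolding bx_def p_def[symmetric]
    proof (intro allI impI subsetI)
      fix t s z assume ts: "q - p \<le> t \<and> t \<le> q + p \<and> \<bar>s\<bar> \<le> p" and z: "z \<in> cball (a + t *\<^sub>R d + s *\<^sub>R rot d) p"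
      have "norm (z - (a + t0 *\<^sub>R d)) \<le> norm (z - (a + t *\<^sub>R d + s *\<^sub>R rot d)) + norm ((t - t0) *\<^sub>R d) + norm (s *\<^sub>R rot d)"
        by (rule order_trans[OF _ order_trans[OF norm_triangle_ineq add_right_mono[OF norm_triangle_ineq]]])
          (simp add: algebra_simps)
      also have "\<dots> \<le> p + (2 * p) * norm d + p * norm d"
      proof (intro add_mono)
        show "norm (z - (a + t *\<^sub>R d + s *\<^sub>R rot d)) \<le> p" using z by (simp add: dist_norm norm_minus_commute)
        have "\<bar>t - t0\<bar> \<le> 2 * p" using ts q by linarith
        then show "norm ((t - t0) *\<^sub>R d) \<le> (2 * p) * norm d" by (simp add: mult_right_mono)
        show "norm (s *\<^sub>R rot d) \<le> p * norm d" using ts by (simp add: norm_rot mult_right_mono)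
      qed
      also have "\<dots> = (3 * norm d + 1) * p" by (simp add: algebra_simps)
      also have "\<dots> < \<eta>" by (rule p)
      finally show "z \<in> W" using \<eta>(2) by (auto simp: dist_norm norm_minus_commute)
    qed
    then show "\<exists>v. lebesgue_value w (a + t0 *\<^sub>R d) v"
      using *[rule_format, OF q(1), of n] q p unfolding p_def[symmetric] by auto
  qed
qed

section \<open>Triangles and surrogate meshes\<close>

lemma two_simplex_compact_convex:
  fixes T :: "(real^2) set"
  assumes "2 simplex T"
  shows "compact T" "convex T" "aff_dim T = 2"
proof -
  obtain C where C: "finite C" "\<not> affine_dependent C" "int (card C) = 2 + 1" "T = convex hull C"
    using assms unfolding simplex by auto
  show "compact T" "convex T" using C by (auto intro: compact_convex_hull finite_imp_compact)
  show "aff_dim T = 2" using C by (simp add: aff_dim_convex_hull aff_dim_affine_independent)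
qed

lemma edge_of_two_simplex:
  fixes T :: "(real^2) set"
  assumes T: "2 simplex T" and E: "E edge_of T"
  obtains a b c where "a \<noteq> b" "E = closed_segment a b" "T = convex hull {a, b, c}"
proof -
  obtain C where C: "finite C" "\<not> affine_dependent C" "card C = 3" "T = convex hull C"
    using T unfolding simplex by auto
  obtain c' where c': "c' \<subseteq> C" "E = convex hull c'"
    using E C face_of_convex_hull_affine_independent unfolding edge_of_def by metis
  have "aff_dim c' = int (card c') - 1"
    using affine_independent_subset[OF C(2) c'(1)] by (simp add: aff_dim_affine_independent)
  then have "card c' = 2" using E c' by (simp add: edge_of_def aff_dim_convex_hull)
  then obtain a b where ab: "c' = {a, b}" "a \<noteq> b" by (auto simp: card_2_iff)
  have "card (C - c') = 1" using C c' \<open>card c' = 2\<close> by (simp add: card_Diff_subset finite_subset)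
  then obtain c where "C - c' = {c}" by (auto simp: card_1_singleton_iff)
  then have "C = {a, b, c}" using c' ab by auto
  with C c' ab that show ?thesis by (simp add: segment_convex_hull)
qed

lemma card_edges_two_simplex:
  fixes T :: "(real^2) set"
  assumes "2 simplex T"
  shows "finite {E. E edge_of T}" "card {E. E edge_of T} \<le> 8"
proof -
  obtain C where C: "finite C" "\<not> affine_dependent C" "card C = 3" "T = convex hull C"
    using assms unfolding simplex by auto
  have sub: "{E. E edge_of T} \<subseteq> (hull) convex ` Pow C"
    using C face_of_convex_hull_affine_independent[OF C(2)] unfolding edge_of_def by blast
  have fin: "finite ((hull) convex ` Pow C)" using C by auto
  show "finite {E. E edge_of T}" by (rule finite_subset[OF sub fin])
  have "card {E. E edge_of T} \<le> card ((hull) convex ` Pow C)" by (rule card_mono[OF fin sub])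
  also have "\<dots> \<le> card (Pow C)" using C by (intro card_image_le) auto
  also have "\<dots> = 8" using C by (simp add: card_Pow)
  finally show "card {E. E edge_of T} \<le> 8" .
qed

lemma inball_le_edge_length:
  fixes a b c x :: "real^2"
  assumes ab: "a \<noteq> b" and r: "0 < r" and sub: "cball x r \<subseteq> convex hull {a, b, c}"
  shows "2 * r \<le> norm (b - a)"
proof -
  let ?d = "b - a" and ?\<phi> = "\<lambda>y. (y - a) \<bullet> rot (b - a)"
  define len where "len = norm ?d"
  have len: "0 < len" using ab by (simp add: len_def)
  have mem: "\<exists>u v. y = a + u *\<^sub>R ?d + v *\<^sub>R (c - a) \<and> 0 \<le> u \<and> 0 \<le> v \<and> u + v \<le> 1" if "y \<in> cball x r" for y
    using that sub unfolding convex_hull_3_alt by blast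
  have \<phi>: "?\<phi> (a + u *\<^sub>R ?d + v *\<^sub>R (c - a)) = v * ?\<phi> c" for u v
    by (simp add: inner_add_left inner_rot_self)
  have c0: "?\<phi> c \<noteq> 0"
  proof
    assume 0: "?\<phi> c = 0"
    have z: "?\<phi> y = 0" if "y \<in> cball x r" for y using mem[OF that] \<phi> 0 by auto
    have "x + (r / len) *\<^sub>R rot ?d \<in> cball x r" "x \<in> cball x r"
      using r len by (auto simp: dist_norm norm_rot len_def)
    then have "?\<phi> (x + (r / len) *\<^sub>R rot ?d) - ?\<phi> x = 0" using z by simp
    moreover have "?\<phi> (x + q *\<^sub>R rot ?d) - ?\<phi> x = q * (rot ?d \<bullet> rot ?d)" for q
      by (simp add: inner_diff_left inner_add_left)
    moreover have "rot ?d \<bullet> rot ?d = len\<^sup>2"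
      by (metis len_def norm_rot power2_norm_eq_inner)
    ultimately show False using r len by simp
  qed
  have "x + (r / len) *\<^sub>R ?d \<in> cball x r" "x - (r / len) *\<^sub>R ?d \<in> cball x r"
    using r len by (auto simp: dist_norm len_def)
  then obtain u v u' v' where
    1: "x + (r / len) *\<^sub>R ?d = a + u *\<^sub>R ?d + v *\<^sub>R (c - a)" "0 \<le> u" "0 \<le> v" "u + v \<le> 1" and
    2: "x - (r / len) *\<^sub>R ?d = a + u' *\<^sub>R ?d + v' *\<^sub>R (c - a)" "0 \<le> u'" "0 \<le> v'" "u' + v' \<le> 1"
    using mem by metis
  have "?\<phi> (x + (r / len) *\<^sub>R ?d) = ?\<phi> (x - (r / len) *\<^sub>R ?d)"
    by (simp add: inner_diff_left inner_add_left inner_rot_self)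
  then have "v = v'" unfolding 1(1) 2(1) \<phi> using c0 by simp
  have "(2 * (r / len)) *\<^sub>R ?d = (x + (r / len) *\<^sub>R ?d) - (x - (r / len) *\<^sub>R ?d)"
    by (simp add: algebra_simps scaleR_2[symmetric])
  also have "\<dots> = (u - u') *\<^sub>R ?d" unfolding 1(1) 2(1) \<open>v = v'\<close> by (simp add: algebra_simps)
  finally have "2 * (r / len) = u - u'" using ab by simp
  then have "2 * (r / len) \<le> 1" using 1 2 by linarith
  then show ?thesis using len by (simp add: field_simps len_def)
qed

lemma diameter_two_simplex_pos:
  fixes T :: "(real^2) set"
  assumes "2 simplex T"
  shows "0 < diameter T"
proof -
  note T = two_simplex_compact_convex[OF assms]
  have "T \<noteq> {}" using T(3) by auto
  then obtain x where x: "x \<in> T" by blast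
  have "T \<noteq> {x}" using T(3) by auto
  then obtain y where y: "y \<in> T" "y \<noteq> x" using x by blast
  have "dist x y \<le> diameter T" using diameter_bounded_bound[OF compact_imp_bounded[OF T(1)] x y(1)] .
  moreover have "0 < dist x y" using y by simp
  ultimately show ?thesis by linarith
qed

lemma shape_regular_inball:
  fixes T :: "(real^2) set"
  assumes T: "2 simplex T" and \<kappa>: "0 < \<kappa>" and reg: "diameter T \<le> \<kappa> * inradius T"
  obtains x r where "cball x r \<subseteq> T" "diameter T / (2 * \<kappa>) < r"
proof -
  note T' = two_simplex_compact_convex[OF T]
  let ?R = "{r. 0 \<le> r \<and> (\<exists>x. cball x r \<subseteq> T)}"
  have d: "0 < diameter T" by (rule diameter_two_simplex_pos[OF T])
  then have "diameter T / (2 * \<kappa>) < diameter T / \<kappa>" using \<kappa> by (simp add: field_simps)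
  also have "\<dots> \<le> Sup ?R" using reg \<kappa> by (simp add: inradius_def field_simps)
  finally have lt: "diameter T / (2 * \<kappa>) < Sup ?R" .
  obtain x where "x \<in> T" using d by (metis all_not_in_conv diameter_empty less_irrefl)
  then have "0 \<in> ?R" by (auto intro!: exI[of _ x])
  then obtain r where "r \<in> ?R" "diameter T / (2 * \<kappa>) < r"
    using less_cSupE[OF lt] by blast
  then show ?thesis using that by blast
qed

lemma measure_cball_2: "0 \<le> r \<Longrightarrow> measure lebesgue (cball (x::real^2) r) = pi * r\<^sup>2"
  using content_cball[of r x] by (simp add: unit_ball_vol_2)

lemma sum_measure_triangles_le:
  fixes \<A> :: "(real^2) set set"
  assumes tri: "triangulation \<T>" and s2: "\<And>T. T \<in> \<T> \<Longrightarrow> 2 simplex T" and A: "\<A> \<subseteq> \<T>"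
    and B: "B \<in> lmeasurable" and sub: "\<And>T. T \<in> \<A> \<Longrightarrow> T \<subseteq> B"
  shows "(\<Sum>T\<in>\<A>. measure lebesgue T) \<le> measure lebesgue B"
proof -
  have fin: "finite \<A>" using tri A unfolding triangulation_def by (auto intro: finite_subset)
  have lm: "T \<in> lmeasurable" if "T \<in> \<A>" for T
    using two_simplex_compact_convex[OF s2] that A lmeasurable_compact by blast
  have "measure lebesgue (\<Union>\<A>) = (\<Sum>T\<in>\<A>. measure lebesgue T)"
  proof (rule measure_negligible_finite_Union[OF fin lm])
    show "pairwise (\<lambda>S T. negligible (S \<inter> T)) \<A>"
    proof (rule pairwiseI)
      fix S T assume ST: "S \<in> \<A>" "T \<in> \<A>" "S \<noteq> T"
      note S' = two_simplex_compact_convex[OF s2[of S]] and T' = two_simplex_compact_convex[OF s2[of T]]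
      have mem: "S \<in> \<T>" "T \<in> \<T>" using ST A by auto
      have f1: "S \<inter> T face_of S" and f2: "T \<inter> S face_of T" using tri mem unfolding triangulation_def by auto
      have "S \<inter> T \<noteq> S"
      proof
        assume eq: "S \<inter> T = S"
        then have "S face_of T" using f2 by (simp add: Int_commute)
        then have "aff_dim S < aff_dim T" using face_of_aff_dim_lt[OF T'(2)] ST mem by blast
        then show False using S'(3) T'(3) mem by simp
      qed
      then have "aff_dim (S \<inter> T) < aff_dim S" using face_of_aff_dim_lt[OF S'(2)] f1 mem by blast
      then have "interior (S \<inter> T) = {}" using S'(3) mem by (intro low_dim_interior) simp
      moreover have "convex (S \<inter> T)" using S'(2) T'(2) mem by (intro convex_Int) auto
      ultimately show "negligible (S \<inter> T)" by (simp add: negligible_convex_interior)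
    qed
  qed
  moreover have "measure lebesgue (\<Union>\<A>) \<le> measure lebesgue B"
    using lm fin B sub by (intro measure_mono_fmeasurable) (auto intro: fmeasurableD finite_Union)
  ultimately show ?thesis by simp
qed

lemma sum_diameter_square_le:
  fixes \<E> :: "((real^2) set \<times> (real^2) set) set"
  assumes tri: "triangulation \<T>" and s2: "\<And>T. T \<in> \<T> \<Longrightarrow> 2 simplex T"
    and \<kappa>: "0 < \<kappa>" and reg: "\<And>T. T \<in> \<T> \<Longrightarrow> diameter T \<le> \<kappa> * inradius T"
    and E: "\<And>T E. (T, E) \<in> \<E> \<Longrightarrow> T \<in> \<T> \<and> E edge_of T \<and> T \<subseteq> B" and B: "B \<in> lmeasurable"
  shows "(\<Sum>(T, E)\<in>\<E>. (diameter T)\<^sup>2) \<le> 32 * \<kappa>\<^sup>2 / pi * measure lebesgue B"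
proof -
  let ?A = "fst ` \<E>"
  have A: "?A \<subseteq> \<T>" using E by auto
  have fA: "finite ?A" using tri A unfolding triangulation_def by (auto intro: finite_subset)
  have sub: "\<E> \<subseteq> Sigma ?A (\<lambda>T. {E. E edge_of T})" using E by force
  have fE: "finite {E. E edge_of T}" "card {E. E edge_of T} \<le> 8" if "T \<in> ?A" for T
    using card_edges_two_simplex[OF s2] A that by blast+
  have "(\<Sum>(T, E)\<in>\<E>. (diameter T)\<^sup>2) \<le> (\<Sum>(T, E)\<in>Sigma ?A (\<lambda>T. {E. E edge_of T}). (diameter T)\<^sup>2)"
    using fA fE by (intro sum_mono2[OF _ sub]) auto
  also have "\<dots> = (\<Sum>T\<in>?A. \<Sum>E\<in>{E. E edge_of T}. (diameter T)\<^sup>2)"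
    using fA fE by (subst sum.Sigma) auto
  also have "\<dots> \<le> (\<Sum>T\<in>?A. 8 * (4 * \<kappa>\<^sup>2 / pi * measure lebesgue T))"
  proof (rule sum_mono)
    fix T assume T: "T \<in> ?A"
    then have TT: "T \<in> \<T>" using A by auto
    obtain x r where xr: "cball x r \<subseteq> T" "diameter T / (2 * \<kappa>) < r"
      using shape_regular_inball[OF s2[OF TT] \<kappa> reg[OF TT]] .
    have d: "0 < diameter T" by (rule diameter_two_simplex_pos[OF s2[OF TT]])
    have r: "0 < r" using xr(2) d \<kappa> by (meson divide_pos_pos less_trans mult_pos_pos zero_less_numeral)
    have "(diameter T)\<^sup>2 \<le> (2 * \<kappa> * r)\<^sup>2"
      using xr(2) \<kappa> d by (intro power_mono) (auto simp: field_simps)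
    also have "\<dots> = 4 * \<kappa>\<^sup>2 / pi * measure lebesgue (cball x r)"
      using r by (subst measure_cball_2) (auto simp: power_mult_distrib)
    also have "\<dots> \<le> 4 * \<kappa>\<^sup>2 / pi * measure lebesgue T"
      using two_simplex_compact_convex[OF s2[OF TT]] xr
      by (intro mult_left_mono measure_mono_fmeasurable) (auto intro: lmeasurable_compact)
    finally have le: "(diameter T)\<^sup>2 \<le> 4 * \<kappa>\<^sup>2 / pi * measure lebesgue T" .
    have "(\<Sum>E\<in>{E. E edge_of T}. (diameter T)\<^sup>2) = real (card {E. E edge_of T}) * (diameter T)\<^sup>2" by simp
    also have "\<dots> \<le> 8 * (diameter T)\<^sup>2" using fE(2)[OF T] by (intro mult_right_mono) auto
    finally show "(\<Sum>E\<in>{E. E edge_of T}. (diameter T)\<^sup>2) \<le> 8 * (4 * \<kappa>\<^sup>2 / pi * measure lebesgue T)"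
      using le by linarith
  qed
  also have "\<dots> = 32 * \<kappa>\<^sup>2 / pi * (\<Sum>T\<in>?A. measure lebesgue T)"
    unfolding sum_distrib_left[symmetric] by simp
  also have "\<dots> \<le> 32 * \<kappa>\<^sup>2 / pi * measure lebesgue B"
  proof (intro mult_left_mono sum_measure_triangles_le[OF tri s2 A B])
    fix T assume "T \<in> ?A" then show "T \<subseteq> B" using E by force
  qed auto
  finally show ?thesis .
qed

lemma tube_measure_le:
  fixes \<gamma> :: "real \<Rightarrow> real^2"
  assumes L: "0 \<le> L" and lip: "\<And>s t. s \<in> {0..1} \<Longrightarrow> t \<in> {0..1} \<Longrightarrow> norm (\<gamma> s - \<gamma> t) \<le> L * \<bar>s - t\<bar>"
    and h: "0 < h" "h \<le> 1"
  obtains B where "B \<in> lmeasurable" "\<And>t. t \<in> {0..1} \<Longrightarrow> cball (\<gamma> t) (2 * h) \<subseteq> B"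
    "measure lebesgue B \<le> 3 * pi * (L + 2)\<^sup>2 * h"
proof -
  define N where "N = nat \<lceil>1 / h\<rceil>"
  have N1: "1 / h \<le> real N" unfolding N_def by (rule real_nat_ceiling_ge)
  have h1: "1 \<le> 1 / h" using h by simp
  have N0: "0 < real N" using N1 h1 by linarith
  have N2: "real N \<le> 1 / h + 1" unfolding N_def using h by (simp add: of_nat_ceiling)
  define B where "B = (\<Union>j\<in>{..N}. cball (\<gamma> (real j / real N)) ((L + 2) * h))"
  show ?thesis
  proof
    show "B \<in> lmeasurable" unfolding B_def by (intro lmeasurable_compact compact_UN) auto
    have "measure lebesgue B \<le> (\<Sum>j\<in>{..N}. measure lebesgue (cball (\<gamma> (real j / real N)) ((L + 2) * h)))"
      unfolding B_def by (intro measure_UNION_le) (auto intro: fmeasurableD lmeasurable_cball)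
    also have "\<dots> = (real N + 1) * (pi * ((L + 2) * h)\<^sup>2)"
    proof -
      have "measure lebesgue (cball y ((L + 2) * h)) = pi * ((L + 2) * h)\<^sup>2" for y :: "real^2"
        using L h by (intro measure_cball_2) auto
      then show ?thesis by (simp only: sum_constant card_atMost) simp
    qed
    also have "\<dots> \<le> (3 / h) * (pi * ((L + 2) * h)\<^sup>2)"
    proof (rule mult_right_mono)
      have "real N + 1 \<le> 1 / h + 2" using N2 by simp
      also have "\<dots> \<le> 3 / h" using h1 by (simp add: add_divide_distrib[symmetric])
      finally show "real N + 1 \<le> 3 / h" .
    qed simp
    also have "\<dots> = 3 * pi * (L + 2)\<^sup>2 * h" using h by (simp add: power2_eq_square)
    finally show "measure lebesgue B \<le> 3 * pi * (L + 2)\<^sup>2 * h" .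
    fix t :: real assume t: "t \<in> {0..1}"
    define j where "j = nat \<lfloor>t * real N\<rfloor>"
    have tN: "0 \<le> t * real N" using t N0 by simp
    have j: "real j \<le> t * real N" "t * real N < real j + 1"
      unfolding j_def using tN by linarith+
    have "t * real N \<le> real N" using t N0 by (simp add: mult_left_le_one_le)
    then have jN: "j \<le> N" using j by linarith
    have jt: "\<bar>t - real j / real N\<bar> \<le> h"
    proof -
      have "t - real j / real N = (t * real N - real j) / real N" using N0 by (simp add: field_simps)
      then have "0 \<le> t - real j / real N" "t - real j / real N \<le> 1 / real N"
        using j N0 by (simp_all add: divide_right_mono)
      moreover have "1 / real N \<le> h" using N1 N0 h by (simp add: field_simps)
      ultimately show ?thesis by linarith
    qed
    show "cball (\<gamma> t) (2 * h) \<subseteq> B"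
    proof
      fix x assume x: "x \<in> cball (\<gamma> t) (2 * h)"
      have "dist (\<gamma> (real j / real N)) x \<le> norm (\<gamma> (real j / real N) - \<gamma> t) + dist (\<gamma> t) x"
        by (metis dist_norm dist_triangle)
      also have "\<dots> \<le> L * h + 2 * h"
      proof (rule add_mono)
        have "norm (\<gamma> (real j / real N) - \<gamma> t) \<le> L * \<bar>real j / real N - t\<bar>"
          using jN N0 t by (intro lip) auto
        also have "\<dots> \<le> L * h" using jt L by (intro mult_left_mono) auto
        finally show "norm (\<gamma> (real j / real N) - \<gamma> t) \<le> L * h" .
      qed (use x in simp)
      finally show "x \<in> B" unfolding B_def using jN by (auto simp: algebra_simps)
    qed
  qed
qed

lemma surrogate_edges_diameter_le:
  fixes \<T> :: "(real^2) set set"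
  assumes adm: "admissible_triangulation D \<T>" and TE: "(T, E) \<in> surrogate_edges \<Omega> S \<T> M"
  shows "diameter T \<le> boundary_meshsize \<Omega> \<T>"
proof -
  have T: "T \<in> interior_mesh \<Omega> \<T>" "E edge_of T" "E \<subseteq> surrogate_boundary \<Omega> \<T>"
    using TE by (auto simp: surrogate_edges_def)
  have fin: "finite \<T>" using adm by (auto simp: admissible_triangulation_def triangulation_def)
  have "E \<noteq> {}" using T(2) by (auto simp: edge_of_def)
  then have "T \<inter> surrogate_boundary \<Omega> \<T> \<noteq> {}" using T edge_of_imp_subset by blast
  then show ?thesis unfolding boundary_meshsize_def
    using T fin by (intro Max_ge) (auto simp: interior_mesh_def)
qed

lemma finite_surrogate_edges:
  fixes \<T> :: "(real^2) set set"
  assumes adm: "admissible_triangulation D \<T>"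
  shows "finite (surrogate_edges \<Omega> S \<T> M)"
proof (rule finite_subset)
  show "surrogate_edges \<Omega> S \<T> M \<subseteq> Sigma \<T> (\<lambda>T. {E. E edge_of T})"
    by (auto simp: surrogate_edges_def interior_mesh_def)
  show "finite (Sigma \<T> (\<lambda>T. {E. E edge_of T}))"
    using adm card_edges_two_simplex(1)
    by (intro finite_SigmaI) (auto simp: admissible_triangulation_def triangulation_def)
qed

section \<open>The boundary layer at a single edge\<close>

locale edge_geometry =
  fixes a b :: "real^2" and M n :: "real^2 \<Rightarrow> real^2" and K \<delta> :: real
  assumes ab: "a \<noteq> b" and K: "0 \<le> K"
    and n1: "\<And>x. x \<in> closed_segment a b \<Longrightarrow> norm (n x) = 1"
    and Mx: "\<And>x. x \<in> closed_segment a b \<Longrightarrow> M x - x = norm (M x - x) *\<^sub>R n x"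
    and nlip: "\<And>x x'. x \<in> closed_segment a b \<Longrightarrow> x' \<in> closed_segment a b \<Longrightarrow>
      norm (n x - n x') \<le> K * norm (M x' - M x)"
    and nquad: "\<And>x x'. x \<in> closed_segment a b \<Longrightarrow> x' \<in> closed_segment a b \<Longrightarrow>
      \<bar>n x \<bullet> (M x' - M x)\<bar> \<le> K * (norm (M x' - M x))\<^sup>2"
    and \<delta>: "\<And>x. x \<in> closed_segment a b \<Longrightarrow> norm (M x - x) \<le> \<delta>"
    and K\<delta>: "K * \<delta> \<le> 1 / 8"
    and small: "2 * (2 * \<delta> + K * (norm (b - a) + 2 * \<delta>)\<^sup>2) \<le> norm (b - a) / 4"
begin

abbreviation "E \<equiv> closed_segment a b"

definition depth :: "real^2 \<Rightarrow> real" where "depth x = norm (M x - x)"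

lemma depth_nonneg: "0 \<le> depth x" by (simp add: depth_def)

lemma depth_le: "x \<in> E \<Longrightarrow> depth x \<le> \<delta>" using \<delta> by (simp add: depth_def)

lemma M_eq: "x \<in> E \<Longrightarrow> M x = x + depth x *\<^sub>R n x"
  using Mx[of x] by (simp add: depth_def algebra_simps)

lemma inner_n_le: "x \<in> E \<Longrightarrow> \<bar>n x \<bullet> v\<bar> \<le> norm v"
  using Cauchy_Schwarz_ineq2[of "n x" v] n1[of x] by simp

lemma segment_diff:
  assumes "x \<in> E" "x' \<in> E"
  obtains t where "x - x' = t *\<^sub>R (b - a)" "\<bar>t\<bar> \<le> 1"
proof -
  obtain s s' where s: "x = (1 - s) *\<^sub>R a + s *\<^sub>R b" "x' = (1 - s') *\<^sub>R a + s' *\<^sub>R b"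
    "0 \<le> s" "s \<le> 1" "0 \<le> s'" "s' \<le> 1"
    using assms by (auto simp: in_segment)
  have "x - x' = (s - s') *\<^sub>R (b - a)" unfolding s(1,2) by (simp add: algebra_simps)
  moreover have "\<bar>s - s'\<bar> \<le> 1" using s by linarith
  ultimately show ?thesis using that by blast
qed

text \<open>The edge is almost tangential since its end points are much closer to the boundary than its length.\<close>

lemma transversal:
  assumes x: "x \<in> E"
  shows "\<bar>n x \<bullet> (b - a)\<bar> \<le> norm (b - a) / 4"
proof -
  have end_le: "\<bar>n x \<bullet> (c - x)\<bar> \<le> 2 * \<delta> + K * (norm (b - a) + 2 * \<delta>)\<^sup>2" if c: "c \<in> E" for c
  proof -
    obtain t where t: "c - x = t *\<^sub>R (b - a)" "\<bar>t\<bar> \<le> 1" using segment_diff[OF c x] .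
    then have cx: "norm (c - x) \<le> norm (b - a)" by (simp add: mult_left_le_one_le)
    have "M c - M x = (M c - c) + (c - x) + (x - M x)" by simp
    also have "norm \<dots> \<le> norm (M c - c) + norm (c - x) + norm (x - M x)"
      by (meson add_right_mono norm_triangle_ineq order_trans)
    also have "\<dots> \<le> norm (b - a) + 2 * \<delta>" using \<delta>[OF c] \<delta>[OF x] cx by (simp add: norm_minus_commute)
    finally have "(norm (M c - M x))\<^sup>2 \<le> (norm (b - a) + 2 * \<delta>)\<^sup>2" by (intro power_mono) auto
    then have "\<bar>n x \<bullet> (M c - M x)\<bar> \<le> K * (norm (b - a) + 2 * \<delta>)\<^sup>2"
      using nquad[OF x c] K by (meson mult_left_mono order_trans)
    moreover have "\<bar>n x \<bullet> (M c - c)\<bar> \<le> \<delta>" "\<bar>n x \<bullet> (M x - x)\<bar> \<le> \<delta>"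
      using inner_n_le[OF x] \<delta>[OF c] \<delta>[OF x] order_trans by blast+
    moreover have "n x \<bullet> (c - x) = n x \<bullet> (M c - M x) - n x \<bullet> (M c - c) + n x \<bullet> (M x - x)"
      by (simp add: inner_diff_right)
    ultimately show ?thesis by linarith
  qed
  have "n x \<bullet> (b - a) = n x \<bullet> (b - x) - n x \<bullet> (a - x)" by (simp add: inner_diff_right)
  moreover have "\<bar>n x \<bullet> (a - x)\<bar> \<le> 2 * \<delta> + K * (norm (b - a) + 2 * \<delta>)\<^sup>2" by (rule end_le) simp
  moreover have "\<bar>n x \<bullet> (b - x)\<bar> \<le> 2 * \<delta> + K * (norm (b - a) + 2 * \<delta>)\<^sup>2" by (rule end_le) simp
  ultimately have "\<bar>n x \<bullet> (b - a)\<bar> \<le> 2 * (2 * \<delta> + K * (norm (b - a) + 2 * \<delta>)\<^sup>2)"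
    using abs_triangle_ineq4[of "n x \<bullet> (b - x)" "n x \<bullet> (a - x)"] by (simp only: mult_2)
  then show ?thesis using small by (rule order_trans)
qed

lemma foot_le:
  assumes x: "x \<in> E" "x' \<in> E" and s: "0 \<le> s" "s \<le> depth x" "0 \<le> s'" "s' \<le> depth x'"
  defines "z \<equiv> x + s *\<^sub>R n x" and "z' \<equiv> x' + s' *\<^sub>R n x'"
  shows "norm (M x - M x') \<le> 2 * norm (z - z')"
proof (cases "M x = M x'")
  case False
  define y where "y = M x' - M x"
  define \<sigma> where "\<sigma> = depth x - s"
  define \<sigma>' where "\<sigma>' = depth x' - s'"
  have \<sigma>: "0 \<le> \<sigma>" "\<sigma> \<le> \<delta>" "0 \<le> \<sigma>'" "\<sigma>' \<le> \<delta>" using s depth_le x by (auto simp: \<sigma>_def \<sigma>'_def) (smt (verit))+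
  have zz: "z' - z = y + \<sigma> *\<^sub>R n x - \<sigma>' *\<^sub>R n x'"
    using M_eq[OF x(1)] M_eq[OF x(2)] by (simp add: z_def z'_def y_def \<sigma>_def \<sigma>'_def algebra_simps)
  have q1: "\<bar>n x \<bullet> y\<bar> \<le> K * (norm y)\<^sup>2" using nquad[OF x] by (simp add: y_def)
  have q2: "\<bar>n x' \<bullet> y\<bar> \<le> K * (norm y)\<^sup>2" using nquad[OF x(2,1)] by (simp add: y_def norm_minus_commute inner_diff_right abs_minus_commute)
  have b1: "\<bar>\<sigma> * (n x \<bullet> y)\<bar> \<le> 1 / 8 * (norm y)\<^sup>2"
  proof -
    have "\<bar>\<sigma> * (n x \<bullet> y)\<bar> \<le> \<delta> * (K * (norm y)\<^sup>2)"
      unfolding abs_mult using \<sigma> q1 K by (intro mult_mono) auto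
    also have "\<dots> = (K * \<delta>) * (norm y)\<^sup>2" by simp
    also have "\<dots> \<le> 1 / 8 * (norm y)\<^sup>2" by (intro mult_right_mono K\<delta>) simp
    finally show ?thesis .
  qed
  have b2: "\<bar>\<sigma>' * (n x' \<bullet> y)\<bar> \<le> 1 / 8 * (norm y)\<^sup>2"
  proof -
    have "\<bar>\<sigma>' * (n x' \<bullet> y)\<bar> \<le> \<delta> * (K * (norm y)\<^sup>2)"
      unfolding abs_mult using \<sigma> q2 K by (intro mult_mono) auto
    also have "\<dots> = (K * \<delta>) * (norm y)\<^sup>2" by simp
    also have "\<dots> \<le> 1 / 8 * (norm y)\<^sup>2" by (intro mult_right_mono K\<delta>) simp
    finally show ?thesis .
  qed
  have "(z' - z) \<bullet> y = (norm y)\<^sup>2 + \<sigma> * (n x \<bullet> y) - \<sigma>' * (n x' \<bullet> y)"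
    by (simp add: zz inner_diff_left inner_add_left power2_norm_eq_inner)
  then have "1 / 2 * (norm y)\<^sup>2 \<le> (z' - z) \<bullet> y" using b1 b2 by (simp add: abs_le_iff)
  also have "\<dots> \<le> norm (z' - z) * norm y" by (rule norm_cauchy_schwarz)
  finally have "(1 / 2 * norm y) * norm y \<le> norm (z' - z) * norm y" by (simp add: power2_eq_square)
  then have "1 / 2 * norm y \<le> norm (z' - z)" using False by (simp add: y_def)
  then show ?thesis by (simp add: y_def norm_minus_commute)
qed simp

lemma M_lipschitz: "x \<in> E \<Longrightarrow> x' \<in> E \<Longrightarrow> norm (M x - M x') \<le> 2 * norm (x - x')"
  using foot_le[of x x' 0 0] by (simp add: depth_nonneg)

lemma continuous_on_M: "continuous_on E M"
proof (rule continuous_on_compose2[OF lipschitz_on_continuous_on[of 2 E M] continuous_on_id])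
  show "2-lipschitz_on E M" by (rule lipschitz_onI) (auto simp: dist_norm M_lipschitz)
qed auto

lemma continuous_on_depth: "continuous_on E depth"
  unfolding depth_def by (intro continuous_intros continuous_on_M)

lemma depth_diff_le: "\<bar>depth x - depth x'\<bar> \<le> norm (x - x') + norm (M x - M x')"
proof -
  have "\<bar>depth x - depth x'\<bar> \<le> norm ((M x - x) - (M x' - x'))"
    unfolding depth_def by (rule norm_triangle_ineq3)
  also have "(M x - x) - (M x' - x') = (M x - M x') - (x - x')" by simp
  also have "norm \<dots> \<le> norm (x - x') + norm (M x - M x')"
    using norm_triangle_ineq4[of "M x - M x'" "x - x'"] by simp
  finally show ?thesis .
qed

lemma base_le:
  assumes x: "x \<in> E" "x' \<in> E"
  shows "norm (x - x') \<le> 2 * norm (M x - M x')"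
proof (cases "x = x'")
  case False
  define lx where "lx = norm (x - x')"
  define y where "y = M x - M x'"
  have lx: "0 < lx" using False by (simp add: lx_def)
  obtain t where t: "x - x' = t *\<^sub>R (b - a)" using segment_diff[OF x] .
  have tn: "\<bar>n x \<bullet> (x - x')\<bar> \<le> 1 / 4 * lx"
  proof -
    have "\<bar>n x \<bullet> (x - x')\<bar> = \<bar>t\<bar> * \<bar>n x \<bullet> (b - a)\<bar>" by (simp add: t abs_mult)
    also have "\<dots> \<le> \<bar>t\<bar> * (norm (b - a) / 4)" by (intro mult_left_mono transversal x) simp
    finally show ?thesis by (simp add: lx_def t)
  qed
  have eq: "x - x' = y - (depth x - depth x') *\<^sub>R n x - depth x' *\<^sub>R (n x - n x')"
    using M_eq[OF x(1)] M_eq[OF x(2)] by (simp add: y_def algebra_simps)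
  have "lx\<^sup>2 = (x - x') \<bullet> (x - x')" by (simp add: lx_def power2_norm_eq_inner)
  also have "\<dots> = (y - (depth x - depth x') *\<^sub>R n x - depth x' *\<^sub>R (n x - n x')) \<bullet> (x - x')"
    using eq by simp
  also have "\<dots> = y \<bullet> (x - x') - (depth x - depth x') * (n x \<bullet> (x - x')) - depth x' * ((n x - n x') \<bullet> (x - x'))"
    by (simp add: inner_diff_left)
  also have "\<dots> \<le> norm y * lx + (lx + norm y) * (1 / 4 * lx) + 1 / 8 * norm y * lx"
  proof -
    have 1: "y \<bullet> (x - x') \<le> norm y * lx" unfolding lx_def by (rule norm_cauchy_schwarz)
    have 2: "\<bar>(depth x - depth x') * (n x \<bullet> (x - x'))\<bar> \<le> (lx + norm y) * (1 / 4 * lx)"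
      unfolding abs_mult using depth_diff_le[of x x'] tn by (intro mult_mono) (auto simp: lx_def y_def)
    have "\<bar>(n x - n x') \<bullet> (x - x')\<bar> \<le> norm (n x - n x') * lx" unfolding lx_def by (rule Cauchy_Schwarz_ineq2)
    also have "\<dots> \<le> (K * norm y) * lx"
      using nlip[OF x] lx by (intro mult_right_mono) (auto simp: y_def norm_minus_commute)
    finally have "\<bar>depth x' * ((n x - n x') \<bullet> (x - x'))\<bar> \<le> \<delta> * ((K * norm y) * lx)"
      unfolding abs_mult using depth_le[OF x(2)] depth_nonneg[of x'] by (intro mult_mono) auto
    also have "\<dots> = (K * \<delta>) * (norm y * lx)" by simp
    also have "\<dots> \<le> 1 / 8 * (norm y * lx)" using lx by (intro mult_right_mono K\<delta>) auto
    finally have 3: "\<bar>depth x' * ((n x - n x') \<bullet> (x - x'))\<bar> \<le> 1 / 8 * (norm y * lx)" .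
    have "p - q - r \<le> p' + q' + r'" if "p \<le> p'" "\<bar>q\<bar> \<le> q'" "\<bar>r\<bar> \<le> r'" for p q r p' q' r' :: real
      using that by linarith
    from this[OF 1 2 3] show ?thesis by simp
  qed
  finally have "lx * lx \<le> (norm y + 1 / 4 * lx + 1 / 4 * norm y + 1 / 8 * norm y) * lx"
    by (simp add: power2_eq_square field_simps)
  then have "lx \<le> norm y + 1 / 4 * lx + 1 / 4 * norm y + 1 / 8 * norm y" using lx by simp
  then show ?thesis unfolding lx_def[symmetric] y_def[symmetric] using norm_ge_zero[of y] by linarith
qed simp

lemma normal_coordinates_le:
  assumes x: "x \<in> E" "x' \<in> E" and s: "0 \<le> s" "s \<le> depth x" "0 \<le> s'" "s' \<le> depth x'"
  defines "z \<equiv> x + s *\<^sub>R n x" and "z' \<equiv> x' + s' *\<^sub>R n x'"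
  shows "norm (x - x') \<le> 4 * norm (z - z')" "\<bar>s - s'\<bar> \<le> 9 * norm (z - z')"
proof -
  have y: "norm (M x - M x') \<le> 2 * norm (z - z')" unfolding z_def z'_def by (rule foot_le[OF x s])
  then show xx: "norm (x - x') \<le> 4 * norm (z - z')" using base_le[OF x] by linarith
  have d: "norm (M w - (w + q *\<^sub>R n w)) = depth w - q" if "w \<in> E" "q \<le> depth w" for w q
  proof -
    have "M w - (w + q *\<^sub>R n w) = (depth w - q) *\<^sub>R n w" using M_eq[OF that(1)] by (simp add: algebra_simps)
    then show ?thesis using n1[OF that(1)] that by simp
  qed
  have "\<bar>(depth x - s) - (depth x' - s')\<bar> \<le> norm ((M x - z) - (M x' - z'))"
    using d[OF x(1) s(2)] d[OF x(2) s(4)] norm_triangle_ineq3[of "M x - z" "M x' - z'"] by (simp add: z_def z'_def)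
  also have "(M x - z) - (M x' - z') = (M x - M x') - (z - z')" by simp
  also have "norm \<dots> \<le> norm (M x - M x') + norm (z - z')" by (rule norm_triangle_ineq4)
  finally have "\<bar>(depth x - s) - (depth x' - s')\<bar> \<le> 3 * norm (z - z')" using y by simp
  moreover have "\<bar>depth x - depth x'\<bar> \<le> 6 * norm (z - z')" using depth_diff_le[of x x'] xx y by simp
  ultimately show "\<bar>s - s'\<bar> \<le> 9 * norm (z - z')" by linarith
qed

end

section \<open>Traces and Lebesgue values\<close>

lemma moll_diff_le_ball:
  assumes \<theta>: "0 < \<theta>" and w: "integrable lborel w"
  shows "ennreal (bump_mass \<theta> * \<bar>moll \<theta> w z - c\<bar>) \<le> (\<integral>\<^sup>+y\<in>ball z \<theta>. ennreal \<bar>w y - c\<bar> \<partial>lborel)"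
proof -
  have m: "0 < bump_mass \<theta>" by (rule bump_mass_pos[OF \<theta>])
  have i1: "integrable lborel (\<lambda>y. w y * kern \<theta> (z - y))" by (rule integrable_mult_kern[OF \<theta> w])
  have i2: "integrable lborel (\<lambda>y. c * kern \<theta> (z - y))" by (intro integrable_mult_right integrable_kern_shift \<theta>)
  have "moll \<theta> w z - c = (LINT y|lborel. w y * kern \<theta> (z - y) - c * kern \<theta> (z - y))"
    unfolding moll_def using i1 i2 integral_kern_shift[OF \<theta>, of z]
    by (subst Bochner_Integration.integral_diff) auto
  then have "ennreal \<bar>moll \<theta> w z - c\<bar> \<le> (\<integral>\<^sup>+y. ennreal (norm (w y * kern \<theta> (z - y) - c * kern \<theta> (z - y))) \<partial>lborel)"
    using integral_norm_bound_ennreal[OF Bochner_Integration.integrable_diff[OF i1 i2]] by simp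
  also have "\<dots> \<le> (\<integral>\<^sup>+y. ennreal (1 / bump_mass \<theta>) * (ennreal \<bar>w y - c\<bar> * indicator (ball z \<theta>) y) \<partial>lborel)"
  proof (rule nn_integral_mono)
    fix y
    have "norm (w y * kern \<theta> (z - y) - c * kern \<theta> (z - y)) = \<bar>w y - c\<bar> * kern \<theta> (z - y)"
      using kern_nonneg[OF \<theta>, of "z - y"] by (simp add: left_diff_distrib[symmetric] abs_mult)
    moreover have "\<bar>w y - c\<bar> * kern \<theta> (z - y) \<le> \<bar>w y - c\<bar> * (1 / bump_mass \<theta>)"
      by (intro mult_left_mono kern_le \<theta>) simp
    moreover have "kern \<theta> (z - y) = 0" if "y \<notin> ball z \<theta>"
      using that by (intro kern_eq_0 \<theta>) (simp add: dist_norm)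
    ultimately show "ennreal (norm (w y * kern \<theta> (z - y) - c * kern \<theta> (z - y)))
        \<le> ennreal (1 / bump_mass \<theta>) * (ennreal \<bar>w y - c\<bar> * indicator (ball z \<theta>) y)"
      using m by (cases "y \<in> ball z \<theta>") (auto simp: ennreal_mult[symmetric] mult.commute intro!: ennreal_leI)
  qed
  also have "\<dots> = ennreal (1 / bump_mass \<theta>) * (\<integral>\<^sup>+y\<in>ball z \<theta>. ennreal \<bar>w y - c\<bar> \<partial>lborel)"
  proof (rule nn_integral_cmult)
    have [measurable]: "w \<in> borel_measurable borel" "ball z \<theta> \<in> sets borel" using w by auto
    show "(\<lambda>y. ennreal \<bar>w y - c\<bar> * indicator (ball z \<theta>) y) \<in> borel_measurable lborel" by measurable
  qed
  finally have "ennreal (bump_mass \<theta>) * ennreal \<bar>moll \<theta> w z - c\<bar>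
      \<le> ennreal (bump_mass \<theta>) * (ennreal (1 / bump_mass \<theta>) * (\<integral>\<^sup>+y\<in>ball z \<theta>. ennreal \<bar>w y - c\<bar> \<partial>lborel))"
    by (rule mult_left_mono) simp
  also have "\<dots> = (\<integral>\<^sup>+y\<in>ball z \<theta>. ennreal \<bar>w y - c\<bar> \<partial>lborel)"
    using m by (simp add: mult.assoc[symmetric] ennreal_mult[symmetric])
  finally show ?thesis using m by (simp add: ennreal_mult)
qed

definition mass_const :: real where "mass_const = exp (- (4 / 3)) * pi / 4"

lemma mass_const_pos: "0 < mass_const" by (simp add: mass_const_def)

lemma bump_mass_ge_const: "0 < r \<Longrightarrow> mass_const * r\<^sup>2 \<le> bump_mass r"
  using bump_mass_ge[of r] by (simp add: mass_const_def power_divide)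

lemma moll_tendsto_lebesgue_value:
  assumes w: "integrable lborel w" and v: "lebesgue_value w x v"
  shows "((\<lambda>\<theta>. moll \<theta> w x) \<longlongrightarrow> v) (at_right 0)"
proof (rule tendstoI)
  fix e :: real assume e: "0 < e"
  define e' where "e' = e * mass_const / 2"
  have e': "0 < e'" using e mass_const_pos by (simp add: e'_def)
  have "\<forall>\<^sub>F r in at_right 0. (\<integral>\<^sup>+y\<in>ball x r. ennreal \<bar>w y - v\<bar> \<partial>lborel) \<le> ennreal (e' * r\<^sup>2)"
    using v e' unfolding lebesgue_value_def by blast
  then show "\<forall>\<^sub>F \<theta> in at_right 0. dist (moll \<theta> w x) v < e"
    using eventually_at_right_less[of 0]
  proof eventually_elim
    case (elim \<theta>)
    have "ennreal (bump_mass \<theta> * \<bar>moll \<theta> w x - v\<bar>) \<le> ennreal (e' * \<theta>\<^sup>2)"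
      using moll_diff_le_ball[OF elim(2) w, of x v] elim(1) by (rule order_trans)
    then have "bump_mass \<theta> * \<bar>moll \<theta> w x - v\<bar> \<le> e' * \<theta>\<^sup>2"
      using e' by (subst (asm) ennreal_le_iff) auto
    moreover have "mass_const * \<theta>\<^sup>2 * \<bar>moll \<theta> w x - v\<bar> \<le> bump_mass \<theta> * \<bar>moll \<theta> w x - v\<bar>"
      by (intro mult_right_mono bump_mass_ge_const elim) simp
    ultimately have "(mass_const * \<theta>\<^sup>2) * \<bar>moll \<theta> w x - v\<bar> \<le> (mass_const * \<theta>\<^sup>2) * (e / 2)"
      by (simp add: e'_def mult_ac)
    then have "\<bar>moll \<theta> w x - v\<bar> \<le> e / 2"
      using mass_const_pos elim(2) by (subst (asm) mult_le_cancel_left_pos) auto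
    then show ?case using e by (simp add: dist_real_def)
  qed
qed

lemma has_trace_at_of_lebesgue_value:
  fixes w w0 :: "real^2 \<Rightarrow> 'b::euclidean_space"
  assumes x: "x \<in> W" "W \<subseteq> \<Omega>" "open W"
    and w: "integrable lborel w" and m0: "w0 \<in> borel_measurable (lebesgue_on W)"
    and eq: "AE y in lebesgue. y \<in> W \<longrightarrow> w0 y = w y"
    and v: "\<And>i. i \<in> Basis \<Longrightarrow> lebesgue_value (\<lambda>y. w y \<bullet> i) x (v \<bullet> i)"
  shows "has_trace_at \<Omega> w0 x v"
proof -
  obtain \<eta> where \<eta>: "0 < \<eta>" "ball x \<eta> \<subseteq> W" using x open_contains_ball by blast
  have ev: "\<forall>\<^sub>F r in at_right 0. 0 < r \<and> r < \<eta>"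
    using \<eta> by (auto simp: eventually_at_right_field intro!: exI[of _ \<eta>])
  have bW: "ball x r \<subseteq> W" if "r < \<eta>" for r
    using subset_ball[of r \<eta> x] that \<eta>(2) by simp
  have [measurable]: "w \<in> borel_measurable borel" using w by simp
  have wl: "integrable (lebesgue_on (ball x r)) w" for r
  proof -
    have "integrable lebesgue w" using w by (simp add: integrable_completion)
    then show ?thesis by (intro integrable_restrict_space[THEN iffD2]) (auto intro: integrable_mult_indicator)
  qed
  have eqr: "AE y in lebesgue_on (ball x r). w y = w0 y" if "r < \<eta>" for r
  proof -
    have "AE y in lebesgue. y \<in> ball x r \<longrightarrow> w y = w0 y"
      using eq
    proof eventually_elim
      case (elim y)
      show ?case
      proof
        assume "y \<in> ball x r"
        then have "y \<in> ball x \<eta>" using that by simp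
        then show "w y = w0 y" using elim \<eta> by auto
      qed
    qed
    then show ?thesis by (subst AE_restrict_space_iff) auto
  qed
  have w0m: "w0 \<in> borel_measurable (lebesgue_on (ball x r))" if "r < \<eta>" for r
    by (rule measurable_restrict_mono[OF m0 bW[OF that]])
  have w0i: "integrable (lebesgue_on (ball x r)) w0" if "r < \<eta>" for r
    by (rule integrable_cong_AE_imp[OF wl w0m[OF that] eqr[OF that]])
  have sub: "ball x r \<inter> \<Omega> = ball x r" if "r < \<eta>" for r using bW[OF that] x(2) by blast
  have "\<forall>\<^sub>F r in at_right 0. integrable (lebesgue_on (ball x r \<inter> \<Omega>)) w0"
    using ev by eventually_elim (simp add: sub w0i)
  moreover have "((\<lambda>r. (LINT y|lebesgue_on (ball x r \<inter> \<Omega>). norm (w0 y - v)) / measure lebesgue (ball x r \<inter> \<Omega>)) \<longlongrightarrow> 0) (at_right 0)"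
  proof (rule tendstoI)
    fix e :: real assume e: "0 < e"
    define e' where "e' = e * pi / (2 * real DIM('b))"
    have e': "0 < e'" using e by (simp add: e'_def)
    have "\<forall>\<^sub>F r in at_right 0. \<forall>i\<in>Basis. (\<integral>\<^sup>+y\<in>ball x r. ennreal \<bar>w y \<bullet> i - v \<bullet> i\<bar> \<partial>lborel) \<le> ennreal (e' * r\<^sup>2)"
      using v e' unfolding lebesgue_value_def by (intro eventually_ball_finite) auto
    then show "\<forall>\<^sub>F r in at_right 0. dist ((LINT y|lebesgue_on (ball x r \<inter> \<Omega>). norm (w0 y - v)) / measure lebesgue (ball x r \<inter> \<Omega>)) 0 < e"
      using ev
    proof eventually_elim
      case (elim r)
      have r: "0 < r" "r < \<eta>" using elim by auto
      have i0: "integrable (lebesgue_on (ball x r)) (\<lambda>y. norm (w0 y - v))"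
        by (intro integrable_norm Bochner_Integration.integrable_diff w0i r)
          (simp add: integrable_const_ivl finite_measure.integrable_const finite_measure_lebesgue_on)
      have "ennreal (LINT y|lebesgue_on (ball x r). norm (w0 y - v)) = (\<integral>\<^sup>+y. ennreal (norm (w0 y - v)) \<partial>lebesgue_on (ball x r))"
        by (rule nn_integral_eq_integral[symmetric, OF i0]) simp
      also have "\<dots> = (\<integral>\<^sup>+y. ennreal (norm (w y - v)) \<partial>lebesgue_on (ball x r))"
        by (rule nn_integral_cong_AE) (use eqr[OF r(2)] in \<open>eventually_elim, simp\<close>)
      also have "\<dots> = (\<integral>\<^sup>+y\<in>ball x r. ennreal (norm (w y - v)) \<partial>lebesgue)"
        by (subst nn_integral_restrict_space) auto
      also have "\<dots> = (\<integral>\<^sup>+y\<in>ball x r. ennreal (norm (w y - v)) \<partial>lborel)"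
        by (rule nn_integral_completion)
      also have "\<dots> \<le> (\<integral>\<^sup>+y. (\<Sum>i\<in>Basis. ennreal \<bar>w y \<bullet> i - v \<bullet> i\<bar> * indicator (ball x r) y) \<partial>lborel)"
      proof (rule nn_integral_mono)
        fix y
        have "norm (w y - v) \<le> (\<Sum>i\<in>Basis. \<bar>w y \<bullet> i - v \<bullet> i\<bar>)"
          using norm_le_l1[of "w y - v"] by (simp add: inner_diff_left)
        then have "ennreal (norm (w y - v)) \<le> (\<Sum>i\<in>Basis. ennreal \<bar>w y \<bullet> i - v \<bullet> i\<bar>)"
          by (simp add: ennreal_leI)
        then show "ennreal (norm (w y - v)) * indicator (ball x r) y \<le> (\<Sum>i\<in>Basis. ennreal \<bar>w y \<bullet> i - v \<bullet> i\<bar> * indicator (ball x r) y)"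
          by (auto split: split_indicator)
      qed
      also have "\<dots> = (\<Sum>i\<in>Basis. \<integral>\<^sup>+y\<in>ball x r. ennreal \<bar>w y \<bullet> i - v \<bullet> i\<bar> \<partial>lborel)"
      proof (rule nn_integral_sum)
        have [measurable]: "ball x r \<in> sets borel" by simp
        show "(\<lambda>y. ennreal \<bar>w y \<bullet> i - v \<bullet> i\<bar> * indicator (ball x r) y) \<in> borel_measurable lborel" for i by measurable
      qed
      also have "\<dots> \<le> (\<Sum>i\<in>(Basis::'b set). ennreal (e' * r\<^sup>2))"
        using elim(1) by (intro sum_mono) auto
      also have "\<dots> = ennreal (real DIM('b) * (e' * r\<^sup>2))"
        using e' by (simp add: ennreal_mult ennreal_of_nat_eq_real_of_nat)
      finally have "(LINT y|lebesgue_on (ball x r). norm (w0 y - v)) \<le> real DIM('b) * (e' * r\<^sup>2)"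
        using e' by (subst (asm) ennreal_le_iff) auto
      also have "\<dots> = (e / 2) * (pi * r\<^sup>2)" by (simp add: e'_def)
      finally have "(LINT y|lebesgue_on (ball x r). norm (w0 y - v)) \<le> (e / 2) * (pi * r\<^sup>2)" .
      moreover have "measure lebesgue (ball x r) = pi * r\<^sup>2"
        using content_ball[of r x] r by (simp add: unit_ball_vol_2)
      moreover have "0 < pi * r\<^sup>2" using r by simp
      ultimately have "(LINT y|lebesgue_on (ball x r). norm (w0 y - v)) / measure lebesgue (ball x r) \<le> e / 2"
        by (simp add: pos_divide_le_eq)
      moreover have "0 \<le> (LINT y|lebesgue_on (ball x r). norm (w0 y - v)) / measure lebesgue (ball x r)"
        by (intro divide_nonneg_nonneg Bochner_Integration.integral_nonneg) auto
      ultimately show ?case using e unfolding sub[OF r(2)] dist_real_def by linarith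
    qed
  qed
  ultimately show ?thesis unfolding has_trace_at_def by blast
qed

lemma has_trace_at_unique:
  fixes w :: "real^2 \<Rightarrow> 'b::euclidean_space"
  assumes \<Omega>: "open \<Omega>" "x \<in> closure \<Omega>" and s: "has_trace_at \<Omega> w x s" and t: "has_trace_at \<Omega> w x t"
  shows "s = t"
proof -
  let ?B = "\<lambda>r. ball x r \<inter> \<Omega>"
  define A where "A c r = (LINT y|lebesgue_on (?B r). norm (w y - c)) / measure lebesgue (?B r)" for c r
  have "((\<lambda>r. A s r + A t r) \<longlongrightarrow> 0 + 0) (at_right 0)"
    using s t unfolding has_trace_at_def A_def by (intro tendsto_add) auto
  moreover have "\<forall>\<^sub>F r in at_right 0. norm (s - t) \<le> A s r + A t r"
  proof -
    have "\<forall>\<^sub>F r in at_right 0. integrable (lebesgue_on (?B r)) w" using s by (simp add: has_trace_at_def)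
    then show ?thesis using eventually_at_right_less[of 0]
    proof eventually_elim
      case (elim r)
      have lm: "?B r \<in> lmeasurable" using \<Omega> by (intro bounded_set_imp_lmeasurable) (auto intro: bounded_subset)
      have fm: "finite_measure (lebesgue_on (?B r))" by (rule finite_measure_lebesgue_on[OF lm])
      obtain y where "y \<in> \<Omega>" "dist y x < r" using \<Omega>(2) elim(2) unfolding closure_approachable by blast
      then have ne: "?B r \<noteq> {}" by (auto simp: dist_commute)
      have "\<not> negligible (?B r)" using \<Omega> ne by (intro open_not_negligible) auto
      then have mp: "0 < measure lebesgue (?B r)"
        using lm by (metis negligible_iff_measure zero_less_measure_iff)
      have ic: "integrable (lebesgue_on (?B r)) (\<lambda>y. norm (w y - c))" for c
        by (intro integrable_norm Bochner_Integration.integrable_diff elim finite_measure.integrable_const[OF fm])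
      have "norm (s - t) * measure lebesgue (?B r) = (LINT y|lebesgue_on (?B r). norm (s - t))"
        using lm by (simp add: measure_restrict_space)
      also have "\<dots> \<le> (LINT y|lebesgue_on (?B r). norm (w y - s) + norm (w y - t))"
      proof (rule integral_mono)
        fix y
        show "norm (s - t) \<le> norm (w y - s) + norm (w y - t)"
          using norm_triangle_ineq4[of "w y - t" "w y - s"] by simp
      qed (auto intro: ic finite_measure.integrable_const[OF fm])
      also have "\<dots> = (LINT y|lebesgue_on (?B r). norm (w y - s)) + (LINT y|lebesgue_on (?B r). norm (w y - t))"
        by (rule Bochner_Integration.integral_add[OF ic ic])
      finally have "norm (s - t) \<le> ((LINT y|lebesgue_on (?B r). norm (w y - s)) + (LINT y|lebesgue_on (?B r). norm (w y - t))) / measure lebesgue (?B r)"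
        using mp by (simp add: pos_le_divide_eq)
      then show ?case by (simp add: A_def add_divide_distrib)
    qed
  qed
  ultimately have "norm (s - t) \<le> 0 + 0"
    by (rule tendsto_lowerbound) simp
  then show ?thesis by simp
qed

lemma trace_at_eq:
  fixes w :: "real^2 \<Rightarrow> 'b::euclidean_space"
  assumes "open \<Omega>" "x \<in> closure \<Omega>" "has_trace_at \<Omega> w x s"
  shows "trace_at \<Omega> w x = s"
  unfolding trace_at_def using assms has_trace_at_unique by (intro the_equality) blast+

text \<open>The balls of radius \<open>\<theta>\<close> around \<open>y - 2 \<theta> n\<close> approach the boundary point \<open>y\<close> non-tangentially.\<close>

lemma moll_tendsto_boundary_trace:
  fixes u u0 :: "real^2 \<Rightarrow> real"
  assumes u: "integrable lborel u" and \<Omega>: "open \<Omega>" and W: "open W"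
    and eq: "AE y in lebesgue. y \<in> W \<longrightarrow> u0 y = u y"
    and L: "0 < L" and n: "norm n = 1" and ball: "ball x L \<subseteq> \<Omega> \<inter> W" and y: "y = x + L *\<^sub>R n"
    and tr: "has_trace_at \<Omega> u0 y c"
  shows "((\<lambda>\<theta>. moll \<theta> u (x + (L - 2 * \<theta>) *\<^sub>R n)) \<longlongrightarrow> c) (at_right 0)"
proof (rule tendstoI)
  fix e :: real assume e: "0 < e"
  define e' where "e' = e * mass_const / (32 * pi)"
  have e': "0 < e'" using e mass_const_pos by (simp add: e'_def)
  have "\<forall>\<^sub>F r in at_right 0. integrable (lebesgue_on (ball y r \<inter> \<Omega>)) u0 \<and>
     dist ((LINT z|lebesgue_on (ball y r \<inter> \<Omega>). norm (u0 z - c)) / measure lebesgue (ball y r \<inter> \<Omega>)) 0 < e'"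
    using tr e' unfolding has_trace_at_def by (intro eventually_conj tendstoD) auto
  then obtain b where b: "0 < b" "\<And>r. 0 < r \<Longrightarrow> r < b \<Longrightarrow> integrable (lebesgue_on (ball y r \<inter> \<Omega>)) u0 \<and>
     dist ((LINT z|lebesgue_on (ball y r \<inter> \<Omega>). norm (u0 z - c)) / measure lebesgue (ball y r \<inter> \<Omega>)) 0 < e'"
    unfolding eventually_at_right_field by blast
  show "\<forall>\<^sub>F \<theta> in at_right 0. dist (moll \<theta> u (x + (L - 2 * \<theta>) *\<^sub>R n)) c < e"
    unfolding eventually_at_right_field
  proof (intro exI[of _ "min (b / 4) (L / 2)"] conjI allI impI)
    show "0 < min (b / 4) (L / 2)" using b L by simp
    fix \<theta> :: real assume \<theta>: "0 < \<theta>" "\<theta> < min (b / 4) (L / 2)"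
    let ?z = "x + (L - 2 * \<theta>) *\<^sub>R n" and ?B = "ball y (4 * \<theta>) \<inter> \<Omega>"
    have zx: "dist x ?z = L - 2 * \<theta>" using \<theta> n by (simp add: dist_norm)
    have zy: "dist y ?z = 2 * \<theta>" using \<theta> n by (simp add: y dist_norm algebra_simps scaleR_2[symmetric])
    have s1: "ball ?z \<theta> \<subseteq> ball x L"
    proof
      fix q assume "q \<in> ball ?z \<theta>"
      then have "dist x q < (L - 2 * \<theta>) + \<theta>" using dist_triangle[of x q ?z] zx by simp
      then show "q \<in> ball x L" using \<theta> by simp
    qed
    have s2: "ball ?z \<theta> \<subseteq> ball y (4 * \<theta>)"
    proof
      fix q assume "q \<in> ball ?z \<theta>"
      then have "dist y q < 2 * \<theta> + \<theta>" using dist_triangle[of y q ?z] zy by simp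
      then show "q \<in> ball y (4 * \<theta>)" using \<theta> by simp
    qed
    have lm: "?B \<in> lmeasurable" using \<Omega> by (intro bounded_set_imp_lmeasurable) (auto intro: bounded_subset)
    have bb: "integrable (lebesgue_on ?B) u0" "(LINT z|lebesgue_on ?B. norm (u0 z - c)) / measure lebesgue ?B < e'"
      using b(2)[of "4 * \<theta>"] \<theta> by auto
    have i0: "integrable (lebesgue_on ?B) (\<lambda>z. norm (u0 z - c))"
      by (intro integrable_norm Bochner_Integration.integrable_diff bb finite_measure.integrable_const finite_measure_lebesgue_on lm)
    have "ball ?z \<theta> \<subseteq> ?B" using s1 s2 ball by auto
    moreover have "ball ?z \<theta> \<noteq> {}" using \<theta> by simp
    ultimately have "\<not> negligible ?B" using negligible_subset open_not_negligible open_ball by metis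
    then have mp: "0 < measure lebesgue ?B"
      using lm by (metis negligible_iff_measure zero_less_measure_iff)
    have "measure lebesgue ?B \<le> measure lebesgue (ball y (4 * \<theta>))"
      using lm by (intro measure_mono_fmeasurable) (auto intro: fmeasurableD)
    also have "\<dots> = pi * (4 * \<theta>)\<^sup>2" using content_ball[of "4 * \<theta>" y] \<theta> by (simp add: unit_ball_vol_2)
    finally have mB: "measure lebesgue ?B \<le> 16 * pi * \<theta>\<^sup>2" by (simp add: power_mult_distrib)
    have "ennreal (bump_mass \<theta> * \<bar>moll \<theta> u ?z - c\<bar>) \<le> (\<integral>\<^sup>+q\<in>ball ?z \<theta>. ennreal \<bar>u q - c\<bar> \<partial>lborel)"
      by (rule moll_diff_le_ball[OF \<theta>(1) u])
    also have "\<dots> = (\<integral>\<^sup>+q\<in>ball ?z \<theta>. ennreal \<bar>u q - c\<bar> \<partial>lebesgue)"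
      by (rule nn_integral_completion[symmetric])
    also have "\<dots> = (\<integral>\<^sup>+q\<in>ball ?z \<theta>. ennreal \<bar>u0 q - c\<bar> \<partial>lebesgue)"
    proof (rule nn_integral_cong_AE)
      show "AE q in lebesgue. ennreal \<bar>u q - c\<bar> * indicator (ball ?z \<theta>) q = ennreal \<bar>u0 q - c\<bar> * indicator (ball ?z \<theta>) q"
        using eq by eventually_elim (use s1 ball in \<open>auto split: split_indicator\<close>)
    qed
    also have "\<dots> \<le> (\<integral>\<^sup>+q\<in>?B. ennreal \<bar>u0 q - c\<bar> \<partial>lebesgue)"
      using s1 s2 ball by (intro nn_integral_mono) (auto split: split_indicator)
    also have "\<dots> = (\<integral>\<^sup>+q. ennreal (norm (u0 q - c)) \<partial>lebesgue_on ?B)"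
      using lm by (subst nn_integral_restrict_space) auto
    also have "\<dots> = ennreal (LINT q|lebesgue_on ?B. norm (u0 q - c))"
      by (rule nn_integral_eq_integral[OF i0]) simp
    finally have "bump_mass \<theta> * \<bar>moll \<theta> u ?z - c\<bar> \<le> (LINT q|lebesgue_on ?B. norm (u0 q - c))"
      by (subst (asm) ennreal_le_iff) (auto intro!: Bochner_Integration.integral_nonneg)
    also have "\<dots> \<le> e' * measure lebesgue ?B" using bb(2) mp by (simp add: pos_divide_less_eq less_imp_le)
    also have "\<dots> \<le> e' * (16 * pi * \<theta>\<^sup>2)" using e' mB by (intro mult_left_mono) auto
    also have "\<dots> = (mass_const * \<theta>\<^sup>2) * (e / 2)" by (simp add: e'_def)
    finally have "bump_mass \<theta> * \<bar>moll \<theta> u ?z - c\<bar> \<le> (mass_const * \<theta>\<^sup>2) * (e / 2)" .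
    moreover have "mass_const * \<theta>\<^sup>2 * \<bar>moll \<theta> u ?z - c\<bar> \<le> bump_mass \<theta> * \<bar>moll \<theta> u ?z - c\<bar>"
      by (intro mult_right_mono bump_mass_ge_const \<theta>) simp
    ultimately have "(mass_const * \<theta>\<^sup>2) * \<bar>moll \<theta> u ?z - c\<bar> \<le> (mass_const * \<theta>\<^sup>2) * (e / 2)" by linarith
    then have "\<bar>moll \<theta> u ?z - c\<bar> \<le> e / 2"
      using mass_const_pos \<theta>(1) by (subst (asm) mult_le_cancel_left_pos) auto
    then show "dist (moll \<theta> u ?z) c < e" using e by (simp add: dist_real_def)
  qed
qed

section \<open>The remainder on a single edge\<close>

lemma borel_measurable_lebesgue_AE:
  fixes f g :: "'a::euclidean_space \<Rightarrow> 'b::euclidean_space"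
  assumes g: "g \<in> borel_measurable lebesgue" and eq: "AE x in lebesgue. f x = g x"
  shows "f \<in> borel_measurable lebesgue"
proof (rule measurableI)
  fix B :: "'b set" assume B: "B \<in> sets borel"
  have "g -` B \<in> sets lebesgue" using measurable_sets[OF g B] by simp
  moreover have "AE x in lebesgue. x \<in> g -` B \<longleftrightarrow> x \<in> f -` B" using eq by eventually_elim simp
  ultimately have "f -` B \<in> sets lebesgue" by (intro completion.in_sets_AE[where A="g -` B" and B="f -` B"]) auto
  then show "f -` B \<inter> space lebesgue \<in> sets lebesgue" by simp
qed simp

lemma Cauchy_Schwarz_interval:
  fixes p q :: "real \<Rightarrow> real"
  assumes p: "continuous_on {0..c} p" and q: "continuous_on {0..c} q"
  shows "(integral {0..c} (\<lambda>s. p s * q s))\<^sup>2 \<le> integral {0..c} (\<lambda>s. (p s)\<^sup>2) * integral {0..c} (\<lambda>s. (q s)\<^sup>2)"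
proof -
  define I P Q where "I = integral {0..c} (\<lambda>s. p s * q s)"
    and "P = integral {0..c} (\<lambda>s. (p s)\<^sup>2)" and "Q = integral {0..c} (\<lambda>s. (q s)\<^sup>2)"
  have ip: "(\<lambda>s. (p s)\<^sup>2) integrable_on {0..c}" "(\<lambda>s. (q s)\<^sup>2) integrable_on {0..c}" "(\<lambda>s. p s * q s) integrable_on {0..c}"
    by (intro integrable_continuous_real continuous_intros p q)+
  have nn: "0 \<le> P - 2 * l * I + l\<^sup>2 * Q" for l
  proof -
    have "0 \<le> integral {0..c} (\<lambda>s. (p s - l * q s)\<^sup>2)"
      by (intro integral_nonneg integrable_continuous_real continuous_intros p q) simp
    also have "integral {0..c} (\<lambda>s. (p s - l * q s)\<^sup>2) = integral {0..c} (\<lambda>s. (p s)\<^sup>2 - (2 * l) * (p s * q s) + l\<^sup>2 * (q s)\<^sup>2)"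
      by (intro integral_cong) (simp add: power2_eq_square algebra_simps)
    also have "\<dots> = P - 2 * l * I + l\<^sup>2 * Q"
      unfolding P_def I_def Q_def using ip
      by (simp add: integral_add integral_diff integrable_diff integrable_on_mult_right)
    finally show ?thesis .
  qed
  have "0 \<le> Q" unfolding Q_def by (intro integral_nonneg ip) simp
  then consider "Q = 0" | "0 < Q" by linarith
  then have "I\<^sup>2 \<le> P * Q"
  proof cases
    case 1
    have "I = 0"
    proof (rule ccontr)
      assume "I \<noteq> 0"
      then show False using nn[of "(P + 1) / (2 * I)"] 1 by simp
    qed
    then show ?thesis using 1 by simp
  next
    case 2
    then have "0 \<le> P - I\<^sup>2 / Q" using nn[of "I / Q"] by (simp add: power2_eq_square)
    then show ?thesis using 2 by (simp add: field_simps)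
  qed
  then show ?thesis by (simp add: I_def P_def Q_def)
qed

lemma taylor_square_le:
  fixes k k1 k2 B :: "real \<Rightarrow> real"
  assumes c: "0 \<le> c"
    and k: "\<And>s. s \<in> {0..c} \<Longrightarrow> (k has_real_derivative k1 s) (at s)"
    and k1: "\<And>s. s \<in> {0..c} \<Longrightarrow> (k1 has_real_derivative k2 s) (at s)"
    and k2: "continuous_on UNIV k2" and B: "continuous_on UNIV B"
    and le: "\<And>s. s \<in> {0..c} \<Longrightarrow> (k2 s)\<^sup>2 \<le> B s"
  shows "ennreal ((k c - k 0 - c * k1 0)\<^sup>2) \<le> ennreal (c ^ 3) * (\<integral>\<^sup>+s\<in>{0..c}. ennreal (B s) \<partial>lborel)"
proof -
  have ck: "continuous_on {0..c} k2" "continuous_on {0..c} B" using k2 B continuous_on_subset by blast+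
  define Df where "Df m = (if m = 0 then k else if m = 1 then k1 else k2)" for m :: nat
  have "((\<lambda>s. ((c - s) ^ (2 - 1) / fact (2 - 1)) *\<^sub>R Df 2 s) has_integral
      k c - (\<Sum>i<2. ((c - 0) ^ i / fact i) *\<^sub>R Df i 0)) {0..c}"
  proof (rule Taylor_has_integral)
    fix m :: nat and t assume m: "m < 2" and t: "0 \<le> t" "t \<le> c"
    show "(Df m has_vector_derivative Df (Suc m) t) (at t within {0..c})"
    proof (rule has_vector_derivative_at_within)
      have "m = 0 \<or> m = 1" using m by auto
      then show "(Df m has_vector_derivative Df (Suc m) t) (at t)"
        using k[of t] k1[of t] t by (auto simp: Df_def has_real_derivative_iff_has_vector_derivative)
    qed
  qed (use c in \<open>auto simp: Df_def\<close>)
  then have eq: "integral {0..c} (\<lambda>s. (c - s) * k2 s) = k c - k 0 - c * k1 0"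
    by (intro integral_unique) (simp add: Df_def numeral_2_eq_2 algebra_simps)
  have "(k c - k 0 - c * k1 0)\<^sup>2 \<le> integral {0..c} (\<lambda>s. (c - s)\<^sup>2) * integral {0..c} (\<lambda>s. (k2 s)\<^sup>2)"
    unfolding eq[symmetric] by (intro Cauchy_Schwarz_interval continuous_intros ck)
  also have "\<dots> \<le> c ^ 3 * integral {0..c} B"
  proof (rule mult_mono)
    have "integral {0..c} (\<lambda>s. (c - s)\<^sup>2) \<le> integral {0..c} (\<lambda>s. c\<^sup>2)"
      by (intro integral_le integrable_continuous_real continuous_intros) (auto intro: power_mono)
    then show "integral {0..c} (\<lambda>s. (c - s)\<^sup>2) \<le> c ^ 3" using c by (simp add: power3_eq_cube power2_eq_square)
    show "integral {0..c} (\<lambda>s. (k2 s)\<^sup>2) \<le> integral {0..c} B"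
      by (intro integral_le integrable_continuous_real continuous_intros ck le)
    show "0 \<le> integral {0..c} (\<lambda>s. (k2 s)\<^sup>2)"
      by (intro integral_nonneg integrable_continuous_real continuous_intros ck) simp
  qed (use c in simp)
  finally have main: "(k c - k 0 - c * k1 0)\<^sup>2 \<le> c ^ 3 * integral {0..c} B" .
  have B0: "0 \<le> B s" if "s \<in> {0..c}" for s using le[OF that] zero_le_power2 order_trans by blast
  have si: "set_integrable lborel {0..c} B" by (rule borel_integrable_atLeastAtMost'[OF ck(2)])
  have "ennreal (integral {0..c} B) = ennreal (LINT s:{0..c}|lborel. B s)"
    using set_borel_integral_eq_integral(2)[OF si] by simp
  also have "\<dots> = (\<integral>\<^sup>+s. ennreal (indicator {0..c} s *\<^sub>R B s) \<partial>lborel)"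
    unfolding set_lebesgue_integral_def
    by (rule nn_integral_eq_integral[symmetric]) (use si B0 in \<open>auto simp: set_integrable_def split: split_indicator\<close>)
  also have "\<dots> = (\<integral>\<^sup>+s\<in>{0..c}. ennreal (B s) \<partial>lborel)"
    by (intro nn_integral_cong) (auto split: split_indicator)
  finally have "ennreal (c ^ 3) * (\<integral>\<^sup>+s\<in>{0..c}. ennreal (B s) \<partial>lborel) = ennreal (c ^ 3 * integral {0..c} B)"
    using c by (simp add: ennreal_mult')
  then show ?thesis using main by (simp add: ennreal_leI)
qed

lemma quadratic_form_le:
  fixes A :: "real^2^2" and n :: "real^2"
  assumes "norm n = 1"
  shows "\<bar>\<Sum>j\<in>UNIV. n $ j * (A $ j \<bullet> n)\<bar> \<le> norm A"
proof -
  have "\<bar>\<Sum>j\<in>UNIV. n $ j * (A $ j \<bullet> n)\<bar> \<le> (\<Sum>j\<in>UNIV. \<bar>n $ j\<bar> * norm (A $ j))"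
  proof (rule order_trans[OF sum_abs sum_mono])
    fix j
    have "\<bar>A $ j \<bullet> n\<bar> \<le> norm (A $ j)" using Cauchy_Schwarz_ineq2[of "A $ j" n] assms by simp
    then show "\<bar>n $ j * (A $ j \<bullet> n)\<bar> \<le> \<bar>n $ j\<bar> * norm (A $ j)" by (simp add: abs_mult mult_left_mono)
  qed
  also have "\<dots> \<le> L2_set (\<lambda>j. n $ j) UNIV * L2_set (\<lambda>j. norm (A $ j)) UNIV"
    using L2_set_mult_ineq[where A=UNIV and f="\<lambda>j. n $ j" and g="\<lambda>j. norm (A $ j)"] by simp
  also have "L2_set (\<lambda>j. n $ j) UNIV = norm n" by (simp add: norm_vec_def L2_set_def)
  also have "L2_set (\<lambda>j. norm (A $ j)) UNIV = norm A" by (simp add: norm_vec_def)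
  finally show ?thesis using assms by simp
qed

locale edge_estimate = edge_geometry +
  fixes \<Omega> W N :: "(real^2) set" and u u0 g :: "real^2 \<Rightarrow> real" and G G0 :: "real^2 \<Rightarrow> real^2"
    and H :: "real^2 \<Rightarrow> real^2^2" and A :: real and V :: "real^2 \<Rightarrow> real"
  assumes \<Omega>: "open \<Omega>" and W: "open W" "W \<subseteq> \<Omega>"
    and u: "integrable lborel u" and G: "\<And>i. integrable lborel (\<lambda>y. G y $ i)"
    and H: "\<And>i j. integrable lborel (\<lambda>y. H y $ i $ j)"
    and weak1: "\<And>\<phi> i. test_function W \<phi> \<Longrightarrow>
      (LINT y|lborel. u y * partial_deriv i \<phi> y) = - (LINT y|lborel. G y $ i * \<phi> y)"
    and weak2: "\<And>\<phi> i j. test_function W \<phi> \<Longrightarrow>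
      (LINT y|lborel. G y $ j * partial_deriv i \<phi> y) = - (LINT y|lborel. H y $ j $ i * \<phi> y)"
    and H2: "integrable lborel (\<lambda>y. (norm (H y))\<^sup>2)"
    and A: "0 \<le> A" and V: "integrable lborel V" "\<And>y. 0 \<le> V y"
    and HAV: "\<And>y. (norm (H y))\<^sup>2 \<le> A + V y"
    and u0: "u0 \<in> borel_measurable (lebesgue_on W)" "AE y in lebesgue. y \<in> W \<longrightarrow> u0 y = u y"
    and G0: "G0 \<in> borel_measurable (lebesgue_on W)" "AE y in lebesgue. y \<in> W \<longrightarrow> G0 y = G y"
    and E_closure: "closed_segment a b \<subseteq> closure \<Omega>"
    and ball: "\<And>x. x \<in> closed_segment a b \<Longrightarrow> M x \<noteq> x \<Longrightarrow> ball x (norm (M x - x)) \<subseteq> W"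
    and N: "arc_length_null N"
    and trace: "\<And>x. x \<in> closed_segment a b \<Longrightarrow> M x \<notin> N \<Longrightarrow> has_trace_at \<Omega> u0 (M x) (g (M x))"
begin

definition X :: "real \<Rightarrow> real^2" where "X t = a + t *\<^sub>R (b - a)"

lemma X_in_E: "t \<in> {0..1} \<Longrightarrow> X t \<in> E"
  by (auto simp: X_def in_segment algebra_simps intro!: exI[of _ t])

lemma continuous_X: "continuous_on S X"
  unfolding X_def by (intro continuous_intros)

lemma dist_X: "norm (X t - X t') = \<bar>t - t'\<bar> * norm (b - a)"
proof -
  have "X t - X t' = (t - t') *\<^sub>R (b - a)" by (simp add: X_def algebra_simps)
  then show ?thesis by simp
qed

lemma ball_W: "x \<in> E \<Longrightarrow> 0 < depth x \<Longrightarrow> ball x (depth x) \<subseteq> W"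
  using ball[of x] by (auto simp: depth_def)

definition dir :: "real^2 \<Rightarrow> real^2" where "dir x = (1 / depth x) *\<^sub>R (M x - x)"

lemma dir_eq: "x \<in> E \<Longrightarrow> 0 < depth x \<Longrightarrow> dir x = n x"
  using M_eq[of x] by (simp add: dir_def)

definition rem :: "real \<Rightarrow> real^2 \<Rightarrow> real" where
  "rem \<theta> x = moll \<theta> u (x + (depth x - 2 * \<theta>) *\<^sub>R dir x) - moll \<theta> u x
     - (depth x - 2 * \<theta>) * (\<Sum>i\<in>UNIV. dir x $ i * moll \<theta> (\<lambda>y. G y $ i) x)"

lemma rem_square_le:
  assumes x: "x \<in> E" and \<theta>: "0 < \<theta>" "2 * \<theta> < depth x"
  shows "ennreal ((rem \<theta> x)\<^sup>2) \<le> ennreal ((depth x - 2 * \<theta>) ^ 3) *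
    (\<integral>\<^sup>+s\<in>{0..depth x - 2 * \<theta>}. ennreal (A + moll \<theta> V (x + s *\<^sub>R n x)) \<partial>lborel)"
proof -
  define c where "c = depth x - 2 * \<theta>"
  define w where "w = n x"
  have c: "0 \<le> c" using \<theta> by (simp add: c_def)
  have w1: "norm w = 1" using n1[OF x] by (simp add: w_def)
  have dw: "dir x = w" using dir_eq[OF x] \<theta> by (simp add: w_def)
  define q where "q y = (\<Sum>j\<in>UNIV. w $ j * (H y $ j \<bullet> w))" for y
  define k where "k s = moll \<theta> u (x + s *\<^sub>R w)" for s
  define k1 where "k1 s = (\<Sum>j\<in>UNIV. w $ j * moll \<theta> (\<lambda>y. G y $ j) (x + s *\<^sub>R w))" for s
  define k2 where "k2 s = moll \<theta> q (x + s *\<^sub>R w)" for s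
  have sub: "cball (x + s *\<^sub>R w) \<theta> \<subseteq> W" if s: "s \<in> {0..c}" for s
  proof
    fix z assume z: "z \<in> cball (x + s *\<^sub>R w) \<theta>"
    have "dist x (x + s *\<^sub>R w) = s" using s w1 by (simp add: dist_norm)
    then have "dist x z < depth x"
      using dist_triangle[of x z "x + s *\<^sub>R w"] z s \<theta> by (simp add: c_def)
    then show "z \<in> W" using ball_W[OF x] \<theta> by auto
  qed
  have Hw: "integrable lborel (\<lambda>y. H y $ j \<bullet> w)" for j
    unfolding inner_vec_def using H by auto
  have qi: "integrable lborel q" unfolding q_def using Hw by auto
  have [measurable]: "q \<in> borel_measurable borel" using qi by simp
  have qle: "(q y)\<^sup>2 \<le> (norm (H y))\<^sup>2" for y
    using quadratic_form_le[OF w1, of "H y"] by (simp add: q_def abs_le_square_iff[symmetric])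
  have q2: "integrable lborel (\<lambda>y. (q y)\<^sup>2)"
    by (rule Bochner_Integration.integrable_bound[OF H2]) (use qle in auto)
  have dk: "(k has_real_derivative k1 s) (at s)" if s: "s \<in> {0..c}" for s
  proof -
    have "(k has_real_derivative moll \<theta> (\<lambda>y. G y \<bullet> w) (x + s *\<^sub>R w)) (at s)"
      unfolding k_def by (rule DERIV_moll_line[OF \<theta>(1) u G weak1 sub[OF s]])
    moreover have "moll \<theta> (\<lambda>y. G y \<bullet> w) z = (\<Sum>j\<in>UNIV. w $ j * moll \<theta> (\<lambda>y. G y $ j) z)" for z
      unfolding moll_def inner_vec_def sum_distrib_right
      by (subst Bochner_Integration.integral_sum)
        (use integrable_mult_kern[OF \<theta>(1) G] in \<open>auto simp: mult.commute[of _ "w $ _"] mult.assoc\<close>)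
    ultimately show ?thesis by (simp add: k1_def)
  qed
  have dk1: "(k1 has_real_derivative k2 s) (at s)" if s: "s \<in> {0..c}" for s
  proof -
    have "((\<lambda>s. moll \<theta> (\<lambda>y. G y $ j) (x + s *\<^sub>R w)) has_real_derivative moll \<theta> (\<lambda>y. H y $ j \<bullet> w) (x + s *\<^sub>R w)) (at s)" for j
      by (rule DERIV_moll_line[OF \<theta>(1) G H weak2 sub[OF s]])
    then have "(k1 has_real_derivative (\<Sum>j\<in>UNIV. w $ j * moll \<theta> (\<lambda>y. H y $ j \<bullet> w) (x + s *\<^sub>R w))) (at s)"
      unfolding k1_def by (intro DERIV_sum DERIV_cmult)
    moreover have "moll \<theta> q z = (\<Sum>j\<in>UNIV. w $ j * moll \<theta> (\<lambda>y. H y $ j \<bullet> w) z)" for z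
      unfolding moll_def q_def sum_distrib_right
      by (subst Bochner_Integration.integral_sum)
        (use integrable_mult_kern[OF \<theta>(1) Hw] in \<open>auto simp: mult.assoc\<close>)
    ultimately show ?thesis by (simp add: k2_def)
  qed
  have k2c: "continuous_on UNIV k2" unfolding k2_def
    by (rule continuous_on_compose2[OF continuous_moll[OF \<theta>(1) qi, of UNIV]]) (auto intro!: continuous_intros)
  have Bc: "continuous_on UNIV (\<lambda>s. A + moll \<theta> V (x + s *\<^sub>R w))"
    by (intro continuous_intros continuous_on_compose2[OF continuous_moll[OF \<theta>(1) V(1), of UNIV]]) auto
  have le: "(k2 s)\<^sup>2 \<le> A + moll \<theta> V (x + s *\<^sub>R w)" for s
  proof -
    let ?z = "x + s *\<^sub>R w"
    have "(k2 s)\<^sup>2 \<le> moll \<theta> (\<lambda>y. (q y)\<^sup>2) ?z"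
      unfolding k2_def by (rule moll_Cauchy_Schwarz[OF \<theta>(1) qi q2])
    also have "\<dots> \<le> (LINT y|lborel. A * kern \<theta> (?z - y) + V y * kern \<theta> (?z - y))"
      unfolding moll_def
    proof (rule integral_mono)
      show "integrable lborel (\<lambda>y. (q y)\<^sup>2 * kern \<theta> (?z - y))" by (rule integrable_mult_kern[OF \<theta>(1) q2])
      show "integrable lborel (\<lambda>y. A * kern \<theta> (?z - y) + V y * kern \<theta> (?z - y))"
        by (intro Bochner_Integration.integrable_add integrable_mult_right integrable_kern_shift integrable_mult_kern \<theta> V)
      fix y
      have "(q y)\<^sup>2 \<le> A + V y" using qle[of y] HAV[of y] by simp
      then show "(q y)\<^sup>2 * kern \<theta> (?z - y) \<le> A * kern \<theta> (?z - y) + V y * kern \<theta> (?z - y)"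
        unfolding distrib_right[symmetric] by (rule mult_right_mono) (rule kern_nonneg[OF \<theta>(1)])
    qed
    also have "\<dots> = A + moll \<theta> V ?z"
      unfolding moll_def using integrable_kern_shift[OF \<theta>(1)] integrable_mult_kern[OF \<theta>(1) V(1)] integral_kern_shift[OF \<theta>(1), of ?z]
      by (subst Bochner_Integration.integral_add) auto
    finally show ?thesis .
  qed
  have "ennreal ((k c - k 0 - c * k1 0)\<^sup>2) \<le> ennreal (c ^ 3) * (\<integral>\<^sup>+s\<in>{0..c}. ennreal (A + moll \<theta> V (x + s *\<^sub>R w)) \<partial>lborel)"
    by (rule taylor_square_le[OF c dk dk1 k2c Bc]) (auto intro: le)
  moreover have "rem \<theta> x = k c - k 0 - c * k1 0"
    by (simp add: rem_def k_def k1_def c_def dw)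
  ultimately show ?thesis by (simp add: c_def w_def)
qed

definition region :: "(real^2) set" where "region = (\<Union>x\<in>E. closed_segment x (M x))"

lemma compact_region: "compact region"
proof -
  have "region = (\<lambda>p. fst p + snd p *\<^sub>R (M (fst p) - fst p)) ` (E \<times> {0..1})"
  proof -
    have seg: "closed_segment x (M x) = (\<lambda>s. x + s *\<^sub>R (M x - x)) ` {0..1}" for x
      unfolding closed_segment_image_interval by (intro image_cong) (auto simp: algebra_simps)
    have "(\<Union>x\<in>E. f x ` {0..1}) = (\<lambda>p. f (fst p) (snd p)) ` (E \<times> {0..1})" for f :: "real^2 \<Rightarrow> real \<Rightarrow> real^2"
      by force
    then show ?thesis unfolding region_def seg .
  qed
  moreover have "compact \<dots>"
    by (intro compact_continuous_image compact_Times compact_segment compact_Icc continuous_intros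
      continuous_on_compose2[OF continuous_on_M]) auto
  ultimately show ?thesis by simp
qed

lemma line_in_region:
  assumes x: "x \<in> E" and s: "0 \<le> s" "s \<le> depth x"
  shows "x + s *\<^sub>R n x \<in> region"
proof (cases "depth x = 0")
  case True
  then have "x + s *\<^sub>R n x = x" using s by simp
  then show ?thesis using x by (auto simp: region_def)
next
  case False
  then have d: "0 < depth x" using depth_nonneg[of x] by simp
  have "x + s *\<^sub>R n x = (1 - s / depth x) *\<^sub>R x + (s / depth x) *\<^sub>R M x"
    using M_eq[OF x] d by (simp add: algebra_simps)
  then have "x + s *\<^sub>R n x \<in> closed_segment x (M x)"
    using s d by (auto simp: in_segment intro!: exI[of _ "s / depth x"])
  then show ?thesis using x by (auto simp: region_def)
qed

definition remt :: "real \<Rightarrow> real \<Rightarrow> real" where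
  "remt \<theta> t = (if t \<in> {0..1} \<and> 2 * \<theta> < depth (X t) then rem \<theta> (X t) else 0)"

lemma continuous_depth_X: "continuous_on {0..1} (\<lambda>t. depth (X t))"
  by (rule continuous_on_compose2[OF continuous_on_depth continuous_X]) (auto simp: X_in_E)

lemma continuous_M_X: "continuous_on {0..1} (\<lambda>t. M (X t))"
  by (rule continuous_on_compose2[OF continuous_on_M continuous_X]) (auto simp: X_in_E)

lemma depth_set_borel: "0 < c \<Longrightarrow> {t \<in> {0..1}. c < depth (X t)} \<in> sets borel"
proof -
  assume c: "0 < c"
  have [measurable]: "(\<lambda>t. indicator {0..1} t *\<^sub>R depth (X t)) \<in> borel_measurable borel"
    by (rule borel_measurable_continuous_on_indicator[OF _ continuous_depth_X]) simp
  have "{t \<in> {0..1}. c < depth (X t)} = {t \<in> space borel. c < indicator {0..1} t *\<^sub>R depth (X t)}"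
    using c by (auto split: split_indicator)
  also have "\<dots> \<in> sets borel" by measurable
  finally show ?thesis .
qed

lemma remt_measurable: 
  assumes \<theta>: "0 < \<theta>"
  shows "remt \<theta> \<in> borel_measurable borel"
proof -
  let ?S = "{t \<in> {0..1}. 2 * \<theta> < depth (X t)}"
  have cM: "continuous_on ?S (\<lambda>t. M (X t))" and cd: "continuous_on ?S (\<lambda>t. depth (X t))"
    by (rule continuous_on_subset[OF continuous_M_X], force) (rule continuous_on_subset[OF continuous_depth_X], force)
  have cdir: "continuous_on ?S (\<lambda>t. dir (X t))"
    unfolding dir_def using \<theta> by (intro continuous_intros cM cd continuous_X) auto
  have cm: "continuous_on ?S (\<lambda>t. moll \<theta> f (h t))" if "integrable lborel f" "continuous_on ?S h" for f h
    by (rule continuous_on_compose2[OF continuous_moll[OF \<theta> that(1), of UNIV] that(2)]) simp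
  have cd2: "continuous_on ?S (\<lambda>t. depth (X t) - 2 * \<theta>)"
    by (rule continuous_on_diff[OF cd continuous_on_const])
  have c1: "continuous_on ?S (\<lambda>t. moll \<theta> u (X t + (depth (X t) - 2 * \<theta>) *\<^sub>R dir (X t)))"
    by (rule cm[OF u continuous_on_add[OF continuous_X continuous_on_scaleR[OF cd2 cdir]]])
  have c2: "continuous_on ?S (\<lambda>t. \<Sum>i\<in>UNIV. dir (X t) $ i * moll \<theta> (\<lambda>y. G y $ i) (X t))"
    by (rule continuous_on_sum) (rule continuous_on_mult[OF continuous_on_component[OF cdir] cm[OF G continuous_X]])
  have "continuous_on ?S (\<lambda>t. rem \<theta> (X t))"
    using continuous_on_diff[OF continuous_on_diff[OF c1 cm[OF u continuous_X]] continuous_on_mult[OF cd2 c2]]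
    unfolding rem_def .
  moreover have "?S \<in> sets borel" using \<theta> by (intro depth_set_borel) simp
  ultimately have "(\<lambda>t. indicator ?S t *\<^sub>R rem \<theta> (X t)) \<in> borel_measurable borel"
    by (intro borel_measurable_continuous_on_indicator)
  moreover have "indicator ?S t *\<^sub>R rem \<theta> (X t) = remt \<theta> t" for t
  proof (cases "t \<in> {0..1} \<and> 2 * \<theta> < depth (X t)")
    case True
    then show ?thesis by (simp add: remt_def)
  next
    case False
    then have "remt \<theta> t = 0" unfolding remt_def by (rule if_not_P)
    moreover have "indicator ?S t = (0::real)" using False by (intro indicator_simps(2)) blast
    ultimately show ?thesis by (metis scaleR_zero_left)
  qed
  ultimately show ?thesis by simp
qed

lemma nn_integral_remt_le:
  assumes \<theta>: "0 < \<theta>"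
  shows "(\<integral>\<^sup>+t. ennreal ((remt \<theta> t)\<^sup>2) \<partial>lborel) \<le> ennreal (\<delta> ^ 4 * A) +
    ennreal (\<delta> ^ 3) * (ennreal (576 / norm (b - a)) * (\<integral>\<^sup>+y\<in>region. ennreal (moll \<theta> V y) \<partial>lborel))"
proof -
  have \<delta>0: "0 \<le> \<delta>" using depth_le[of a] depth_nonneg[of a] by simp
  define F where "F y = ennreal (moll \<theta> V y) * indicator region y" for y
  have mV: "0 \<le> moll \<theta> V y" for y using V(2) by (intro moll_nonneg \<theta>) auto
  have [measurable]: "region \<in> sets borel" using compact_region by (rule borel_compact)
  have [measurable]: "moll \<theta> V \<in> borel_measurable borel" by (rule moll_measurable[OF \<theta> V(1)])
  have Fm [measurable]: "F \<in> borel_measurable borel" unfolding F_def by measurable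
  define S where "S = {p :: real \<times> real. fst p \<in> {0..1} \<and> 0 \<le> snd p \<and> snd p \<le> depth (X (fst p)) - 2 * \<theta>}"
  define \<Psi> where "\<Psi> p = X (fst p) + snd p *\<^sub>R dir (X (fst p))" for p :: "real \<times> real"
  have cS: "continuous_on ({0..1} \<times> UNIV) (\<lambda>p :: real \<times> real. depth (X (fst p)))"
    by (rule continuous_on_compose2[OF continuous_depth_X]) (auto intro!: continuous_intros)
  have "closed S"
  proof -
    have "closed (({0..1} \<times> UNIV) \<inter> (\<lambda>p :: real \<times> real. depth (X (fst p)) - 2 * \<theta> - snd p) -` {0..})"
    proof (rule continuous_closed_preimage)
      show "continuous_on ({0..1} \<times> UNIV) (\<lambda>p :: real \<times> real. depth (X (fst p)) - 2 * \<theta> - snd p)"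
        by (intro continuous_on_diff cS continuous_on_const continuous_on_snd continuous_on_id)
      show "closed ({0..1::real} \<times> (UNIV :: real set))" by (intro closed_Times) auto
    qed simp
    moreover have "closed ((UNIV :: real set) \<times> {0::real..})" by (intro closed_Times) auto
    ultimately have "closed ((({0..1} \<times> UNIV) \<inter> (\<lambda>p :: real \<times> real. depth (X (fst p)) - 2 * \<theta> - snd p) -` {0..}) \<inter> (UNIV \<times> {0..}))"
      by (rule closed_Int)
    also have "(({0..1} \<times> UNIV) \<inter> (\<lambda>p :: real \<times> real. depth (X (fst p)) - 2 * \<theta> - snd p) -` {0..}) \<inter> (UNIV \<times> {0..}) = S"
      by (auto simp: S_def)
    finally show ?thesis .
  qed
  then have SB [measurable]: "S \<in> sets borel" by simp
  have Sd: "X (fst p) \<in> E" "0 < depth (X (fst p))" "dir (X (fst p)) = n (X (fst p))" "0 \<le> snd p" "snd p \<le> depth (X (fst p))"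
    if "p \<in> S" for p
    using that \<theta> by (auto simp: S_def X_in_E intro!: dir_eq)
  have c\<Psi>: "continuous_on S \<Psi>"
  proof -
    have f: "continuous_on S (\<lambda>p. fst p)" by (intro continuous_intros)
    have "continuous_on S (\<lambda>p. depth (X (fst p)))" "continuous_on S (\<lambda>p. M (X (fst p)))"
      by (rule continuous_on_compose2[OF continuous_depth_X f], force simp: S_def)
        (rule continuous_on_compose2[OF continuous_M_X f], force simp: S_def)
    moreover have "continuous_on S (\<lambda>p. X (fst p))" by (rule continuous_on_compose2[OF continuous_X[of UNIV] f]) auto
    moreover have "\<forall>p\<in>S. depth (X (fst p)) \<noteq> 0" using Sd(2) by fastforce
    ultimately show ?thesis unfolding \<Psi>_def dir_def
      by (intro continuous_intros) auto
  qed
  have lp: "0 < norm (b - a)" using ab by simp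
  define Lc where "Lc i = fst i * (4 / norm (b - a)) + snd i * 9" for i :: "real \<times> real"
  have "(\<integral>\<^sup>+p. F (\<Psi> p) * indicator S p \<partial>lborel) \<le> ennreal (\<Prod>i\<in>Basis. 2 * real DIM(real^2) * Lc i) * (\<integral>\<^sup>+y. F y \<partial>lborel)"
  proof (rule nn_integral_expanding_le[OF _ SB c\<Psi> _ _ Fm])
    fix i :: "real \<times> real" assume i: "i \<in> Basis"
    then have i2: "i = (1, 0) \<or> i = (0, 1)" by (auto simp: Basis_prod_def)
    then show "0 \<le> Lc i" by (auto simp: Lc_def)
    fix p q assume pq: "p \<in> S" "q \<in> S"
    note nc = normal_coordinates_le[OF Sd(1)[OF pq(1)] Sd(1)[OF pq(2)] Sd(4,5)[OF pq(1)] Sd(4,5)[OF pq(2)]]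
    have 1: "\<bar>fst p - fst q\<bar> * norm (b - a) \<le> 4 * dist (\<Psi> p) (\<Psi> q)"
      using nc(1) Sd(3)[OF pq(1)] Sd(3)[OF pq(2)] by (simp add: \<Psi>_def dist_norm dist_X)
    then have 1: "\<bar>fst p - fst q\<bar> \<le> 4 / norm (b - a) * dist (\<Psi> p) (\<Psi> q)"
      using lp by (simp add: field_simps)
    have 2: "\<bar>snd p - snd q\<bar> \<le> 9 * dist (\<Psi> p) (\<Psi> q)"
      using nc(2) Sd(3)[OF pq(1)] Sd(3)[OF pq(2)] by (simp add: \<Psi>_def dist_norm)
    show "\<bar>p \<bullet> i - q \<bullet> i\<bar> \<le> Lc i * dist (\<Psi> p) (\<Psi> q)"
      using i2 1 2 by (auto simp: Lc_def inner_prod_def)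
  qed auto
  also have "(\<Prod>i\<in>Basis. 2 * real DIM(real^2) * Lc i) = 576 / norm (b - a)"
  proof -
    have B: "(Basis :: (real \<times> real) set) = {(1, 0), (0, 1)}" by (auto simp: Basis_prod_def)
    show ?thesis unfolding B by (simp add: Lc_def)
  qed
  finally have FS: "(\<integral>\<^sup>+p. F (\<Psi> p) * indicator S p \<partial>lborel) \<le> ennreal (576 / norm (b - a)) * (\<integral>\<^sup>+y. F y \<partial>lborel)" .
  have \<Psi>m: "(\<lambda>p. F (\<Psi> p) * indicator S p) \<in> borel_measurable borel"
  proof -
    have [measurable]: "(\<lambda>p. indicator S p *\<^sub>R \<Psi> p) \<in> borel_measurable borel"
      by (rule borel_measurable_continuous_on_indicator[OF SB c\<Psi>])
    have "(\<lambda>p. F (indicator S p *\<^sub>R \<Psi> p) * indicator S p) \<in> borel_measurable borel" by measurable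
    moreover have "(\<lambda>p. F (indicator S p *\<^sub>R \<Psi> p) * indicator S p) = (\<lambda>p. F (\<Psi> p) * indicator S p)"
      by (auto split: split_indicator)
    ultimately show ?thesis by simp
  qed
  have pt: "ennreal ((remt \<theta> t)\<^sup>2) \<le> ennreal (\<delta> ^ 4 * A) * indicator {0..1} t + ennreal (\<delta> ^ 3) * (\<integral>\<^sup>+s. F (\<Psi> (t, s)) * indicator S (t, s) \<partial>lborel)" for t
  proof (cases "t \<in> {0..1} \<and> 2 * \<theta> < depth (X t)")
    case False
    then have "remt \<theta> t = 0" unfolding remt_def by (rule if_not_P)
    then show ?thesis by simp
  next
    case True
    then have x: "X t \<in> E" by (simp add: X_in_E)
    define c where "c = depth (X t) - 2 * \<theta>"
    have c: "0 \<le> c" "c \<le> \<delta>" using True \<theta> depth_le[OF x] by (auto simp: c_def)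
    have F: "ennreal (moll \<theta> V (X t + s *\<^sub>R n (X t))) * indicator {0..c} s = F (\<Psi> (t, s)) * indicator S (t, s)" for s
    proof (cases "s \<in> {0..c}")
      case s: True
      then have "(t, s) \<in> S" using True by (auto simp: S_def c_def)
      moreover have "X t + s *\<^sub>R n (X t) \<in> region" using s \<theta> by (intro line_in_region x) (auto simp: c_def)
      ultimately show ?thesis using Sd(3)[of "(t, s)"] s by (simp add: F_def \<Psi>_def)
    next
      case s: False
      then have "(t, s) \<notin> S" by (auto simp: S_def c_def)
      then show ?thesis using s by simp
    qed
    have [measurable]: "(\<lambda>s. moll \<theta> V (X t + s *\<^sub>R n (X t))) \<in> borel_measurable borel"
      by (intro borel_measurable_continuous_onI continuous_on_compose2[OF continuous_moll[OF \<theta> V(1), of UNIV]] continuous_intros) auto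
    have "ennreal ((remt \<theta> t)\<^sup>2) \<le> ennreal (c ^ 3) * (\<integral>\<^sup>+s\<in>{0..c}. ennreal (A + moll \<theta> V (X t + s *\<^sub>R n (X t))) \<partial>lborel)"
      using rem_square_le[OF x \<theta>] True by (simp add: remt_def c_def)
    also have "(\<integral>\<^sup>+s\<in>{0..c}. ennreal (A + moll \<theta> V (X t + s *\<^sub>R n (X t))) \<partial>lborel)
       = (\<integral>\<^sup>+s. ennreal A * indicator {0..c} s + ennreal (moll \<theta> V (X t + s *\<^sub>R n (X t))) * indicator {0..c} s \<partial>lborel)"
      using A mV by (intro nn_integral_cong) (auto split: split_indicator)
    also have "\<dots> = (\<integral>\<^sup>+s. ennreal A * indicator {0..c} s \<partial>lborel) + (\<integral>\<^sup>+s. ennreal (moll \<theta> V (X t + s *\<^sub>R n (X t))) * indicator {0..c} s \<partial>lborel)"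
      by (rule nn_integral_add) measurable
    also have "\<dots> = ennreal A * ennreal c + (\<integral>\<^sup>+s. F (\<Psi> (t, s)) * indicator S (t, s) \<partial>lborel)"
      unfolding F using c by (simp add: nn_integral_cmult_indicator)
    also have "ennreal (c ^ 3) * \<dots> \<le> ennreal (\<delta> ^ 4 * A) + ennreal (\<delta> ^ 3) * (\<integral>\<^sup>+s. F (\<Psi> (t, s)) * indicator S (t, s) \<partial>lborel)"
      unfolding distrib_left
    proof (rule add_mono)
      have "ennreal (c ^ 3) * (ennreal A * ennreal c) = ennreal (c ^ 4 * A)"
        using c A by (simp add: ennreal_mult[symmetric] power_Suc eval_nat_numeral mult_ac)
      also have "\<dots> \<le> ennreal (\<delta> ^ 4 * A)" using c A by (intro ennreal_leI mult_right_mono power_mono) auto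
      finally show "ennreal (c ^ 3) * (ennreal A * ennreal c) \<le> ennreal (\<delta> ^ 4 * A)" .
      show "ennreal (c ^ 3) * (\<integral>\<^sup>+s. F (\<Psi> (t, s)) * indicator S (t, s) \<partial>lborel) \<le> ennreal (\<delta> ^ 3) * (\<integral>\<^sup>+s. F (\<Psi> (t, s)) * indicator S (t, s) \<partial>lborel)"
        using c by (intro mult_right_mono ennreal_leI power_mono) auto
    qed
    finally show ?thesis using True by simp
  qed
  have im: "(\<lambda>t. \<integral>\<^sup>+s. F (\<Psi> (t, s)) * indicator S (t, s) \<partial>lborel) \<in> borel_measurable lborel"
  proof -
    have "(\<lambda>p. F (\<Psi> p) * indicator S p) \<in> borel_measurable (lborel \<Otimes>\<^sub>M lborel)" using \<Psi>m by (simp add: lborel_prod)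
    from lborel.borel_measurable_nn_integral_fst[OF this] show ?thesis .
  qed
  have "(\<integral>\<^sup>+t. ennreal ((remt \<theta> t)\<^sup>2) \<partial>lborel) \<le> (\<integral>\<^sup>+t. ennreal (\<delta> ^ 4 * A) * indicator {0..1} t
      + ennreal (\<delta> ^ 3) * (\<integral>\<^sup>+s. F (\<Psi> (t, s)) * indicator S (t, s) \<partial>lborel) \<partial>lborel)"
    by (intro nn_integral_mono pt)
  also have "\<dots> = ennreal (\<delta> ^ 4 * A) + ennreal (\<delta> ^ 3) * (\<integral>\<^sup>+t. \<integral>\<^sup>+s. F (\<Psi> (t, s)) * indicator S (t, s) \<partial>lborel \<partial>lborel)"
    using im by (subst nn_integral_add) (auto simp: nn_integral_cmult nn_integral_cmult_indicator)
  also have "(\<integral>\<^sup>+t. \<integral>\<^sup>+s. F (\<Psi> (t, s)) * indicator S (t, s) \<partial>lborel \<partial>lborel) = (\<integral>\<^sup>+p. F (\<Psi> p) * indicator S p \<partial>lborel)"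
    by (rule nn_integral_lborel_pair[symmetric, OF \<Psi>m])
  also have "ennreal (\<delta> ^ 4 * A) + ennreal (\<delta> ^ 3) * \<dots> \<le> ennreal (\<delta> ^ 4 * A) + ennreal (\<delta> ^ 3) * (ennreal (576 / norm (b - a)) * (\<integral>\<^sup>+y. F y \<partial>lborel))"
    by (intro add_left_mono mult_left_mono FS) simp
  finally show ?thesis by (simp add: F_def)
qed

end

context edge_estimate
begin

lemma AE_M_X_not_in_N: "AE t in lborel. t \<in> {0..1} \<longrightarrow> M (X t) \<notin> N"
proof -
  let ?bad = "{t \<in> {0..1}. M (X t) \<in> N}"
  define q where "q = 4 / norm (b - a)"
  have q: "0 < q" using ab by (simp add: q_def)
  have "negligible ?bad"
    unfolding negligible_outer_le
  proof (intro allI impI)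
    fix e :: real assume e: "0 < e"
    have "0 < e / (2 * q)" using e q by simp
    then obtain c :: "nat \<Rightarrow> real^2" and r :: "nat \<Rightarrow> real" where
      r: "\<And>k. 0 \<le> r k" "N \<subseteq> (\<Union>k. cball (c k) (r k))" "summable r" "suminf r < e / (2 * q)"
      using N[unfolded arc_length_null_def, rule_format, of "e / (2 * q)"] by metis
    define \<tau> where "\<tau> k = (SOME t. t \<in> {0..1} \<and> M (X t) \<in> cball (c k) (r k))" for k
    define T where "T k = {\<tau> k - q * r k .. \<tau> k + q * r k}" for k
    have Tm: "T k \<in> lmeasurable" for k unfolding T_def by simp
    have mT: "measure lebesgue (T k) = 2 * q * r k" for k
      unfolding T_def using q r(1)[of k] by simp
    have bound: "measure lebesgue (\<Union>k\<in>I. T k) \<le> e" if "finite I" for I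
    proof -
      have "measure lebesgue (\<Union>k\<in>I. T k) \<le> (\<Sum>k\<in>I. measure lebesgue (T k))"
        using that Tm by (intro measure_UNION_le) (auto intro: fmeasurableD)
      also have "\<dots> = 2 * q * (\<Sum>k\<in>I. r k)" by (simp add: mT sum_distrib_left)
      also have "\<dots> \<le> 2 * q * suminf r"
        using q r that by (intro mult_left_mono sum_le_suminf) auto
      also have "\<dots> \<le> e" using r(4) q by (simp add: field_simps)
      finally show ?thesis .
    qed
    show "\<exists>T. ?bad \<subseteq> T \<and> T \<in> lmeasurable \<and> measure lebesgue T \<le> e"
    proof (intro exI[of _ "\<Union>k. T k"] conjI)
      show "(\<Union>k. T k) \<in> lmeasurable" by (rule fmeasurable_UN_bound[OF _ Tm bound]) auto
      show "measure lebesgue (\<Union>k. T k) \<le> e" by (rule measure_UN_bound[OF _ Tm bound]) auto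
      show "?bad \<subseteq> (\<Union>k. T k)"
      proof
        fix t assume t: "t \<in> ?bad"
        then obtain k where k: "M (X t) \<in> cball (c k) (r k)" using r(2) by auto
        then have \<tau>: "\<tau> k \<in> {0..1}" "M (X (\<tau> k)) \<in> cball (c k) (r k)"
          using someI[of "\<lambda>t. t \<in> {0..1} \<and> M (X t) \<in> cball (c k) (r k)" t] t unfolding \<tau>_def by auto
        have "norm (M (X t) - M (X (\<tau> k))) \<le> 2 * r k"
          using k \<tau>(2) dist_triangle2[of "M (X t)" "M (X (\<tau> k))" "c k"] by (simp add: dist_norm norm_minus_commute)
        then have "\<bar>t - \<tau> k\<bar> * norm (b - a) \<le> 4 * r k"
          using base_le[of "X t" "X (\<tau> k)"] X_in_E[of t] X_in_E[of "\<tau> k"] t \<tau>(1) by (simp add: dist_X)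
        then have "\<bar>t - \<tau> k\<bar> \<le> q * r k" using ab by (simp add: q_def field_simps)
        then have "t \<in> T k" unfolding T_def by (simp add: abs_le_iff)
        then show "t \<in> (\<Union>k. T k)" by blast
      qed
    qed
  qed
  then have "?bad \<in> null_sets lebesgue" by (simp add: negligible_iff_null_sets)
  then have "AE t in lebesgue. t \<notin> ?bad" by (rule AE_not_in)
  then have "AE t in lborel. t \<notin> ?bad" by (simp add: AE_completion_iff)
  then show ?thesis by eventually_elim auto
qed

definition rho :: "real \<Rightarrow> real" where "rho t = taylor_remainder \<Omega> g u0 G0 M (X t)"

lemma remt_tendsto:
  "AE t in lborel. (\<lambda>k. remt (1 / real (Suc k)) t) \<longlonglongrightarrow> indicator {0..1} t * rho t"
proof -
  have d: "b - a \<noteq> 0" using ab by simp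
  have 1: "AE t in lborel. a + t *\<^sub>R (b - a) \<in> W \<longrightarrow> (\<exists>v. lebesgue_value u (a + t *\<^sub>R (b - a)) v)"
    by (rule lebesgue_value_on_line[OF d W(1) u G weak1])
  have 2: "AE t in lborel. a + t *\<^sub>R (b - a) \<in> W \<longrightarrow> (\<exists>v. lebesgue_value (\<lambda>y. G y $ i) (a + t *\<^sub>R (b - a)) v)" for i
    by (rule lebesgue_value_on_line[OF d W(1) G H weak2])
  have 2: "AE t in lborel. \<forall>i. a + t *\<^sub>R (b - a) \<in> W \<longrightarrow> (\<exists>v. lebesgue_value (\<lambda>y. G y $ i) (a + t *\<^sub>R (b - a)) v)"
    using 2 by (subst AE_all_countable) auto
  have lim0: "filterlim (\<lambda>k. 1 / real (Suc k)) (at_right 0) sequentially"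
    unfolding filterlim_at using LIMSEQ_inverse_real_of_nat by (auto simp: inverse_eq_divide)
  from 1 2 AE_M_X_not_in_N show ?thesis
  proof eventually_elim
    case (elim t)
    show ?case
    proof (cases "t \<in> {0..1}")
      case False
      then have "remt \<theta> t = 0" for \<theta> unfolding remt_def by auto
      then show ?thesis using False by simp
    next
      case True
      define x where "x = X t"
      have x: "x \<in> E" using True by (simp add: x_def X_in_E)
      have cl: "x \<in> closure \<Omega>" using x E_closure by blast
      have tr: "has_trace_at \<Omega> u0 (M x) (g (M x))" using elim(3) True by (intro trace x) (simp add: x_def)
      show ?thesis
      proof (cases "depth x = 0")
        case d0: True
        then have Mxx: "M x = x" by (simp add: depth_def)
        have "trace_at \<Omega> u0 x = g x" using trace_at_eq[OF \<Omega> cl] tr Mxx by simp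
        then have "rho t = 0"
          by (simp add: rho_def taylor_remainder_def taylor_extension_def x_def[symmetric] Mxx)
        moreover have "remt (1 / real (Suc k)) t = 0" for k
        proof -
          have "\<not> 2 * (1 / real (Suc k)) < depth (X t)" using d0 by (simp add: x_def not_less)
          then show ?thesis unfolding remt_def by simp
        qed
        ultimately show ?thesis by simp
      next
        case False
        then have d0: "0 < depth x" using depth_nonneg[of x] by simp
        have dir: "dir x = n x" by (rule dir_eq[OF x d0])
        have bW: "ball x (depth x) \<subseteq> \<Omega> \<inter> W" using ball_W[OF x d0] W by blast
        then have xW: "x \<in> W" using d0 by auto
        obtain v where v: "lebesgue_value u x v" using elim(1) xW by (auto simp: x_def X_def)
        have "\<forall>i. \<exists>v. lebesgue_value (\<lambda>y. G y $ i) x v" using elim(2) xW by (auto simp: x_def X_def)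
        then obtain vf where vf: "\<And>i. lebesgue_value (\<lambda>y. G y $ i) x (vf i)" by metis
        define vG :: "real^2" where "vG = (\<chi> i. vf i)"
        have tu: "trace_at \<Omega> u0 x = v"
          by (intro trace_at_eq[OF \<Omega> cl] has_trace_at_of_lebesgue_value[OF xW W(2,1) u u0]) (use v in auto)
        have GI: "integrable lborel G"
        proof -
          have "integrable lborel (\<lambda>y. \<Sum>i\<in>UNIV. (G y $ i) *\<^sub>R (axis i 1 :: real^2))"
            using G by (intro Bochner_Integration.integrable_sum integrable_scaleR_left) auto
          moreover have "(\<Sum>i\<in>UNIV. (G y $ i) *\<^sub>R (axis i 1 :: real^2)) = G y" for y
            using basis_expansion[of "G y"] by (simp add: scalar_mult_eq_scaleR)
          ultimately show ?thesis by simp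
        qed
        have tG: "trace_at \<Omega> G0 x = vG"
        proof (intro trace_at_eq[OF \<Omega> cl] has_trace_at_of_lebesgue_value[OF xW W(2,1) GI G0])
          fix i :: "real^2" assume "i \<in> Basis"
          then obtain j where j: "i = axis j 1" by (auto simp: Basis_vec_def)
          show "lebesgue_value (\<lambda>y. G y \<bullet> i) x (vG \<bullet> i)"
            using vf[of j] by (simp add: j inner_axis vG_def)
        qed
        have "((\<lambda>\<theta>. moll \<theta> u (x + (depth x - 2 * \<theta>) *\<^sub>R n x)) \<longlongrightarrow> g (M x)) (at_right 0)"
          by (rule moll_tendsto_boundary_trace[OF u \<Omega> W(1) u0(2) d0 n1[OF x] bW M_eq[OF x] tr])
        moreover have "((\<lambda>\<theta>. moll \<theta> u x) \<longlongrightarrow> v) (at_right 0)"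
          by (rule moll_tendsto_lebesgue_value[OF u v])
        moreover have "((\<lambda>\<theta>. moll \<theta> (\<lambda>y. G y $ i) x) \<longlongrightarrow> vf i) (at_right 0)" for i
          by (rule moll_tendsto_lebesgue_value[OF G vf])
        moreover have "((\<lambda>\<theta>::real. depth x - 2 * \<theta>) \<longlongrightarrow> depth x) (at_right 0)"
          by (rule tendsto_eq_intros | simp)+
        ultimately have lim: "((\<lambda>\<theta>. rem \<theta> x) \<longlongrightarrow> g (M x) - v - depth x * (\<Sum>i\<in>UNIV. n x $ i * vf i)) (at_right 0)"
          unfolding rem_def dir by (intro tendsto_diff tendsto_mult tendsto_sum tendsto_const)
        have "rho t = g (M x) - v - depth x * (\<Sum>i\<in>UNIV. n x $ i * vf i)"
        proof -
          have "M x - x = depth x *\<^sub>R n x" using M_eq[OF x] by (simp add: algebra_simps)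
          then have "vG \<bullet> (M x - x) = depth x * (\<Sum>i\<in>UNIV. n x $ i * vf i)"
            by (simp add: inner_vec_def vG_def sum_distrib_left mult_ac)
          then show ?thesis
            by (simp add: rho_def taylor_remainder_def taylor_extension_def x_def[symmetric] tu tG)
        qed
        then have "(\<lambda>k. rem (1 / real (Suc k)) x) \<longlonglongrightarrow> rho t"
          using filterlim_compose[OF lim lim0] by simp
        moreover have "\<forall>\<^sub>F k in sequentially. rem (1 / real (Suc k)) x = remt (1 / real (Suc k)) t"
        proof -
          have "(\<lambda>k. 2 * (1 / real (Suc k))) \<longlonglongrightarrow> 2 * 0"
            using LIMSEQ_inverse_real_of_nat by (intro tendsto_mult tendsto_const) (simp add: inverse_eq_divide)
          then have "\<forall>\<^sub>F k in sequentially. 2 * (1 / real (Suc k)) < depth x"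
            using d0 by (intro order_tendstoD) auto
          then show ?thesis by eventually_elim (use True in \<open>simp add: remt_def x_def\<close>)
        qed
        ultimately show ?thesis using True by (simp add: Lim_transform_eventually)
      qed
    qed
  qed
qed

lemma rho_measurable: "rho \<in> borel_measurable (lebesgue_on {0..1})"
proof -
  have [measurable]: "remt (1 / real (Suc k)) \<in> borel_measurable borel" for k
    by (rule remt_measurable) simp
  have "(\<lambda>t. lim (\<lambda>k. remt (1 / real (Suc k)) t)) \<in> borel_measurable borel" by measurable
  then have "(\<lambda>t. lim (\<lambda>k. remt (1 / real (Suc k)) t)) \<in> borel_measurable lebesgue"
    by (intro measurable_completion) simp
  moreover have "AE t in lebesgue. indicator {0..1} t * rho t = lim (\<lambda>k. remt (1 / real (Suc k)) t)"
  proof -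
    have "AE t in lebesgue. (\<lambda>k. remt (1 / real (Suc k)) t) \<longlonglongrightarrow> indicator {0..1} t * rho t"
      using remt_tendsto by (rule AE_completion)
    then show ?thesis by eventually_elim (simp add: limI)
  qed
  ultimately have "(\<lambda>t. indicator {0..1} t * rho t) \<in> borel_measurable lebesgue"
    by (rule borel_measurable_lebesgue_AE)
  then show ?thesis
    by (subst borel_measurable_restrict_space_iff) auto
qed

lemma nn_integral_rho_le:
  "(\<integral>\<^sup>+t. ennreal ((rho t)\<^sup>2) \<partial>lebesgue_on {0..1}) \<le> ennreal (\<delta> ^ 4 * A) +
    ennreal (\<delta> ^ 3) * (ennreal (576 / norm (b - a)) * (\<integral>\<^sup>+y\<in>region. ennreal (V y) \<partial>lborel))"
proof -
  have [measurable]: "remt (1 / real (Suc k)) \<in> borel_measurable borel" for k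
    by (rule remt_measurable) simp
  have [measurable]: "V \<in> borel_measurable borel" using V(1) by simp
  have [measurable]: "region \<in> sets borel" using compact_region by (rule borel_compact)
  have lim0: "filterlim (\<lambda>k. 1 / real (Suc k)) (at_right 0) sequentially"
    unfolding filterlim_at using LIMSEQ_inverse_real_of_nat by (auto simp: inverse_eq_divide)
  define e where "e k = (\<integral>\<^sup>+z. ennreal \<bar>moll (1 / real (Suc k)) V z - V z\<bar> \<partial>lborel)" for k
  have e0: "e \<longlonglongrightarrow> 0" using filterlim_compose[OF moll_L1[OF V(1)] lim0] by (simp add: e_def[abs_def])
  let ?I = "\<integral>\<^sup>+y\<in>region. ennreal (V y) \<partial>lborel"
  define R where "R z = ennreal (\<delta> ^ 4 * A) + ennreal (\<delta> ^ 3) * (ennreal (576 / norm (b - a)) * (?I + z))" for z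
  have "(\<integral>\<^sup>+t. ennreal ((rho t)\<^sup>2) \<partial>lebesgue_on {0..1}) = (\<integral>\<^sup>+t. ennreal ((rho t)\<^sup>2) * indicator {0..1} t \<partial>lebesgue)"
    by (subst nn_integral_restrict_space) auto
  also have "\<dots> = (\<integral>\<^sup>+t. ennreal ((rho t)\<^sup>2) * indicator {0..1} t \<partial>lborel)"
    by (rule nn_integral_completion)
  also have "\<dots> = (\<integral>\<^sup>+t. liminf (\<lambda>k. ennreal ((remt (1 / real (Suc k)) t)\<^sup>2)) \<partial>lborel)"
  proof (rule nn_integral_cong_AE)
    show "AE t in lborel. ennreal ((rho t)\<^sup>2) * indicator {0..1} t = liminf (\<lambda>k. ennreal ((remt (1 / real (Suc k)) t)\<^sup>2))"
      using remt_tendsto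
    proof eventually_elim
      case (elim t)
      have "(\<lambda>k. ennreal ((remt (1 / real (Suc k)) t)\<^sup>2)) \<longlonglongrightarrow> ennreal ((indicator {0..1} t * rho t)\<^sup>2)"
        by (intro tendsto_ennrealI tendsto_power elim)
      then have "liminf (\<lambda>k. ennreal ((remt (1 / real (Suc k)) t)\<^sup>2)) = ennreal ((indicator {0..1} t * rho t)\<^sup>2)"
        by (intro lim_imp_Liminf) auto
      then show ?case by (auto split: split_indicator)
    qed
  qed
  also have "\<dots> \<le> liminf (\<lambda>k. \<integral>\<^sup>+t. ennreal ((remt (1 / real (Suc k)) t)\<^sup>2) \<partial>lborel)"
    by (rule nn_integral_liminf) measurable
  also have "\<dots> \<le> liminf (\<lambda>k. R (e k))"
  proof (intro Liminf_mono always_eventually allI)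
    fix k
    let ?\<theta> = "1 / real (Suc k)"
    have [measurable]: "moll ?\<theta> V \<in> borel_measurable borel" by (rule moll_measurable[OF _ V(1)]) simp
    have "(\<integral>\<^sup>+y\<in>region. ennreal (moll ?\<theta> V y) \<partial>lborel) \<le> (\<integral>\<^sup>+y. ennreal (V y) * indicator region y + ennreal \<bar>moll ?\<theta> V y - V y\<bar> \<partial>lborel)"
    proof (rule nn_integral_mono)
      fix y
      have "moll ?\<theta> V y \<le> V y + \<bar>moll ?\<theta> V y - V y\<bar>" by simp
      then have "ennreal (moll ?\<theta> V y) \<le> ennreal (V y + \<bar>moll ?\<theta> V y - V y\<bar>)" by (rule ennreal_leI)
      also have "\<dots> = ennreal (V y) + ennreal \<bar>moll ?\<theta> V y - V y\<bar>"
        using V(2)[of y] by (intro ennreal_plus) auto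
      finally show "ennreal (moll ?\<theta> V y) * indicator region y \<le> ennreal (V y) * indicator region y + ennreal \<bar>moll ?\<theta> V y - V y\<bar>"
        by (auto split: split_indicator)
    qed
    also have "\<dots> = ?I + e k" unfolding e_def by (rule nn_integral_add) measurable
    finally have "(\<integral>\<^sup>+y\<in>region. ennreal (moll ?\<theta> V y) \<partial>lborel) \<le> ?I + e k" .
    then show "(\<integral>\<^sup>+t. ennreal ((remt ?\<theta> t)\<^sup>2) \<partial>lborel) \<le> R (e k)"
      unfolding R_def by (intro order_trans[OF nn_integral_remt_le] add_left_mono mult_left_mono) auto
  qed
  also have "\<dots> = R 0"
  proof (intro lim_imp_Liminf)
    show "(\<lambda>k. R (e k)) \<longlonglongrightarrow> R 0" unfolding R_def
      by (intro tendsto_add tendsto_const ennreal_tendsto_cmult e0) auto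
  qed simp
  finally show ?thesis by (simp add: R_def)
qed

lemma integrable_rho:
  "integrable (lebesgue_on {0..1}) (\<lambda>t. (rho t)\<^sup>2)"
  "(LINT t|lebesgue_on {0..1}. (rho t)\<^sup>2) \<le> \<delta> ^ 4 * A + \<delta> ^ 3 * (576 / norm (b - a)) * (LINT y|lborel. indicator region y * V y)"
proof -
  have \<delta>0: "0 \<le> \<delta>" using depth_le[of a] depth_nonneg[of a] by simp
  have [measurable]: "region \<in> sets borel" using compact_region by (rule borel_compact)
  have Vi: "integrable lborel (\<lambda>y. indicator region y * V y)"
    using integrable_mult_indicator[OF _ V(1), of region] by simp
  define J where "J = (LINT y|lborel. indicator region y * V y)"
  have J: "0 \<le> J" unfolding J_def using V(2) by (intro Bochner_Integration.integral_nonneg) auto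
  have "(\<integral>\<^sup>+y\<in>region. ennreal (V y) \<partial>lborel) = (\<integral>\<^sup>+y. ennreal (indicator region y * V y) \<partial>lborel)"
    by (intro nn_integral_cong) (auto split: split_indicator)
  also have "\<dots> = ennreal J" unfolding J_def using V(2) by (intro nn_integral_eq_integral Vi) auto
  finally have IV: "(\<integral>\<^sup>+y\<in>region. ennreal (V y) \<partial>lborel) = ennreal J" .
  define Q where "Q = \<delta> ^ 4 * A + \<delta> ^ 3 * (576 / norm (b - a)) * J"
  have Q0: "0 \<le> Q" unfolding Q_def using \<delta>0 A J by simp
  have "ennreal (\<delta> ^ 4 * A) + ennreal (\<delta> ^ 3) * (ennreal (576 / norm (b - a)) * ennreal J) = ennreal Q"
    unfolding Q_def using \<delta>0 A J
    by (subst ennreal_mult[symmetric], simp, simp, subst ennreal_mult[symmetric], simp, simp,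
        subst ennreal_plus[symmetric]) (auto simp: mult.assoc)
  then have le: "(\<integral>\<^sup>+t. ennreal ((rho t)\<^sup>2) \<partial>lebesgue_on {0..1}) \<le> ennreal Q"
    using nn_integral_rho_le unfolding IV by simp
  have m: "(\<lambda>t. (rho t)\<^sup>2) \<in> borel_measurable (lebesgue_on {0..1})" using rho_measurable by measurable
  show int: "integrable (lebesgue_on {0..1}) (\<lambda>t. (rho t)\<^sup>2)"
    using m le by (intro integrableI_bounded) (auto simp: le_less_trans[OF le])
  have "ennreal (LINT t|lebesgue_on {0..1}. (rho t)\<^sup>2) \<le> ennreal Q"
    using le nn_integral_eq_integral[OF int] by simp
  then show "(LINT t|lebesgue_on {0..1}. (rho t)\<^sup>2) \<le> \<delta> ^ 4 * A + \<delta> ^ 3 * (576 / norm (b - a)) * (LINT y|lborel. indicator region y * V y)"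
    using Q0 by (simp add: Q_def J_def)
qed

end

section \<open>Summation over the edges\<close>

lemma diameter_closed_segment: "diameter (closed_segment a b) = norm (b - a)" for a b :: "real^2"
proof (rule antisym)
  show "diameter (closed_segment a b) \<le> norm (b - a)"
  proof (rule diameter_le)
    fix x y assume "x \<in> closed_segment a b" "y \<in> closed_segment a b"
    then obtain s t where st: "x = (1 - s) *\<^sub>R a + s *\<^sub>R b" "y = (1 - t) *\<^sub>R a + t *\<^sub>R b" "0 \<le> s" "s \<le> 1" "0 \<le> t" "t \<le> 1"
      by (auto simp: in_segment)
    have "x - y = (s - t) *\<^sub>R (b - a)" unfolding st(1,2) by (simp add: algebra_simps)
    moreover have "\<bar>s - t\<bar> \<le> 1" using st by linarith
    ultimately show "norm (x - y) \<le> norm (b - a)" by (simp add: mult_left_le_one_le)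
  qed simp
  show "norm (b - a) \<le> diameter (closed_segment a b)"
    using diameter_bounded_bound[OF compact_imp_bounded[OF compact_segment[of a b]], of b a] by (simp add: dist_norm)
qed

lemma edge_path_linepath:
  fixes E :: "(real^2) set"
  assumes E: "E edge_of T" and T: "2 simplex T"
  obtains a b where "edge_path E = linepath a b" "E = closed_segment a b" "a \<noteq> b"
proof -
  obtain a b c where "E = closed_segment a b" using edge_of_two_simplex[OF T E] by blast
  then have "\<exists>c a b. c = linepath a b \<and> E = closed_segment a b" by blast
  from someI_ex[OF this] obtain a b where ab: "edge_path E = linepath a b" "E = closed_segment a b"
    unfolding edge_path_def by blast
  have "a \<noteq> b" using E ab(2) by (auto simp: edge_of_def)
  then show ?thesis using ab that by blast
qed

lemma edge_length_ge:
  assumes T: "2 simplex T" and E: "E edge_of T" "E = closed_segment a b"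
    and \<kappa>: "0 < \<kappa>" and reg: "diameter T \<le> \<kappa> * inradius T"
  shows "diameter T \<le> \<kappa> * norm (b - a)"
proof -
  obtain a' b' c' where abc: "a' \<noteq> b'" "E = closed_segment a' b'" "T = convex hull {a', b', c'}"
    using edge_of_two_simplex[OF T E(1)] by blast
  obtain x r where xr: "cball x r \<subseteq> T" "diameter T / (2 * \<kappa>) < r"
    using shape_regular_inball[OF T \<kappa> reg] by blast
  have "0 < diameter T / (2 * \<kappa>)" using diameter_two_simplex_pos[OF T] \<kappa> by simp
  then have r: "0 < r" using xr(2) by linarith
  have "2 * r \<le> norm (b' - a')" by (rule inball_le_edge_length[OF abc(1) r]) (use xr abc in simp)
  also have "norm (b' - a') = norm (b - a)" using abc(2) E(2) diameter_closed_segment by metis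
  finally have "2 * r * \<kappa> \<le> norm (b - a) * \<kappa>" using \<kappa> by (intro mult_right_mono) auto
  moreover have "diameter T \<le> 2 * r * \<kappa>" using xr(2) \<kappa> by (simp add: field_simps)
  ultimately show ?thesis by (simp add: mult.commute)
qed

locale mesh_estimate =
  fixes \<Omega> D W N :: "(real^2) set" and \<T> :: "(real^2) set set" and M :: "real^2 \<Rightarrow> real^2"
    and \<gamma> \<nu> :: "real \<Rightarrow> real^2" and \<kappa> c\<^sub>d \<zeta> K L h :: real
    and u u0 g :: "real^2 \<Rightarrow> real" and G G0 :: "real^2 \<Rightarrow> real^2"
    and H :: "real^2 \<Rightarrow> real^2^2" and A :: real and V :: "real^2 \<Rightarrow> real"
  assumes adm: "admissible_triangulation D \<T>" and \<kappa>: "0 < \<kappa>"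
    and reg: "\<And>T. T \<in> \<T> \<Longrightarrow> diameter T \<le> \<kappa> * inradius T"
    and cd: "0 < c\<^sub>d" and \<zeta>: "0 < \<zeta>"
    and distance: "\<And>T x. T \<in> interior_mesh \<Omega> \<T> \<Longrightarrow> x \<in> T \<inter> surrogate_boundary \<Omega> \<T> \<Longrightarrow>
         norm (M x - x) \<le> c\<^sub>d * diameter T powr (1 + \<zeta>)"
    and K: "0 < K" and \<nu>1: "\<And>t. t \<in> {0..1} \<Longrightarrow> norm (\<nu> t) = 1"
    and \<nu>lip: "\<And>t t'. t \<in> {0..1} \<Longrightarrow> t' \<in> {0..1} \<Longrightarrow> norm (\<nu> t - \<nu> t') \<le> K * norm (\<gamma> t' - \<gamma> t)"
    and \<nu>quad: "\<And>t t'. t \<in> {0..1} \<Longrightarrow> t' \<in> {0..1} \<Longrightarrow> \<bar>\<nu> t \<bullet> (\<gamma> t' - \<gamma> t)\<bar> \<le> K * (norm (\<gamma> t' - \<gamma> t))\<^sup>2"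
    and L: "0 \<le> L" and \<gamma>lip: "\<And>s t. s \<in> {0..1} \<Longrightarrow> t \<in> {0..1} \<Longrightarrow> norm (\<gamma> s - \<gamma> t) \<le> L * \<bar>s - t\<bar>"
    and frontier: "path_image \<gamma> \<subseteq> frontier \<Omega>"
    and closest: "\<And>T E. (T, E) \<in> surrogate_edges \<Omega> (path_image \<gamma>) \<T> M \<Longrightarrow> closest_point_map_on E (frontier \<Omega>) M"
    and foot: "\<And>T E x. (T, E) \<in> surrogate_edges \<Omega> (path_image \<gamma>) \<T> M \<Longrightarrow> x \<in> E \<Longrightarrow>
         \<exists>t\<in>{0..1}. \<gamma> t = M x \<and> M x - x = norm (M x - x) *\<^sub>R \<nu> t"
    and h: "h = boundary_meshsize \<Omega> \<T>"
    and small: "h \<le> 1" "c\<^sub>d * h powr \<zeta> \<le> 1" "32 * \<kappa> * (c\<^sub>d * h powr \<zeta>) \<le> 1" "144 * K * \<kappa> * h \<le> 1" "8 * K * h \<le> 1"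
    and near: "\<And>x t. t \<in> {0..1} \<Longrightarrow> dist x (\<gamma> t) < 2 * h \<Longrightarrow> x \<in> \<Omega> \<Longrightarrow> x \<in> W"
    and \<Omega>: "open \<Omega>" and W: "open W" "W \<subseteq> \<Omega>"
    and u: "integrable lborel u" and G: "\<And>i. integrable lborel (\<lambda>y. G y $ i)"
    and H: "\<And>i j. integrable lborel (\<lambda>y. H y $ i $ j)"
    and weak1: "\<And>\<phi> i. test_function W \<phi> \<Longrightarrow>
      (LINT y|lborel. u y * partial_deriv i \<phi> y) = - (LINT y|lborel. G y $ i * \<phi> y)"
    and weak2: "\<And>\<phi> i j. test_function W \<phi> \<Longrightarrow>
      (LINT y|lborel. G y $ j * partial_deriv i \<phi> y) = - (LINT y|lborel. H y $ j $ i * \<phi> y)"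
    and H2: "integrable lborel (\<lambda>y. (norm (H y))\<^sup>2)"
    and A: "0 \<le> A" and V: "integrable lborel V" "\<And>y. 0 \<le> V y"
    and HAV: "\<And>y. (norm (H y))\<^sup>2 \<le> A + V y"
    and u0: "u0 \<in> borel_measurable (lebesgue_on W)" "AE y in lebesgue. y \<in> W \<longrightarrow> u0 y = u y"
    and G0: "G0 \<in> borel_measurable (lebesgue_on W)" "AE y in lebesgue. y \<in> W \<longrightarrow> G0 y = G y"
    and N: "arc_length_null N"
    and trace: "\<And>y. y \<in> frontier \<Omega> - N \<Longrightarrow> has_trace_at \<Omega> u0 y (g y)"
begin

abbreviation "edges \<equiv> surrogate_edges \<Omega> (path_image \<gamma>) \<T> M"
abbreviation "R \<equiv> taylor_remainder \<Omega> g u0 G0 M"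

definition strip :: "(real^2) set \<Rightarrow> (real^2) set" where
  "strip E = (\<Union>x\<in>E. closed_segment x (M x))"

lemma edgeD:
  assumes "(T, E) \<in> edges"
  shows "T \<in> \<T>" "T \<subseteq> closure \<Omega>" "2 simplex T" "E edge_of T" "E \<subseteq> T" "M ` E \<subseteq> path_image \<gamma>"
    "0 < diameter T" "diameter T \<le> h"
    "\<And>x. x \<in> E \<Longrightarrow> norm (M x - x) \<le> c\<^sub>d * diameter T powr (1 + \<zeta>)"
proof -
  show T: "T \<in> \<T>" "T \<subseteq> closure \<Omega>" "E edge_of T" "M ` E \<subseteq> path_image \<gamma>"
    using assms by (auto simp: surrogate_edges_def interior_mesh_def)
  show s: "2 simplex T" using adm T(1) by (simp add: admissible_triangulation_def)
  show ET: "E \<subseteq> T" using T edge_of_imp_subset by blast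
  show "0 < diameter T" by (rule diameter_two_simplex_pos[OF s])
  show "diameter T \<le> h" unfolding h by (rule surrogate_edges_diameter_le[OF adm assms])
  show "norm (M x - x) \<le> c\<^sub>d * diameter T powr (1 + \<zeta>)" if "x \<in> E" for x
    using that ET assms by (intro distance) (auto simp: surrogate_edges_def)
qed

lemma depth_bound:
  assumes "(T, E) \<in> edges"
  shows "c\<^sub>d * diameter T powr (1 + \<zeta>) \<le> (c\<^sub>d * h powr \<zeta>) * diameter T" "c\<^sub>d * diameter T powr (1 + \<zeta>) \<le> diameter T"
proof -
  note D = edgeD[OF assms]
  have "diameter T powr (1 + \<zeta>) = diameter T * diameter T powr \<zeta>" using D(7) by (simp add: powr_add)
  also have "\<dots> \<le> diameter T * h powr \<zeta>" using D(7,8) \<zeta> by (intro mult_left_mono powr_mono2) auto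
  finally show 1: "c\<^sub>d * diameter T powr (1 + \<zeta>) \<le> (c\<^sub>d * h powr \<zeta>) * diameter T"
    using cd by (simp add: mult_ac mult_left_mono)
  also have "\<dots> \<le> 1 * diameter T" using small(2) D(7) by (intro mult_right_mono) auto
  finally show "c\<^sub>d * diameter T powr (1 + \<zeta>) \<le> diameter T" by simp
qed

lemma ball_subset:
  assumes TE: "(T, E) \<in> edges" and x: "x \<in> E" and Mx: "M x \<noteq> x"
  shows "ball x (norm (M x - x)) \<subseteq> W"
proof -
  note D = edgeD[OF TE]
  let ?B = "ball x (norm (M x - x))"
  have near': "dist x (M x) \<le> dist x y" if "y \<in> frontier \<Omega>" for y
    using closest[OF TE] x that by (auto simp: closest_point_map_on_def)
  have disj: "?B \<inter> frontier \<Omega> = {}"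
  proof -
    have "y \<notin> frontier \<Omega>" if "y \<in> ?B" for y
    proof
      assume "y \<in> frontier \<Omega>"
      from near'[OF this] that show False by (simp add: dist_norm norm_minus_commute)
    qed
    then show ?thesis by blast
  qed
  have xB: "x \<in> ?B" using Mx by simp
  have "x \<in> closure \<Omega>" using D x by blast
  have x\<Omega>: "x \<in> \<Omega>"
  proof (rule ccontr)
    assume "x \<notin> \<Omega>"
    then have "x \<in> frontier \<Omega>" using \<open>x \<in> closure \<Omega>\<close> \<Omega> by (simp add: frontier_def interior_open)
    then show False using disj xB by blast
  qed
  have B\<Omega>: "?B \<subseteq> \<Omega>"
  proof (rule ccontr)
    assume "\<not> ?B \<subseteq> \<Omega>"
    then have "?B - \<Omega> \<noteq> {}" by blast
    moreover have "?B \<inter> \<Omega> \<noteq> {}" using xB x\<Omega> by blast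
    ultimately show False using connected_Int_frontier[OF connected_ball, of x "norm (M x - x)" \<Omega>] disj by blast
  qed
  obtain t where t: "t \<in> {0..1}" "\<gamma> t = M x" using foot[OF TE x] by blast
  show ?thesis
  proof
    fix y assume y: "y \<in> ?B"
    have "dist y (\<gamma> t) \<le> dist x y + dist x (M x)" unfolding t(2) by (rule dist_triangle3)
    also have "\<dots> < 2 * norm (M x - x)" using y by (simp add: dist_norm norm_minus_commute)
    also have "\<dots> \<le> 2 * h" using D(9)[OF x] depth_bound(2)[OF TE] D(8) by linarith
    finally show "y \<in> W" using y B\<Omega> t(1) by (intro near) auto
  qed
qed

lemma edge_estimate_holds:
  assumes TE: "(T, E) \<in> edges" and ab: "E = closed_segment a b" "a \<noteq> b"
  obtains n where "edge_estimate a b M n K (c\<^sub>d * diameter T powr (1 + \<zeta>)) \<Omega> W N u u0 g G G0 H A V"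
proof -
  note D = edgeD[OF TE]
  define \<delta> where "\<delta> = c\<^sub>d * diameter T powr (1 + \<zeta>)"
  have \<delta>1: "\<delta> \<le> (c\<^sub>d * h powr \<zeta>) * diameter T" "\<delta> \<le> diameter T" using depth_bound[OF TE] by (simp_all add: \<delta>_def)
  have \<delta>0: "0 \<le> \<delta>" using cd by (simp add: \<delta>_def)
  have "\<forall>x\<in>E. \<exists>t. t \<in> {0..1} \<and> \<gamma> t = M x \<and> M x - x = norm (M x - x) *\<^sub>R \<nu> t"
    using foot[OF TE] by blast
  then obtain \<tau> where \<tau>: "\<And>x. x \<in> E \<Longrightarrow> \<tau> x \<in> {0..1} \<and> \<gamma> (\<tau> x) = M x \<and> M x - x = norm (M x - x) *\<^sub>R \<nu> (\<tau> x)"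
    by metis
  have len: "diameter T \<le> \<kappa> * norm (b - a)"
    by (rule edge_length_ge[OF D(3,4) ab(1) \<kappa> reg[OF D(1)]])
  have lenT: "norm (b - a) \<le> diameter T"
  proof -
    have "a \<in> T" "b \<in> T" using D(5) ab by auto
    then show ?thesis
      using diameter_bounded_bound[of T b a] two_simplex_compact_convex(1)[OF D(3)] by (simp add: dist_norm compact_imp_bounded)
  qed
  have "edge_estimate a b M (\<lambda>x. \<nu> (\<tau> x)) K \<delta> \<Omega> W N u u0 g G G0 H A V"
  proof (intro edge_estimate.intro edge_geometry.intro edge_estimate_axioms.intro)
    show "a \<noteq> b" "0 \<le> K" using ab K by auto
    show "norm (\<nu> (\<tau> x)) = 1" if "x \<in> closed_segment a b" for x using \<tau>[of x] \<nu>1 that ab by auto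
    show "M x - x = norm (M x - x) *\<^sub>R \<nu> (\<tau> x)" if "x \<in> closed_segment a b" for x using \<tau>[of x] that ab by auto
    show "norm (\<nu> (\<tau> x) - \<nu> (\<tau> x')) \<le> K * norm (M x' - M x)" if "x \<in> closed_segment a b" "x' \<in> closed_segment a b" for x x'
      using \<nu>lip[of "\<tau> x" "\<tau> x'"] \<tau>[of x] \<tau>[of x'] that ab by auto
    show "\<bar>\<nu> (\<tau> x) \<bullet> (M x' - M x)\<bar> \<le> K * (norm (M x' - M x))\<^sup>2" if "x \<in> closed_segment a b" "x' \<in> closed_segment a b" for x x'
      using \<nu>quad[of "\<tau> x" "\<tau> x'"] \<tau>[of x] \<tau>[of x'] that ab by auto
    show "norm (M x - x) \<le> \<delta>" if "x \<in> closed_segment a b" for x using D(9)[of x] that ab by (simp add: \<delta>_def)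
    have "K * \<delta> \<le> K * h" using \<delta>1 D(8) K by (intro mult_left_mono) auto
    then show "K * \<delta> \<le> 1 / 8" using small(5) by simp
    show "2 * (2 * \<delta> + K * (norm (b - a) + 2 * \<delta>)\<^sup>2) \<le> norm (b - a) / 4"
    proof -
      have "\<delta> \<le> (c\<^sub>d * h powr \<zeta>) * (\<kappa> * norm (b - a))"
        by (rule order_trans[OF \<delta>1(1)]) (use len cd in \<open>auto intro!: mult_left_mono\<close>)
      also have "\<dots> = (32 * \<kappa> * (c\<^sub>d * h powr \<zeta>)) * (norm (b - a) / 32)" by simp
      also have "\<dots> \<le> 1 * (norm (b - a) / 32)" using small(3) by (intro mult_right_mono) auto
      finally have 1: "\<delta> \<le> norm (b - a) / 32" by simp
      have "(norm (b - a) + 2 * \<delta>)\<^sup>2 \<le> (3 * diameter T)\<^sup>2"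
        using lenT \<delta>1(2) \<delta>0 by (intro power_mono) auto
      also have "\<dots> = 9 * (diameter T * diameter T)" by (simp add: power2_eq_square)
      also have "\<dots> \<le> 9 * (h * (\<kappa> * norm (b - a)))"
        using D(7,8) len by (intro mult_left_mono mult_mono) auto
      finally have "K * (norm (b - a) + 2 * \<delta>)\<^sup>2 \<le> K * (9 * (h * (\<kappa> * norm (b - a))))"
        using K by (intro mult_left_mono) auto
      also have "\<dots> = (144 * K * \<kappa> * h) * (norm (b - a) / 16)" by simp
      also have "\<dots> \<le> 1 * (norm (b - a) / 16)" using small(4) by (intro mult_right_mono) auto
      finally show ?thesis using 1 by simp
    qed
    show "closed_segment a b \<subseteq> closure \<Omega>" using D ab by blast
    show "ball x (norm (M x - x)) \<subseteq> W" if "x \<in> closed_segment a b" "M x \<noteq> x" for x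
      using ball_subset[OF TE] that ab by blast
    show "has_trace_at \<Omega> u0 (M x) (g (M x))" if "x \<in> closed_segment a b" "M x \<notin> N" for x
      using trace[of "M x"] that D(6) ab frontier by blast
  qed (fact \<Omega> W u G H weak1 weak2 H2 A V HAV u0 G0 N)+
  then show ?thesis using that by (simp add: \<delta>_def)
qed

lemma single_edge:
  assumes TE: "(T, E) \<in> edges"
  shows "square_integrable_edge E R"
    "compact (strip E)"
    "edge_integral E (\<lambda>x. (diameter T powr (-1/2) * R x)\<^sup>2)
      \<le> c\<^sub>d ^ 4 * A * h powr (2 + 4 * \<zeta>) * (diameter T)\<^sup>2
        + 576 * c\<^sub>d ^ 3 * h powr (3 * \<zeta>) * ((diameter T)\<^sup>2 * (LINT y|lborel. indicator (strip E) y * V y))"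
proof -
  note D = edgeD[OF TE]
  obtain a b where ab: "edge_path E = linepath a b" "E = closed_segment a b" "a \<noteq> b"
    using edge_path_linepath[OF D(4,3)] .
  define \<delta> where "\<delta> = c\<^sub>d * diameter T powr (1 + \<zeta>)"
  obtain n where "edge_estimate a b M n K \<delta> \<Omega> W N u u0 g G G0 H A V"
    using edge_estimate_holds[OF TE ab(2,3)] unfolding \<delta>_def .
  then interpret ee: edge_estimate a b M n K \<delta> \<Omega> W N u u0 g G G0 H A V .
  have X: "linepath a b t = ee.X t" for t by (simp add: linepath_def ee.X_def algebra_simps)
  have Rt: "R (edge_path E t) = ee.rho t" for t by (simp add: ab(1) X ee.rho_def)
  have reg: "ee.region = strip E" by (simp add: ee.region_def strip_def ab(2))
  show "compact (strip E)" using ee.compact_region by (simp add: reg)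
  show "square_integrable_edge E R"
    unfolding square_integrable_edge_def in_Lp_def Rt
    using ee.rho_measurable ee.integrable_rho(1) by simp
  define d where "d = diameter T"
  define J where "J = (LINT y|lborel. indicator (strip E) y * V y)"
  have d: "0 < d" "d \<le> h" using D by (auto simp: d_def)
  have J: "0 \<le> J" unfolding J_def using V(2) by (intro Bochner_Integration.integral_nonneg) auto
  define len where "len = norm (b - a)"
  have len: "0 < len" "len \<le> d"
  proof -
    show "0 < len" using ab by (simp add: len_def)
    have "a \<in> T" "b \<in> T" using D(5) ab by auto
    then show "len \<le> d"
      using diameter_bounded_bound[of T b a] two_simplex_compact_convex(1)[OF D(3)]
      by (simp add: dist_norm compact_imp_bounded len_def d_def)
  qed
  have p2: "(d powr (-1/2))\<^sup>2 = 1 / d" using d by (simp add: powr_powr[symmetric] powr_minus_divide power2_eq_square powr_add[symmetric])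
  have dE: "diameter E = len" by (simp add: ab(2) diameter_closed_segment len_def)
  have \<delta>: "\<delta> = c\<^sub>d * d powr (1 + \<zeta>)" by (simp add: \<delta>_def d_def)
  have "edge_integral E (\<lambda>x. (d powr (-1/2) * R x)\<^sup>2) = len * (LINT t|lebesgue_on {0..1}. (1 / d) * (ee.rho t)\<^sup>2)"
    unfolding edge_integral_def Rt power_mult_distrib p2 dE ..
  also have "\<dots> = len / d * (LINT t|lebesgue_on {0..1}. (ee.rho t)\<^sup>2)" by simp
  also have "\<dots> \<le> len / d * (\<delta> ^ 4 * A + \<delta> ^ 3 * (576 / len) * J)"
    using ee.integrable_rho(2) len d unfolding reg J_def len_def by (intro mult_left_mono) auto
  also have "\<dots> = len / d * (\<delta> ^ 4 * A) + 576 * \<delta> ^ 3 / d * J" using len by (simp add: field_simps)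
  also have "\<dots> \<le> 1 * (\<delta> ^ 4 * A) + 576 * \<delta> ^ 3 / d * J"
    using len d A by (intro add_right_mono mult_right_mono) auto
  also have "\<delta> ^ 4 = c\<^sub>d ^ 4 * (d\<^sup>2 * d powr (2 + 4 * \<zeta>))"
  proof -
    have "(d powr (1 + \<zeta>)) ^ 4 = d powr (4 + 4 * \<zeta>)"
      using d by (simp add: powr_realpow[symmetric] powr_powr algebra_simps)
    also have "\<dots> = d powr 2 * d powr (2 + 4 * \<zeta>)" by (simp add: powr_add[symmetric])
    finally show ?thesis using d by (simp add: \<delta> power_mult_distrib powr_numeral)
  qed
  also have "576 * \<delta> ^ 3 / d * J = 576 * c\<^sub>d ^ 3 * (d\<^sup>2 * d powr (3 * \<zeta>)) * J"
  proof -
    have "(d powr (1 + \<zeta>)) ^ 3 = d powr (3 + 3 * \<zeta>)"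
      using d by (simp add: powr_realpow[symmetric] powr_powr algebra_simps)
    also have "\<dots> = d powr 1 * d powr 2 * d powr (3 * \<zeta>)" by (simp only: powr_add[symmetric]) simp
    finally show ?thesis using d by (simp add: \<delta> power_mult_distrib powr_numeral)
  qed
  also have "1 * (c\<^sub>d ^ 4 * (d\<^sup>2 * d powr (2 + 4 * \<zeta>)) * A) + 576 * c\<^sub>d ^ 3 * (d\<^sup>2 * d powr (3 * \<zeta>)) * J
     \<le> c\<^sub>d ^ 4 * (d\<^sup>2 * h powr (2 + 4 * \<zeta>)) * A + 576 * c\<^sub>d ^ 3 * (d\<^sup>2 * h powr (3 * \<zeta>)) * J"
  proof -
    have "d powr (2 + 4 * \<zeta>) \<le> h powr (2 + 4 * \<zeta>)" "d powr (3 * \<zeta>) \<le> h powr (3 * \<zeta>)"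
      using d \<zeta> by (auto intro!: powr_mono2)
    then show ?thesis unfolding mult_1_left
      using cd A J by (intro add_mono mult_right_mono mult_left_mono) auto
  qed
  finally show "edge_integral E (\<lambda>x. (diameter T powr (-1/2) * R x)\<^sup>2)
      \<le> c\<^sub>d ^ 4 * A * h powr (2 + 4 * \<zeta>) * (diameter T)\<^sup>2
        + 576 * c\<^sub>d ^ 3 * h powr (3 * \<zeta>) * ((diameter T)\<^sup>2 * (LINT y|lborel. indicator (strip E) y * V y))"
    by (simp add: d_def J_def mult_ac)
qed

lemma sum_square_le:
  assumes F: "F \<subseteq> edges" and B: "B \<in> lmeasurable" "\<And>T E. (T, E) \<in> F \<Longrightarrow> T \<subseteq> B"
  shows "(\<Sum>(T, E)\<in>F. (diameter T)\<^sup>2) \<le> 32 * \<kappa>\<^sup>2 / pi * measure lebesgue B"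
proof (rule sum_diameter_square_le[OF _ _ \<kappa> reg _ B(1)])
  show "triangulation \<T>" using adm by (simp add: admissible_triangulation_def)
  show "2 simplex T" if "T \<in> \<T>" for T using adm that by (simp add: admissible_triangulation_def)
  show "T \<in> \<T> \<and> E edge_of T \<and> T \<subseteq> B" if "(T, E) \<in> F" for T E
    using edgeD[of T E] F B(2)[OF that] that by blast
qed

lemma triangle_near_strip:
  assumes TE: "(T, E) \<in> edges" and z: "z \<in> closed_segment x (M x)" and x: "x \<in> E"
  shows "T \<subseteq> cball z (2 * h)"
proof
  note D = edgeD[OF TE]
  fix y assume y: "y \<in> T"
  have "dist x y \<le> diameter T"
    using diameter_bounded_bound[of T x y] two_simplex_compact_convex(1)[OF D(3)] D(5) x y by (auto simp: compact_imp_bounded)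
  moreover have "dist z x \<le> norm (M x - x)"
    using segment_bound(1)[OF z] by (simp add: dist_norm)
  moreover have "norm (M x - x) \<le> diameter T" using D(9)[OF x] depth_bound(2)[OF TE] by linarith
  ultimately have "dist z y \<le> 2 * h" using dist_triangle[of z y x] D(8) by linarith
  then show "y \<in> cball z (2 * h)" by simp
qed

lemma weighted_norm_le:
  "(weighted_edge_norm edges R)\<^sup>2 \<le> (96 * \<kappa>\<^sup>2 * (L + 2)\<^sup>2 * c\<^sub>d ^ 4 + 73728 * \<kappa>\<^sup>2 * c\<^sub>d ^ 3)
     * (A * h powr (3 + 4 * \<zeta>) + h powr (2 + 3 * \<zeta>) * (LINT y|lborel. V y))"
proof (cases "edges = {}")
  case True
  have "0 \<le> (LINT y|lborel. V y)" using V(2) by (intro Bochner_Integration.integral_nonneg) auto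
  then have "0 \<le> (96 * \<kappa>\<^sup>2 * (L + 2)\<^sup>2 * c\<^sub>d ^ 4 + 73728 * \<kappa>\<^sup>2 * c\<^sub>d ^ 3)
     * (A * h powr (3 + 4 * \<zeta>) + h powr (2 + 3 * \<zeta>) * (LINT y|lborel. V y))"
    using A cd by (intro mult_nonneg_nonneg add_nonneg_nonneg) auto
  then show ?thesis by (simp add: True weighted_edge_norm_def)
next
  case False
  have fin: "finite edges" by (rule finite_surrogate_edges[OF adm])
  obtain T0 E0 where TE0: "(T0, E0) \<in> edges" using False by auto
  have hp: "0 < h" using edgeD(7,8)[OF TE0] by linarith
  define I where "I = (LINT y|lborel. V y)"
  have I: "0 \<le> I" unfolding I_def using V(2) by (intro Bochner_Integration.integral_nonneg) auto
  obtain B where B: "B \<in> lmeasurable" "\<And>t. t \<in> {0..1} \<Longrightarrow> cball (\<gamma> t) (2 * h) \<subseteq> B" "measure lebesgue B \<le> 3 * pi * (L + 2)\<^sup>2 * h"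
    using tube_measure_le[OF L \<gamma>lip hp small(1)] by blast
  have TB: "T \<subseteq> B" if TE: "(T, E) \<in> edges" for T E
  proof -
    have "E \<noteq> {}" using edgeD(4)[OF TE] by (auto simp: edge_of_def)
    then obtain x where x: "x \<in> E" by blast
    obtain t where "t \<in> {0..1}" "\<gamma> t = M x" using foot[OF TE x] by blast
    then show ?thesis using triangle_near_strip[OF TE _ x, of "M x"] B(2)[of t] by auto
  qed
  have S1: "(\<Sum>(T, E)\<in>edges. (diameter T)\<^sup>2) \<le> 96 * \<kappa>\<^sup>2 * (L + 2)\<^sup>2 * h"
  proof -
    have "(\<Sum>(T, E)\<in>edges. (diameter T)\<^sup>2) \<le> 32 * \<kappa>\<^sup>2 / pi * measure lebesgue B"
      by (rule sum_square_le[OF order_refl B(1) TB])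
    also have "\<dots> \<le> 32 * \<kappa>\<^sup>2 / pi * (3 * pi * (L + 2)\<^sup>2 * h)" by (intro mult_left_mono B) simp
    also have "\<dots> = 96 * \<kappa>\<^sup>2 * (L + 2)\<^sup>2 * h" by simp
    finally show ?thesis .
  qed
  have Vi: "integrable lborel (\<lambda>y. (diameter T)\<^sup>2 * (indicator (strip E) y * V y))" if "(T, E) \<in> edges" for T E
    using integrable_mult_indicator[OF _ V(1), of "strip E"] borel_compact[OF single_edge(2)[OF that]] by simp
  have S2: "(\<Sum>(T, E)\<in>edges. (diameter T)\<^sup>2 * (LINT y|lborel. indicator (strip E) y * V y)) \<le> 128 * \<kappa>\<^sup>2 * h\<^sup>2 * I"
  proof -
    have "(\<Sum>(T, E)\<in>edges. (diameter T)\<^sup>2 * (LINT y|lborel. indicator (strip E) y * V y))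
       = (LINT y|lborel. (\<Sum>(T, E)\<in>edges. (diameter T)\<^sup>2 * (indicator (strip E) y * V y)))"
      using Vi by (subst Bochner_Integration.integral_sum) (auto simp: case_prod_beta intro!: sum.cong)
    also have "\<dots> \<le> (LINT y|lborel. 128 * \<kappa>\<^sup>2 * h\<^sup>2 * V y)"
    proof (rule integral_mono)
      show "integrable lborel (\<lambda>y. \<Sum>(T, E)\<in>edges. (diameter T)\<^sup>2 * (indicator (strip E) y * V y))"
        using Vi by (intro Bochner_Integration.integrable_sum) (auto simp: case_prod_beta)
      show "integrable lborel (\<lambda>y. 128 * \<kappa>\<^sup>2 * h\<^sup>2 * V y)" using V(1) by simp
      fix z
      let ?F = "{(T, E) \<in> edges. z \<in> strip E}"
      have "(\<Sum>(T, E)\<in>edges. (diameter T)\<^sup>2 * (indicator (strip E) z * V z)) = (\<Sum>(T, E)\<in>?F. (diameter T)\<^sup>2 * V z)"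
        using fin by (intro sum.mono_neutral_cong_right) (auto simp: indicator_def split: if_splits)
      also have "\<dots> = (\<Sum>(T, E)\<in>?F. (diameter T)\<^sup>2) * V z"
        by (simp add: sum_distrib_right case_prod_beta)
      also have "\<dots> \<le> (32 * \<kappa>\<^sup>2 / pi * measure lebesgue (cball z (2 * h))) * V z"
      proof (intro mult_right_mono V sum_square_le)
        fix T E assume "(T, E) \<in> ?F"
        then have TE: "(T, E) \<in> edges" and "z \<in> strip E" by auto
        then obtain x where "x \<in> E" "z \<in> closed_segment x (M x)" by (auto simp: strip_def)
        then show "T \<subseteq> cball z (2 * h)" by (intro triangle_near_strip[OF TE])
      qed auto
      also have "measure lebesgue (cball z (2 * h)) = pi * (2 * h)\<^sup>2" using hp by (intro measure_cball_2) simp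
      also have "32 * \<kappa>\<^sup>2 / pi * (pi * (2 * h)\<^sup>2) * V z = 128 * \<kappa>\<^sup>2 * h\<^sup>2 * V z" by (simp add: power_mult_distrib)
      finally show "(\<Sum>(T, E)\<in>edges. (diameter T)\<^sup>2 * (indicator (strip E) z * V z)) \<le> 128 * \<kappa>\<^sup>2 * h\<^sup>2 * V z" .
    qed
    also have "\<dots> = 128 * \<kappa>\<^sup>2 * h\<^sup>2 * I" by (simp add: I_def)
    finally show ?thesis .
  qed
  have nonneg: "0 \<le> (\<Sum>(T, E)\<in>edges. edge_integral E (\<lambda>x. (diameter T powr (-1/2) * R x)\<^sup>2))"
  proof (intro sum_nonneg, clarify)
    fix T E assume "(T, E) \<in> edges"
    then have "bounded E"
      using edgeD(5) two_simplex_compact_convex(1)[OF edgeD(3)] by (meson bounded_subset compact_imp_bounded)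
    then show "0 \<le> edge_integral E (\<lambda>x. (diameter T powr (-1/2) * R x)\<^sup>2)"
      unfolding edge_integral_def by (intro mult_nonneg_nonneg diameter_ge_0 Bochner_Integration.integral_nonneg) auto
  qed
  have "(weighted_edge_norm edges R)\<^sup>2 = (\<Sum>(T, E)\<in>edges. edge_integral E (\<lambda>x. (diameter T powr (-1/2) * R x)\<^sup>2))"
    unfolding weighted_edge_norm_def using nonneg by (rule real_sqrt_pow2)
  also have "\<dots> \<le> (\<Sum>(T, E)\<in>edges. c\<^sub>d ^ 4 * A * h powr (2 + 4 * \<zeta>) * (diameter T)\<^sup>2
        + 576 * c\<^sub>d ^ 3 * h powr (3 * \<zeta>) * ((diameter T)\<^sup>2 * (LINT y|lborel. indicator (strip E) y * V y)))"
  proof (rule sum_mono)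
    fix p assume p: "p \<in> edges"
    obtain T E where TE: "p = (T, E)" by (cases p)
    show "(case p of (T, E) \<Rightarrow> edge_integral E (\<lambda>x. (diameter T powr (-1/2) * R x)\<^sup>2))
      \<le> (case p of (T, E) \<Rightarrow> c\<^sub>d ^ 4 * A * h powr (2 + 4 * \<zeta>) * (diameter T)\<^sup>2
        + 576 * c\<^sub>d ^ 3 * h powr (3 * \<zeta>) * ((diameter T)\<^sup>2 * (LINT y|lborel. indicator (strip E) y * V y)))"
      using single_edge(3)[of T E] p unfolding TE prod.case by blast
  qed
  also have "\<dots> = c\<^sub>d ^ 4 * A * h powr (2 + 4 * \<zeta>) * (\<Sum>(T, E)\<in>edges. (diameter T)\<^sup>2)
        + 576 * c\<^sub>d ^ 3 * h powr (3 * \<zeta>) * (\<Sum>(T, E)\<in>edges. (diameter T)\<^sup>2 * (LINT y|lborel. indicator (strip E) y * V y))"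
    unfolding case_prod_beta sum.distrib sum_distrib_left[symmetric] ..
  also have "\<dots> \<le> c\<^sub>d ^ 4 * A * h powr (2 + 4 * \<zeta>) * (96 * \<kappa>\<^sup>2 * (L + 2)\<^sup>2 * h)
        + 576 * c\<^sub>d ^ 3 * h powr (3 * \<zeta>) * (128 * \<kappa>\<^sup>2 * h\<^sup>2 * I)"
    using cd A by (intro add_mono mult_left_mono S1 S2) auto
  also have "\<dots> = 96 * \<kappa>\<^sup>2 * (L + 2)\<^sup>2 * c\<^sub>d ^ 4 * (A * (h * h powr (2 + 4 * \<zeta>))) + 73728 * \<kappa>\<^sup>2 * c\<^sub>d ^ 3 * ((h\<^sup>2 * h powr (3 * \<zeta>)) * I)"
    by simp
  also have "h * h powr (2 + 4 * \<zeta>) = h powr (3 + 4 * \<zeta>)"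
    using hp powr_add[of h 1 "2 + 4 * \<zeta>"] by simp
  also have "h\<^sup>2 * h powr (3 * \<zeta>) = h powr (2 + 3 * \<zeta>)"
    using hp powr_add[of h 2 "3 * \<zeta>"] by (simp add: powr_numeral)
  also have "96 * \<kappa>\<^sup>2 * (L + 2)\<^sup>2 * c\<^sub>d ^ 4 * (A * h powr (3 + 4 * \<zeta>)) + 73728 * \<kappa>\<^sup>2 * c\<^sub>d ^ 3 * (h powr (2 + 3 * \<zeta>) * I)
    \<le> (96 * \<kappa>\<^sup>2 * (L + 2)\<^sup>2 * c\<^sub>d ^ 4 + 73728 * \<kappa>\<^sup>2 * c\<^sub>d ^ 3) * (A * h powr (3 + 4 * \<zeta>) + h powr (2 + 3 * \<zeta>) * I)"
  proof -
    have "a * x + c * y \<le> (a + c) * (x + y)" if "0 \<le> a" "0 \<le> c" "0 \<le> x" "0 \<le> y" for a c x y :: real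
      using that by (simp add: algebra_simps)
    then show ?thesis using cd A I by simp
  qed
  finally show ?thesis by (simp add: I_def)
qed

end

section \<open>Hessians in $L^p$\<close>

lemma lebesgue_ex_borel_measurable:
  fixes w :: "'a::euclidean_space \<Rightarrow> 'b::euclidean_space"
  assumes w: "w \<in> borel_measurable lebesgue"
  obtains w' where "w' \<in> borel_measurable borel" "AE x in lebesgue. w x = w' x"
proof -
  have "\<exists>f\<in>borel_measurable lborel. AE x in lborel. w x \<bullet> b = f x" for b
    by (rule completion_ex_borel_measurable_real) (use w in measurable)
  then obtain f where f: "\<And>b. f b \<in> borel_measurable lborel" "\<And>b. AE x in lborel. w x \<bullet> b = f b x"
    by metis
  define w' where "w' x = (\<Sum>b\<in>Basis. f b x *\<^sub>R b)" for x
  have "w' \<in> borel_measurable borel"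
    unfolding w'_def using f(1) by (intro borel_measurable_sum borel_measurable_scaleR) auto
  moreover have "AE x in lebesgue. \<forall>b\<in>Basis. w x \<bullet> b = f b x"
    by (rule AE_finite_allI) (auto intro: AE_completion f(2))
  then have "AE x in lebesgue. w x = w' x"
  proof eventually_elim
    case (elim x)
    have "w x = (\<Sum>b\<in>Basis. (w x \<bullet> b) *\<^sub>R b)" by (rule euclidean_representation[symmetric])
    also have "\<dots> = w' x" unfolding w'_def using elim by (intro sum.cong) auto
    finally show ?case .
  qed
  ultimately show ?thesis using that by blast
qed

lemma in_Lp_integrable:
  fixes w :: "'a \<Rightarrow> 'b::euclidean_space"
  assumes "finite_measure \<mu>" and p: "2 \<le> p" and w: "in_Lp \<mu> p w"
  shows "integrable \<mu> w" "integrable \<mu> (\<lambda>x. (norm (w x))\<^sup>2)"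
proof -
  interpret finite_measure \<mu> by fact
  have [measurable]: "w \<in> borel_measurable \<mu>" using w by (simp add: in_Lp_def)
  have "\<exists>f. integrable \<mu> f \<and> (AE x in \<mu>. (norm (w x))\<^sup>2 \<le> f x)"
  proof (cases "p = \<infinity>")
    case True
    then have "esssup \<mu> (\<lambda>x. ereal (norm (w x))) < \<infinity>" using w by (simp add: in_Lp_def)
    then obtain n :: nat where "esssup \<mu> (\<lambda>x. ereal (norm (w x))) < ereal (real n)"
      using less_PInf_Ex_of_nat by auto
    then obtain B where B: "esssup \<mu> (\<lambda>x. ereal (norm (w x))) \<le> ereal B" using less_imp_le by blast
    have "AE x in \<mu>. (norm (w x))\<^sup>2 \<le> B\<^sup>2"
      using esssup_AE[of "\<lambda>x. ereal (norm (w x))" \<mu>]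
    proof eventually_elim
      case (elim x)
      then have "norm (w x) \<le> B" using B order_trans ereal_less_eq(3) by blast
      then show ?case by (intro power_mono) auto
    qed
    then show ?thesis by (intro exI[of _ "\<lambda>_. B\<^sup>2"]) simp
  next
    case False
    then obtain P where P: "p = ereal P" "2 \<le> P" using p by (cases p) auto
    have "(norm (w x))\<^sup>2 \<le> 1 + norm (w x) powr P" for x
    proof (cases "norm (w x) \<le> 1")
      case True
      then have "(norm (w x))\<^sup>2 \<le> 1" by (simp add: power_le_one)
      then show ?thesis using powr_ge_zero[of "norm (w x)" P] by linarith
    next
      case False
      then have "norm (w x) powr 2 \<le> norm (w x) powr P" using P by (intro powr_mono) auto
      then show ?thesis using False by (simp add: powr_numeral)
    qed
    moreover have "integrable \<mu> (\<lambda>x. 1 + norm (w x) powr P)"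
      using w P by (intro Bochner_Integration.integrable_add) (auto simp: in_Lp_def)
    ultimately show ?thesis by (intro exI[of _ "\<lambda>x. 1 + norm (w x) powr P"]) simp
  qed
  then obtain f where f: "integrable \<mu> f" "AE x in \<mu>. (norm (w x))\<^sup>2 \<le> f x" by blast
  show "integrable \<mu> (\<lambda>x. (norm (w x))\<^sup>2)"
    using f(2) by (intro Bochner_Integration.integrable_bound[OF f(1)]) (auto elim!: eventually_mono)
  then have i: "integrable \<mu> (\<lambda>x. 1 + (norm (w x))\<^sup>2)" by (intro Bochner_Integration.integrable_add) auto
  have "norm y \<le> norm (1 + (norm y)\<^sup>2)" for y :: 'b
  proof -
    have "0 \<le> (norm y - 1)\<^sup>2 + (norm y)\<^sup>2 + 1" by (intro add_nonneg_nonneg) auto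
    then have "2 * norm y \<le> 2 * (1 + (norm y)\<^sup>2)" by (simp add: power2_eq_square algebra_simps)
    then show ?thesis by simp
  qed
  then show "integrable \<mu> w" by (intro Bochner_Integration.integrable_bound[OF i]) auto
qed

lemma Lp_norm_nonneg: "in_Lp \<mu> p w \<Longrightarrow> 0 \<le> Lp_norm \<mu> p w"
proof (cases "p = \<infinity>")
  case True
  assume w: "in_Lp \<mu> p w"
  have [measurable]: "w \<in> borel_measurable \<mu>" using w by (simp add: in_Lp_def)
  have m: "(\<lambda>x. ereal (norm (w x))) \<in> borel_measurable \<mu>" by measurable
  show ?thesis
  proof (cases "emeasure \<mu> (space \<mu>) = 0")
    case True
    then show ?thesis using m \<open>p = \<infinity>\<close> by (simp add: Lp_norm_def esssup_zero_space)
  next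
    case False
    have "esssup \<mu> (\<lambda>x. 0 :: ereal) \<le> esssup \<mu> (\<lambda>x. ereal (norm (w x)))" by (rule esssup_mono) auto
    then show ?thesis using \<open>p = \<infinity>\<close> False by (simp add: Lp_norm_def esssup_const real_of_ereal_pos)
  qed
qed (simp add: Lp_norm_def)

lemma partial_deriv_support:
  assumes "\<phi> x \<noteq> 0 \<or> partial_deriv i \<phi> x \<noteq> 0"
  shows "x \<in> closure {x. \<phi> x \<noteq> 0}"
proof (rule ccontr)
  assume x: "x \<notin> closure {x. \<phi> x \<noteq> 0}"
  have "(\<phi> has_derivative (\<lambda>_. 0)) (at x)"
  proof (rule has_derivative_transform_within_open[OF has_derivative_const])
    show "open (- closure {x. \<phi> x \<noteq> 0})" "x \<in> - closure {x. \<phi> x \<noteq> 0}" using x by auto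
    show "0 = \<phi> y" if "y \<in> - closure {x. \<phi> x \<noteq> 0}" for y
      using that closure_subset[of "{x. \<phi> x \<noteq> 0}"] by auto
  qed
  then have "partial_deriv i \<phi> x = 0" by (simp add: has_derivative_partial_deriv)
  moreover have "\<phi> x = 0" using x closure_subset[of "{x. \<phi> x \<noteq> 0}"] by auto
  ultimately show False using assms by simp
qed

lemma test_function_continuous:
  assumes "test_function S \<phi>"
  shows "continuous_on UNIV \<phi>" "continuous_on UNIV (partial_deriv i \<phi>)"
proof -
  have "Ck_fun 0 \<phi>" "Ck_fun (Suc 0) \<phi>" using assms by (auto simp only: test_function_def)
  then show "continuous_on UNIV \<phi>" "continuous_on UNIV (partial_deriv i \<phi>)" by auto
qed

lemma integral_lebesgue_on_representative:
  fixes w w' \<psi> :: "'a::euclidean_space \<Rightarrow> real"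
  assumes S: "S \<in> sets lebesgue" and W: "W \<subseteq> S" and w: "w \<in> borel_measurable (lebesgue_on S)"
    and w': "w' \<in> borel_measurable borel" "AE x in lebesgue. indicator W x *\<^sub>R w x = w' x"
    and \<psi>: "continuous_on UNIV \<psi>" "\<And>x. \<psi> x \<noteq> 0 \<Longrightarrow> x \<in> W"
  shows "(LINT x|lebesgue_on S. w x * \<psi> x) = (LINT x|lborel. w' x * \<psi> x)"
proof -
  have \<psi>m: "\<psi> \<in> borel_measurable borel" using \<psi>(1) by (rule borel_measurable_continuous_onI)
  have m: "(\<lambda>x. w' x * \<psi> x) \<in> borel_measurable lborel" using w'(1) \<psi>m by simp
  have "\<psi> \<in> borel_measurable (lebesgue_on S)"
    using \<psi>m by (intro measurable_restrict_space1) (auto intro: measurable_completion)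
  then have "(\<lambda>x. w x * \<psi> x) \<in> borel_measurable (lebesgue_on S)" using w by measurable
  then have mS: "(\<lambda>x. indicator S x *\<^sub>R (w x * \<psi> x)) \<in> borel_measurable lebesgue"
    using S by (subst (asm) borel_measurable_restrict_space_iff) auto
  have "(LINT x|lebesgue_on S. w x * \<psi> x) = (LINT x|lebesgue. indicator S x *\<^sub>R (w x * \<psi> x))"
    using S by (subst integral_restrict_space) auto
  also have "\<dots> = (LINT x|lebesgue. w' x * \<psi> x)"
  proof (rule integral_cong_AE[OF mS])
    show "(\<lambda>x. w' x * \<psi> x) \<in> borel_measurable lebesgue" using m by (intro measurable_completion) simp
    show "AE x in lebesgue. indicator S x *\<^sub>R (w x * \<psi> x) = w' x * \<psi> x"
      using w'(2)
    proof eventually_elim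
      case (elim x)
      show ?case
      proof (cases "x \<in> W")
        case True then show ?thesis using elim W by auto
      next
        case False then have "\<psi> x = 0" using \<psi>(2) by blast
        then show ?thesis by simp
      qed
    qed
  qed
  also have "\<dots> = (LINT x|lborel. w' x * \<psi> x)" by (rule integral_completion[OF m])
  finally show ?thesis .
qed

lemma in_Lp_representative:
  fixes w :: "'a::euclidean_space \<Rightarrow> 'b::euclidean_space"
  assumes S: "S \<in> lmeasurable" and W: "W \<in> sets lebesgue" "W \<subseteq> S" and p: "2 \<le> p"
    and w: "in_Lp (lebesgue_on S) p w"
  obtains w' where "w' \<in> borel_measurable borel" "AE x in lebesgue. indicator W x *\<^sub>R w x = w' x"
    "integrable lborel w'" "integrable lborel (\<lambda>x. (norm (w' x))\<^sup>2)"
proof -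
  have Sl: "S \<in> sets lebesgue" using S by (rule fmeasurableD)
  note int = in_Lp_integrable[OF finite_measure_lebesgue_on[OF S] p w]
  have iW: "integrable lebesgue (\<lambda>x. indicator W x *\<^sub>R f x)" if "integrable (lebesgue_on S) f" for f :: "'a \<Rightarrow> 'c::euclidean_space"
  proof -
    have "integrable lebesgue (\<lambda>x. indicator S x *\<^sub>R f x)" using that Sl by (subst (asm) integrable_restrict_space) auto
    from integrable_mult_indicator[OF W(1) this]
    show ?thesis by (rule back_subst[where P="integrable lebesgue"]) (use W(2) in \<open>auto simp: fun_eq_iff split: split_indicator\<close>)
  qed
  obtain w' where w': "w' \<in> borel_measurable borel" "AE x in lebesgue. indicator W x *\<^sub>R w x = w' x"
    using lebesgue_ex_borel_measurable[OF borel_measurable_integrable[OF iW[OF int(1)]]] by blast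
  have m: "w' \<in> borel_measurable lebesgue" using w'(1) by (intro measurable_completion) simp
  have "integrable lebesgue w'" using integrable_cong_AE_imp[OF iW[OF int(1)] m] w'(2) by (auto simp: eq_commute)
  then have "integrable lborel w'" using w'(1) by (simp add: integrable_completion)
  moreover have "integrable lebesgue (\<lambda>x. (norm (w' x))\<^sup>2)"
  proof (rule integrable_cong_AE_imp[OF iW[OF int(2)]])
    show "(\<lambda>x. (norm (w' x))\<^sup>2) \<in> borel_measurable lebesgue" using m by measurable
    show "AE x in lebesgue. indicator W x *\<^sub>R (norm (w x))\<^sup>2 = (norm (w' x))\<^sup>2"
      using w'(2) by eventually_elim (auto split: split_indicator)
  qed
  then have "integrable lborel (\<lambda>x. (norm (w' x))\<^sup>2)" using w'(1) by (simp add: integrable_completion)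
  ultimately show ?thesis using that w' by blast
qed

lemma borel_measurable_nth_component:
  fixes f :: "'a \<Rightarrow> 'b::euclidean_space ^ 'n"
  shows "f \<in> borel_measurable \<mu> \<Longrightarrow> (\<lambda>x. f x $ i) \<in> borel_measurable \<mu>"
  by (rule borel_measurable_continuous_on[where f="\<lambda>v. v $ i"]) (intro continuous_intros)

lemma weak_gradient_representative:
  assumes S: "S \<in> sets lebesgue" "W \<subseteq> S" and wg: "weak_gradient S w g"
    and w: "w \<in> borel_measurable (lebesgue_on S)" "w' \<in> borel_measurable borel"
      "AE x in lebesgue. indicator W x *\<^sub>R w x = w' x"
    and g: "g \<in> borel_measurable (lebesgue_on S)" "g' \<in> borel_measurable borel"
      "AE x in lebesgue. indicator W x *\<^sub>R g x = g' x"
    and \<phi>: "test_function W \<phi>"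
  shows "(LINT y|lborel. w' y * partial_deriv i \<phi> y) = - (LINT y|lborel. g' y $ i * \<phi> y)"
proof -
  have supp: "closure {x. \<phi> x \<noteq> 0} \<subseteq> W" using \<phi> by (simp add: test_function_def)
  have "test_function S \<phi>" using \<phi> S(2) by (auto simp: test_function_def)
  then have "(LINT x|lebesgue_on S. w x * partial_deriv i \<phi> x) = - (LINT x|lebesgue_on S. g x $ i * \<phi> x)"
    using wg by (simp add: weak_gradient_def)
  moreover have "(LINT x|lebesgue_on S. w x * partial_deriv i \<phi> x) = (LINT y|lborel. w' y * partial_deriv i \<phi> y)"
    using partial_deriv_support[of \<phi> _ i] supp
    by (intro integral_lebesgue_on_representative[OF S w test_function_continuous(2)[OF \<phi>]]) blast
  moreover have "(LINT x|lebesgue_on S. g x $ i * \<phi> x) = (LINT y|lborel. g' y $ i * \<phi> y)"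
  proof (rule integral_lebesgue_on_representative[OF S _ _ _ test_function_continuous(1)[OF \<phi>]])
    show "(\<lambda>x. g x $ i) \<in> borel_measurable (lebesgue_on S)" "(\<lambda>x. g' x $ i) \<in> borel_measurable borel"
      using g by (auto intro: borel_measurable_nth_component)
    show "AE x in lebesgue. indicator W x *\<^sub>R g x $ i = g' x $ i"
      using g(3) by eventually_elim (metis vector_scaleR_component)
    show "x \<in> W" if "\<phi> x \<noteq> 0" for x using supp that closure_subset[of "{x. \<phi> x \<noteq> 0}"] by blast
  qed
  ultimately show ?thesis by simp
qed

text \<open>
  For finite \<^term>\<open>p\<close> the splitting is Young's inequality with the weight that balances both
  contributions; it replaces Hoelder's inequality along the boundary strip.
\<close>

lemma Lp_splitting:
  fixes H H' :: "'a::euclidean_space \<Rightarrow> 'b::euclidean_space"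
  assumes S: "S \<in> sets lebesgue" "W \<in> sets lebesgue" "W \<subseteq> S" and p: "2 \<le> p" and H: "in_Lp (lebesgue_on S) p H"
    and H': "H' \<in> borel_measurable borel" "AE x in lebesgue. indicator W x *\<^sub>R H x = H' x"
    and H2: "integrable lborel (\<lambda>x. (norm (H' x))\<^sup>2)"
    and h: "0 < h" and B: "Lp_norm (lebesgue_on S) p H < B"
  obtains A V where "0 \<le> A" "integrable lborel V" "\<And>x. 0 \<le> V x" "\<And>x. (norm (H' x))\<^sup>2 \<le> A + V x"
    "A * h powr (3 + 4 * \<zeta>) + h powr (2 + 3 * \<zeta>) * (LINT x|lborel. V x)
      \<le> (B * h powr (3/2 - real_of_ereal (1 / p) + (2 - real_of_ereal (1 / p)) * \<zeta>))\<^sup>2"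
proof -
  have [measurable]: "H \<in> borel_measurable (lebesgue_on S)" using H by (simp add: in_Lp_def)
  have B0: "0 < B" using Lp_norm_nonneg[OF H] B by simp
  define s where "s = 3/2 - real_of_ereal (1 / p) + (2 - real_of_ereal (1 / p)) * \<zeta>"
  have hs: "(B * h powr s)\<^sup>2 = B\<^sup>2 * h powr (2 * s)"
    using h by (simp add: power_mult_distrib powr_power mult.commute)
  show ?thesis
  proof (cases "p = \<infinity>")
    case True
    have "esssup (lebesgue_on S) (\<lambda>x. ereal (norm (H x))) \<le> ereal B"
      using B H True by (cases "esssup (lebesgue_on S) (\<lambda>x. ereal (norm (H x)))") (auto simp: Lp_norm_def in_Lp_def)
    then have "AE x in lebesgue_on S. norm (H x) \<le> B"
      using esssup_AE[of "\<lambda>x. ereal (norm (H x))" "lebesgue_on S"]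
      by (auto elim!: eventually_mono dest: order_trans)
    then have "AE x in lebesgue. x \<in> S \<longrightarrow> norm (H x) \<le> B" using S by (simp add: AE_restrict_space_iff)
    with H'(2) have "AE x in lebesgue. norm (H' x) \<le> B"
    proof eventually_elim
      case (elim x)
      then show ?case using S(3) B0 by (cases "x \<in> W") auto
    qed
    then have ae: "AE x in lebesgue. max 0 ((norm (H' x))\<^sup>2 - B\<^sup>2) = 0"
    proof eventually_elim
      case (elim x)
      then have "(norm (H' x))\<^sup>2 \<le> B\<^sup>2" by (intro power_mono) auto
      then show ?case by simp
    qed
    have m: "(\<lambda>x. max 0 ((norm (H' x))\<^sup>2 - B\<^sup>2)) \<in> borel_measurable lborel" using H'(1) by simp
    have ae': "AE x in lborel. max 0 ((norm (H' x))\<^sup>2 - B\<^sup>2) = 0"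
      using ae m by (subst (asm) AE_completion_iff) auto
    have "integrable lborel (\<lambda>x. max 0 ((norm (H' x))\<^sup>2 - B\<^sup>2))"
    proof (rule integrable_cong_AE_imp[OF integrable_zero m])
      show "AE x in lborel. 0 = max 0 ((norm (H' x))\<^sup>2 - B\<^sup>2)" using ae' by eventually_elim (rule sym)
    qed
    moreover have "(LINT x|lborel. max 0 ((norm (H' x))\<^sup>2 - B\<^sup>2)) = 0"
      using ae' by (intro integral_eq_zero_AE) auto
    moreover have "2 * s = 3 + 4 * \<zeta>" using True by (simp add: s_def)
    ultimately show ?thesis
      using that[of "B\<^sup>2" "\<lambda>x. max 0 ((norm (H' x))\<^sup>2 - B\<^sup>2)"] hs unfolding s_def[symmetric] by auto
  next
    case False
    then obtain P where P: "p = ereal P" "2 \<le> P" using p by (cases p) auto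
    define q where "q = 2 / P"
    have q: "0 < q" "q \<le> 1" using P by (auto simp: q_def)
    define J where "J = B powr P"
    have J: "0 < J" using B0 by (simp add: J_def)
    have Jq: "J powr q = B\<^sup>2" using B0 P by (simp add: J_def q_def powr_powr powr_numeral)
    define \<tau> where "\<tau> = h powr (-1 - \<zeta>) * J"
    have \<tau>: "0 < \<tau>" using h J by (simp add: \<tau>_def)
    define V where "V x = q * \<tau> powr (q - 1) * norm (H' x) powr P" for x
    have iS: "integrable (lebesgue_on S) (\<lambda>x. norm (H x) powr P)" using H P by (simp add: in_Lp_def)
    then have iS': "integrable lebesgue (\<lambda>x. indicator S x *\<^sub>R (norm (H x) powr P))"
      using S by (subst (asm) integrable_restrict_space) auto
    have iW: "integrable lebesgue (\<lambda>x. indicator W x *\<^sub>R (indicator S x *\<^sub>R (norm (H x) powr P)))"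
      by (rule integrable_mult_indicator[OF S(2) iS'])
    have m: "(\<lambda>x. norm (H' x) powr P) \<in> borel_measurable lborel" using H'(1) by simp
    have mc: "(\<lambda>x. norm (H' x) powr P) \<in> borel_measurable lebesgue" using m by (intro measurable_completion) simp
    have ae: "AE x in lebesgue. indicator W x *\<^sub>R (indicator S x *\<^sub>R (norm (H x) powr P)) = norm (H' x) powr P"
      using H'(2)
    proof eventually_elim
      case (elim x)
      then show ?case using S(3) by (cases "x \<in> W") auto
    qed
    have i: "integrable lebesgue (\<lambda>x. norm (H' x) powr P)" by (rule integrable_cong_AE_imp[OF iW mc ae])
    then have il: "integrable lborel (\<lambda>x. norm (H' x) powr P)" using m by (simp add: integrable_completion)
    have "(LINT x|lborel. norm (H' x) powr P) = (LINT x|lebesgue. norm (H' x) powr P)"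
      using m by (simp add: integral_completion)
    also have "\<dots> \<le> (LINT x|lebesgue. indicator S x *\<^sub>R (norm (H x) powr P))"
    proof (rule integral_mono_AE[OF i iS'])
      show "AE x in lebesgue. norm (H' x) powr P \<le> indicator S x *\<^sub>R (norm (H x) powr P)"
        using ae
      proof eventually_elim
        case (elim x)
        then show ?case by (cases "x \<in> W") (use S(3) in auto)
      qed
    qed
    also have "\<dots> = (LINT x|lebesgue_on S. norm (H x) powr P)" using S by (subst integral_restrict_space) auto
    also have "\<dots> \<le> J"
    proof -
      have "((LINT x|lebesgue_on S. norm (H x) powr P) powr (1 / P)) powr P \<le> B powr P"
        using B P by (intro powr_mono2) (auto simp: Lp_norm_def)
      then show ?thesis using P by (simp add: J_def powr_powr)
    qed
    finally have IJ: "(LINT x|lborel. norm (H' x) powr P) \<le> J" .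
    have LV: "(LINT x|lborel. V x) \<le> q * \<tau> powr (q - 1) * J"
      unfolding V_def using IJ q by (simp add: mult_left_mono)
    have bound: "(norm (H' x))\<^sup>2 \<le> (1 - q) * \<tau> powr q + V x" for x
    proof (cases "H' x = 0")
      case True
      then show ?thesis using q by (simp add: V_def)
    next
      case False
      let ?b = "norm (H' x) powr P"
      have "\<tau> powr (1 - q) * ?b powr q \<le> (1 - q) * \<tau> + q * ?b"
        using q \<tau> False by (intro Youngs_inequality_0) auto
      then have *: "\<tau> powr (q - 1) * (\<tau> powr (1 - q) * ?b powr q) \<le> \<tau> powr (q - 1) * ((1 - q) * \<tau> + q * ?b)"
        by (intro mult_left_mono) auto
      have **: "\<tau> powr (q - 1) * (\<tau> powr (1 - q) * ?b powr q) = ?b powr q"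
        using \<tau> by (simp add: mult.assoc[symmetric] powr_add[symmetric])
      moreover have "?b powr q = (norm (H' x))\<^sup>2" using False P by (simp add: powr_powr q_def powr_numeral)
      moreover have "\<tau> powr (q - 1) * \<tau> = \<tau> powr q" using \<tau> by (simp add: powr_mult_base[symmetric] mult.commute powr_diff)
      moreover have "\<tau> powr (q - 1) * ((1 - q) * \<tau> + q * ?b) = (1 - q) * (\<tau> powr (q - 1) * \<tau>) + V x"
        by (simp only: V_def distrib_left mult_ac)
      ultimately show ?thesis using * unfolding ** by (simp only:)
    qed
    have "(1 - q) * \<tau> powr q * h powr (3 + 4 * \<zeta>) + h powr (2 + 3 * \<zeta>) * (LINT x|lborel. V x)
      \<le> (1 - q) * \<tau> powr q * h powr (3 + 4 * \<zeta>) + h powr (2 + 3 * \<zeta>) * (q * \<tau> powr (q - 1) * J)"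
      using LV by (intro add_left_mono mult_left_mono) auto
    also have "h powr (2 + 3 * \<zeta>) * (q * \<tau> powr (q - 1) * J) = q * (\<tau> powr q * h powr (3 + 4 * \<zeta>))"
    proof -
      have "h powr (2 + 3 * \<zeta>) * J = h powr (3 + 4 * \<zeta>) * \<tau>"
        using h by (simp add: \<tau>_def mult.assoc[symmetric] powr_add[symmetric])
      moreover have "\<tau> powr q = \<tau> powr (q - 1) * \<tau>" using \<tau> powr_add[of \<tau> "q - 1" 1] by simp
      moreover have "h powr (2 + 3 * \<zeta>) * (q * \<tau> powr (q - 1) * J) = q * (\<tau> powr (q - 1) * (h powr (2 + 3 * \<zeta>) * J))"
        by (simp only: mult_ac)
      ultimately show ?thesis by (simp only: mult_ac)
    qed
    also have "(1 - q) * \<tau> powr q * h powr (3 + 4 * \<zeta>) + q * (\<tau> powr q * h powr (3 + 4 * \<zeta>)) = \<tau> powr q * h powr (3 + 4 * \<zeta>)"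
      by (simp add: algebra_simps)
    also have "\<dots> = J powr q * (h powr ((-1 - \<zeta>) * q) * h powr (3 + 4 * \<zeta>))"
      using h J by (simp add: \<tau>_def powr_mult powr_powr)
    also have "h powr ((-1 - \<zeta>) * q) * h powr (3 + 4 * \<zeta>) = h powr (2 * s)"
    proof -
      have "(-1 - \<zeta>) * q + (3 + 4 * \<zeta>) = 2 * s"
        using P by (simp add: s_def q_def one_ereal_def diff_divide_distrib algebra_simps)
      then show ?thesis unfolding powr_add[symmetric] by simp
    qed
    also have "J powr q * h powr (2 * s) = (B * h powr s)\<^sup>2" using hs Jq by simp
    finally have fin: "(1 - q) * \<tau> powr q * h powr (3 + 4 * \<zeta>) + h powr (2 + 3 * \<zeta>) * (LINT x|lborel. V x) \<le> (B * h powr s)\<^sup>2" .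
    have iV: "integrable lborel V" unfolding V_def using il by (rule integrable_mult_right)
    have V0: "0 \<le> V x" and A0: "0 \<le> (1 - q) * \<tau> powr q" for x using q by (simp_all add: V_def)
    show ?thesis by (rule that[OF A0 iV V0 bound fin[unfolded s_def]])
  qed
qed

lemma C2_curve_Lipschitz:
  assumes "C2_curve \<gamma>"
  obtains L where "0 \<le> L" "\<And>s t. s \<in> {0..1} \<Longrightarrow> t \<in> {0..1} \<Longrightarrow> norm (\<gamma> s - \<gamma> t) \<le> L * \<bar>s - t\<bar>"
proof -
  obtain \<gamma>' \<gamma>'' where d: "\<And>t. t \<in> {0..1} \<Longrightarrow> (\<gamma> has_vector_derivative \<gamma>' t) (at t within {0..1})"
    "\<And>t. t \<in> {0..1} \<Longrightarrow> (\<gamma>' has_vector_derivative \<gamma>'' t) (at t within {0..1})"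
    using assms unfolding C2_curve_def by blast
  have "continuous_on {0..1} \<gamma>'"
    using d(2) unfolding continuous_on_eq_continuous_within by (blast intro: has_vector_derivative_continuous)
  then have "bounded (\<gamma>' ` {0..1})" by (intro compact_imp_bounded compact_continuous_image) auto
  then obtain L where L: "\<And>t. t \<in> {0..1} \<Longrightarrow> norm (\<gamma>' t) \<le> L" unfolding bounded_iff by blast
  show ?thesis
  proof (rule that)
    have "norm (\<gamma>' 0) \<le> L" by (rule L) simp
    then show "0 \<le> L" using norm_ge_zero[of "\<gamma>' 0"] by linarith
    show "norm (\<gamma> s - \<gamma> t) \<le> L * \<bar>s - t\<bar>" if "s \<in> {0..1}" "t \<in> {0..1}" for s t
      using vector_differentiable_bound[OF convex_closed_interval d(1) L that] by simp
  qed
qed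

lemma surrogate_edges_meshsize_pos:
  assumes "admissible_triangulation D \<T>" "(T, E) \<in> surrogate_edges \<Omega> S \<T> M"
  shows "0 < boundary_meshsize \<Omega> \<T>"
proof -
  have "2 simplex T"
    using assms by (auto simp: admissible_triangulation_def surrogate_edges_def interior_mesh_def)
  then have "0 < diameter T" by (rule diameter_two_simplex_pos)
  then show ?thesis using surrogate_edges_diameter_le[OF assms] by linarith
qed

theorem proposition3:
  fixes \<Omega> D \<Gamma>\<^sub>S \<Omega>\<^sub>S :: "(real^2) set"
    and \<gamma> \<nu> :: "real \<Rightarrow> real^2"
    and \<T> :: "'i \<Rightarrow> (real^2) set set"
    and M :: "'i \<Rightarrow> real^2 \<Rightarrow> real^2"
    and c\<^sub>d \<zeta> \<zeta>' :: real
    and p :: ereal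
  assumes domain: "open \<Omega>" "connected \<Omega>" "bounded \<Omega>"
      "lipschitz_boundary \<Omega>" "piecewise_C2_boundary \<Omega>"
    and background: "closed_domain D" "closure \<Omega> \<subseteq> D"
    and meshes: "\<And>i. admissible_triangulation D (\<T> i)" "shape_regular_family \<T>"
    and map: "\<And>i. M i ` surrogate_boundary \<Omega> (\<T> i) \<subseteq> frontier \<Omega>"
    and distance: "0 < c\<^sub>d" "0 < \<zeta>"
      "\<And>i T x. T \<in> interior_mesh \<Omega> (\<T> i) \<Longrightarrow> x \<in> T \<inter> surrogate_boundary \<Omega> (\<T> i) \<Longrightarrow>
         norm (M i x - x) \<le> c\<^sub>d * diameter T powr (1 + \<zeta>)"
    and portion: "C2_curve \<gamma>" "\<Gamma>\<^sub>S = path_image \<gamma>" "\<Gamma>\<^sub>S \<subseteq> frontier \<Omega>"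
      "outward_unit_normal_along \<Omega> \<gamma> \<nu>"
    and projection:
      "\<And>i T E. (T, E) \<in> surrogate_edges \<Omega> \<Gamma>\<^sub>S (\<T> i) (M i) \<Longrightarrow>
         closest_point_map_on E (frontier \<Omega>) (M i)"
      "\<And>i T E x. (T, E) \<in> surrogate_edges \<Omega> \<Gamma>\<^sub>S (\<T> i) (M i) \<Longrightarrow> x \<in> E \<Longrightarrow>
         \<exists>t\<in>{0..1}. \<gamma> t = M i x \<and> M i x - x = norm (M i x - x) *\<^sub>R \<nu> t"
    and neighbourhood: "neighbourhood_in (closure \<Omega>) \<Gamma>\<^sub>S \<Omega>\<^sub>S"
    and exponent: "2 \<le> p" "\<zeta>' = (2 - real_of_ereal (1 / p)) * \<zeta>"
  shows "0 < \<zeta>' \<and>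
    (\<exists>C\<^sub>p>0. \<exists>h\<^sub>0>0. \<forall>f g u G H.
       dirichlet_solution \<Omega> f g u G \<longrightarrow> sobolev2 (interior \<Omega>\<^sub>S) p u G H \<longrightarrow>
       (\<forall>i. boundary_meshsize \<Omega> (\<T> i) \<le> h\<^sub>0 \<longrightarrow>
            region_between \<Omega> \<Gamma>\<^sub>S (\<T> i) (M i) \<subseteq> \<Omega>\<^sub>S \<longrightarrow>
          (\<forall>(T, E) \<in> surrogate_edges \<Omega> \<Gamma>\<^sub>S (\<T> i) (M i).
             square_integrable_edge E (taylor_remainder \<Omega> g u G (M i))) \<and>
          weighted_edge_norm (surrogate_edges \<Omega> \<Gamma>\<^sub>S (\<T> i) (M i)) (taylor_remainder \<Omega> g u G (M i))
            \<le> C\<^sub>p * boundary_meshsize \<Omega> (\<T> i) powr (3/2 - real_of_ereal (1 / p) + \<zeta>')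
                 * Lp_norm (lebesgue_on (interior \<Omega>\<^sub>S)) p H))"
proof -
  obtain \<kappa> where \<kappa>: "0 < \<kappa>" "\<And>i T. T \<in> \<T> i \<Longrightarrow> diameter T \<le> \<kappa> * inradius T"
    using meshes(2) unfolding shape_regular_family_def by blast
  have \<nu>: "continuous_on {0..1} \<nu>"
    "\<And>t. t \<in> {0..1} \<Longrightarrow> norm (\<nu> t) = 1 \<and> \<nu> t \<bullet> vector_derivative \<gamma> (at t within {0..1}) = 0"
    using portion(4) by (simp_all add: outward_unit_normal_along_def)
  obtain K where K: "0 < K"
    "\<And>t t'. t \<in> {0..1} \<Longrightarrow> t' \<in> {0..1} \<Longrightarrow> norm (\<nu> t - \<nu> t') \<le> K * norm (\<gamma> t' - \<gamma> t)"
    "\<And>t t'. t \<in> {0..1} \<Longrightarrow> t' \<in> {0..1} \<Longrightarrow> \<bar>\<nu> t \<bullet> (\<gamma> t' - \<gamma> t)\<bar> \<le> K * (norm (\<gamma> t' - \<gamma> t))\<^sup>2"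
    using C2_curve_normal_bounds[OF portion(1) \<nu>] by metis
  obtain L where L: "0 \<le> L" "\<And>s t. s \<in> {0..1} \<Longrightarrow> t \<in> {0..1} \<Longrightarrow> norm (\<gamma> s - \<gamma> t) \<le> L * \<bar>s - t\<bar>"
    using C2_curve_Lipschitz[OF portion(1)] by metis
  obtain U where U: "open U" "\<Gamma>\<^sub>S \<subseteq> U" "U \<inter> closure \<Omega> \<subseteq> \<Omega>\<^sub>S" and sub: "\<Omega>\<^sub>S \<subseteq> closure \<Omega>"
    using neighbourhood unfolding neighbourhood_in_def by blast
  have "compact (path_image \<gamma>)"
    using portion(1) by (simp add: C2_curve_def simple_path_def compact_path_image)
  then obtain \<eta> where \<eta>: "0 < \<eta>" "(\<Union>x\<in>path_image \<gamma>. ball x \<eta>) \<subseteq> U"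
    using compact_subset_open_imp_ball_epsilon_subset[of "path_image \<gamma>" U] U portion(2) by blast
  define m where "m = min 1 (1 / (32 * \<kappa>))"
  define h\<^sub>0 where "h\<^sub>0 = Min {1, \<eta> / 2, 1 / (8 * K), 1 / (144 * K * \<kappa>), (m / c\<^sub>d) powr (1 / \<zeta>)}"
  have m: "0 < m" "m \<le> 1" "32 * \<kappa> * m \<le> 1" using \<kappa>(1) by (auto simp: m_def min_def field_simps)
  have h0: "0 < h\<^sub>0" using m \<eta>(1) K(1) \<kappa>(1) distance(1) by (simp add: h\<^sub>0_def)
  have small: "h \<le> 1" "c\<^sub>d * h powr \<zeta> \<le> 1" "32 * \<kappa> * (c\<^sub>d * h powr \<zeta>) \<le> 1" "144 * K * \<kappa> * h \<le> 1" "8 * K * h \<le> 1" "2 * h \<le> \<eta>"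
    if "0 < h" "h \<le> h\<^sub>0" for h
  proof -
    have le: "h \<le> 1" "h \<le> \<eta> / 2" "h \<le> 1 / (8 * K)" "h \<le> 1 / (144 * K * \<kappa>)" "h \<le> (m / c\<^sub>d) powr (1 / \<zeta>)"
      using that(2) by (simp_all add: h\<^sub>0_def)
    have "h powr \<zeta> \<le> ((m / c\<^sub>d) powr (1 / \<zeta>)) powr \<zeta>"
      using le(5) that(1) distance(2) by (intro powr_mono2) auto
    also have "\<dots> = m / c\<^sub>d" using distance m by (simp add: powr_powr)
    finally have ch: "c\<^sub>d * h powr \<zeta> \<le> m" using distance(1) by (simp add: field_simps)
    then show "c\<^sub>d * h powr \<zeta> \<le> 1" using m by linarith
    have "32 * \<kappa> * (c\<^sub>d * h powr \<zeta>) \<le> 32 * \<kappa> * m" using ch \<kappa>(1) by (intro mult_left_mono) auto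
    then show "32 * \<kappa> * (c\<^sub>d * h powr \<zeta>) \<le> 1" using m by linarith
    show "h \<le> 1" "144 * K * \<kappa> * h \<le> 1" "8 * K * h \<le> 1" "2 * h \<le> \<eta>"
      using le K(1) \<kappa>(1) by (auto simp: field_simps)
  qed
  define S where "S = interior \<Omega>\<^sub>S"
  define W where "W = S \<inter> \<Omega>"
  have "bounded S" using bounded_closure[OF domain(3)] sub interior_subset[of \<Omega>\<^sub>S] unfolding S_def by (meson bounded_subset)
  then have Sm: "S \<in> lmeasurable" by (intro lmeasurable_open) (auto simp: S_def)
  have Sl: "S \<in> sets lebesgue" by (simp add: S_def)
  have W: "open W" "W \<subseteq> \<Omega>" "W \<subseteq> S" "W \<in> sets lebesgue"
    using domain(1) by (auto simp: W_def S_def)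
  have near: "x \<in> W" if "t \<in> {0..1}" "dist x (\<gamma> t) < \<eta>" "x \<in> \<Omega>" for x t
  proof -
    have "x \<in> U \<inter> \<Omega>" using that \<eta>(2) by (force simp: path_image_def dist_commute)
    moreover have "U \<inter> \<Omega> \<subseteq> S"
      unfolding S_def using U(3) closure_subset[of \<Omega>] domain(1) U(1) by (intro interior_maximal) auto
    ultimately show ?thesis by (auto simp: W_def)
  qed
  define C where "C = 96 * \<kappa>\<^sup>2 * (L + 2)\<^sup>2 * c\<^sub>d ^ 4 + 73728 * \<kappa>\<^sup>2 * c\<^sub>d ^ 3"
  have C: "0 < C" unfolding C_def using distance(1) \<kappa>(1) by (intro add_nonneg_pos mult_pos_pos) auto
  have pinv: "real_of_ereal (1 / p) \<le> 1 / 2" "0 \<le> real_of_ereal (1 / p)"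
    using exponent(1) by (cases p; auto simp: one_ereal_def field_simps)+
  have \<zeta>': "0 < \<zeta>'" unfolding exponent(2) using pinv(1) distance(2) by (intro mult_pos_pos) auto
  define s where "s = 3/2 - real_of_ereal (1 / p) + \<zeta>'"
  have estimate: "(\<forall>(T, E) \<in> surrogate_edges \<Omega> \<Gamma>\<^sub>S (\<T> i) (M i).
             square_integrable_edge E (taylor_remainder \<Omega> g u G (M i))) \<and>
          weighted_edge_norm (surrogate_edges \<Omega> \<Gamma>\<^sub>S (\<T> i) (M i)) (taylor_remainder \<Omega> g u G (M i))
            \<le> sqrt C * boundary_meshsize \<Omega> (\<T> i) powr s * Lp_norm (lebesgue_on S) p H"
    if sol: "dirichlet_solution \<Omega> f g u G" and sob: "sobolev2 S p u G H"
      and hi: "boundary_meshsize \<Omega> (\<T> i) \<le> h\<^sub>0" for f g u G H i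
  proof (cases "surrogate_edges \<Omega> \<Gamma>\<^sub>S (\<T> i) (M i) = {}")
    case True
    have "0 \<le> Lp_norm (lebesgue_on S) p H" using sob by (intro Lp_norm_nonneg) (simp add: sobolev2_def)
    then show ?thesis using C by (simp add: True weighted_edge_norm_def)
  next
    case False
    define h where "h = boundary_meshsize \<Omega> (\<T> i)"
    have h: "0 < h" "h \<le> h\<^sub>0"
      using False surrogate_edges_meshsize_pos[OF meshes(1)] hi by (auto simp: h_def)
    obtain N where N: "arc_length_null N" "\<And>x. x \<in> frontier \<Omega> - N \<Longrightarrow> has_trace_at \<Omega> u x (g x)"
      using sol unfolding dirichlet_solution_def by blast
    have Lp: "in_Lp (lebesgue_on S) p u" "in_Lp (lebesgue_on S) p G" "in_Lp (lebesgue_on S) p H"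
      and wu: "weak_gradient S u G" and wG: "\<And>j. weak_gradient S (\<lambda>x. G x $ j) (\<lambda>x. H x $ j)"
      using sob by (auto simp: sobolev2_def sobolev1_def weak_hessian_def)
    have meas: "u \<in> borel_measurable (lebesgue_on S)" "G \<in> borel_measurable (lebesgue_on S)" "H \<in> borel_measurable (lebesgue_on S)"
      using Lp by (simp_all add: in_Lp_def)
    obtain u' where u': "u' \<in> borel_measurable borel" "AE x in lebesgue. indicator W x *\<^sub>R u x = u' x" "integrable lborel u'"
      "integrable lborel (\<lambda>x. (norm (u' x))\<^sup>2)"
      by (rule in_Lp_representative[OF Sm W(4,3) exponent(1) Lp(1)])
    obtain G' where G': "G' \<in> borel_measurable borel" "AE x in lebesgue. indicator W x *\<^sub>R G x = G' x" "integrable lborel G'"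
      "integrable lborel (\<lambda>x. (norm (G' x))\<^sup>2)"
      by (rule in_Lp_representative[OF Sm W(4,3) exponent(1) Lp(2)])
    obtain H' where H': "H' \<in> borel_measurable borel" "AE x in lebesgue. indicator W x *\<^sub>R H x = H' x"
      "integrable lborel H'" "integrable lborel (\<lambda>x. (norm (H' x))\<^sup>2)"
      by (rule in_Lp_representative[OF Sm W(4,3) exponent(1) Lp(3)])
    have est: "mesh_estimate \<Omega> D W N (\<T> i) (M i) \<gamma> \<nu> \<kappa> c\<^sub>d \<zeta> K L h u' u g G' G H' A V"
      if AV: "0 \<le> A" "integrable lborel V" "\<And>x. 0 \<le> V x" "\<And>x. (norm (H' x))\<^sup>2 \<le> A + V x" for A V
    proof (unfold_locales)
      show "admissible_triangulation D (\<T> i)" by (rule meshes(1))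
      show "diameter T \<le> \<kappa> * inradius T" if "T \<in> \<T> i" for T by (rule \<kappa>(2)[OF that])
      show "norm (M i x - x) \<le> c\<^sub>d * diameter T powr (1 + \<zeta>)"
        if "T \<in> interior_mesh \<Omega> (\<T> i)" "x \<in> T \<inter> surrogate_boundary \<Omega> (\<T> i)" for T x
        by (rule distance(3)[OF that])
      show "norm (\<nu> t) = 1" if "t \<in> {0..1}" for t using \<nu>(2)[OF that] by simp
      show "path_image \<gamma> \<subseteq> frontier \<Omega>" using portion by simp
      show "closest_point_map_on E (frontier \<Omega>) (M i)"
        if "(T, E) \<in> surrogate_edges \<Omega> (path_image \<gamma>) (\<T> i) (M i)" for T E
        using projection(1) that portion(2) by simp
      show "\<exists>t\<in>{0..1}. \<gamma> t = M i x \<and> M i x - x = norm (M i x - x) *\<^sub>R \<nu> t"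
        if "(T, E) \<in> surrogate_edges \<Omega> (path_image \<gamma>) (\<T> i) (M i)" "x \<in> E" for T E x
        using projection(2) that portion(2) by simp
      show "x \<in> W" if "t \<in> {0..1}" "dist x (\<gamma> t) < 2 * h" "x \<in> \<Omega>" for x t
        using near[OF that(1) _ that(3)] that(2) small(6)[OF h] by linarith
      show "integrable lborel (\<lambda>y. G' y $ j)" for j
        using integrable_inner_left[OF G'(3), of "axis j 1"] by (simp add: inner_axis)
      show "integrable lborel (\<lambda>y. H' y $ j $ k)" for j k
        using integrable_inner_left[OF H'(3), of "axis j (axis k 1)"] by (simp add: inner_axis)
      show "(LINT y|lborel. u' y * partial_deriv j \<phi> y) = - (LINT y|lborel. G' y $ j * \<phi> y)"
        if "test_function W \<phi>" for \<phi> j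
        by (rule weak_gradient_representative[OF Sl W(3) wu meas(1) u'(1,2) meas(2) G'(1,2) that])
      show "(LINT y|lborel. G' y $ k * partial_deriv j \<phi> y) = - (LINT y|lborel. H' y $ k $ j * \<phi> y)"
        if "test_function W \<phi>" for \<phi> j k
      proof (rule weak_gradient_representative[OF Sl W(3) wG[of k] _ _ _ _ _ _ that])
        show "(\<lambda>x. G x $ k) \<in> borel_measurable (lebesgue_on S)"
          by (rule borel_measurable_nth_component[OF meas(2)])
        show "(\<lambda>x. H x $ k) \<in> borel_measurable (lebesgue_on S)"
          by (rule borel_measurable_nth_component[OF meas(3)])
        show "(\<lambda>x. G' x $ k) \<in> borel_measurable borel" by (rule borel_measurable_nth_component[OF G'(1)])
        show "(\<lambda>x. H' x $ k) \<in> borel_measurable borel" by (rule borel_measurable_nth_component[OF H'(1)])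
        show "AE x in lebesgue. indicator W x *\<^sub>R (G x $ k) = G' x $ k"
          using G'(2) by eventually_elim (metis vector_scaleR_component)
        show "AE x in lebesgue. indicator W x *\<^sub>R (H x $ k) = H' x $ k"
          using H'(2) by eventually_elim (metis vector_scaleR_component)
      qed
      show "u \<in> borel_measurable (lebesgue_on W)" "G \<in> borel_measurable (lebesgue_on W)"
        using meas W(3) by (auto intro: measurable_restrict_mono)
      show "AE y in lebesgue. y \<in> W \<longrightarrow> u y = u' y" using u'(2) by eventually_elim auto
      show "AE y in lebesgue. y \<in> W \<longrightarrow> G y = G' y" using G'(2) by eventually_elim auto
    qed (fact \<kappa>(1) distance(1,2) K L h_def small(1-5)[OF h] domain(1) W(1,2) u'(3) H'(4) AV N)+
    let ?n = "weighted_edge_norm (surrogate_edges \<Omega> \<Gamma>\<^sub>S (\<T> i) (M i)) (taylor_remainder \<Omega> g u G (M i))"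
    have bound: "(\<forall>(T, E) \<in> surrogate_edges \<Omega> \<Gamma>\<^sub>S (\<T> i) (M i). square_integrable_edge E (taylor_remainder \<Omega> g u G (M i))) \<and>
      ?n \<le> (sqrt C * h powr s) * B" if B: "Lp_norm (lebesgue_on S) p H < B" for B
    proof -
      obtain A V where AV: "0 \<le> A" "integrable lborel V" "\<And>x. 0 \<le> V x" "\<And>x. (norm (H' x))\<^sup>2 \<le> A + V x"
        "A * h powr (3 + 4 * \<zeta>) + h powr (2 + 3 * \<zeta>) * (LINT x|lborel. V x)
          \<le> (B * h powr (3/2 - real_of_ereal (1 / p) + (2 - real_of_ereal (1 / p)) * \<zeta>))\<^sup>2"
        by (rule Lp_splitting[OF Sl W(4,3) exponent(1) Lp(3) H'(1,2,4) h(1) B, where \<zeta>=\<zeta>]) (rule that)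
      note est' = est[OF AV(1-4)]
      have "?n\<^sup>2 \<le> C * (A * h powr (3 + 4 * \<zeta>) + h powr (2 + 3 * \<zeta>) * (LINT x|lborel. V x))"
        using mesh_estimate.weighted_norm_le[OF est'] unfolding portion(2) C_def .
      also have "\<dots> \<le> C * (B * h powr s)\<^sup>2"
        using AV(5) C unfolding s_def exponent(2) by (intro mult_left_mono) auto
      also have "\<dots> = (sqrt C * h powr s * B)\<^sup>2" using C by (simp add: power_mult_distrib mult_ac)
      finally have "?n\<^sup>2 \<le> (sqrt C * h powr s * B)\<^sup>2" .
      moreover have "0 \<le> sqrt C * h powr s * B" using C B Lp_norm_nonneg[OF Lp(3)] by simp
      ultimately have "?n \<le> sqrt C * h powr s * B" by (rule power2_le_imp_le)
      moreover have "square_integrable_edge E (taylor_remainder \<Omega> g u G (M i))"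
        if "(T, E) \<in> surrogate_edges \<Omega> \<Gamma>\<^sub>S (\<T> i) (M i)" for T E
        using mesh_estimate.single_edge(1)[OF est'] that unfolding portion(2) by blast
      ultimately show ?thesis by auto
    qed
    have c: "0 < sqrt C * h powr s" using C h(1) by simp
    have "?n / (sqrt C * h powr s) \<le> Lp_norm (lebesgue_on S) p H"
    proof (rule dense_ge)
      fix B assume "Lp_norm (lebesgue_on S) p H < B"
      then show "?n / (sqrt C * h powr s) \<le> B"
        using bound[of B] c by (simp only: pos_divide_le_eq mult.commute[of B])
    qed
    then have "?n \<le> sqrt C * h powr s * Lp_norm (lebesgue_on S) p H"
      using c by (simp only: pos_divide_le_eq mult.commute[of "Lp_norm (lebesgue_on S) p H"])
    then show ?thesis using bound[of "Lp_norm (lebesgue_on S) p H + 1"] unfolding h_def by simp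
  qed
  have sC: "0 < sqrt C" using C by simp
  show ?thesis
  proof (rule conjI[OF \<zeta>'], rule exI[of _ "sqrt C"], rule conjI[OF sC], rule exI[of _ h\<^sub>0], rule conjI[OF h0],
      intro allI impI conjI)
    fix f g u G H i
    assume a: "dirichlet_solution \<Omega> f g u G" "sobolev2 (interior \<Omega>\<^sub>S) p u G H"
      "boundary_meshsize \<Omega> (\<T> i) \<le> h\<^sub>0"
    note e = estimate[unfolded S_def s_def, OF a]
    show "\<forall>(T, E) \<in> surrogate_edges \<Omega> \<Gamma>\<^sub>S (\<T> i) (M i). square_integrable_edge E (taylor_remainder \<Omega> g u G (M i))"
      by (rule conjunct1[OF e])
    show "weighted_edge_norm (surrogate_edges \<Omega> \<Gamma>\<^sub>S (\<T> i) (M i)) (taylor_remainder \<Omega> g u G (M i))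
      \<le> sqrt C * boundary_meshsize \<Omega> (\<T> i) powr (3/2 - real_of_ereal (1 / p) + \<zeta>') * Lp_norm (lebesgue_on (interior \<Omega>\<^sub>S)) p H"
      by (rule conjunct2[OF e])
  qed
qed

end
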